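(* Let $(\mathbf{x},B)$ be a seed such that the underlying graph of the valued quiver $Q_B$ is the Dynkin diagram $E_6,E_7,E_8,F_4$ or $G_2$. Then the face vector $f(\Delta^+(\mathbf{x},B))$ is: ($E_6$) $(1,36,300,1035,1720,1368,418)$; ($E_7$) $(1,63,777,3927,9933,13299,9009,2431)$; ($E_8$) $(1,120,2135,15120,54327,108360,121555,71760,17342)$; ($F_4$) $(1,24,101,144,66)$; ($G_2$) $(1,6,5)$.
   Context: Seeds and mutation. Let $\mathcal F$ be a field of rational functions in $n$ indeterminates over $\mathbb Q$. A labeled seed is a pair $(\mathbf{x},B)$ where $\mathbf{x}=(x_1,\dots,x_n)$ is a free generating set of $\mathcal F$ (the cluster; its elements are cluster variables) and $B=(b_{ij})$ is a skew-symmetrizable $n\times n$ integer matrix (there is a positive integer diagonal matrix $S$ with $SB$ skew-symmetric). With $[b]_+=\max(b,0)$, the mutation in direction $k$ sends $(\mathbf{x},B)$ to $(\mathbf{x}',B')$ with $b'_{ij}=-b_{ij}$ if $i=k$ or $j=k$, and $b'_{ij}=b_{ij}+[b_{ik}]_+b_{kj}+b_{ik}[-b_{kj}]_+$ otherwise; $x'_j=x_j$ for $j\ne k$ and $x'_k=\big(\prod_i x_i^{[b_{ik}]_+}+\prod_i x_i^{[-b_{ik}]_+}\big)/x_k$. Cluster complexes. The cluster complex $\Delta(\mathbf{x},B)$ is the simplicial complex whose vertices are all cluster variables of seeds obtained from $(\mathbf{x},B)$ by finite sequences of mutations, and whose simplices are all subsets (including $\emptyset$) of the clusters of these seeds. The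 positive cluster complex $\Delta^+(\mathbf{x},B)$ is the full subcomplex of $\Delta(\mathbf{x},B)$ on the cluster variables not belonging to the initial cluster $\mathbf{x}$. The face vector is $(f_{-1},f_0,\dots,f_{n-1})$, $f_i$ being the number of $i$-dimensional simplices. Valued quivers. $Q_B$ has vertices $1,\dots,n$ and an arrow $i\to j$ with value $(b_{ij},-b_{ji})$ whenever $b_{ij}>0$. Its underlying graph is the Dynkin diagram $X_n$ if, up to relabeling vertices, the matrix $A(B)$ with diagonal entries $2$ and off-diagonal entries $-|b_{ij}|$ is the Cartan matrix of finite type $X_n$. *)

theory Defs
  imports "HOL-Analysis.Finite_Cartesian_Product" "HOL-Library.Poly_Mapping" "HOL.Hull"
begin

section \<open>Seeds and mutation\<close>

text \<open>The ambient field is a whole type of class \<^class>\<open>field_char_0\<close>, and seeds are indexed by a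
  finite type \<open>'n\<close>, so that \<open>n = CARD('n)\<close>.  That the ambient field is a field of rational
  functions in \<open>n\<close> indeterminates over the rationals is expressed by the existence of a free
  generating set indexed by \<open>'n\<close>.\<close>

text \<open>Polynomials over the rationals in indeterminates indexed by \<open>'n\<close> are finitely supported maps
  from monomials (exponent vectors) to coefficients.\<close>

type_synonym 'n rat_mpoly = "('n \<Rightarrow>\<^sub>0 nat) \<Rightarrow>\<^sub>0 rat"

definition mpoly_eval :: "'n::finite rat_mpoly \<Rightarrow> 'a::field_char_0 ^ 'n \<Rightarrow> 'a" where
  "mpoly_eval p x =
     (\<Sum>m\<in>Poly_Mapping.keys p. of_rat (Poly_Mapping.lookup p m) *
        (\<Prod>i\<in>UNIV. (x $ i) ^ Poly_Mapping.lookup m i))"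

definition alg_independent :: "'a::field_char_0 ^ 'n::finite \<Rightarrow> bool" where
  "alg_independent x \<longleftrightarrow> (\<forall>p. mpoly_eval p x = 0 \<longrightarrow> p = 0)"

definition is_subfield :: "'a::field set \<Rightarrow> bool" where
  "is_subfield K \<longleftrightarrow> 0 \<in> K \<and> 1 \<in> K \<and>
     (\<forall>a\<in>K. \<forall>b\<in>K. a + b \<in> K \<and> a * b \<in> K) \<and>
     (\<forall>a\<in>K. - a \<in> K \<and> inverse a \<in> K)"

text \<open>In characteristic \<open>0\<close> every subfield contains the rationals, so the subfield generated by the
  \<open>x $ i\<close> is the field they generate over the rationals.\<close>

definition free_generating :: "'a::field_char_0 ^ 'n::finite \<Rightarrow> bool" where
  "free_generating x \<longleftrightarrow>
     alg_independent x \<and> is_subfield hull (range (($) x)) = UNIV"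

definition skew_symmetrizable :: "int ^ 'n::finite ^ 'n \<Rightarrow> bool" where
  "skew_symmetrizable B \<longleftrightarrow>
     (\<exists>S :: int ^ 'n ^ 'n. (\<forall>i. S $ i $ i > 0) \<and> (\<forall>i j. i \<noteq> j \<longrightarrow> S $ i $ j = 0) \<and>
        transpose (S ** B) = - (S ** B))"

type_synonym ('a, 'n) seed = "('a ^ 'n) \<times> (int ^ 'n ^ 'n)"

definition is_seed :: "('a::field_char_0, 'n::finite) seed \<Rightarrow> bool" where
  "is_seed s \<longleftrightarrow> free_generating (fst s) \<and> skew_symmetrizable (snd s)"

definition pos_part :: "int \<Rightarrow> int" where
  "pos_part b = max b 0"

definition mutate_matrix :: "'n \<Rightarrow> int ^ 'n::finite ^ 'n \<Rightarrow> int ^ 'n ^ 'n" where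
  "mutate_matrix k B = (\<chi> i j.
     if i = k \<or> j = k then - (B $ i $ j)
     else B $ i $ j + pos_part (B $ i $ k) * B $ k $ j + B $ i $ k * pos_part (- (B $ k $ j)))"

definition mutate_cluster ::
    "'n \<Rightarrow> int ^ 'n::finite ^ 'n \<Rightarrow> 'a::field_char_0 ^ 'n \<Rightarrow> 'a ^ 'n" where
  "mutate_cluster k B x = (\<chi> j.
     if j = k
     then ((\<Prod>i\<in>UNIV. (x $ i) ^ nat (pos_part (B $ i $ k)))
           + (\<Prod>i\<in>UNIV. (x $ i) ^ nat (pos_part (- (B $ i $ k))))) / x $ k
     else x $ j)"

definition mutate :: "'n \<Rightarrow> ('a::field_char_0, 'n::finite) seed \<Rightarrow> ('a, 'n) seed" where
  "mutate k s = (mutate_cluster k (snd s) (fst s), mutate_matrix k (snd s))"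

inductive_set mutation_class :: "('a::field_char_0, 'n::finite) seed \<Rightarrow> ('a, 'n) seed set"
  for s where
  initial: "s \<in> mutation_class s"
| step: "t \<in> mutation_class s \<Longrightarrow> mutate k t \<in> mutation_class s"


section \<open>Cluster complexes\<close>

text \<open>A simplicial complex is represented by the set of its simplices, the empty simplex included.\<close>

definition cluster :: "('a, 'n::finite) seed \<Rightarrow> 'a set" where
  "cluster s = range (($) (fst s))"

definition cluster_variables :: "('a::field_char_0, 'n::finite) seed \<Rightarrow> 'a set" where
  "cluster_variables s = (\<Union>t\<in>mutation_class s. cluster t)"

definition cluster_complex :: "('a::field_char_0, 'n::finite) seed \<Rightarrow> 'a set set" where
  "cluster_complex s = (\<Union>t\<in>mutation_class s. Pow (cluster t))"

definition full_subcomplex :: "'v set set \<Rightarrow> 'v set \<Rightarrow> 'v set set" where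
  "full_subcomplex K V = {\<sigma>\<in>K. \<sigma> \<subseteq> V}"

definition positive_cluster_complex :: "('a::field_char_0, 'n::finite) seed \<Rightarrow> 'a set set" where
  "positive_cluster_complex s =
     full_subcomplex (cluster_complex s) (cluster_variables s - cluster s)"

text \<open>The index \<open>i\<close> starts at \<open>-1\<close>.  Note that \<^const>\<open>card\<close> is \<open>0\<close> on infinite sets, so a nonzero
  value of \<open>face_number\<close> entails that there are only finitely many simplices of that dimension.\<close>

definition face_number :: "'v set set \<Rightarrow> int \<Rightarrow> nat" where
  "face_number K i = card {\<sigma>\<in>K. finite \<sigma> \<and> int (card \<sigma>) - 1 = i}"

definition face_vector :: "nat \<Rightarrow> 'v set set \<Rightarrow> nat list" where
  "face_vector n K = map (face_number K) [-1..int n - 1]"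


section \<open>Dynkin diagrams\<close>

datatype exceptional_type = E6 | E7 | E8 | F4 | G2

text \<open>Bourbaki labeling of the vertices, shifted to start at \<open>0\<close>.\<close>

fun cartan_matrix :: "exceptional_type \<Rightarrow> int list list" where
  "cartan_matrix E6 =
    [[ 2, 0,-1, 0, 0, 0],
     [ 0, 2, 0,-1, 0, 0],
     [-1, 0, 2,-1, 0, 0],
     [ 0,-1,-1, 2,-1, 0],
     [ 0, 0, 0,-1, 2,-1],
     [ 0, 0, 0, 0,-1, 2]]"
| "cartan_matrix E7 =
    [[ 2, 0,-1, 0, 0, 0, 0],
     [ 0, 2, 0,-1, 0, 0, 0],
     [-1, 0, 2,-1, 0, 0, 0],
     [ 0,-1,-1, 2,-1, 0, 0],
     [ 0, 0, 0,-1, 2,-1, 0],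
     [ 0, 0, 0, 0,-1, 2,-1],
     [ 0, 0, 0, 0, 0,-1, 2]]"
| "cartan_matrix E8 =
    [[ 2, 0,-1, 0, 0, 0, 0, 0],
     [ 0, 2, 0,-1, 0, 0, 0, 0],
     [-1, 0, 2,-1, 0, 0, 0, 0],
     [ 0,-1,-1, 2,-1, 0, 0, 0],
     [ 0, 0, 0,-1, 2,-1, 0, 0],
     [ 0, 0, 0, 0,-1, 2,-1, 0],
     [ 0, 0, 0, 0, 0,-1, 2,-1],
     [ 0, 0, 0, 0, 0, 0,-1, 2]]"
| "cartan_matrix F4 =
    [[ 2,-1, 0, 0],
     [-1, 2,-2, 0],
     [ 0,-1, 2,-1],
     [ 0, 0,-1, 2]]"
| "cartan_matrix G2 =
    [[ 2,-1],
     [-3, 2]]"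

definition cartan_counterpart :: "int ^ 'n::finite ^ 'n \<Rightarrow> int ^ 'n ^ 'n" where
  "cartan_counterpart B = (\<chi> i j. if i = j then 2 else - \<bar>B $ i $ j\<bar>)"

text \<open>The underlying graph of the valued quiver of \<open>B\<close> is the Dynkin diagram of type \<open>X\<close>: by
  definition this says that \<open>A(B) = cartan_counterpart B\<close> is the Cartan matrix of type \<open>X\<close> up to a
  relabeling \<open>\<pi>\<close> of the vertices.  In particular \<open>CARD('n)\<close> is the rank of \<open>X\<close>.\<close>

definition underlying_dynkin :: "int ^ 'n::finite ^ 'n \<Rightarrow> exceptional_type \<Rightarrow> bool" where
  "underlying_dynkin B X \<longleftrightarrow>
     (\<exists>\<pi>. bij_betw \<pi> (UNIV :: 'n set) {..<length (cartan_matrix X)} \<and>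
        (\<forall>i j. cartan_counterpart B $ i $ j = cartan_matrix X ! \<pi> i ! \<pi> j))"

end

theory Submission
  imports Defs "HOL-Combinatorics.Permutations"
begin

text \<open>Mutations at sources and sinks orient the tree alternately, and then all nodes of one colour can be
  mutated at once; iterating this with alternating colours gives the bipartite belt. For every connected
  subdiagram \<open>D\<close> the following is shown by induction on the size of \<open>D\<close>: the belt is periodic, its variables are
  all cluster variables, and any two seeds with a common cluster variable are connected by mutations that fix
  this variable.

  In the induction step consider the seeds containing the variable \<open>y\<close> at a node \<open>i\<close> of a bipartite seed. Mutations
  fixing \<open>y\<close> are mutations of the subdiagram \<open>D - {i}\<close>, so by induction their variables are the belt variables of
  \<open>D - {i}\<close>, and it suffices to find each of these in the belt of \<open>D\<close>. Near the initial seed this is clear. The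
  remaining coincidences are obtained one after another: if two belt variables \<open>u, v\<close> both occur together with a
  third variable \<open>w\<close>, then by induction in the link of \<open>w\<close> it is known whether they occur in a common seed; and
  once \<open>v\<close> is known to occur in the link of \<open>u\<close>, it is identified there by its value under a generic tropical
  valuation. The list of these coincidences is a finite certificate, checked by simplification. Periodicity
  follows when two labels of the belt of \<open>D\<close> are matched with the same variable of a link; in rank two it is
  computed directly.

  As links are complexes of smaller diagrams, counting pairs of a face and one of its vertices determines the
  face numbers of all subdiagrams, and inclusion and exclusion over the initial variables yields those of the
  positive complex.\<close>

subsection \<open>Seeds over a semifield\<close>

text \<open>Deleting a node turns its variable into a coefficient. Hence every statement about a
  subdiagram concerns all seeds on the full index set, whatever the values and arrows outside it;
  only then does the induction hypothesis apply to a link. The obstacle is connectedness: two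
  clusters with a common variable have to be joined without mutating it, since otherwise the link of
  that variable could be larger than the complex of the smaller diagram and the count would have no
  recursion. For this reason a coincidence in the certificate always carries a path and is never a
  mere equality, and a tropical value identifies a variable only when a link is known to contain it.
  These values are integers computed by max and plus, which avoids Laurent polynomials beyond rank
  two. Paths are taken up to relabelling, because a belt of type A2 closes only after exchanging its
  two nodes. Coefficients are allowed in types A2 and B2, which occur inside larger diagrams; G2
  occurs alone, so its period is computed with no coefficients. In the labelling used, E6 and E7 are
  the first nodes of E8, so a single table certifies all three types.\<close>

type_synonym 'a fseed = "(nat \<Rightarrow> 'a) \<times> (nat \<Rightarrow> nat \<Rightarrow> int)"

definition prm :: "(nat \<Rightarrow> nat) \<Rightarrow> 'a fseed \<Rightarrow> 'a fseed" where
  "prm \<sigma> s = (fst s \<circ> \<sigma>, \<lambda>i j. snd s (\<sigma> i) (\<sigma> j))"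

definition mutm :: "nat \<Rightarrow> (nat \<Rightarrow> nat \<Rightarrow> int) \<Rightarrow> nat \<Rightarrow> nat \<Rightarrow> int" where
  "mutm k b i j = (if i = k \<or> j = k then - b i j
     else b i j + max (b i k) 0 * b k j + b i k * max (- b k j) 0)"

definition orth :: "nat set \<Rightarrow> nat set \<Rightarrow> 'a fseed \<Rightarrow> bool" where
  "orth K L s \<longleftrightarrow> (\<forall>k\<in>K. \<forall>l\<in>L. snd s k l = 0 \<and> snd s l k = 0)"

abbreviation cl :: "nat set \<Rightarrow> 'a fseed \<Rightarrow> 'a set" where
  "cl J s \<equiv> fst s ` J"

lemma mutm_mutm: "b k k = 0 \<Longrightarrow> mutm k (mutm k b) = b"
  by (intro ext) (auto simp: mutm_def max_def algebra_simps)

lemma mutm_comm: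
  assumes "b k l = 0" "b l k = 0" "k \<noteq> l"
  shows "mutm k (mutm l b) = mutm l (mutm k b)"
  using assms by (intro ext) (auto simp: mutm_def)

text \<open>Such a \<open>k\<close> is not the middle of a directed path between \<open>i\<close>
  and \<open>j\<close>, so both correction terms of the mutation rule vanish.\<close>

lemma mutm_source_sink:
  assumes "i \<noteq> k" "j \<noteq> k" "b i k \<le> 0 \<and> b k j \<ge> 0 \<or> b i k \<ge> 0 \<and> b k j \<le> 0"
  shows "mutm k b i j = b i j"
  using assms by (auto simp: mutm_def max_def)

lemma prm_prm: "prm \<rho> (prm \<sigma> s) = prm (\<sigma> \<circ> \<rho>) s"
  by (simp add: prm_def comp_assoc)

lemma prm_id [simp]: "prm id s = s"
  by (simp add: prm_def)

lemma fst_prm [simp]: "fst (prm \<sigma> s) k = fst s (\<sigma> k)"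
  by (simp add: prm_def)

lemma snd_prm [simp]: "snd (prm \<sigma> s) i j = snd s (\<sigma> i) (\<sigma> j)"
  by (simp add: prm_def)

lemma cl_prm: "\<sigma> permutes J \<Longrightarrow> cl J (prm \<sigma> s) = cl J s"
proof -
  assume "\<sigma> permutes J"
  then have "fst s ` \<sigma> ` J = cl J s" by (simp only: permutes_image)
  then show ?thesis by (simp add: image_image)
qed

text \<open>\<open>P\<close> stands for the subtraction-free rational functions in an initial
  cluster. All cluster variables stay inside it, so no denominator of an exchange relation vanishes,
  and max-plus valuations make sense on it because nothing cancels in a sum.\<close>

locale semifield_seeds =
  fixes I :: "nat set" and P :: "'a::field set"
  assumes finite_I [simp, intro]: "finite I"
    and P_one: "1 \<in> P"
    and P_add: "f \<in> P \<Longrightarrow> g \<in> P \<Longrightarrow> f + g \<in> P"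
    and P_mult: "f \<in> P \<Longrightarrow> g \<in> P \<Longrightarrow> f * g \<in> P"
    and P_divide: "f \<in> P \<Longrightarrow> g \<in> P \<Longrightarrow> f / g \<in> P"
    and P_nonzero: "0 \<notin> P"
begin

definition mon :: "(nat \<Rightarrow> 'a) \<Rightarrow> (nat \<Rightarrow> int) \<Rightarrow> 'a" where
  "mon x e = (\<Prod>i\<in>I. x i ^ nat (e i))"

definition mut :: "nat \<Rightarrow> 'a fseed \<Rightarrow> 'a fseed" where
  "mut k s = ((fst s)(k := (mon (fst s) (\<lambda>i. snd s i k) + mon (fst s) (\<lambda>i. - snd s i k)) / fst s k),
     mutm k (snd s))"

definition trop_hom :: "('a \<Rightarrow> int) \<Rightarrow> bool" where
  "trop_hom \<tau> \<longleftrightarrow> (\<forall>f\<in>P. \<forall>g\<in>P. \<tau> (f * g) = \<tau> f + \<tau> g \<and> \<tau> (f + g) = max (\<tau> f) (\<tau> g))"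

text \<open>The last conjunct is all that is used of the algebraic independence of a cluster: there are enough
  tropical valuations to separate cluster variables.\<close>

definition good :: "'a fseed \<Rightarrow> bool" where
  "good s \<longleftrightarrow> (\<forall>i\<in>I. fst s i \<in> P) \<and> (\<forall>i j. snd s i j \<noteq> 0 \<longrightarrow> i \<in> I \<and> j \<in> I) \<and>
     (\<exists>d. \<forall>i j. d i > 0 \<and> d i * snd s i j = - (d j * snd s j i)) \<and>
     (\<forall>\<omega>. \<exists>\<tau>. trop_hom \<tau> \<and> (\<forall>i\<in>I. \<tau> (fst s i) = \<omega> i))"

lemma snd_mut [simp]: "snd (mut k s) = mutm k (snd s)"
  by (simp add: mut_def)

lemma fst_mut_neq [simp]: "l \<noteq> k \<Longrightarrow> fst (mut k s) l = fst s l"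
  by (simp add: mut_def)

lemma fst_mut_eq: "fst (mut k s) k = (mon (fst s) (\<lambda>i. snd s i k) + mon (fst s) (\<lambda>i. - snd s i k)) / fst s k"
  by (simp add: mut_def)

lemma P_power: "f \<in> P \<Longrightarrow> f ^ n \<in> P"
  by (induction n) (auto intro: P_one P_mult)

lemma P_prod: "(\<And>i. i \<in> K \<Longrightarrow> f i \<in> P) \<Longrightarrow> prod f K \<in> P"
  by (induction K rule: infinite_finite_induct) (auto intro: P_one P_mult)

lemma P_mon: "(\<And>i. i \<in> I \<Longrightarrow> x i \<in> P) \<Longrightarrow> mon x e \<in> P"
  unfolding mon_def by (intro P_prod P_power)

context
  fixes \<tau> :: "'a \<Rightarrow> int" assumes hom: "trop_hom \<tau>"
begin

lemma trop_mult: "f \<in> P \<Longrightarrow> g \<in> P \<Longrightarrow> \<tau> (f * g) = \<tau> f + \<tau> g"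
  and trop_add: "f \<in> P \<Longrightarrow> g \<in> P \<Longrightarrow> \<tau> (f + g) = max (\<tau> f) (\<tau> g)"
  using hom by (auto simp: trop_hom_def)

lemma trop_one: "\<tau> 1 = 0"
  using trop_mult[OF P_one P_one] by simp

lemma trop_divide: "f \<in> P \<Longrightarrow> g \<in> P \<Longrightarrow> \<tau> (f / g) = \<tau> f - \<tau> g"
  using trop_mult[of "f / g" g] P_nonzero P_divide[of f g] by (cases "g = 0") auto

lemma trop_power: "f \<in> P \<Longrightarrow> \<tau> (f ^ n) = int n * \<tau> f"
  by (induction n) (auto simp: trop_one trop_mult P_power algebra_simps)

lemma trop_prod: "(\<And>i. i \<in> K \<Longrightarrow> f i \<in> P) \<Longrightarrow> \<tau> (prod f K) = (\<Sum>i\<in>K. \<tau> (f i))"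
  by (induction K rule: infinite_finite_induct) (auto simp: trop_one trop_mult P_prod)

lemma trop_mon: "(\<And>i. i \<in> I \<Longrightarrow> x i \<in> P) \<Longrightarrow> \<tau> (mon x e) = (\<Sum>i\<in>I. max (e i) 0 * \<tau> (x i))"
  unfolding mon_def by (subst trop_prod) (auto intro: P_power simp: trop_power max_def intro!: sum.cong)

lemma trop_mut:
  assumes "\<And>i. i \<in> I \<Longrightarrow> fst s i \<in> P" "k \<in> I"
  shows "\<tau> (fst (mut k s) k) =
    max (\<Sum>i\<in>I. max (snd s i k) 0 * \<tau> (fst s i)) (\<Sum>i\<in>I. max (- snd s i k) 0 * \<tau> (fst s i)) - \<tau> (fst s k)"
  using assms by (simp add: fst_mut_eq trop_divide trop_add trop_mon P_mon P_add)

end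

lemma goodD:
  assumes "good s"
  shows "i \<in> I \<Longrightarrow> fst s i \<in> P" and "i \<in> I \<Longrightarrow> fst s i \<noteq> 0" and "snd s i i = 0"
    and "snd s i j > 0 \<longleftrightarrow> snd s j i < 0" and "snd s i j = 0 \<longleftrightarrow> snd s j i = 0"
    and "i \<notin> I \<Longrightarrow> snd s i j = 0" and "j \<notin> I \<Longrightarrow> snd s i j = 0"
proof -
  obtain d where d: "\<And>i. d i > 0" "\<And>i j. d i * snd s i j = - (d j * snd s j i)"
    using assms unfolding good_def by blast
  show "snd s i i = 0" using d(1)[of i] d(2)[of i i] by simp
  have "snd s i j > 0 \<longleftrightarrow> d i * snd s i j > 0" using d(1)[of i] by (simp add: zero_less_mult_iff)
  also have "\<dots> \<longleftrightarrow> d j * snd s j i < 0" using d(2)[of i j] by simp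
  also have "\<dots> \<longleftrightarrow> snd s j i < 0" using d(1)[of j] by (simp add: mult_less_0_iff)
  finally show "snd s i j > 0 \<longleftrightarrow> snd s j i < 0" .
  show "snd s i j = 0 \<longleftrightarrow> snd s j i = 0"
    using d(1)[of i] d(1)[of j] d(2)[of i j] by auto
qed (use assms P_nonzero in \<open>auto simp: good_def\<close>)

text \<open>A tropical valuation with value \<open>k\<close> at the variable of node
  \<open>k\<close> tells all nodes apart.\<close>

lemma good_inj: "good s \<Longrightarrow> inj_on (fst s) I"
proof (rule inj_onI)
  fix i j assume s: "good s" "i \<in> I" "j \<in> I" "fst s i = fst s j"
  obtain \<tau> where "\<forall>k\<in>I. \<tau> (fst s k) = int k" using s(1) unfolding good_def by meson
  then show "i = j" using s by (metis of_nat_eq_iff)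
qed

lemma mutm_skew:
  fixes d :: "nat \<Rightarrow> int"
  assumes d: "\<And>i j. d i > 0 \<and> d i * b i j = - (d j * b j i)"
  shows "d i * mutm k b i j = - (d j * mutm k b j i)"
proof (cases "i = k \<or> j = k")
  case True
  then show ?thesis using d[of i j] by (auto simp: mutm_def)
next
  case False
  \<comment> \<open>The symmetrizer exchanges the positive part of an entry with the negative part
    of the transposed entry. This turns each correction term of \<open>mutm\<close> at
    \<open>(i, j)\<close> into the other correction term at \<open>(j, i)\<close>.\<close>
  have pos: "d i * max (b i k) 0 = d k * max (- b k i) 0" "d i * max (- b i k) 0 = d k * max (b k i) 0"
     "d j * max (b j k) 0 = d k * max (- b k j) 0" "d j * max (- b j k) 0 = d k * max (b k j) 0" for i j
    using d[of i k] d[of k i] d[of j k] d[of k j]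
    by (auto simp: max_mult_distrib_left)
  have "d i * mutm k b i j = d i * b i j + (d i * max (b i k) 0) * b k j + (d i * b i k) * max (- b k j) 0"
    using False by (simp add: mutm_def algebra_simps)
  also have "\<dots> = - (d j * b j i) + (d k * max (- b k i) 0) * b k j - (d k * b k i) * max (- b k j) 0"
    using pos(1)[of i] d[of i j] d[of i k] by simp
  also have "\<dots> = - (d j * b j i) + max (- b k i) 0 * (d k * b k j) - b k i * (d k * max (- b k j) 0)"
    by (simp add: algebra_simps)
  also have "\<dots> = - (d j * b j i) - max (- b k i) 0 * (d j * b j k) - b k i * (d j * max (b j k) 0)"
    using pos(3)[of j] d[of k j] by simp
  also have "\<dots> = - (d j * mutm k b j i)"
    using False by (simp add: mutm_def algebra_simps)
  finally show ?thesis .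
qed

lemma good_mut:
  assumes "good s" "k \<in> I"
  shows "good (mut k s)"
proof -
  have P: "fst s i \<in> P" if "i \<in> I" for i using goodD(1)[OF assms(1) that] .
  obtain d where d: "\<And>i j. d i > 0 \<and> d i * snd s i j = - (d j * snd s j i)"
    using assms unfolding good_def by blast
  have 1: "fst (mut k s) i \<in> P" if "i \<in> I" for i
    using P that assms(2) by (cases "i = k") (auto simp: fst_mut_eq intro!: P_divide P_add P_mon)
  have 2: "\<exists>\<tau>. trop_hom \<tau> \<and> (\<forall>i\<in>I. \<tau> (fst (mut k s) i) = \<omega> i)" for \<omega>
  proof -
    \<comment> \<open>The tropical exchange relation is an involution. Solving it for the old
      variable gives the value \<open>W\<close> that has to be prescribed at \<open>k\<close> before
      the mutation to obtain \<open>\<omega> k\<close> after it.\<close>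
    define W where "W = max (\<Sum>i\<in>I. max (snd s i k) 0 * \<omega> i) (\<Sum>i\<in>I. max (- snd s i k) 0 * \<omega> i) - \<omega> k"
    obtain \<tau> where \<tau>: "trop_hom \<tau>" "\<forall>i\<in>I. \<tau> (fst s i) = (\<omega>(k := W)) i"
      using assms(1) unfolding good_def by meson
    have "\<tau> (fst (mut k s) k) = \<omega> k"
    proof -
      have "(\<Sum>i\<in>I. max (snd s i k) 0 * \<tau> (fst s i)) = (\<Sum>i\<in>I. max (snd s i k) 0 * \<omega> i)"
        "(\<Sum>i\<in>I. max (- snd s i k) 0 * \<tau> (fst s i)) = (\<Sum>i\<in>I. max (- snd s i k) 0 * \<omega> i)"
        using \<tau>(2) goodD(3)[OF assms(1), of k] by (auto intro!: sum.cong)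
      moreover have "\<tau> (fst (mut k s) k) = max (\<Sum>i\<in>I. max (snd s i k) 0 * \<tau> (fst s i))
          (\<Sum>i\<in>I. max (- snd s i k) 0 * \<tau> (fst s i)) - \<tau> (fst s k)"
        using trop_mut[OF \<tau>(1), of s k] P assms(2) by blast
      moreover have "\<tau> (fst s k) = W" using \<tau>(2) assms(2) by simp
      ultimately show ?thesis by (simp add: W_def)
    qed
    moreover have "\<tau> (fst (mut k s) i) = \<omega> i" if "i \<in> I" "i \<noteq> k" for i
      using \<tau>(2) that by simp
    ultimately show ?thesis using \<tau>(1) by (intro exI[of _ \<tau>]) metis
  qed
  have 3: "i \<in> I \<and> j \<in> I" if "mutm k (snd s) i j \<noteq> 0" for i j
  proof (rule ccontr)
    assume "\<not> (i \<in> I \<and> j \<in> I)"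
    then have "snd s i j = 0 \<and> (snd s i k = 0 \<or> snd s k j = 0)"
      using goodD(6)[OF assms(1), of i] goodD(7)[OF assms(1), of j] by blast
    then show False using that by (auto simp: mutm_def split: if_splits)
  qed
  show ?thesis
    unfolding good_def snd_mut using 1 2 3 mutm_skew[of d "snd s"] d by blast
qed

lemma good_prm:
  assumes "good s" "\<sigma> permutes J" "J \<subseteq> I"
  shows "good (prm \<sigma> s)"
proof -
  have \<sigma>: "\<sigma> permutes I" using assms permutes_subset by blast
  then have in_I: "\<sigma> i \<in> I \<longleftrightarrow> i \<in> I" for i by (rule permutes_in_image)
  obtain d where d: "\<And>i j. d i > 0 \<and> d i * snd s i j = - (d j * snd s j i)"
    using assms unfolding good_def by blast
  have "\<exists>\<tau>. trop_hom \<tau> \<and> (\<forall>i\<in>I. \<tau> (fst (prm \<sigma> s) i) = \<omega> i)" for \<omega>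
  proof -
    obtain \<tau> where "trop_hom \<tau>" "\<forall>i\<in>I. \<tau> (fst s i) = (\<omega> \<circ> inv \<sigma>) i"
      using assms(1) unfolding good_def by meson
    then show ?thesis using in_I permutes_inverses(2)[OF \<sigma>] by (intro exI[of _ \<tau>]) auto
  qed
  moreover have "\<exists>d. \<forall>i j. d i > 0 \<and> d i * snd (prm \<sigma> s) i j = - (d j * snd (prm \<sigma> s) j i)"
  proof (intro exI[of _ "d \<circ> \<sigma>"] allI)
    fix i j show "(d \<circ> \<sigma>) i > 0 \<and> (d \<circ> \<sigma>) i * snd (prm \<sigma> s) i j = - ((d \<circ> \<sigma>) j * snd (prm \<sigma> s) j i)"
      using d[of "\<sigma> i" "\<sigma> j"] by simp
  qed
  moreover have "i \<in> I \<and> j \<in> I" if "snd (prm \<sigma> s) i j \<noteq> 0" for i j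
  proof -
    have "\<sigma> i \<in> I \<and> \<sigma> j \<in> I"
      using goodD(6)[OF assms(1), of "\<sigma> i"] goodD(7)[OF assms(1), of "\<sigma> j"] that unfolding snd_prm by blast
    then show ?thesis using in_I by simp
  qed
  moreover have "fst (prm \<sigma> s) i \<in> P" if "i \<in> I" for i
    using goodD(1)[OF assms(1)] in_I that by auto
  ultimately show ?thesis unfolding good_def by blast
qed

lemma mon_cong: "(\<And>i. i \<in> I \<Longrightarrow> e i > 0 \<Longrightarrow> x i = y i) \<Longrightarrow> mon x e = mon y e"
  unfolding mon_def by (rule prod.cong) (auto, metis nat_0_iff not_less power_0)

lemma mut_mut:
  assumes "good s" "k \<in> I"
  shows "mut k (mut k s) = s"
proof -
  have b: "snd s k k = 0" using goodD(3)[OF assms(1)] .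
  have P: "fst s i \<in> P" if "i \<in> I" for i using goodD(1)[OF assms(1) that] .
  \<comment> \<open>The mutation negates column \<open>k\<close> and changes only the variable at
    \<open>k\<close>, whose own exponent is 0. So the two exchange monomials just trade
    places.\<close>
  have m: "mon (fst (mut k s)) (\<lambda>i. snd (mut k s) i k) = mon (fst s) (\<lambda>i. - snd s i k)"
    "mon (fst (mut k s)) (\<lambda>i. - snd (mut k s) i k) = mon (fst s) (\<lambda>i. snd s i k)"
  proof -
    have *: "snd (mut k s) i k = - snd s i k" for i by (simp add: mutm_def)
    show "mon (fst (mut k s)) (\<lambda>i. snd (mut k s) i k) = mon (fst s) (\<lambda>i. - snd s i k)"
      unfolding * using b by (intro mon_cong) (metis fst_mut_neq minus_zero order_less_irrefl)
    show "mon (fst (mut k s)) (\<lambda>i. - snd (mut k s) i k) = mon (fst s) (\<lambda>i. snd s i k)"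
      unfolding * minus_minus using b by (intro mon_cong) (metis fst_mut_neq order_less_irrefl)
  qed
  have nz: "mon (fst s) (\<lambda>i. snd s i k) + mon (fst s) (\<lambda>i. - snd s i k) \<noteq> 0" "fst s k \<noteq> 0"
  proof -
    have "mon (fst s) (\<lambda>i. snd s i k) + mon (fst s) (\<lambda>i. - snd s i k) \<in> P" by (intro P_add P_mon P)
    then show "mon (fst s) (\<lambda>i. snd s i k) + mon (fst s) (\<lambda>i. - snd s i k) \<noteq> 0" using P_nonzero by auto
    show "fst s k \<noteq> 0" using P_nonzero P[OF assms(2)] by auto
  qed
  have "fst (mut k (mut k s)) l = fst s l" for l
  proof (cases "l = k")
    case True
    show ?thesis unfolding True fst_mut_eq[of k "mut k s"] m using nz by (simp add: fst_mut_eq add.commute)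
  qed simp
  moreover have "snd (mut k (mut k s)) = snd s" using mutm_mutm[of "snd s" k] b by simp
  ultimately show ?thesis by (simp add: prod_eq_iff ext)
qed

lemma mut_prm:
  assumes "\<sigma> permutes J" "J \<subseteq> I"
  shows "mut k (prm \<sigma> s) = prm \<sigma> (mut (\<sigma> k) s)"
proof -
  have \<sigma>: "\<sigma> permutes I" using assms permutes_subset by blast
  have inj: "\<sigma> i = \<sigma> j \<longleftrightarrow> i = j" for i j using permutes_inj[OF \<sigma>] by (auto dest: injD)
  have m: "mon (fst (prm \<sigma> s)) (\<lambda>i. e (\<sigma> i)) = mon (fst s) e" for e
    unfolding mon_def fst_prm by (subst (2) prod.permute[OF \<sigma>]) (simp add: o_def)
  have "fst (mut k (prm \<sigma> s)) l = fst (prm \<sigma> (mut (\<sigma> k) s)) l" for l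
  proof (cases "l = k")
    case True
    then show ?thesis
      using m[of "\<lambda>i. snd s i (\<sigma> k)"] m[of "\<lambda>i. - snd s i (\<sigma> k)"] by (simp add: fst_mut_eq)
  qed (auto simp: inj)
  moreover have "snd (mut k (prm \<sigma> s)) = snd (prm \<sigma> (mut (\<sigma> k) s))"
    by (intro ext) (auto simp: mutm_def inj)
  ultimately show ?thesis by (simp add: prod_eq_iff ext)
qed

lemma mut_comm:
  assumes "snd s k l = 0" "snd s l k = 0"
  shows "mut k (mut l s) = mut l (mut k s)"
proof (cases "k = l")
  case False
  have *: "fst (mut k (mut l s)) k = fst (mut l (mut k s)) k" if "snd s k l = 0" "snd s l k = 0" "k \<noteq> l" for k l
  proof -
    have "snd (mut l s) i k = snd s i k" for i
      using that by (cases "i = l") (auto simp: mutm_def)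
    then have "mon (fst (mut l s)) (\<lambda>i. snd (mut l s) i k) = mon (fst s) (\<lambda>i. snd s i k)"
      "mon (fst (mut l s)) (\<lambda>i. - snd (mut l s) i k) = mon (fst s) (\<lambda>i. - snd s i k)"
      using that by (auto intro!: mon_cong) (metis fst_mut_neq order_less_irrefl)+
    then show ?thesis using that by (simp add: fst_mut_eq)
  qed
  have "fst (mut k (mut l s)) m = fst (mut l (mut k s)) m" for m
    using *[OF assms False] *[OF assms(2,1)] False by (cases "m = k"; cases "m = l") auto
  moreover have "snd (mut k (mut l s)) = snd (mut l (mut k s))"
    using assms False by (simp add: mutm_comm)
  ultimately show ?thesis by (simp add: prod_eq_iff ext)
qed simp

text \<open>\<open>Z\<close> freezes values and not nodes, because a relabelling of \<open>J\<close>
  can carry a frozen variable to another node. Nodes outside \<open>J\<close> never move, so their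
  variables act as coefficients.\<close>

inductive reach :: "nat set \<Rightarrow> 'a set \<Rightarrow> 'a fseed \<Rightarrow> 'a fseed \<Rightarrow> bool" for J Z s where
  refl: "reach J Z s s"
| mut: "reach J Z s t \<Longrightarrow> k \<in> J \<Longrightarrow> fst t k \<notin> Z \<Longrightarrow> reach J Z s (mut k t)"
| prm: "reach J Z s t \<Longrightarrow> \<sigma> permutes J \<Longrightarrow> reach J Z s (prm \<sigma> t)"

lemma reach_trans: "reach J Z t u \<Longrightarrow> reach J Z s t \<Longrightarrow> reach J Z s u"
  by (induction rule: reach.induct) (auto intro: reach.intros)

lemma reach_mono: "reach J Z s t \<Longrightarrow> J \<subseteq> J' \<Longrightarrow> Z' \<subseteq> Z \<Longrightarrow> reach J' Z' s t"
  by (induction rule: reach.induct) (auto intro: reach.intros permutes_subset)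

lemma reach_good: "reach J Z s t \<Longrightarrow> good s \<Longrightarrow> J \<subseteq> I \<Longrightarrow> good t"
  by (induction rule: reach.induct) (auto intro: good_mut good_prm)

lemma reach_frozen: "reach J Z s t \<Longrightarrow> f \<notin> J \<Longrightarrow> fst t f = fst s f"
proof (induction rule: reach.induct)
  case (mut t k) then show ?case by (metis fst_mut_neq)
qed (auto simp: permutes_not_in)

lemma reach_cl: "reach J Z s t \<Longrightarrow> Z \<subseteq> cl J s \<Longrightarrow> Z \<subseteq> cl J t"
proof (induction rule: reach.induct)
  case (mut t k)
  show ?case
  proof
    fix z assume z: "z \<in> Z"
    then obtain l where l: "l \<in> J" "z = fst t l" using mut by auto
    then have "l \<noteq> k" using z mut.hyps(3) by auto
    then show "z \<in> cl J (mut k t)" using l by (auto intro: image_eqI[of _ _ l])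
  qed
next
  case (prm t \<sigma>)
  show ?case unfolding cl_prm[OF prm.hyps(2)] using prm by blast
qed auto

text \<open>A frozen value already occupies another node, which the mutation leaves alone, and the
  variables of a good seed are distinct. This is what makes frozen paths reversible.\<close>

lemma fst_mut_notin:
  assumes "good t" "k \<in> J" "J \<subseteq> I" "Z \<subseteq> cl J t" "fst t k \<notin> Z"
  shows "fst (mut k t) k \<notin> Z"
proof
  assume "fst (mut k t) k \<in> Z"
  then obtain l where l: "l \<in> J" "fst (mut k t) k = fst t l" using assms(4) by blast
  moreover have "l \<noteq> k" using l \<open>fst (mut k t) k \<in> Z\<close> assms(5) by metis
  ultimately have "l \<in> J" "fst (mut k t) k = fst t l" "l \<noteq> k" by blast+
  then show False using good_inj[OF good_mut[OF assms(1)], of k] assms(2,3)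
    by (metis fst_mut_neq inj_on_def subsetD)
qed

lemma reach_sym:
  assumes "good s" "J \<subseteq> I" "Z \<subseteq> cl J s"
  shows "reach J Z s t \<Longrightarrow> reach J Z t s"
proof (induction rule: reach.induct)
  case refl
  show ?case by (rule reach.refl)
next
  case (mut t k)
  have g: "good t" "k \<in> I" using reach_good mut.hyps assms by auto
  have "fst (mut k t) k \<notin> Z"
    using fst_mut_notin[OF g(1) mut.hyps(2) assms(2) reach_cl[OF mut.hyps(1) assms(3)] mut.hyps(3)] .
  then have "reach J Z (mut k t) t"
    using reach.mut[OF reach.refl mut.hyps(2), of "mut k t" Z] mut_mut[OF g] by simp
  then show ?case using mut.IH reach_trans by blast
next
  case (prm t \<sigma>)
  have "reach J Z (prm \<sigma> t) t"
    using reach.prm[OF reach.refl permutes_inv[OF prm.hyps(2)], of Z "prm \<sigma> t"]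
    by (simp add: prm_prm permutes_inv_o[OF prm.hyps(2)])
  then show ?case using prm.IH reach_trans by blast
qed

lemma reach_delete_freeze:
  assumes "good s" "i \<in> J" "J \<subseteq> I"
  shows "reach (J - {i}) Z s t \<Longrightarrow> reach J (insert (fst s i) Z) s t"
proof (induction rule: reach.induct)
  case (mut t k)
  have "fst t i = fst s i" using reach_frozen[OF mut.hyps(1)] by simp
  then have "fst t k \<noteq> fst s i"
    using good_inj[OF reach_good[OF mut.hyps(1) assms(1)]] assms mut.hyps(2)
    by (metis Diff_iff inj_on_def insertI1 subsetD subset_trans Diff_subset)
  then show ?case using mut by (auto intro: reach.mut)
next
  case (prm t \<sigma>)
  then show ?case by (meson Diff_subset permutes_subset reach.prm)
qed (rule reach.refl)

lemma reach_freeze_delete: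
  assumes "i \<in> J" "J \<subseteq> I"
  shows "reach J (insert (fst s i) Z) s t \<Longrightarrow> \<exists>\<sigma> t'. \<sigma> permutes J \<and> reach (J - {i}) Z s t' \<and> t = prm \<sigma> t'"
proof (induction rule: reach.induct)
  case refl
  show ?case using reach.refl permutes_id prm_id by metis
next
  case (mut t k)
  obtain \<sigma> t' where t: "\<sigma> permutes J" "reach (J - {i}) Z s t'" "t = prm \<sigma> t'"
    using mut.IH by blast
  have "\<sigma> k \<in> J - {i}"
    using mut.hyps(2,3) t reach_frozen[OF t(2), of i] by (auto simp: permutes_in_image)
  then have "reach (J - {i}) Z s (mut (\<sigma> k) t')" using mut.hyps(3) t by (auto intro: reach.mut)
  then show ?case using mut_prm[OF t(1) assms(2)] t by metis
next
  case (prm t \<rho>)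
  then show ?case using prm_prm permutes_compose by metis
qed

section \<open>Words of mutations at commuting nodes\<close>

definition mutw :: "nat list \<Rightarrow> 'a fseed \<Rightarrow> 'a fseed" where
  "mutw ks s = fold mut ks s"

lemma mutw_simps [simp]: "mutw [] s = s" "mutw (k # ks) s = mutw ks (mut k s)"
  "mutw (ks @ ls) s = mutw ls (mutw ks s)"
  by (auto simp: mutw_def)

lemma reach_mutw_refl: "set ks \<subseteq> J \<Longrightarrow> reach J {} s (mutw ks s)"
proof (induction ks arbitrary: s)
  case (Cons k ks)
  then have "reach J {} s (mut k s)" by (intro reach.mut reach.refl) auto
  then show ?case using Cons reach_trans by (metis mutw_simps(2) list.set_intros(2) subset_code(1))
qed (simp add: reach.refl)

lemma fst_mutw [simp]: "k \<notin> set ks \<Longrightarrow> fst (mutw ks s) k = fst s k"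
  by (induction ks arbitrary: s) auto

lemma mutw_rev: "good s \<Longrightarrow> set ks \<subseteq> I \<Longrightarrow> mutw (rev ks) (mutw ks s) = s"
proof (induction ks arbitrary: s)
  case (Cons k ks)
  then show ?case using good_mut mut_mut by simp
qed simp

lemma orth_mut1: "orth K L s \<Longrightarrow> k \<in> K \<Longrightarrow> orth K L (mut k s)"
  by (auto simp: orth_def mutm_def)

lemma orth_sym: "orth K L s \<longleftrightarrow> orth L K s"
  by (auto simp: orth_def)

lemma orth_mut2: "orth K L s \<Longrightarrow> k \<in> L \<Longrightarrow> orth K L (mut k s)"
  using orth_mut1 orth_sym by blast

lemma orth_mutw1: "orth K L s \<Longrightarrow> set ks \<subseteq> K \<Longrightarrow> orth K L (mutw ks s)"
proof (induction ks arbitrary: s)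
  case (Cons k ks)
  then show ?case using orth_mut1[OF Cons.prems(1), of k] by simp
qed simp

lemma orth_mono: "orth K L s \<Longrightarrow> K' \<subseteq> K \<Longrightarrow> L' \<subseteq> L \<Longrightarrow> orth K' L' s"
  by (auto simp: orth_def)

lemma mut_mutw_comm: "orth {k} (set ls) s \<Longrightarrow> mut k (mutw ls s) = mutw ls (mut k s)"
proof (induction ls arbitrary: s)
  case (Cons l ls)
  have "mut k (mut l s) = mut l (mut k s)" using Cons.prems by (intro mut_comm) (auto simp: orth_def)
  moreover have "orth {k} (set ls) (mut l s)"
    using orth_mut2[OF Cons.prems, of l] by (auto intro: orth_mono)
  ultimately show ?case using Cons.IH by simp
qed simp

lemma mutw_comm: "orth (set ks) (set ls) s \<Longrightarrow> mutw ks (mutw ls s) = mutw ls (mutw ks s)"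
proof (induction ks arbitrary: s)
  case (Cons k ks)
  have "mut k (mutw ls s) = mutw ls (mut k s)"
    using Cons.prems by (intro mut_mutw_comm orth_mono[OF Cons.prems]) auto
  moreover have "orth (set ks) (set ls) (mut k s)"
    using orth_mut1[OF Cons.prems, of k] by (auto intro: orth_mono)
  ultimately show ?case using Cons.IH by simp
qed simp

text \<open>The head of \<open>ks\<close> is moved to the front of \<open>ls\<close> past orthogonal
  nodes; orthogonality survives every mutation inside the set.\<close>

lemma mutw_cong_set:
  assumes "distinct ks" "distinct ls" "set ks = set ls" "orth (set ks) (set ks) s"
  shows "mutw ks s = mutw ls s"
  using assms
proof (induction ks arbitrary: ls s)
  case (Cons k ks)
  obtain as bs where ls: "ls = as @ k # bs" using Cons.prems(3) by (metis list.set_intros(1) split_list)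
  have "mutw ls s = mutw (as @ bs) (mut k s)"
  proof -
    have "orth {k} (set as) s" using Cons.prems(3,4) ls by (auto intro: orth_mono)
    then have "mut k (mutw as s) = mutw as (mut k s)" by (rule mut_mutw_comm)
    then show ?thesis using ls by simp
  qed
  moreover have "mutw ks (mut k s) = mutw (as @ bs) (mut k s)"
  proof (rule Cons.IH)
    show "orth (set ks) (set ks) (mut k s)"
      using orth_mut1[OF Cons.prems(4)] by (auto intro: orth_mono)
  qed (use Cons.prems ls in auto)
  ultimately show ?case by simp
qed simp

lemma orth_prm1:
  assumes "orth K L s" "\<sigma> permutes K" "K \<inter> L = {}"
  shows "orth K L (prm \<sigma> s)"
proof -
  have "\<sigma> l = l" if "l \<in> L" for l
  proof -
    have "l \<notin> K" using assms(3) that by blast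
    then show ?thesis using assms(2) by (rule permutes_not_in[rotated])
  qed
  then show ?thesis using assms(1,2) by (auto simp: orth_def permutes_in_image)
qed

lemma orth_prm2: "orth K L s \<Longrightarrow> \<sigma> permutes L \<Longrightarrow> K \<inter> L = {} \<Longrightarrow> orth K L (prm \<sigma> s)"
  using orth_prm1[of L K s \<sigma>] orth_sym by blast

text \<open>Each \<open>J2\<close>-step is pushed back through the entire \<open>J1\<close>-path.
  This is possible because no arrow ever arises between the two sets and because relabellings of
  disjoint sets commute. The equality on \<open>J2\<close> allows the variables of \<open>J2\<close>
  to be read off before the \<open>J1\<close>-path starts.\<close>

lemma reach_comm:
  assumes "J1 \<inter> J2 = {}" "J1 \<subseteq> I" "J2 \<subseteq> I"
  shows "reach J2 {} t1 t2 \<Longrightarrow> reach J1 {} s t1 \<Longrightarrow> orth J1 J2 s \<Longrightarrow>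
     \<exists>t. reach J2 {} s t \<and> reach J1 {} t t2 \<and> (\<forall>j\<in>J2. fst t j = fst t2 j)"
proof (induction rule: reach.induct)
  case refl
  have "fst s j = fst t1 j" if "j \<in> J2" for j
  proof -
    have "j \<notin> J1" using that assms(1) by blast
    then show ?thesis using reach_frozen[OF refl(1), of j] by simp
  qed
  then show ?case using refl(1) reach.refl[of J2 "{}" s] by blast
next
  case (mut t2 k)
  then obtain t where t: "reach J2 {} s t" "reach J1 {} t t2" "\<forall>j\<in>J2. fst t j = fst t2 j" by blast
  have "reach J1 {} (mut k t) (mut k t2) \<and> orth J1 J2 t2" if "orth J1 J2 t"
    using t(2) that
  proof (induction rule: reach.induct)
    case (mut t2 l)
    have "mut k (mut l t2) = mut l (mut k t2)"
      using mut \<open>k \<in> J2\<close> by (intro mut_comm) (auto simp: orth_def)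
    then show ?case using mut orth_mut1 by (auto intro: reach.mut)
  next
    case (prm t2 \<sigma>)
    have "\<sigma> k = k" using permutes_not_in[OF prm.hyps(2)] \<open>k \<in> J2\<close> assms(1) by blast
    then have "mut k (prm \<sigma> t2) = prm \<sigma> (mut k t2)"
      using mut_prm[OF prm.hyps(2) assms(2), of k t2] by simp
    moreover have "orth J1 J2 (prm \<sigma> t2)"
      using prm.IH[OF prm.prems] prm.hyps(2) assms(1) by (intro orth_prm1) auto
    ultimately show ?case using prm by (auto intro: reach.prm)
  qed (auto intro: reach.refl)
  moreover have "orth J1 J2 t"
    using t(1) mut.prems(2)
  proof (induction rule: reach.induct)
    case (prm t \<sigma>)
    then show ?case using assms(1) by (intro orth_prm2) auto
  qed (auto intro: orth_mut2)
  ultimately have 1: "reach J1 {} (mut k t) (mut k t2)" by blast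
  moreover have "reach J2 {} s (mut k t)" using t mut by (auto intro: reach.mut)
  moreover have "fst (mut k t) j = fst (mut k t2) j" if "j \<in> J2" for j
    using reach_frozen[OF 1, of j] that assms(1) by (metis disjoint_iff)
  ultimately show ?case by blast
next
  case (prm t2 \<sigma>)
  then obtain t where t: "reach J2 {} s t" "reach J1 {} t t2" "\<forall>j\<in>J2. fst t j = fst t2 j" by blast
  have fix1: "\<sigma> j = j" if "j \<in> J1" for j
    using permutes_not_in[OF prm.hyps(2)] that assms(1) by blast
  have "reach J1 {} (prm \<sigma> t) (prm \<sigma> t2)"
    using t(2)
  proof (induction rule: reach.induct)
    case (mut t2 l)
    have "mut l (prm \<sigma> t2) = prm \<sigma> (mut l t2)"
      using mut_prm[OF prm.hyps(2) assms(3), of l t2] fix1 mut.hyps(2) by simp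
    then show ?case using reach.mut[OF mut.IH mut.hyps(2)] by simp
  next
    case (prm t2 \<rho>)
    have "\<rho> \<circ> \<sigma> = \<sigma> \<circ> \<rho>"
    proof
      fix j show "(\<rho> \<circ> \<sigma>) j = (\<sigma> \<circ> \<rho>) j"
      proof (cases "j \<in> J1")
        case True
        then have "\<rho> j \<in> J1" using prm.hyps(2) by (simp add: permutes_in_image)
        then show ?thesis using True fix1 by simp
      next
        case False
        then have "\<sigma> j \<notin> J1" using \<open>\<sigma> permutes J2\<close> assms(1)
          by (cases "j \<in> J2") (auto simp: permutes_in_image permutes_not_in)
        then show ?thesis using False prm.hyps(2) by (simp add: permutes_not_in)
      qed
    qed
    then show ?case using prm prm_prm by (metis reach.prm)
  qed (auto intro: reach.refl)
  moreover have "fst (prm \<sigma> t) j = fst (prm \<sigma> t2) j" if "j \<in> J2" for j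
    using t(3) that prm.hyps(2) by (auto simp: permutes_in_image)
  ultimately show ?case using t prm.hyps(2) by (metis reach.prm)
qed

end

section \<open>Bipartite seeds and the alternating belt\<close>

locale dynkin_seeds = semifield_seeds I P for I :: "nat set" and P :: "'a::field set" +
  fixes col :: "nat \<Rightarrow> int" and A :: "nat \<Rightarrow> nat \<Rightarrow> int"
  assumes A_nonneg: "0 \<le> A i j"
    and A_eq_0: "A i j = 0 \<longleftrightarrow> A j i = 0"
    and A_col: "A i j \<noteq> 0 \<Longrightarrow> odd (col i + col j)"
begin

text \<open>Heights encode orientations: for \<open>\<sigma> = 1\<close> the arrows run from lower
  to higher nodes. Mutating a node that lies one below all its neighbours amounts to raising it by
  2, so moving along the belt is addition of heights and the sign stays fixed.\<close>

definition oriented :: "nat set \<Rightarrow> int \<Rightarrow> (nat \<Rightarrow> int) \<Rightarrow> 'a fseed \<Rightarrow> bool" where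
  "oriented J \<sigma> h s \<longleftrightarrow> (\<forall>i\<in>J. \<forall>j\<in>J. snd s i j = \<sigma> * sgn (h j - h i) * A i j)"

text \<open>The heights of the bipartite orientation: layer \<open>q\<close> is at the bottom, so it
  consists only of sources or only of sinks, depending on the sign.\<close>

definition hb :: "int \<Rightarrow> nat \<Rightarrow> int" where
  "hb q k = (if even (col k + q) then 0 else 1)"

definition bip :: "nat set \<Rightarrow> 'a fseed \<Rightarrow> bool" where
  "bip J s \<longleftrightarrow> (\<exists>\<sigma>. \<bar>\<sigma>\<bar> = 1 \<and> oriented J \<sigma> (hb 0) s)"

definition layer :: "nat set \<Rightarrow> int \<Rightarrow> nat list" where
  "layer J q = sorted_list_of_set {k \<in> J. even (col k + q)}"

definition mutl :: "nat set \<Rightarrow> int \<Rightarrow> 'a fseed \<Rightarrow> 'a fseed" where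
  "mutl J q s = mutw (layer J q) s"

primrec fwd :: "nat set \<Rightarrow> int \<Rightarrow> nat \<Rightarrow> 'a fseed \<Rightarrow> 'a fseed" where
  "fwd J q 0 s = s"
| "fwd J q (Suc r) s = mutl J (q + int r) (fwd J q r s)"

text \<open>A layer mutation is its own inverse. Going backwards therefore means alternating in the
  same way, but starting with the colour that the first forward step does not use.\<close>

definition belt :: "nat set \<Rightarrow> int \<Rightarrow> 'a fseed \<Rightarrow> int \<Rightarrow> 'a fseed" where
  "belt J p s c = (if c \<ge> 0 then fwd J p (nat c) s else fwd J (p + 1) (nat (- c)) s)"

definition X :: "nat set \<Rightarrow> int \<Rightarrow> 'a fseed \<Rightarrow> nat \<times> int \<Rightarrow> 'a" where
  "X J p s l = fst (belt J p s (snd l)) (fst l)"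

lemma A_diag [simp]: "A k k = 0"
  using A_col[of k k] by auto

lemma oriented_mono: "oriented J \<sigma> h s \<Longrightarrow> J' \<subseteq> J \<Longrightarrow> oriented J' \<sigma> h s"
  by (auto simp: oriented_def)

lemma bip_mono: "bip J s \<Longrightarrow> J' \<subseteq> J \<Longrightarrow> bip J' s"
  unfolding bip_def using oriented_mono by blast

lemma oriented_cong:
  "oriented J \<sigma> h s \<Longrightarrow> (\<And>i j. i \<in> J \<Longrightarrow> j \<in> J \<Longrightarrow> A i j \<noteq> 0 \<Longrightarrow> sgn (h j - h i) = sgn (h' j - h' i)) \<Longrightarrow> oriented J \<sigma> h' s"
  unfolding oriented_def
proof (intro ballI)
  fix i j assume *: "\<forall>i\<in>J. \<forall>j\<in>J. snd s i j = \<sigma> * sgn (h j - h i) * A i j" "i \<in> J" "j \<in> J"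
    and "\<And>i j. i \<in> J \<Longrightarrow> j \<in> J \<Longrightarrow> A i j \<noteq> 0 \<Longrightarrow> sgn (h j - h i) = sgn (h' j - h' i)"
  then show "snd s i j = \<sigma> * sgn (h' j - h' i) * A i j" by (cases "A i j = 0") auto
qed

lemma oriented_hb: "oriented J \<sigma> (hb q) s \<Longrightarrow> oriented J (if even (q - q') then \<sigma> else - \<sigma>) (hb q') s"
  unfolding oriented_def
proof (intro ballI)
  fix i j assume *: "\<forall>i\<in>J. \<forall>j\<in>J. snd s i j = \<sigma> * sgn (hb q j - hb q i) * A i j" "i \<in> J" "j \<in> J"
  show "snd s i j = (if even (q - q') then \<sigma> else - \<sigma>) * sgn (hb q' j - hb q' i) * A i j"
  proof (cases "A i j = 0")
    case False
    then have "odd (col i + col j)" by (rule A_col)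
    then show ?thesis using * by (auto simp: hb_def split: if_splits; presburger)
  qed (use * in auto)
qed

lemma bip_oriented: "bip J s \<Longrightarrow> \<exists>\<sigma>. \<bar>\<sigma>\<bar> = 1 \<and> oriented J \<sigma> (hb q) s"
proof -
  assume "bip J s"
  then obtain \<sigma> where "\<bar>\<sigma>\<bar> = 1" "oriented J \<sigma> (hb 0) s" unfolding bip_def by blast
  then show ?thesis
    using oriented_hb[of J \<sigma> 0 s q] by (intro exI[of _ "if even (0 - q) then \<sigma> else - \<sigma>"]) auto
qed

lemma oriented_bip: "\<bar>\<sigma>\<bar> = 1 \<Longrightarrow> oriented J \<sigma> (hb q) s \<Longrightarrow> bip J s"
  unfolding bip_def using oriented_hb[of J \<sigma> q s 0]
  by (intro exI[of _ "if even (q - 0) then \<sigma> else - \<sigma>"]) auto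

text \<open>The node is a source or a sink, so the only effect on the matrix is to reverse its
  arrows. Moving it from one below to one above its neighbours says the same in terms of
  heights.\<close>

lemma oriented_mut:
  assumes o: "oriented J \<sigma> h s" and "k \<in> J" and h: "\<And>j. j \<in> J \<Longrightarrow> A k j \<noteq> 0 \<Longrightarrow> h j = h k + 1"
  shows "oriented J \<sigma> (h(k := h k + 2)) (mut k s)"
  unfolding oriented_def
proof (intro ballI)
  fix i j assume ij: "i \<in> J" "j \<in> J"
  have b: "snd s i j = \<sigma> * sgn (h j - h i) * A i j" if "i \<in> J" "j \<in> J" for i j
    using o that unfolding oriented_def by blast
  show "snd (mut k s) i j = \<sigma> * sgn ((h(k := h k + 2)) j - (h(k := h k + 2)) i) * A i j"
  proof (cases "i = k \<or> j = k")
    case True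
    have "A k l = 0 \<or> h l = h k + 1" "A l k = 0 \<or> h l = h k + 1" if "l \<in> J" for l
      using h[OF that] A_eq_0[of l k] by auto
    from this[OF ij(1)] this[OF ij(2)] show ?thesis using True b[OF ij] ij by (auto simp: mutm_def)
  next
    case False
    have "snd s i k = - (\<sigma> * A i k)"
      using b[of i k] h[of i] A_eq_0[of i k] ij assms(2) by (cases "A i k = 0") auto
    moreover have "snd s k j = \<sigma> * A k j"
      using b[of k j] h[of j] ij assms(2) by (cases "A k j = 0") auto
    ultimately have "mutm k (snd s) i j = snd s i j"
      using False A_nonneg[of i k] A_nonneg[of k j]
      by (intro mutm_source_sink) (auto simp: zero_le_mult_iff mult_le_0_iff)
    then show ?thesis using b[OF ij] False by simp
  qed
qed

lemma oriented_mutw: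
  assumes "oriented J \<sigma> h s" "set ks \<subseteq> J" "distinct ks"
    and "\<And>k. k \<in> set ks \<Longrightarrow> h k = c" and "\<And>k j. k \<in> set ks \<Longrightarrow> j \<in> J \<Longrightarrow> A k j \<noteq> 0 \<Longrightarrow> h j = c + 1"
  shows "oriented J \<sigma> (\<lambda>k. if k \<in> set ks then c + 2 else h k) (mutw ks s)"
  using assms
proof (induction ks arbitrary: s h)
  case (Cons k ks)
  have "oriented J \<sigma> (h(k := h k + 2)) (mut k s)"
    using Cons.prems by (intro oriented_mut) auto
  then have "oriented J \<sigma> (\<lambda>l. if l \<in> set ks then c + 2 else (h(k := h k + 2)) l) (mutw ks (mut k s))"
  proof (rule Cons.IH)
    fix k' j assume *: "k' \<in> set ks" "j \<in> J" "A k' j \<noteq> 0"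
    then have "h j = c + 1" using Cons.prems(5)[of k' j] by simp
    then show "(h(k := h k + 2)) j = c + 1" using Cons.prems(4)[of k] by auto
  qed (use Cons.prems in auto)
  moreover have "(\<lambda>l. if l \<in> set ks then c + 2 else (h(k := h k + 2)) l) = (\<lambda>l. if l \<in> set (k # ks) then c + 2 else h l)"
    using Cons.prems(4)[of k] by auto
  ultimately show ?case by (simp only: mutw_simps)
qed simp

lemma finite_subset_I: "J \<subseteq> I \<Longrightarrow> finite J"
  using finite_subset finite_I by blast

lemma set_layer: "J \<subseteq> I \<Longrightarrow> set (layer J q) = {k \<in> J. even (col k + q)}"
  unfolding layer_def using finite_subset_I[of J] by (subst set_sorted_list_of_set) auto

lemma distinct_layer: "distinct (layer J q)"
  by (simp add: layer_def)

lemma layer_parity: "even (q - q') \<Longrightarrow> layer J q = layer J q'"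
proof -
  assume "even (q - q')"
  then have "even (col k + q) \<longleftrightarrow> even (col k + q')" for k by presburger
  then show ?thesis by (simp add: layer_def)
qed

lemma oriented_mutl:
  assumes "oriented J \<sigma> (\<lambda>k. c + hb q k) s" "J \<subseteq> I"
  shows "oriented J \<sigma> (\<lambda>k. c + 1 + hb (q + 1) k) (mutl J q s)"
proof -
  have "oriented J \<sigma> (\<lambda>k. if k \<in> set (layer J q) then c + 2 else c + hb q k) (mutl J q s)"
    unfolding mutl_def
  proof (rule oriented_mutw[OF assms(1)])
    fix k j assume "k \<in> set (layer J q)" "j \<in> J" "A k j \<noteq> 0"
    then show "c + hb q j = c + 1"
      using A_col[of k j] set_layer[OF assms(2)] by (auto simp: hb_def; presburger)
  qed (use set_layer[OF assms(2)] distinct_layer in \<open>auto simp: hb_def\<close>)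
  then show ?thesis
    by (rule oriented_cong) (use set_layer[OF assms(2)] in \<open>auto simp: hb_def\<close>)
qed

lemma oriented_fwd:
  assumes "oriented J \<sigma> (hb q) s" "J \<subseteq> I"
  shows "oriented J \<sigma> (\<lambda>k. int r + hb (q + int r) k) (fwd J q r s)"
proof (induction r)
  case 0
  then show ?case using assms by simp
next
  case (Suc r)
  then show ?case using oriented_mutl[OF Suc assms(2)] by (simp add: add_ac)
qed

lemma bip_fwd: "bip J s \<Longrightarrow> J \<subseteq> I \<Longrightarrow> bip J (fwd J q r s)"
proof -
  assume "bip J s" "J \<subseteq> I"
  then obtain \<sigma> where \<sigma>: "\<bar>\<sigma>\<bar> = 1" "oriented J \<sigma> (hb q) s" using bip_oriented by blast
  have "oriented J \<sigma> (hb (q + int r)) (fwd J q r s)"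
    by (rule oriented_cong[OF oriented_fwd[OF \<sigma>(2) \<open>J \<subseteq> I\<close>]]) simp
  then show ?thesis using oriented_bip \<sigma>(1) by blast
qed

lemma reach_fwd: "J \<subseteq> I \<Longrightarrow> reach J {} s (fwd J q r s)"
proof (induction r)
  case (Suc r)
  have "reach J {} (fwd J q r s) (fwd J q (Suc r) s)"
    using set_layer[OF Suc.prems] by (auto simp: mutl_def intro: reach_mutw_refl)
  then show ?case using Suc reach_trans by blast
qed (simp add: reach.refl)

lemma reach_belt: "J \<subseteq> I \<Longrightarrow> reach J {} s (belt J p s c)"
  by (simp add: belt_def reach_fwd)

lemma good_belt: "good s \<Longrightarrow> J \<subseteq> I \<Longrightarrow> good (belt J p s c)"
  using reach_belt reach_good by blast

lemma bip_belt: "bip J s \<Longrightarrow> J \<subseteq> I \<Longrightarrow> bip J (belt J p s c)"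
  by (simp add: belt_def bip_fwd)

lemma bip_orth:
  assumes "bip J s" "K \<subseteq> J" "\<And>i j. i \<in> K \<Longrightarrow> j \<in> K \<Longrightarrow> even (col i + col j)"
  shows "orth K K s"
  unfolding orth_def
proof (intro ballI)
  fix k l assume kl: "k \<in> K" "l \<in> K"
  obtain \<sigma> where "oriented J \<sigma> (hb 0) s" using assms(1) bip_def by blast
  then have "snd s k l = \<sigma> * sgn (hb 0 l - hb 0 k) * A k l" "snd s l k = \<sigma> * sgn (hb 0 k - hb 0 l) * A l k"
    using kl assms(2) unfolding oriented_def by blast+
  moreover have "A k l = 0" "A l k = 0" using A_col[of k l] A_eq_0[of k l] assms(3)[OF kl] by auto
  ultimately show "snd s k l = 0 \<and> snd s l k = 0" by simp
qed

lemma orth_layer: "bip J s \<Longrightarrow> J \<subseteq> I \<Longrightarrow> orth (set (layer J q)) (set (layer J q)) s"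
  by (rule bip_orth) (auto simp: set_layer)

lemma mutl_mutl:
  assumes "good s" "bip J s" "J \<subseteq> I"
  shows "mutl J q (mutl J q s) = s"
proof -
  have o: "orth (set (layer J q)) (set (layer J q)) (mutw (layer J q) s)"
    by (rule orth_mutw1[OF orth_layer[OF assms(2,3)]]) simp
  have "mutw (layer J q) (mutw (layer J q) s) = mutw (rev (layer J q)) (mutw (layer J q) s)"
    using o by (intro mutw_cong_set) (auto simp: distinct_layer)
  then show ?thesis using mutw_rev[OF assms(1)] set_layer[OF assms(3)] assms(3) by (auto simp: mutl_def)
qed

lemma mutl_parity: "even (q - q') \<Longrightarrow> mutl J q s = mutl J q' s"
  using layer_parity[of q q' J] by (simp add: mutl_def)

lemma fwd_parity: "even (q - q') \<Longrightarrow> fwd J q r s = fwd J q' r s"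
proof (induction r)
  case (Suc r)
  then show ?case using mutl_parity[of "q + int r" "q' + int r"] by simp
qed simp

lemma belt_parity: "even (p - p') \<Longrightarrow> belt J p s = belt J p' s"
  using fwd_parity[of p p'] fwd_parity[of "p + 1" "p' + 1"] by (auto simp: belt_def fun_eq_iff)

lemma X_parity: "even (p - p') \<Longrightarrow> X J p s = X J p' s"
  using belt_parity[of p p'] by (auto simp: X_def fun_eq_iff)

lemma belt_0 [simp]: "belt J p s 0 = s"
  by (simp add: belt_def)

lemma belt_step:
  assumes "good s" "bip J s" "J \<subseteq> I"
  shows "belt J p s (c + 1) = mutl J (p + c) (belt J p s c)"
proof (cases "c \<ge> 0")
  case True
  then have "nat (c + 1) = Suc (nat c)" by simp
  then show ?thesis using True by (simp add: belt_def)
next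
  case False
  define r where "r = nat (- c - 1)"
  have r: "nat (- c) = Suc r" "c + 1 \<ge> 0 \<longleftrightarrow> r = 0" "nat (- (c + 1)) = r" using False by (auto simp: r_def)
  have c: "belt J p s c = mutl J (p + 1 + int r) (fwd J (p + 1) r s)" using False r by (simp add: belt_def)
  have c1: "belt J p s (c + 1) = fwd J (p + 1) r s" using r by (auto simp: belt_def)
  have "mutl J (p + c) (belt J p s c) = mutl J (p + 1 + int r) (belt J p s c)"
    using False by (intro mutl_parity) (auto simp: r_def)
  also have "\<dots> = fwd J (p + 1) r s"
    unfolding c using reach_good[OF reach_fwd[OF assms(3)] assms(1,3)] bip_fwd[OF assms(2,3)] assms(3)
    by (intro mutl_mutl)
  finally show ?thesis using c1 by simp
qed

lemma belt_step_back:
  assumes "good s" "bip J s" "J \<subseteq> I"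
  shows "belt J p s (c - 1) = mutl J (p + c - 1) (belt J p s c)"
  using belt_step[OF assms, of p "c - 1"] mutl_mutl[OF good_belt[OF assms(1,3)] bip_belt[OF assms(2,3)] assms(3), of "p + c - 1" p "c - 1"]
  by (simp add: algebra_simps)

lemma belt_shift:
  assumes "good s" "bip J s" "J \<subseteq> I"
  shows "belt J (p + a) (belt J p s a) c = belt J p s (a + c)"
proof -
  have g: "good (belt J p s a)" "bip J (belt J p s a)" using assms good_belt bip_belt by blast+
  show ?thesis
  proof (induction c rule: int_induct[where k = 0])
    case (step1 c)
    then show ?case using belt_step[OF g assms(3), of "p + a" c] belt_step[OF assms, of p "a + c"]
      by (simp add: algebra_simps)
  next
    case (step2 c)
    then show ?case using belt_step_back[OF g assms(3), of "p + a" c] belt_step_back[OF assms, of p "a + c"]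
      by (simp add: algebra_simps)
  qed simp
qed

lemma X_shift:
  assumes "good s" "bip J s" "J \<subseteq> I"
  shows "X J (p + a) (belt J p s a) (k, c) = X J p s (k, a + c)"
  using belt_shift[OF assms] by (simp add: X_def)

lemma mutl_other: "J \<subseteq> I \<Longrightarrow> odd (col k + q) \<Longrightarrow> fst (mutl J q s) k = fst s k"
  unfolding mutl_def by (rule fst_mutw) (simp add: set_layer)

text \<open>Node \<open>k\<close> is idle in the next step, so its variable is also the one of the
  valid label that is one step later.\<close>

lemma X_next:
  assumes "good s" "bip J s" "J \<subseteq> I" "odd (col k + p + c)"
  shows "fst (belt J p s c) k = X J p s (k, c + 1)"
  using belt_step[OF assms(1-3), of p c] mutl_other[OF assms(3), of k "p + c"] assms(4)
  by (simp add: X_def add_ac)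

subsection \<open>Belts of subdiagrams\<close>

text \<open>A light cone argument: \<open>d\<close> is at most the distance to the nodes outside
  \<open>E\<close>, and the effect of deleting these travels along one edge per step. After
  \<open>r\<close> steps both belts are obtained from one common seed \<open>T\<close> by words in
  nodes with \<open>d k < r\<close>, while at all other nodes \<open>T\<close> has already reached
  the heights of the full belt.\<close>

lemma fwd_subset:
  assumes s: "good s" "bip D s" and "D \<subseteq> I" "E \<subseteq> D"
    and d0: "\<And>k. k \<in> D - E \<Longrightarrow> d k = (0::nat)"
    and d: "\<And>i j. i \<in> D \<Longrightarrow> j \<in> D \<Longrightarrow> A i j \<noteq> 0 \<Longrightarrow> d i \<le> Suc (d j)"
  shows "\<exists>T ws vs h \<sigma>. set ws \<subseteq> {k\<in>D. d k < r} \<and> set vs \<subseteq> {k\<in>E. d k < r} \<and> reach D {} s T \<and>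
    fwd D q r s = mutw ws T \<and> fwd E q r s = mutw vs T \<and> oriented D \<sigma> h T \<and>
    (\<forall>k\<in>D. d k \<ge> r \<longrightarrow> h k = int r + hb (q + int r) k)"
proof (induction r)
  case 0
  obtain \<sigma> where "oriented D \<sigma> (hb q) s" using s bip_oriented by blast
  then show ?case
    by (intro exI[of _ s] exI[of _ "[]"] exI[of _ "hb q"] exI[of _ \<sigma>]) (auto intro: reach.refl)
next
  case (Suc r)
  then obtain T ws vs h \<sigma> where ws: "set ws \<subseteq> {k\<in>D. d k < r}" and vs: "set vs \<subseteq> {k\<in>E. d k < r}" and T: "reach D {} s T"
    and fD: "fwd D q r s = mutw ws T" and fE: "fwd E q r s = mutw vs T" and o: "oriented D \<sigma> h T"
    and h: "\<And>k. k\<in>D \<Longrightarrow> d k \<ge> r \<Longrightarrow> h k = int r + hb (q + int r) k" by blast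
  have EI: "E \<subseteq> I" using assms by blast
  \<comment> \<open>\<open>L\<close> is the part of the layer that the deletion has not influenced
    yet; both belts mutate it. \<open>LD\<close> and \<open>LE\<close> are the remaining parts,
    where the belts may differ.\<close>
  define L where "L = filter (\<lambda>k. d k \<ge> Suc r) (layer D (q + int r))"
  define LD where "LD = filter (\<lambda>k. \<not> d k \<ge> Suc r) (layer D (q + int r))"
  define LE where "LE = filter (\<lambda>k. \<not> d k \<ge> Suc r) (layer E (q + int r))"
  define T' where "T' = mutw L T"
  have setL: "set L = {k\<in>E. even (col k + (q + int r)) \<and> d k \<ge> Suc r}"
    using d0 assms(4) by (fastforce simp: L_def set_layer[OF assms(3)])
  have L: "set L \<subseteq> {k\<in>D. d k \<ge> Suc r}" using setL assms(4) by auto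
  \<comment> \<open>\<open>d\<close> changes by at most 1 along an edge, so nodes on the two sides
    of level \<open>r\<close> are not adjacent, and \<open>L\<close> can be moved in front of
    \<open>ws\<close> and of \<open>vs\<close>.\<close>
  have orthT: "orth {k\<in>D. d k < r} {k\<in>D. d k \<ge> Suc r} T"
    unfolding orth_def
  proof (intro ballI)
    fix k l assume kl: "k \<in> {k\<in>D. d k < r}" "l \<in> {k\<in>D. d k \<ge> Suc r}"
    then have "A l k = 0" using d[of l k] by force
    then show "snd T k l = 0 \<and> snd T l k = 0" using o kl A_eq_0[of l k] unfolding oriented_def by auto
  qed
  have stepD: "fwd D q (Suc r) s = mutw (ws @ LD) T'"
  proof -
    have "fwd D q (Suc r) s = mutw (L @ LD) (fwd D q r s)"
      unfolding fwd.simps mutl_def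
      using orth_layer[OF bip_fwd[OF s(2) assms(3)] assms(3)]
      by (intro mutw_cong_set) (auto simp: distinct_layer L_def LD_def)
    also have "mutw L (mutw ws T) = mutw ws (mutw L T)"
      by (rule mutw_comm) (use orth_mono[OF orthT ws L] orth_sym in blast)
    then have "mutw (L @ LD) (fwd D q r s) = mutw (ws @ LD) T'" by (simp add: fD T'_def)
    finally show ?thesis .
  qed
  have stepE: "fwd E q (Suc r) s = mutw (vs @ LE) T'"
  proof -
    have bE: "bip E s" using s(2) assms(4) bip_mono by blast
    have "fwd E q (Suc r) s = mutw (L @ LE) (fwd E q r s)"
      unfolding fwd.simps mutl_def
    proof (intro mutw_cong_set)
      show "set (layer E (q + int r)) = set (L @ LE)"
        using setL by (auto simp: LE_def set_layer[OF EI])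
      show "distinct (L @ LE)" by (auto simp: L_def LE_def distinct_layer)
    qed (use orth_layer[OF bip_fwd[OF bE EI] EI] distinct_layer in auto)
    also have "mutw L (mutw vs T) = mutw vs (mutw L T)"
    proof (rule mutw_comm)
      have "set vs \<subseteq> {k\<in>D. d k < r}" using vs assms(4) by blast
      then show "orth (set L) (set vs) T" using orth_mono[OF orthT _ L] orth_sym by blast
    qed
    then have "mutw (L @ LE) (fwd E q r s) = mutw (vs @ LE) T'" by (simp add: fE T'_def)
    finally show ?thesis .
  qed
  have o': "oriented D \<sigma> (\<lambda>k. if k \<in> set L then int r + 2 else h k) T'"
    unfolding T'_def
  proof (rule oriented_mutw[OF o])
    show "set L \<subseteq> D" using L by auto
    show "distinct L" by (simp add: L_def distinct_layer)
    show "h k = int r" if "k \<in> set L" for k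
      using h[of k] that setL assms(4) by (auto simp: hb_def)
    show "h j = int r + 1" if "k \<in> set L" "j \<in> D" "A k j \<noteq> 0" for k j
    proof -
      have "d j \<ge> r" using d[of k j] that L by fastforce
      moreover have "odd (col j + (q + int r))" using A_col[OF that(3)] that(1) setL by auto
      ultimately show ?thesis using h[of j] that(2) by (simp add: hb_def)
    qed
  qed
  have h': "(if k \<in> set L then int r + 2 else h k) = int (Suc r) + hb (q + int (Suc r)) k"
    if "k \<in> D" "d k \<ge> Suc r" for k
  proof -
    have "k \<in> E" using d0[of k] that by (cases "k \<in> E") auto
    then show ?thesis using that h[of k] setL by (auto simp: hb_def)
  qed
  show ?case
  proof (intro exI conjI)
    show "set (ws @ LD) \<subseteq> {k\<in>D. d k < Suc r}"
      using ws by (auto simp: LD_def set_layer[OF assms(3)])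
    show "set (vs @ LE) \<subseteq> {k\<in>E. d k < Suc r}"
      using vs by (auto simp: LE_def set_layer[OF EI])
    show "reach D {} s T'"
    proof -
      have "reach D {} T T'" unfolding T'_def using L by (intro reach_mutw_refl) auto
      then show ?thesis using T reach_trans by blast
    qed
    show "\<forall>k\<in>D. d k \<ge> Suc r \<longrightarrow> (if k \<in> set L then int r + 2 else h k) = int (Suc r) + hb (q + int (Suc r)) k"
      using h' by blast
  qed (use stepD stepE o' in auto)
qed

lemma fwd_subset_agree:
  assumes s: "good s" "bip D s" and "D \<subseteq> I" "E \<subseteq> D"
    and d0: "\<And>k. k \<in> D - E \<Longrightarrow> d k = (0::nat)"
    and d: "\<And>i j. i \<in> D \<Longrightarrow> j \<in> D \<Longrightarrow> A i j \<noteq> 0 \<Longrightarrow> d i \<le> Suc (d j)"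
    and k: "k \<in> E" "d k \<ge> r"
  shows "fst (fwd D q r s) k = fst (fwd E q r s) k \<and> reach (D - {k}) {} (fwd D q r s) (fwd E q r s)"
proof -
  obtain T ws vs where ws: "set ws \<subseteq> {k\<in>D. d k < r}" and vs: "set vs \<subseteq> {k\<in>E. d k < r}" and T: "reach D {} s T"
    and fD: "fwd D q r s = mutw ws T" and fE: "fwd E q r s = mutw vs T"
    using fwd_subset[where d = d and r = r and q = q, OF assms(1-6)] by blast
  have g: "good T" using reach_good T s assms(3) by blast
  have ws': "set ws \<subseteq> D - {k}" "set vs \<subseteq> D - {k}" using ws vs k assms(4) by auto
  have "reach (D - {k}) {} T (fwd D q r s)" "reach (D - {k}) {} T (fwd E q r s)"
    unfolding fD fE using ws' by (auto intro!: reach_mutw_refl)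
  then have "reach (D - {k}) {} (fwd D q r s) (fwd E q r s)"
    using reach_trans reach_sym[OF g, of "D - {k}" "{}"] assms(3) by blast
  moreover have "k \<notin> set ws" "k \<notin> set vs" using ws' by blast+
  then have "fst (fwd D q r s) k = fst (fwd E q r s) k" unfolding fD fE by simp
  ultimately show ?thesis by blast
qed

lemma belt_subset_agree:
  assumes s: "good s" "bip D s" and "D \<subseteq> I" "E \<subseteq> D"
    and d0: "\<And>k. k \<in> D - E \<Longrightarrow> d k = (0::nat)"
    and d: "\<And>i j. i \<in> D \<Longrightarrow> j \<in> D \<Longrightarrow> A i j \<noteq> 0 \<Longrightarrow> d i \<le> Suc (d j)"
    and k: "k \<in> E" "\<bar>c\<bar> \<le> int (d k)"
  shows "X D p s (k, c) = X E p s (k, c)" "reach (D - {k}) {} (belt D p s c) (belt E p s c)"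
proof -
  have "fst (belt D p s c) k = fst (belt E p s c) k \<and> reach (D - {k}) {} (belt D p s c) (belt E p s c)"
  proof (cases "c \<ge> 0")
    case True
    then show ?thesis unfolding belt_def using k fwd_subset_agree[where d = d and r = "nat c", OF assms(1-6) k(1)] by simp
  next
    case False
    then show ?thesis unfolding belt_def using k fwd_subset_agree[where d = d and r = "nat (- c)", OF assms(1-6) k(1)] by simp
  qed
  then show "X D p s (k, c) = X E p s (k, c)" "reach (D - {k}) {} (belt D p s c) (belt E p s c)"
    by (auto simp: X_def)
qed

subsection \<open>Tropical belts\<close>

text \<open>In a bipartite seed all arrows at a node of the layer point the same way, so one
  exchange monomial consists of frozen variables only. These get weight 0, which leaves
  \<open>max 0\<close> of the other monomial whatever the sign of the orientation.\<close>

definition tstep :: "nat set \<Rightarrow> int \<Rightarrow> (nat \<Rightarrow> int) \<Rightarrow> nat \<Rightarrow> int" where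
  "tstep J q v k = (if k \<in> J \<and> even (col k + q) then max 0 (\<Sum>j\<in>J. A j k * v j) - v k else v k)"

primrec tfwd :: "nat set \<Rightarrow> int \<Rightarrow> nat \<Rightarrow> (nat \<Rightarrow> int) \<Rightarrow> nat \<Rightarrow> int" where
  "tfwd J q 0 v = v"
| "tfwd J q (Suc r) v = tstep J (q + int r) (tfwd J q r v)"

definition tX :: "nat set \<Rightarrow> int \<Rightarrow> (nat \<Rightarrow> int) \<Rightarrow> nat \<times> int \<Rightarrow> int" where
  "tX J p v l = (if snd l \<ge> 0 then tfwd J p (nat (snd l)) v else tfwd J (p + 1) (nat (- snd l)) v) (fst l)"

lemma trop_mutl:
  assumes s: "good s" "bip J s" and "J \<subseteq> I" and \<tau>: "trop_hom \<tau>" "\<And>f. f \<in> I - J \<Longrightarrow> \<tau> (fst s f) = 0" and "k \<in> J"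
  shows "\<tau> (fst (mutl J q s) k) = tstep J q (\<lambda>k. \<tau> (fst s k)) k"
proof (cases "even (col k + q)")
  case False
  then show ?thesis using mutl_other[OF assms(3)] by (simp add: tstep_def)
next
  case True
  have kL: "k \<in> set (layer J q)" using True assms(6) set_layer[OF assms(3)] by simp
  have "mutl J q s = mutw (k # remove1 k (layer J q)) s"
    unfolding mutl_def using kL
    by (intro mutw_cong_set orth_layer s assms(3)) (auto simp: distinct_layer)
  then have "fst (mutl J q s) k = fst (mut k s) k" by (simp add: distinct_layer)
  moreover have "\<tau> (fst (mut k s) k) = max 0 (\<Sum>j\<in>J. A j k * \<tau> (fst s j)) - \<tau> (fst s k)"
  proof -
    obtain \<sigma> where \<sigma>: "\<bar>\<sigma>\<bar> = 1" "oriented J \<sigma> (hb q) s" using s bip_oriented by blast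
    have b: "snd s j k = - \<sigma> * A j k" if "j \<in> J" for j
    proof (cases "A j k = 0")
      case True
      then show ?thesis using \<sigma>(2) that assms(6) unfolding oriented_def by simp
    next
      case False
      then have "odd (col j + q)" using A_col[of j k] True by auto
      then show ?thesis using \<sigma>(2) that assms(6) True unfolding oriented_def by (simp add: hb_def)
    qed
    have sum: "(\<Sum>i\<in>I. f (snd s i k) * \<tau> (fst s i)) = (\<Sum>j\<in>J. f (- \<sigma> * A j k) * \<tau> (fst s j))" for f :: "int \<Rightarrow> int"
    proof -
      have "(\<Sum>i\<in>I. f (snd s i k) * \<tau> (fst s i)) = (\<Sum>i\<in>J. f (snd s i k) * \<tau> (fst s i))"
        using \<tau>(2) assms(3) by (intro sum.mono_neutral_right) auto
      then show ?thesis using b by simp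
    qed
    have "\<tau> (fst (mut k s) k) = max (\<Sum>i\<in>I. max (snd s i k) 0 * \<tau> (fst s i)) (\<Sum>i\<in>I. max (- snd s i k) 0 * \<tau> (fst s i)) - \<tau> (fst s k)"
      using trop_mut[OF \<tau>(1), of s k] goodD(1)[OF s(1)] assms(3,6) by blast
    moreover have "max (\<Sum>i\<in>I. max (snd s i k) 0 * \<tau> (fst s i)) (\<Sum>i\<in>I. max (- snd s i k) 0 * \<tau> (fst s i))
      = max 0 (\<Sum>j\<in>J. A j k * \<tau> (fst s j))"
    proof -
      have "max (A j k) 0 = A j k" "max (- A j k) 0 = 0" for j using A_nonneg[of j k] by auto
      moreover have "\<sigma> = 1 \<or> \<sigma> = -1" using \<sigma>(1) by auto
      ultimately show ?thesis
        using sum[of "\<lambda>b. max b 0"] sum[of "\<lambda>b. max (- b) 0"] by (auto simp: max.commute)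
    qed
    ultimately show ?thesis by simp
  qed
  ultimately show ?thesis using True assms(6) by (simp add: tstep_def)
qed

lemma tstep_cong: "(\<And>j. j \<in> J \<Longrightarrow> v j = w j) \<Longrightarrow> k \<in> J \<Longrightarrow> tstep J q v k = tstep J q w k"
  by (simp add: tstep_def)

lemma tfwd_cong: "(\<And>j. j \<in> J \<Longrightarrow> v j = w j) \<Longrightarrow> k \<in> J \<Longrightarrow> tfwd J q r v k = tfwd J q r w k"
proof (induction r arbitrary: k)
  case (Suc r)
  then show ?case by (auto intro!: tstep_cong)
qed simp

lemma trop_fwd:
  assumes s: "good s" "bip J s" and "J \<subseteq> I" and \<tau>: "trop_hom \<tau>" "\<And>f. f \<in> I - J \<Longrightarrow> \<tau> (fst s f) = 0" and "k \<in> J"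
  shows "\<tau> (fst (fwd J q r s) k) = tfwd J q r (\<lambda>k. \<tau> (fst s k)) k"
  using assms(6)
proof (induction r arbitrary: k)
  case (Suc r)
  have "\<tau> (fst (fwd J q r s) f) = 0" if "f \<in> I - J" for f
    using \<tau>(2)[OF that] reach_frozen[OF reach_fwd[OF assms(3)], of f] that by simp
  then have "\<tau> (fst (fwd J q (Suc r) s) k) = tstep J (q + int r) (\<lambda>k. \<tau> (fst (fwd J q r s) k)) k"
    unfolding fwd.simps using Suc.prems reach_good[OF reach_fwd[OF assms(3)] s(1) assms(3)] bip_fwd[OF s(2) assms(3)]
    by (intro trop_mutl \<tau>(1) assms(3)) auto
  then show ?case using Suc by (simp cong: tstep_cong add: tstep_def)
qed simp

lemma trop_X:
  assumes "good s" "bip J s" "J \<subseteq> I" "trop_hom \<tau>" "\<And>f. f \<in> I - J \<Longrightarrow> \<tau> (fst s f) = 0" "fst l \<in> J"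
    and "\<And>j. j \<in> J \<Longrightarrow> v j = \<tau> (fst s j)"
  shows "\<tau> (X J p s l) = tX J p v l"
  unfolding X_def tX_def belt_def
  using trop_fwd[OF assms(1-6)] tfwd_cong[of J v "\<lambda>j. \<tau> (fst s j)", OF assms(7) assms(6)] by simp

lemma exists_trop:
  assumes "good s"
  shows "\<exists>\<tau>. trop_hom \<tau> \<and> (\<forall>i\<in>I. \<tau> (fst s i) = \<omega> i)"
  using assms unfolding good_def by blast

end

section \<open>Coincidences between belt variables and the stars of variables\<close>

context dynkin_seeds
begin

text \<open>A label \<open>(k, c)\<close> names the variable at node \<open>k\<close> after \<open>c\<close> steps of the belt with base parity \<open>p\<close>.
  A variable stays in place for two steps; valid labels refer to the second one.\<close>

definition valid :: "nat set \<Rightarrow> int \<Rightarrow> nat \<times> int \<Rightarrow> bool" where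
  "valid J p l \<longleftrightarrow> fst l \<in> J \<and> even (col (fst l) + p + snd l)"

text \<open>Connectedness of the links of vertices in the exchange graph.\<close>

definition conn :: "nat set \<Rightarrow> 'a fseed \<Rightarrow> bool" where
  "conn J s \<longleftrightarrow> (\<forall>t t' v. reach J {} s t \<and> reach J {} s t' \<and> v \<in> cl J t \<and> v \<in> cl J t' \<longrightarrow> reach J {v} t t')"

definition nice :: "nat set \<Rightarrow> (int \<Rightarrow> (nat \<times> int) set) \<Rightarrow> bool" where
  "nice J L \<longleftrightarrow> (\<forall>p. \<forall>l\<in>L p. valid J p l) \<and>
    (\<forall>s p. good s \<longrightarrow> bip J s \<longrightarrow> conn J s \<and> (\<forall>t. reach J {} s t \<longrightarrow> cl J t \<subseteq> X J p s ` L p) \<and> inj_on (X J p s) (L p))"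

text \<open>The stars of two belt variables meet: some seed is reached from either belt position without
  mutating the respective variable.\<close>

definition joined :: "nat set \<Rightarrow> int \<Rightarrow> 'a fseed \<Rightarrow> nat \<times> int \<Rightarrow> nat \<times> int \<Rightarrow> bool" where
  "joined D p s l1 l2 \<longleftrightarrow> (\<exists>t. reach D {X D p s l1} (belt D p s (snd l1)) t \<and> reach D {X D p s l2} (belt D p s (snd l2)) t)"

text \<open>The link of the variable at \<open>i\<close> is the exchange graph of \<open>D - {i}\<close>; its variable with label \<open>e\<close> is the
  variable with label \<open>l\<close> of the belt of \<open>D\<close>.\<close>

definition known :: "nat set \<Rightarrow> nat \<Rightarrow> nat \<times> int \<Rightarrow> nat \<times> int \<Rightarrow> bool" where
  "known D i e l \<longleftrightarrow> fst e \<in> D - {i} \<and> valid D (col i) l \<and>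
     (\<forall>s. good s \<longrightarrow> bip D s \<longrightarrow> joined D (col i) s (i, 0) l \<and> X (D - {i}) (col i) s e = X D (col i) s l)"

text \<open>Zamolodchikov periodicity at one node: after \<open>h\<close> steps the variable of
  \<open>k\<close> is back, at node \<open>st k\<close>. The path is part of the claim, because the
  stars taken at the two belt positions have to agree as well.\<close>

definition per :: "nat set \<Rightarrow> int \<Rightarrow> (nat \<Rightarrow> nat) \<Rightarrow> nat \<Rightarrow> bool" where
  "per D h st k \<longleftrightarrow> st k \<in> D \<and> even (col (st k) + col k + h) \<and>
     (\<forall>s. good s \<longrightarrow> bip D s \<longrightarrow> X D (col k) s (st k, h) = fst s k \<and> reach D {fst s k} s (belt D (col k) s h))"

lemma niceD:
  assumes "nice J L" "good s" "bip J s"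
  shows "conn J s" "reach J {} s t \<Longrightarrow> cl J t \<subseteq> X J p s ` L p" "inj_on (X J p s) (L p)"
  using assms unfolding nice_def by blast+

lemma nice_valid: "nice J L \<Longrightarrow> l \<in> L p \<Longrightarrow> valid J p l"
  unfolding nice_def by blast

lemma X_in_cl: "fst l \<in> D \<Longrightarrow> X D p s l \<in> cl D (belt D p s (snd l))"
  by (simp add: X_def)

lemma joined_cl:
  assumes "reach D {X D p s l} (belt D p s (snd l)) t" "fst l \<in> D"
  shows "X D p s l \<in> cl D t"
  using reach_cl[OF assms(1)] X_in_cl[OF assms(2), of p s] by blast

lemma joined_parity: "even (p - p') \<Longrightarrow> joined D p s l1 l2 = joined D p' s l1 l2"
  unfolding joined_def using X_parity[of p p' D s] belt_parity[of p p' D s] by simp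

lemma joined_shift:
  assumes "good s" "bip D s" "D \<subseteq> I"
  shows "joined D (p + a) (belt D p s a) (i, c) (k, c') = joined D p s (i, a + c) (k, a + c')"
  unfolding joined_def using X_shift[OF assms] belt_shift[OF assms] by simp

text \<open>Up to relabelling both seeds are seeds of \<open>D - {i}\<close>, and \<open>v\<close>
  differs from the deleted variable. So \<open>v\<close> is shared inside the smaller diagram, where
  connectedness is already known.\<close>

lemma conn_star:
  assumes s: "good s" and iD: "i \<in> D" "D \<subseteq> I" and c: "conn (D - {i}) s"
    and t: "reach D {fst s i} s t" "reach D {fst s i} s t'"
    and v: "v \<in> cl D t" "v \<in> cl D t'" "v \<noteq> fst s i"
  shows "reach D {v} t t'"
proof -
  have split: "\<exists>\<sigma> u. \<sigma> permutes D \<and> reach (D - {i}) {} s u \<and> t = prm \<sigma> u \<and> v \<in> cl (D - {i}) u"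
    if t: "reach D {fst s i} s t" "v \<in> cl D t" for t
  proof -
    obtain \<sigma> u where u: "\<sigma> permutes D" "reach (D - {i}) {} s u" "t = prm \<sigma> u"
      using reach_freeze_delete[OF iD t(1)] by blast
    have "v \<in> cl D u" using t(2) u cl_prm[OF u(1)] by metis
    moreover have "fst u i = fst s i" using reach_frozen[OF u(2), of i] by simp
    ultimately have "v \<in> cl (D - {i}) u" using v(3) by auto
    then show ?thesis using u by blast
  qed
  obtain \<sigma> u where u: "\<sigma> permutes D" "reach (D - {i}) {} s u" "t = prm \<sigma> u" "v \<in> cl (D - {i}) u"
    using split t(1) v(1) by blast
  obtain \<sigma>' u' where u': "\<sigma>' permutes D" "reach (D - {i}) {} s u'" "t' = prm \<sigma>' u'" "v \<in> cl (D - {i}) u'"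
    using split t(2) v(2) by blast
  have "reach (D - {i}) {v} u u'" using c u u' unfolding conn_def by blast
  then have 1: "reach D {v} u u'" by (rule reach_mono) auto
  have "prm (inv \<sigma>) t = u" using u(3) prm_prm permutes_inv_o(1)[OF u(1)] prm_id by metis
  then have 2: "reach D {v} t u" using reach.prm[OF reach.refl permutes_inv[OF u(1)]] by metis
  have 3: "reach D {v} u' t'" unfolding u'(3) by (rule reach.prm[OF reach.refl u'(1)])
  show ?thesis using 1 2 3 reach_trans by blast
qed

lemma star_cl_sub:
  assumes s: "good s" and iD: "i \<in> D" "D \<subseteq> I" and t: "reach D {fst s i} s t" and v: "v \<in> cl D t" "v \<noteq> fst s i"
  obtains u where "reach (D - {i}) {} s u" "v \<in> cl (D - {i}) u"
proof -
  obtain \<sigma> u where u: "\<sigma> permutes D" "reach (D - {i}) {} s u" "t = prm \<sigma> u"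
    using reach_freeze_delete[OF iD t] by blast
  have "v \<in> cl D u" using v(1) u cl_prm[OF u(1)] by metis
  moreover have "fst u i = fst s i" using reach_frozen[OF u(2), of i] by simp
  ultimately have "v \<in> cl (D - {i}) u" using v(2) by auto
  then show ?thesis using u that by blast
qed

lemma cl_sub_neq:
  assumes "good s" "i \<in> D" "D \<subseteq> I" "reach (D - {i}) {} s u" "v \<in> cl (D - {i}) u"
  shows "v \<noteq> fst s i"
proof -
  have "good u" using reach_good[OF assms(4,1)] assms(3) by blast
  obtain k where k: "k \<in> D - {i}" "v = fst u k" using assms(5) by blast
  have "fst u i = fst s i" using reach_frozen[OF assms(4), of i] by simp
  moreover have "fst u k \<noteq> fst u i" using good_inj[OF \<open>good u\<close>] k assms(2,3) by (auto dest: inj_onD)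
  ultimately show ?thesis using k by simp
qed

lemma reach_freezeI:
  assumes "good s" "i \<in> D" "D \<subseteq> I" "reach (D - {i}) {} s t"
  shows "reach D {fst s i} s t"
  using reach_delete_freeze[OF assms] .

lemma X_sub_neq:
  assumes "good s" "i \<in> D" "D \<subseteq> I" "fst e \<in> D - {i}"
  shows "X (D - {i}) p s e \<noteq> fst s i"
proof (rule cl_sub_neq[OF assms(1-3)])
  show "reach (D - {i}) {} s (belt (D - {i}) p s (snd e))" using assms(3) by (intro reach_belt) auto
  show "X (D - {i}) p s e \<in> cl (D - {i}) (belt (D - {i}) p s (snd e))" using X_in_cl[OF assms(4)] .
qed

text \<open>The third variable sits at \<open>j\<close> after \<open>c\<close> steps. Viewed from
  that step, the other two have labels shifted by \<open>- c\<close>, and in the link of the third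
  variable they are \<open>eu\<close> and \<open>ev\<close>. A seed that joins \<open>eu\<close>
  with \<open>ev\<close> inside this link contains all three variables.\<close>

lemma triangle:
  assumes D: "D \<subseteq> I" "i \<in> D" "j \<in> D" "k \<in> D"
    and n: "nice (D - {j}) L"
    and u: "known D j eu (i, - c)" and v: "known D j ev (k, b - c)"
    and e: "\<And>s. good s \<Longrightarrow> bip (D - {j}) s \<Longrightarrow> joined (D - {j}) (col j) s eu ev"
    and s: "good s" "bip D s"
  shows "joined D (col i) s (i, 0) (k, b)"
proof -
  define w where "w = belt D (col i) s c"
  have w: "good w" "bip D w" unfolding w_def using s D good_belt bip_belt by blast+
  have bw: "bip (D - {j}) w" using w(2) bip_mono by blast
  have ej: "fst eu \<in> D - {j}" "fst ev \<in> D - {j}" using u v unfolding known_def by blast+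
  have DI: "D - {j} \<subseteq> I" using D by blast
  obtain t1 where t1: "reach (D - {j}) {X (D - {j}) (col j) w eu} (belt (D - {j}) (col j) w (snd eu)) t1"
    "reach (D - {j}) {X (D - {j}) (col j) w ev} (belt (D - {j}) (col j) w (snd ev)) t1"
    using e[OF w(1) bw] unfolding joined_def by blast
  have "reach (D - {j}) {} w t1"
    using reach_trans[OF reach_mono[OF t1(1)] reach_belt[OF DI]] by blast
  then have t1w: "reach D {fst w j} w t1" using reach_freezeI[OF w(1) D(3,1)] by blast
  \<comment> \<open>Joining \<open>l\<close> with the variable at \<open>j\<close> provides some
    seed \<open>t\<close>. Both \<open>t\<close> and \<open>t1\<close> lie in the star of the
    variable at \<open>j\<close> and contain the variable of \<open>l\<close>, so
    \<open>conn_star\<close> connects them without mutating it.\<close>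
  have key: "reach D {X D (col j) w l} (belt D (col j) w (snd l)) t1"
    if l: "known D j e l" and r: "reach (D - {j}) {X (D - {j}) (col j) w e} (belt (D - {j}) (col j) w (snd e)) t1" for e l
  proof -
    have el: "fst e \<in> D - {j}" "fst l \<in> D" "joined D (col j) w (j, 0) l" "X (D - {j}) (col j) w e = X D (col j) w l"
      using l w unfolding known_def valid_def by blast+
    then obtain t where t: "reach D {fst w j} w t" "reach D {X D (col j) w l} (belt D (col j) w (snd l)) t"
      unfolding joined_def by (auto simp: X_def)
    have "reach D {X D (col j) w l} t t1"
    proof (rule conn_star[OF w(1) D(3,1) niceD(1)[OF n w(1) bw] t(1) t1w])
      show "X D (col j) w l \<in> cl D t" using joined_cl[OF t(2) el(2)] .
      show "X D (col j) w l \<in> cl D t1" using joined_cl[OF r el(1)] unfolding el(4) by blast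
      show "X D (col j) w l \<noteq> fst w j" using X_sub_neq[OF w(1) D(3,1) el(1), of "col j"] unfolding el(4) .
    qed
    then show ?thesis using t(2) reach_trans by blast
  qed
  have "joined D (col j) w (i, - c) (k, b - c)"
    unfolding joined_def using key[OF u t1(1)] key[OF v t1(2)] by blast
  moreover have "even (col i + c - col j)" using u unfolding known_def valid_def by auto
  ultimately have "joined D (col i + c) w (i, - c) (k, b - c)" using joined_parity by blast
  then show ?thesis unfolding w_def joined_shift[OF s D(1)] by simp
qed

lemma tX_match:
  assumes D: "D \<subseteq> I" "i \<in> D" and s: "good s" "bip D s"
    and n: "nice (D - {i}) L" and t: "reach D {fst s i} s t" and l: "X D (col i) s l \<in> cl D t" "fst l \<in> D"
    and e: "e \<in> L (col i)" and inj: "inj_on (tX (D - {i}) (col i) \<omega>) (L (col i))"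
    and eq: "tX (D - {i}) (col i) \<omega> e = tX D (col i) \<omega> l" and nz: "tX (D - {i}) (col i) \<omega> e \<noteq> 0" and \<omega>: "\<omega> i = 0"
  shows "X (D - {i}) (col i) s e = X D (col i) s l"
proof -
  let ?v = "X D (col i) s l"
  have DI: "D - {i} \<subseteq> I" using D by blast
  have bs: "bip (D - {i}) s" using s(2) bip_mono by blast
  obtain \<tau> where \<tau>: "trop_hom \<tau>" "\<forall>k\<in>I. \<tau> (fst s k) = (if k \<in> D then \<omega> k else 0)"
    using exists_trop[OF s(1), of "\<lambda>k. if k \<in> D then \<omega> k else 0"] by blast
  have 1: "\<tau> ?v = tX D (col i) \<omega> l"
    using \<tau> D l by (intro trop_X s) auto
  have 2: "\<tau> (X (D - {i}) (col i) s e') = tX (D - {i}) (col i) \<omega> e'" if "e' \<in> L (col i)" for e'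
    using \<tau> DI D \<omega> nice_valid[OF n that] by (intro trop_X s bs) (auto simp: valid_def)
  have "\<tau> (fst s i) = 0" using \<tau> D \<omega> by auto
  then have neq: "?v \<noteq> fst s i" using 1 eq nz by metis
  obtain u where u: "reach (D - {i}) {} s u" "?v \<in> cl (D - {i}) u"
    using star_cl_sub[OF s(1) D(2,1) t l(1) neq] .
  then obtain e0 where e0: "e0 \<in> L (col i)" "?v = X (D - {i}) (col i) s e0"
    using niceD(2)[OF n s(1) bs u(1), of "col i"] by blast
  have "tX (D - {i}) (col i) \<omega> e0 = tX (D - {i}) (col i) \<omega> e"
    using 2[OF e0(1)] 1 eq e0(2) by simp
  then have "e0 = e" using inj e0(1) e by (auto dest: inj_onD)
  then show ?thesis using e0(2) by simp
qed

lemma known_match: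
  assumes D: "D \<subseteq> I" "i \<in> D" and n: "nice (D - {i}) L"
    and j: "\<And>s. good s \<Longrightarrow> bip D s \<Longrightarrow> joined D (col i) s (i, 0) l" and l: "valid D (col i) l"
    and e: "e \<in> L (col i)" and inj: "inj_on (tX (D - {i}) (col i) \<omega>) (L (col i))"
    and eq: "tX (D - {i}) (col i) \<omega> e = tX D (col i) \<omega> l" and nz: "tX (D - {i}) (col i) \<omega> e \<noteq> 0" and \<omega>: "\<omega> i = 0"
  shows "known D i e l"
  unfolding known_def
proof (intro conjI allI impI)
  show "fst e \<in> D - {i}" using nice_valid[OF n e] by (simp add: valid_def)
  fix s assume s: "good s" "bip D s"
  show "joined D (col i) s (i, 0) l" using j[OF s] .
  then obtain t where t: "reach D {fst s i} s t" "reach D {X D (col i) s l} (belt D (col i) s (snd l)) t"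
    unfolding joined_def by (auto simp: X_def)
  have "fst l \<in> D" using l by (simp add: valid_def)
  show "X (D - {i}) (col i) s e = X D (col i) s l"
    by (rule tX_match[OF D s n t(1) joined_cl[OF t(2)] _ e inj eq nz \<omega>]) fact+
qed (rule l)

text \<open>Up to \<open>d k\<close> steps the belts of \<open>D\<close> and \<open>D - {i}\<close>
  carry the same variable at \<open>k\<close>. The seed of the smaller belt lies in the stars of
  both variables and is the witness that joins them.\<close>

lemma known_coslice:
  assumes D: "D \<subseteq> I" "i \<in> D" and d0: "d i = (0::nat)"
    and d: "\<And>i j. i \<in> D \<Longrightarrow> j \<in> D \<Longrightarrow> A i j \<noteq> 0 \<Longrightarrow> d i \<le> Suc (d j)"
    and k: "k \<in> D - {i}" "\<bar>c\<bar> \<le> int (d k)" "even (col k + col i + c)"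
  shows "known D i (k, c) (k, c)"
  unfolding known_def
proof (intro conjI allI impI)
  show "valid D (col i) (k, c)" using k by (simp add: valid_def)
  fix s assume s: "good s" "bip D s"
  have d0': "d j = 0" if "j \<in> D - (D - {i})" for j using that d0 by auto
  note agree = belt_subset_agree[where d = d, OF s D(1) Diff_subset d0' d k(1,2), of "col i"]
  show "X (D - {i}) (col i) s (k, c) = X D (col i) s (k, c)" using agree(1) by simp
  have g: "good (belt D (col i) s c)" using good_belt s D by blast
  have 1: "reach D {fst (belt D (col i) s c) k} (belt D (col i) s c) (belt (D - {i}) (col i) s c)"
    using agree(2) k(1) by (intro reach_freezeI[OF g _ D(1)]) auto
  have 2: "reach D {fst s i} s (belt (D - {i}) (col i) s c)"
    using D by (intro reach_freezeI[OF s(1) D(2,1)] reach_belt) auto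
  show "joined D (col i) s (i, 0) (k, c)"
    unfolding joined_def X_def fst_conv snd_conv belt_0 using 1 2 by blast
qed (use k in auto)

lemma X_parity_base:
  assumes "good s" "bip D s" "D \<subseteq> I" "even (p + a - q)"
  shows "X D q (belt D p s a) (k, c) = X D p s (k, a + c)" "belt D q (belt D p s a) c = belt D p s (a + c)"
  using X_shift[OF assms(1-3), of p a k c] belt_shift[OF assms(1-3), of p a c]
    X_parity[OF assms(4)] belt_parity[OF assms(4)] by simp_all

lemma perD:
  assumes "per D h st k" "good s" "bip D s" "D \<subseteq> I" "valid D p (k, c)"
  shows "X D p s (st k, c + h) = X D p s (k, c)"
    and "reach D {X D p s (k, c)} (belt D p s c) (belt D p s (c + h))"
    and "valid D p (st k, c + h)"
proof -
  define w where "w = belt D p s c"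
  have w: "good w" "bip D w" unfolding w_def using assms good_belt bip_belt by blast+
  have par: "even (p + c - col k)" using assms(5) by (auto simp: valid_def)
  note base = X_parity_base[OF assms(2-4) par]
  have "X D (col k) w (st k, h) = fst w k" "reach D {fst w k} w (belt D (col k) w h)"
    using assms(1) w unfolding per_def by blast+
  then show "X D p s (st k, c + h) = X D p s (k, c)" "reach D {X D p s (k, c)} (belt D p s c) (belt D p s (c + h))"
    unfolding w_def base by (simp_all add: X_def)
  show "valid D p (st k, c + h)"
    using assms(1,5) unfolding per_def valid_def by auto
qed

text \<open>Two labels matched with the same link variable name the same variable. The seeds joining
  them to \<open>i\<close> share it inside one link, and connectedness of that link supplies the
  path demanded by \<open>per\<close>.\<close>

lemma per_known:
  assumes D: "D \<subseteq> I" "i \<in> D" and n: "nice (D - {i}) L"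
    and l: "known D i e (k, c)" "known D i e (st k, c + h)"
  shows "per D h st k"
  unfolding per_def
proof (intro conjI allI impI)
  have v: "valid D (col i) (k, c)" "valid D (col i) (st k, c + h)" using l unfolding known_def by blast+
  then show "st k \<in> D" "even (col (st k) + col k + h)" by (auto simp: valid_def)
  fix s' assume s': "good s'" "bip D s'"
  \<comment> \<open>The base is moved back by \<open>c\<close> steps, so that \<open>(k, c)\<close>
    names the variable \<open>fst s' k\<close> at the given seed.\<close>
  define s where "s = belt D (col k) s' (- c)"
  have s: "good s" "bip D s" unfolding s_def using s' D good_belt bip_belt by blast+
  have bs: "bip (D - {i}) s" using s bip_mono by blast
  have par: "even (col k + (- c) - col i)" using v(1) by (auto simp: valid_def)
  note base = X_parity_base[OF s' D(1) par]
  let ?v = "fst s' k"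
  have Xl: "X D (col i) s (k, c) = ?v" unfolding s_def base by (simp add: X_def)
  have 1: "joined D (col i) s (i, 0) (k, c)" "X (D - {i}) (col i) s e = ?v"
  proof -
    have "joined D (col i) s (i, 0) (k, c) \<and> X (D - {i}) (col i) s e = X D (col i) s (k, c)"
      using l(1) s unfolding known_def by blast
    then show "joined D (col i) s (i, 0) (k, c)" "X (D - {i}) (col i) s e = ?v" using Xl by simp_all
  qed
  have 2: "joined D (col i) s (i, 0) (st k, c + h)" "X D (col i) s (st k, c + h) = ?v"
  proof -
    have "joined D (col i) s (i, 0) (st k, c + h) \<and> X (D - {i}) (col i) s e = X D (col i) s (st k, c + h)"
      using l(2) s unfolding known_def by blast
    then show "joined D (col i) s (i, 0) (st k, c + h)" "X D (col i) s (st k, c + h) = ?v" using 1(2) by simp_all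
  qed
  then show "X D (col k) s' (st k, h) = ?v" unfolding s_def base by simp
  obtain t where t: "reach D {fst s i} s t" "reach D {?v} s' t"
    using 1(1) Xl base(2)[of c] unfolding joined_def s_def[symmetric] by (auto simp: X_def[of D "col i" s "(i, 0)"])
  obtain t' where t': "reach D {fst s i} s t'" "reach D {?v} (belt D (col k) s' h) t'"
    using 2 base(2)[of "c + h"] unfolding joined_def s_def[symmetric] by (auto simp: X_def[of D "col i" s "(i, 0)"])
  have kD: "k \<in> D" using v by (simp add: valid_def)
  have st: "?v \<in> cl D (belt D (col k) s' h)"
    using X_in_cl[of "(st k, h)" D "col k" s'] \<open>st k \<in> D\<close> \<open>X D (col k) s' (st k, h) = ?v\<close> by simp
  have "reach D {?v} t t'"
  proof (rule conn_star[OF s(1) D(2,1) niceD(1)[OF n s(1) bs] t(1) t'(1)])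
    show "?v \<in> cl D t" using reach_cl[OF t(2)] kD by blast
    show "?v \<in> cl D t'" using reach_cl[OF t'(2)] st by blast
    show "?v \<noteq> fst s i" using X_sub_neq[OF s(1) D(2,1), of e "col i"] l(1) 1(2) unfolding known_def by auto
  qed
  then have "reach D {?v} s' t'" using t(2) reach_trans by blast
  moreover have "reach D {?v} t' (belt D (col k) s' h)"
    using reach_sym[OF good_belt[OF s'(1) D(1)] D(1) _ t'(2)] st by blast
  ultimately show "reach D {?v} s' (belt D (col k) s' h)" using reach_trans by blast
qed

text \<open>\<open>(j, c)\<close> is close to \<open>k\<close> at time 0, and
  \<open>(st j, c)\<close> is close to \<open>st k\<close> when the belt is started at time
  \<open>h\<close>. By the period at \<open>k\<close> these two observers are the same variable, so
  both labels lie in one link, where \<open>tX_match\<close> identifies them.\<close>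

lemma per_propagate:
  assumes D: "D \<subseteq> I" "k \<in> D" and n: "nice (D - {k}) L" and P: "per D h st k"
    and y: "known D k (j, c) (j, c)" and y': "known D (st k) e' (st j, c)"
    and e: "(j, c) \<in> L (col k)" and inj: "inj_on (tX (D - {k}) (col k) \<omega>) (L (col k))"
    and eq: "tX (D - {k}) (col k) \<omega> (j, c) = tX D (col k) \<omega> (st j, c + h)"
    and nz: "tX (D - {k}) (col k) \<omega> (j, c) \<noteq> 0" and \<omega>: "\<omega> k = 0"
  shows "per D h st j"
  unfolding per_def
proof (intro conjI allI impI)
  have v: "valid D (col k) (j, c)" "valid D (col (st k)) (st j, c)" using y y' unfolding known_def by blast+
  have st: "st k \<in> D" "even (col (st k) + col k + h)" using P unfolding per_def by blast+
  show "st j \<in> D" using v by (simp add: valid_def)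
  show "even (col (st j) + col j + h)" using v st by (auto simp: valid_def)
  fix s' assume s': "good s'" "bip D s'"
  define s where "s = belt D (col j) s' (- c)"
  have s: "good s" "bip D s" unfolding s_def using s' D good_belt bip_belt by blast+
  have bs: "bip (D - {k}) s" using s bip_mono by blast
  have par: "even (col j + (- c) - col k)" using v(1) by (auto simp: valid_def)
  note base = X_parity_base[OF s' D(1) par]
  let ?v = "fst s' j"
  have Xl: "X D (col k) s (j, c) = ?v" unfolding s_def base by (simp add: X_def)
  have 1: "joined D (col k) s (k, 0) (j, c)" "X (D - {k}) (col k) s (j, c) = ?v"
  proof -
    have "joined D (col k) s (k, 0) (j, c) \<and> X (D - {k}) (col k) s (j, c) = X D (col k) s (j, c)"
      using y s unfolding known_def by blast
    then show "joined D (col k) s (k, 0) (j, c)" "X (D - {k}) (col k) s (j, c) = ?v" using Xl by simp_all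
  qed
  obtain t where t: "reach D {fst s k} s t" "reach D {?v} s' t"
    using 1(1) Xl base(2)[of c] unfolding joined_def s_def[symmetric] by (auto simp: X_def[of D "col k" s "(k, 0)"])
  define w where "w = belt D (col k) s h"
  have w: "good w" "bip D w" unfolding w_def using s D good_belt bip_belt by blast+
  have par2: "even (col k + h - col (st k))" using st by presburger
  note base2 = X_parity_base[OF s D(1) par2]
  have P': "X D (col k) s (st k, h) = fst s k" "reach D {fst s k} s w"
    using P s unfolding per_def w_def by blast+
  have wk: "fst w (st k) = fst s k" using P'(1) by (simp add: X_def w_def)
  have "joined D (col (st k)) w (st k, 0) (st j, c)" using y' w unfolding known_def by blast
  then obtain t' where t': "reach D {fst w (st k)} w t'" "reach D {X D (col (st k)) w (st j, c)} (belt D (col (st k)) w c) t'"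
    unfolding joined_def by (auto simp: X_def)
  have X': "X D (col (st k)) w (st j, c) = X D (col k) s (st j, c + h)"
    unfolding w_def base2 by (simp add: add.commute)
  have b': "belt D (col (st k)) w c = belt D (col j) s' h"
    unfolding w_def base2(2) using base(2)[of "h + c"] by (simp add: s_def)
  have st': "reach D {fst s k} s t'" using t'(1) P'(2) wk reach_trans by metis
  have c': "X D (col k) s (st j, c + h) \<in> cl D t'"
    using joined_cl[of D "col (st k)" w "(st j, c)" t'] t'(2) \<open>st j \<in> D\<close> X' by simp
  have eqv: "X (D - {k}) (col k) s (j, c) = X D (col k) s (st j, c + h)"
    by (rule tX_match[OF D s n st' c' _ e inj eq nz \<omega>]) (simp add: \<open>st j \<in> D\<close>)
  then have Xv: "X D (col k) s (st j, c + h) = ?v" using 1(2) by simp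
  then show "X D (col j) s' (st j, h) = ?v" unfolding s_def base by simp
  have t'2: "reach D {?v} (belt D (col j) s' h) t'" using t'(2) X' Xv b' by simp
  have jD: "j \<in> D" using v by (simp add: valid_def)
  have st: "?v \<in> cl D (belt D (col j) s' h)"
    using X_in_cl[of "(st j, h)" D "col j" s'] \<open>st j \<in> D\<close> \<open>X D (col j) s' (st j, h) = ?v\<close> by simp
  have "reach D {?v} t t'"
  proof (rule conn_star[OF s(1) D(2,1) niceD(1)[OF n s(1) bs] t(1) st'])
    show "?v \<in> cl D t" using reach_cl[OF t(2)] jD by blast
    show "?v \<in> cl D t'" using c' Xv by simp
    show "?v \<noteq> fst s k" using X_sub_neq[OF s(1) D(2,1), of "(j, c)" "col k"] y 1(2) unfolding known_def by simp
  qed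
  then have "reach D {?v} s' t'" using t(2) reach_trans by blast
  moreover have "reach D {?v} t' (belt D (col j) s' h)"
    using reach_sym[OF good_belt[OF s'(1) D(1)] D(1) _ t'2] st by blast
  ultimately show "reach D {?v} s' (belt D (col j) s' h)" using reach_trans by blast
qed

lemma joined_per:
  assumes P: "per D h st k" and s: "good s" "bip D s" "D \<subseteq> I" and v: "valid D p (k, c)"
  shows "joined D p s l (st k, c + h) \<longleftrightarrow> joined D p s l (k, c)"
proof -
  note pd = perD[OF P s v]
  have kD: "k \<in> D" using v by (simp add: valid_def)
  have sym: "reach D {X D p s (k, c)} (belt D p s (c + h)) (belt D p s c)"
  proof (rule reach_sym[OF good_belt[OF s(1,3)] s(3) _ pd(2)])
    show "{X D p s (k, c)} \<subseteq> cl D (belt D p s c)" using X_in_cl[of "(k, c)" D p s] kD by simp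
  qed
  show ?thesis unfolding joined_def snd_conv pd(1) using pd(2) sym reach_trans by metis
qed

text \<open>\<open>E\<close> is a union of components of \<open>F\<close>, so no influence crosses
  its boundary. In the light cone argument \<open>d\<close> may then be any constant on
  \<open>E\<close>, in particular one that is as large as the time of the label.\<close>

lemma joined_mono:
  assumes F: "F \<subseteq> I" "E \<subseteq> F" and no: "\<And>i j. i \<in> E \<Longrightarrow> j \<in> F - E \<Longrightarrow> A i j = 0"
    and s: "good s" "bip F s" and l: "fst l1 \<in> E" "fst l2 \<in> E" and j: "joined E p s l1 l2"
  shows "joined F p s l1 l2"
proof -
  have agree: "X F p s l = X E p s l" "reach (F - {fst l}) {} (belt F p s (snd l)) (belt E p s (snd l))" if "fst l \<in> E" for l
  proof -
    define d where "d = (\<lambda>k. if k \<in> E then nat \<bar>snd l\<bar> else 0)"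
    have d: "d i \<le> Suc (d j)" if "i \<in> F" "j \<in> F" "A i j \<noteq> 0" for i j
      using no[of i j] that by (auto simp: d_def)
    have d0: "d k = 0" if "k \<in> F - E" for k using that by (simp add: d_def)
    show "X F p s l = X E p s l" "reach (F - {fst l}) {} (belt F p s (snd l)) (belt E p s (snd l))"
      using belt_subset_agree[where d = d, OF s F(1,2) d0 d that, of "snd l" p] that by (auto simp: d_def)
  qed
  obtain t where t: "reach E {X E p s l1} (belt E p s (snd l1)) t" "reach E {X E p s l2} (belt E p s (snd l2)) t"
    using j unfolding joined_def by blast
  have "reach F {X F p s l} (belt F p s (snd l)) t" if "fst l \<in> E" "reach E {X E p s l} (belt E p s (snd l)) t" for l
  proof -
    have "reach F {fst (belt F p s (snd l)) (fst l)} (belt F p s (snd l)) (belt E p s (snd l))"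
      using agree(2)[OF that(1)] F that(1) by (intro reach_freezeI good_belt s) auto
    moreover have "reach F {X F p s l} (belt E p s (snd l)) t"
      unfolding agree(1)[OF that(1)] using that(2) F(2) by (rule reach_mono) auto
    ultimately show ?thesis using reach_trans by (simp add: X_def)
  qed
  then show ?thesis unfolding joined_def using t l by blast
qed

subsection \<open>Seeds sharing a cluster variable\<close>

lemma nice_empty: "nice {} (\<lambda>p. {})"
  by (auto simp: nice_def conn_def)

definition labels :: "nat set \<Rightarrow> int \<Rightarrow> int \<Rightarrow> (nat \<times> int) set" where
  "labels D h p = {l. valid D p l \<and> 0 \<le> snd l \<and> snd l < h}"

text \<open>A label is moved into the window by whole periods. A late label is moved down through a
  preimage of its node, which exists because \<open>st\<close> maps \<open>D\<close> onto itself; an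
  early one is moved up by \<open>st\<close>.\<close>

lemma per_norm:
  assumes D: "D \<subseteq> I" and P: "\<And>k. k \<in> D \<Longrightarrow> per D h st k" and st: "st ` D = D" and h: "h > 0"
    and s: "good s" "bip D s"
  shows "valid D p l \<Longrightarrow> \<exists>n\<in>labels D h p. X D p s n = X D p s l \<and> reach D {X D p s l} (belt D p s (snd l)) (belt D p s (snd n))"
proof (induction "snd l div h" arbitrary: l rule: int_induct[where k = 0])
  case base
  then have "0 \<le> snd l" "snd l < h" using h zdiv_eq_0_iff[of "snd l" h] by auto
  then have "l \<in> labels D h p" using base.prems by (simp add: labels_def)
  then show ?case using reach.refl by blast
next
  case (step1 m)
  have "fst l \<in> st ` D" using step1.prems st by (simp add: valid_def)
  then obtain k where k: "k \<in> D" "st k = fst l" by (metis imageE)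
  have par: "even (col (st k) + col k + h)" using P[OF k(1)] by (simp add: per_def)
  have v: "valid D p (k, snd l - h)" using step1.prems par k by (auto simp: valid_def)
  have "(snd l - h) div h = m" using step1.hyps(3) h div_add_self2[of h "snd l - h"] by simp
  then obtain n where n: "n\<in>labels D h p" "X D p s n = X D p s (k, snd l - h)"
     "reach D {X D p s (k, snd l - h)} (belt D p s (snd l - h)) (belt D p s (snd n))"
    using step1.hyps(2)[of "(k, snd l - h)"] v by auto
  note pd = perD[OF P[OF k(1)] s D v]
  have X: "X D p s (k, snd l - h) = X D p s l" using pd(1) k(2) by simp
  have "reach D {X D p s l} (belt D p s (snd l)) (belt D p s (snd l - h))"
  proof (rule reach_sym[OF good_belt[OF s(1) D] D])
    show "{X D p s l} \<subseteq> cl D (belt D p s (snd l - h))" using X_in_cl[of "(k, snd l - h)" D p s] k X by simp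
    show "reach D {X D p s l} (belt D p s (snd l - h)) (belt D p s (snd l))" using pd(2) X by simp
  qed
  then show ?case using n X reach_trans by metis
next
  case (step2 m)
  have lD: "fst l \<in> D" using step2.prems by (simp add: valid_def)
  note pd = perD[OF P[OF lD] s D, of p "snd l"]
  have v: "valid D p (fst l, snd l)" using step2.prems by simp
  have "(snd l + h) div h = m" using step2.hyps h by simp
  then obtain n where n: "n\<in>labels D h p" "X D p s n = X D p s (st (fst l), snd l + h)"
     "reach D {X D p s (st (fst l), snd l + h)} (belt D p s (snd l + h)) (belt D p s (snd n))"
    using step2.hyps(2)[of "(st (fst l), snd l + h)"] pd(3)[OF v] by auto
  have "reach D {X D p s l} (belt D p s (snd l)) (belt D p s (snd l + h))" "X D p s (st (fst l), snd l + h) = X D p s l"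
    using pd(1,2)[OF v] by simp_all
  then show ?case using n reach_trans by metis
qed

lemma reach_star_belt_next:
  assumes s: "good s" "bip D s" and D: "D \<subseteq> I" "k \<in> D" "odd (col k + p)"
  shows "reach D {fst s k} (belt D p s 1) s"
proof -
  have "reach (D - {k}) {} s (belt D p s 1)"
    using D(3) by (auto simp: belt_def mutl_def set_layer[OF D(1)] intro!: reach_mutw_refl)
  then have "reach D {fst s k} s (belt D p s 1)" by (rule reach_freezeI[OF s(1) D(2,1)])
  then show ?thesis using reach_sym[OF s(1) D(1)] D(2) by blast
qed

lemma inj_on_X:
  assumes "good s" "bip D s" "D \<subseteq> I" and v: "\<And>l. l \<in> L \<Longrightarrow> valid D p l" and inj: "inj_on (tX D p \<omega>) L"
  shows "inj_on (X D p s) L"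
proof (rule inj_onI)
  fix l l' assume l: "l \<in> L" "l' \<in> L" "X D p s l = X D p s l'"
  obtain \<tau> where \<tau>: "trop_hom \<tau>" "\<forall>k\<in>I. \<tau> (fst s k) = (if k \<in> D then \<omega> k else 0)"
    using exists_trop[OF assms(1), of "\<lambda>k. if k \<in> D then \<omega> k else 0"] by blast
  have "\<tau> (X D p s l) = tX D p \<omega> l" if "l \<in> L" for l
    using \<tau> assms(3) v[OF that] by (intro trop_X assms(1,2)) (auto simp: valid_def)
  then show "l = l'" using l inj by (metis inj_onD)
qed

text \<open>Every seed \<open>t\<close> reached by mutations stays attached to the belt: each
  variable of \<open>t\<close> is a belt variable, and the belt seed at its label reaches
  \<open>t\<close> without mutating it. Two seeds with a common variable are then attached to the
  same belt seed, which yields \<open>conn\<close>.\<close>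

theorem nice_step:
  assumes D: "D \<subseteq> I" and two: "\<And>k. k \<in> D \<Longrightarrow> \<exists>l\<in>D. l \<noteq> k"
    and P: "\<And>k. k \<in> D \<Longrightarrow> per D h st k" and st: "st ` D = D" and h: "h > 0"
    and n: "\<And>i. i \<in> D \<Longrightarrow> nice (D - {i}) (L i)"
    and cover: "\<And>i e. i \<in> D \<Longrightarrow> e \<in> L i (col i) \<Longrightarrow>
      \<exists>l. valid D (col i) l \<and> (\<forall>s. good s \<longrightarrow> bip D s \<longrightarrow> joined D (col i) s (i, 0) l \<and> X (D - {i}) (col i) s e = X D (col i) s l)"
    and inj: "\<And>p. inj_on (tX D p \<omega>) (labels D h p)"
  shows "nice D (labels D h)"
proof -
  have main: "conn D s \<and> (\<forall>t. reach D {} s t \<longrightarrow> cl D t \<subseteq> X D p s ` labels D h p) \<and> inj_on (X D p s) (labels D h p)"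
    if s: "good s" "bip D s" for s p
  proof -
    \<comment> \<open>If \<open>t\<close> is attached to the variable \<open>z\<close>, its other
      variables lie in the link of \<open>z\<close>. There \<open>cover\<close> recognizes them as
      belt variables, and \<open>conn_star\<close> attaches \<open>t\<close> to each of
      them.\<close>
    have edge: "\<exists>l. valid D p l \<and> y = X D p s l \<and> reach D {y} (belt D p s (snd l)) t"
      if z: "valid D p z" and t: "reach D {X D p s z} (belt D p s (snd z)) t" and y: "y \<in> cl D t" "y \<noteq> X D p s z" for z t y
    proof -
      obtain i a where ia: "z = (i, a)" by fastforce
      have iD: "i \<in> D" using z ia by (simp add: valid_def)
      define w where "w = belt D p s a"
      have w: "good w" "bip D w" unfolding w_def using s D good_belt bip_belt by blast+
      have bw: "bip (D - {i}) w" using w bip_mono by blast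
      have par: "even (p + a - col i)" using z ia by (auto simp: valid_def)
      note base = X_parity_base[OF s D par]
      have Xz: "X D p s z = fst w i" by (simp add: ia X_def w_def)
      have tw: "reach D {fst w i} w t" using t Xz ia w_def by simp
      have yi: "y \<noteq> fst w i" using y(2) Xz by simp
      obtain u where "reach (D - {i}) {} w u" "y \<in> cl (D - {i}) u"
        using star_cl_sub[OF w(1) iD D tw y(1) yi] .
      then obtain e where e: "e \<in> L i (col i)" "y = X (D - {i}) (col i) w e"
        using niceD(2)[OF n[OF iD] w(1) bw, of u "col i"] by blast
      obtain l where l: "valid D (col i) l" "joined D (col i) w (i, 0) l" "y = X D (col i) w l"
        using cover[OF iD e(1)] w e(2) by metis
      obtain t1 where t1: "reach D {fst w i} w t1" "reach D {y} (belt D (col i) w (snd l)) t1"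
        using l(2,3) unfolding joined_def by (auto simp: X_def)
      have lD: "fst l \<in> D" using l(1) by (simp add: valid_def)
      have "reach D {y} t1 t"
      proof (rule conn_star[OF w(1) iD D niceD(1)[OF n[OF iD] w(1) bw] t1(1) tw _ y(1) yi])
        show "y \<in> cl D t1" using reach_cl[OF t1(2)] X_in_cl[OF lD, of "col i" w] l(3) by blast
      qed
      then have "reach D {y} (belt D p s (a + snd l)) t" using t1(2) reach_trans unfolding w_def base by blast
      moreover have "y = X D p s (fst l, a + snd l)" using l(3) base(1)[of "fst l" "snd l"] by (simp add: w_def)
      moreover have "valid D p (fst l, a + snd l)" using l(1) par by (auto simp: valid_def)
      ultimately show ?thesis by (metis snd_conv)
    qed
    have closure: "\<exists>l. valid D p l \<and> y = X D p s l \<and> reach D {y} (belt D p s (snd l)) t"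
      if "reach D {} s t" "y \<in> cl D t" for t y
      using that
    proof (induction arbitrary: y rule: reach.induct)
      case refl
      then obtain k where k: "k \<in> D" "y = fst s k" by blast
      show ?case
      proof (cases "even (col k + p)")
        case True
        then show ?thesis using k by (intro exI[of _ "(k, 0)"]) (simp add: valid_def X_def reach.refl)
      next
        case False
        then show ?thesis using k X_next[OF s D, of k p 0] reach_star_belt_next[OF s D k(1)]
          by (intro exI[of _ "(k, 1)"]) (simp add: valid_def)
      qed
    next
      case (mut t k)
      have g: "good t" "good (mut k t)" using reach_good[OF mut.hyps(1) s(1) D] mut.hyps(2) D good_mut by blast+
      have old: "\<exists>l. valid D p l \<and> fst t m = X D p s l \<and> reach D {fst t m} (belt D p s (snd l)) (mut k t)"
        if m: "m \<in> D" "m \<noteq> k" for m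
      proof -
        obtain l where l: "valid D p l" "fst t m = X D p s l" "reach D {fst t m} (belt D p s (snd l)) t"
          using mut.IH[of "fst t m"] m by blast
        have "fst t k \<notin> {fst t m}" using inj_onD[OF good_inj[OF g(1)], of k m] m mut.hyps(2) D by auto
        then show ?thesis using l reach.mut mut.hyps(2) by blast
      qed
      obtain m where m: "m \<in> D" "y = fst (mut k t) m" using mut.prems by blast
      show ?case
      proof (cases "m = k")
        case False
        then show ?thesis using old[of m] m by simp
      next
        case True
        \<comment> \<open>The new variable is not attached to anything yet. It is reached from a
          variable that the mutation leaves in place, which exists because the rank is at least
          two.\<close>
        obtain m' where m': "m' \<in> D" "m' \<noteq> k" using two mut.hyps(2) by blast
        obtain z where z: "valid D p z" "fst t m' = X D p s z" "reach D {X D p s z} (belt D p s (snd z)) (mut k t)"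
          using old[OF m'] by metis
        have "fst (mut k t) k \<noteq> fst (mut k t) m'" using inj_onD[OF good_inj[OF g(2)], of k m'] m' mut.hyps(2) D by auto
        then have "y \<noteq> X D p s z" using z(2) m'(2) m True by simp
        then show ?thesis using edge[OF z(1,3)] mut.prems by blast
      qed
    next
      case (prm t \<sigma>)
      then show ?case using cl_prm[OF prm.hyps(2)] by (metis reach.prm)
    qed
    have norm: "\<exists>l\<in>labels D h p. y = X D p s l \<and> reach D {y} (belt D p s (snd l)) t"
      if t: "reach D {} s t" "y \<in> cl D t" for t y
    proof -
      obtain l where l: "valid D p l" "y = X D p s l" "reach D {y} (belt D p s (snd l)) t"
        using closure[OF t] by blast
      obtain m where m: "m \<in> labels D h p" "X D p s m = y" "reach D {y} (belt D p s (snd l)) (belt D p s (snd m))"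
        using per_norm[OF D P st h s l(1)] l(2) by auto
      have "{y} \<subseteq> cl D (belt D p s (snd l))" using l(1,2) X_in_cl[of l D p s] by (simp add: valid_def)
      then have "reach D {y} (belt D p s (snd m)) (belt D p s (snd l))"
        using reach_sym[OF good_belt[OF s(1) D] D _ m(3)] by blast
      then show ?thesis using m l reach_trans by metis
    qed
    have i: "inj_on (X D p s) (labels D h p)"
      by (rule inj_on_X[OF s D _ inj]) (simp add: labels_def)
    have "conn D s"
      unfolding conn_def
    proof (intro allI impI, elim conjE)
      fix t t' v assume t: "reach D {} s t" "reach D {} s t'" "v \<in> cl D t" "v \<in> cl D t'"
      obtain l where l: "l\<in>labels D h p" "v = X D p s l" "reach D {v} (belt D p s (snd l)) t"
        using norm[OF t(1,3)] by blast
      obtain l' where l': "l'\<in>labels D h p" "v = X D p s l'" "reach D {v} (belt D p s (snd l')) t'"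
        using norm[OF t(2,4)] by blast
      \<comment> \<open>Within one window a variable has only one label, so both seeds are attached
        to the belt at the same position.\<close>
      have "l = l'" using i l l' by (metis inj_onD)
      moreover have "{v} \<subseteq> cl D (belt D p s (snd l))" using l X_in_cl[of l D p s] by (simp add: valid_def labels_def)
      then have "reach D {v} t (belt D p s (snd l))"
        using reach_sym[OF good_belt[OF s(1) D] D _ l(3)] by blast
      ultimately show "reach D {v} t t'" using l' reach_trans by metis
    qed
    then show ?thesis using i norm by blast
  qed
  then show ?thesis unfolding nice_def by (auto simp: labels_def)
qed

text \<open>Rank one is treated by hand, as a mutation leaves no other variable to hold on to. The
  belt is idle in every second step, so the two mutations that return to the start take 4
  steps.\<close>

lemma nice_singleton:
  assumes k: "k \<in> I"
  shows "nice {k} (labels {k} 4)" "per {k} 4 id k"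
proof -
  have mutl: "mutl {k} q s = (if even (col k + q) then mut k s else s)" for q s
  proof -
    have "{j \<in> {k}. even (col j + q)} = (if even (col k + q) then {k} else {})" by auto
    then show ?thesis by (simp add: mutl_def layer_def)
  qed
  have belt: "belt {k} p s 0 = s" "belt {k} p s 1 = (if even (col k + p) then mut k s else s)"
     "belt {k} p s 2 = mut k s" "good s \<Longrightarrow> belt {k} p s 3 = (if even (col k + p) then s else mut k s)"
     "good s \<Longrightarrow> belt {k} p s 4 = s" for p s
  proof -
    show "belt {k} p s 0 = s" "belt {k} p s 1 = (if even (col k + p) then mut k s else s)"
     "belt {k} p s 2 = mut k s" by (auto simp: belt_def mutl eval_nat_numeral)
    show "belt {k} p s 3 = (if even (col k + p) then s else mut k s)" "belt {k} p s 4 = s" if "good s"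
      using mut_mut[OF that k] by (auto simp: belt_def mutl eval_nat_numeral)
  qed
  show "per {k} 4 id k"
    unfolding per_def using belt by (auto simp: X_def intro: reach.refl)
  have reach: "t = s \<or> t = mut k s" if "reach {k} {} s t" "good s" for s t
    using that
  proof (induction rule: reach.induct)
    case (prm t \<sigma>)
    then have "\<sigma> = id" by (metis permutes_sing)
    then show ?case using prm by simp
  qed (auto simp: mut_mut[OF _ k])
  have lab: "labels {k} 4 p = (if even (col k + p) then {(k, 0), (k, 2)} else {(k, 1), (k, 3)})" for p
  proof -
    have c: "0 \<le> c \<and> c < 4 \<longleftrightarrow> c = 0 \<or> c = 1 \<or> c = 2 \<or> c = 3" for c :: int by presburger
    have "(j, c) \<in> labels {k} 4 p \<longleftrightarrow> (j, c) \<in> (if even (col k + p) then {(k, 0), (k, 2)} else {(k, 1), (k, 3)})" for j c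
      unfolding labels_def valid_def mem_Collect_eq fst_conv snd_conv c by auto
    then show ?thesis by (intro set_eqI) (simp only: split_paired_all)
  qed
  have neq: "fst (mut k s) k \<noteq> fst s k" if s: "good s" "bip {k} s" for s
  proof
    assume eq: "fst (mut k s) k = fst s k"
    obtain \<tau> where \<tau>: "trop_hom \<tau>" "\<forall>j\<in>I. \<tau> (fst s j) = (if j = k then 1 else 0)"
      using exists_trop[OF s(1), of "\<lambda>j. if j = k then 1 else 0"] by blast
    have kk: "snd s k k = 0" using goodD(3)[OF s(1)] .
    \<comment> \<open>The weight is 1 at \<open>k\<close> and 0 elsewhere. Both exchange monomials
      avoid \<open>k\<close> and have value 0, so the new variable has value \<open>- 1\<close> and
      differs from the old one.\<close>
    have z: "(\<Sum>i\<in>I. max (snd s i k) 0 * \<tau> (fst s i)) = 0" "(\<Sum>i\<in>I. max (- snd s i k) 0 * \<tau> (fst s i)) = 0"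
      using \<tau>(2) kk by (auto intro!: sum.neutral)
    have "\<tau> (fst (mut k s) k) = - 1"
      using trop_mut[OF \<tau>(1), of s k] goodD(1)[OF s(1)] k \<tau>(2) z by simp
    then show False using eq \<tau>(2) k by simp
  qed
  show "nice {k} (labels {k} 4)"
    unfolding nice_def
  proof (intro conjI allI impI ballI)
    fix p l assume "l \<in> labels {k} 4 p" then show "valid {k} p l" by (simp add: labels_def)
  next
    fix s p assume s: "good s" "bip {k} s"
    show "conn {k} s"
      unfolding conn_def
    proof (intro allI impI, elim conjE)
      fix t t' v assume t: "reach {k} {} s t" "reach {k} {} s t'" "v \<in> cl {k} t" "v \<in> cl {k} t'"
      have "t = t'" using reach[OF t(1) s(1)] reach[OF t(2) s(1)] t(3,4) neq[OF s] by auto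
      then show "reach {k} {v} t t'" by (simp add: reach.refl)
    qed
    show "inj_on (X {k} p s) (labels {k} 4 p)"
      using neq[OF s] by (auto simp: lab X_def belt s)
    fix t assume "reach {k} {} s t"
    then have "t = s \<or> t = mut k s" using reach s by blast
    then show "cl {k} t \<subseteq> X {k} p s ` labels {k} 4 p"
      by (auto simp: lab X_def belt s)
  qed
qed

section \<open>Disjoint unions of subdiagrams\<close>

lemma orth_reach:
  assumes "J1 \<inter> J2 = {}" "orth J1 J2 s"
  shows "reach J1 {} s t \<Longrightarrow> orth J1 J2 t"
proof (induction rule: reach.induct)
  case (prm t \<sigma>)
  then show ?case using assms orth_prm1 by blast
qed (use assms orth_mut1 in blast)+

lemma tfwd_Un:
  assumes "finite J1" "finite J2" "J1 \<inter> J2 = {}" and no: "\<And>i j. i \<in> J2 \<Longrightarrow> j \<in> J1 \<Longrightarrow> A i j = 0"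
  shows "k \<in> J1 \<Longrightarrow> tfwd (J1 \<union> J2) q r v k = tfwd J1 q r v k"
proof (induction r arbitrary: k)
  case (Suc r)
  have "(\<Sum>j\<in>J1 \<union> J2. A j k * tfwd (J1 \<union> J2) q r v j) = (\<Sum>j\<in>J1. A j k * tfwd (J1 \<union> J2) q r v j)"
    using assms Suc.prems by (intro sum.mono_neutral_right) auto
  also have "\<dots> = (\<Sum>j\<in>J1. A j k * tfwd J1 q r v j)" using Suc.IH by simp
  finally have sum: "(\<Sum>j\<in>J1 \<union> J2. A j k * tfwd (J1 \<union> J2) q r v j) = (\<Sum>j\<in>J1. A j k * tfwd J1 q r v j)" .
  have "k \<in> J1 \<union> J2" using Suc.prems by blast
  then show ?case
    unfolding tfwd.simps tstep_def Suc.IH[OF Suc.prems] sum using Suc.prems by (simp only: simp_thms)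
qed simp

lemma tfwd_zero: "(\<And>j. j \<in> J \<Longrightarrow> v j = 0) \<Longrightarrow> k \<in> J \<Longrightarrow> tfwd J q r v k = 0"
proof (induction r arbitrary: k)
  case (Suc r)
  then show ?case by (simp add: tstep_def)
qed simp

text \<open>A path splits into a \<open>J1\<close>-path and a \<open>J2\<close>-path in either
  order, so a cluster is a union of clusters of the two parts. A weight supported on
  \<open>J1\<close> is nonzero on every variable of \<open>J1\<close> and 0 on every variable of
  \<open>J2\<close>; hence a shared variable lives in one part only, and connectedness of that part
  suffices.\<close>

theorem nice_Un:
  assumes J: "J1 \<subseteq> I" "J2 \<subseteq> I" "J1 \<inter> J2 = {}" and no: "\<And>i j. i \<in> J1 \<Longrightarrow> j \<in> J2 \<Longrightarrow> A i j = 0"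
    and n: "nice J1 L1" "nice J2 L2" and nz: "\<And>p l. l \<in> L1 p \<Longrightarrow> tX J1 p \<omega> l \<noteq> 0"
  shows "nice (J1 \<union> J2) (\<lambda>p. L1 p \<union> L2 p)"
proof -
  let ?J = "J1 \<union> J2"
  have JI: "?J \<subseteq> I" using J by blast
  have fin: "finite J1" "finite J2" using J finite_subset_I by blast+
  have no': "A i j = 0" if "i \<in> J2" "j \<in> J1" for i j using no[OF that(2,1)] A_eq_0 by blast
  have main: "conn ?J s \<and> (\<forall>t. reach ?J {} s t \<longrightarrow> cl ?J t \<subseteq> X ?J p s ` (L1 p \<union> L2 p)) \<and> inj_on (X ?J p s) (L1 p \<union> L2 p)"
    if s: "good s" "bip ?J s" for s p
  proof -
    have b: "bip J1 s" "bip J2 s" using s(2) bip_mono by blast+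
    have o: "orth J1 J2 s"
    proof -
      obtain \<sigma> where "oriented ?J \<sigma> (hb 0) s" using s(2) bip_def by blast
      then have "snd s i j = \<sigma> * sgn (hb 0 j - hb 0 i) * A i j" if "i \<in> ?J" "j \<in> ?J" for i j
        using that unfolding oriented_def by blast
      then show ?thesis unfolding orth_def using no no' by simp
    qed
    have agree: "X ?J p s l = X E p s l" if "fst l \<in> E" "E = J1 \<or> E = J2" for l E
    proof -
      define d where "d = (\<lambda>k. if k \<in> E then nat \<bar>snd l\<bar> else 0)"
      have d: "d i \<le> Suc (d j)" if "i \<in> ?J" "j \<in> ?J" "A i j \<noteq> 0" for i j
        using no[of i j] no'[of i j] that \<open>E = J1 \<or> E = J2\<close> by (auto simp: d_def)
      have d0: "d k = 0" if "k \<in> ?J - E" for k using that by (simp add: d_def)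
      have "E \<subseteq> ?J" using that(2) by blast
      then show ?thesis
        using belt_subset_agree(1)[where d = d, OF s JI _ d0 d that(1), of "snd l" p] that(1) by (auto simp: d_def)
    qed
    have X1: "X ?J p s ` L1 p = X J1 p s ` L1 p" and X2: "X ?J p s ` L2 p = X J2 p s ` L2 p"
      using agree nice_valid[OF n(1), of _ p] nice_valid[OF n(2), of _ p] unfolding valid_def by (intro image_cong; blast)+
    have disj: "X J1 p s l1 \<noteq> X J2 p s l2" if l: "l1 \<in> L1 p" "l2 \<in> L2 p" for l1 l2
    proof
      assume eq: "X J1 p s l1 = X J2 p s l2"
      obtain \<tau> where \<tau>: "trop_hom \<tau>" "\<forall>k\<in>I. \<tau> (fst s k) = (if k \<in> J1 then \<omega> k else 0)"
        using exists_trop[OF s(1), of "\<lambda>k. if k \<in> J1 then \<omega> k else 0"] by blast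
      define v where "v = (\<lambda>k. if k \<in> J1 then \<omega> k else 0)"
      have l': "fst l1 \<in> J1" "fst l2 \<in> J2" using nice_valid[OF n(1) l(1)] nice_valid[OF n(2) l(2)] by (simp_all add: valid_def)
      have \<tau>X: "\<tau> (X ?J p s l) = tX ?J p v l" if "fst l \<in> ?J" for l
        using \<tau> JI that by (intro trop_X s) (auto simp: v_def)
      have "tX ?J p v l1 = tX J1 p v l1"
        unfolding tX_def using tfwd_Un[OF fin J(3) no' l'(1)] by simp
      also have "\<dots> = tX J1 p \<omega> l1"
        unfolding tX_def using tfwd_cong[of J1 v \<omega>, OF _ l'(1)] by (simp add: v_def)
      finally have "\<tau> (X J1 p s l1) \<noteq> 0" using \<tau>X[of l1] l' agree[of l1 J1] nz[OF l(1)] by simp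
      moreover have "tX ?J p v l2 = tX J2 p v l2"
        unfolding tX_def using tfwd_Un[OF fin(2,1) _ no l'(2)] J(3) by (simp add: Un_commute Int_commute)
      moreover have v2: "v j = 0" if "j \<in> J2" for j using that J(3) by (auto simp: v_def)
      have "tX J2 p v l2 = 0"
        unfolding tX_def using tfwd_zero[of J2 v, OF v2 l'(2)] by simp
      ultimately show False using \<tau>X[of l2] l' agree[of l2 J2] eq by simp
    qed
    have dec: "\<exists>\<sigma> t1 t2. \<sigma> permutes ?J \<and> reach J1 {} s t1 \<and> reach J2 {} t1 t2 \<and> t = prm \<sigma> t2" if "reach ?J {} s t" for t
      using that
    proof (induction rule: reach.induct)
      case refl
      show ?case using permutes_id reach.refl prm_id by metis
    next
      case (mut t k)
      then obtain \<sigma> t1 t2 where t: "\<sigma> permutes ?J" "reach J1 {} s t1" "reach J2 {} t1 t2" "t = prm \<sigma> t2" by blast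
      have eq: "mut k t = prm \<sigma> (mut (\<sigma> k) t2)" using mut_prm[OF t(1) JI] t(4) by simp
      have k: "\<sigma> k \<in> ?J" using mut.hyps(2) permutes_in_image[OF t(1)] by blast
      show ?case
      proof (cases "\<sigma> k \<in> J2")
        case True
        then show ?thesis using t eq reach.mut[OF t(3) True] by blast
      next
        case False
        \<comment> \<open>A \<open>J1\<close>-step that comes after the \<open>J2\<close>-path is
          moved in front of it by \<open>reach_comm\<close>.\<close>
        then have "reach J1 {} t2 (mut (\<sigma> k) t2)" using k by (intro reach.mut reach.refl) auto
        moreover have "orth J2 J1 t1" using orth_reach[OF J(3) o t(2)] orth_sym by blast
        ultimately obtain t' where "reach J1 {} t1 t'" "reach J2 {} t' (mut (\<sigma> k) t2)"
          using reach_comm[of J2 J1 t2 "mut (\<sigma> k) t2" t1] J t(3) by (auto simp: Int_commute)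
        then show ?thesis using t eq reach_trans by metis
      qed
    next
      case (prm t \<rho>)
      then obtain \<sigma> t1 t2 where t: "\<sigma> permutes ?J" "reach J1 {} s t1" "reach J2 {} t1 t2" "t = prm \<sigma> t2" by blast
      then show ?case using prm.hyps(2) prm_prm permutes_compose by metis
    qed
    \<comment> \<open>\<open>t1\<close> exhibits the \<open>J1\<close>-part of the cluster and
      \<open>u\<close> the \<open>J2\<close>-part; \<open>t2\<close> carries both and agrees with
      \<open>t\<close> up to relabelling.\<close>
    have parts: "\<exists>t1 t2 u. reach J1 {} s t1 \<and> reach J2 {} t1 t2 \<and> reach J2 {} s u \<and> reach J1 {} u t2 \<and>
       reach ?J {v} t t2 \<and> reach ?J {v} t2 t \<and> cl J1 t1 \<subseteq> X J1 p s ` L1 p \<and> cl J2 u \<subseteq> X J2 p s ` L2 p \<and>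
       cl ?J t = cl J1 t1 \<union> cl J2 u"
      if R: "reach ?J {} s t" for t v
    proof -
      obtain \<sigma> t1 t2 where t: "\<sigma> permutes ?J" "reach J1 {} s t1" "reach J2 {} t1 t2" "t = prm \<sigma> t2"
        using dec[OF R] by blast
      obtain u where u: "reach J2 {} s u" "reach J1 {} u t2" "\<forall>j\<in>J2. fst u j = fst t2 j"
        using reach_comm[OF J(3,1,2) t(3,2) o] by blast
      have "prm (inv \<sigma>) t = t2" using t(4) prm_prm permutes_inv_o(1)[OF t(1)] prm_id by metis
      then have "reach ?J {v} t t2" using reach.prm[OF reach.refl permutes_inv[OF t(1)]] by metis
      moreover have "reach ?J {v} t2 t" unfolding t(4) by (rule reach.prm[OF reach.refl t(1)])
      moreover have "fst t1 j = fst t2 j" if "j \<in> J1" for j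
      proof -
        have "j \<notin> J2" using that J(3) by blast
        then show ?thesis using reach_frozen[OF t(3)] by simp
      qed
      then have "cl ?J t = cl J1 t1 \<union> cl J2 u" using cl_prm[OF t(1), of t2] t(4) u(3) by (auto simp: image_Un)
      moreover have "cl J1 t1 \<subseteq> X J1 p s ` L1 p" by (rule niceD(2)[OF n(1) s(1) b(1) t(2)])
      moreover have "cl J2 u \<subseteq> X J2 p s ` L2 p" by (rule niceD(2)[OF n(2) s(1) b(2) u(1)])
      ultimately show ?thesis using t(2,3) u(1,2) by (intro exI[of _ t1] exI[of _ t2] exI[of _ u]) simp
    qed
    have cover: "cl ?J t \<subseteq> X ?J p s ` (L1 p \<union> L2 p)" if R: "reach ?J {} s t" for t
    proof -
      obtain t1 u where "cl J1 t1 \<subseteq> X J1 p s ` L1 p" "cl J2 u \<subseteq> X J2 p s ` L2 p" "cl ?J t = cl J1 t1 \<union> cl J2 u"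
        using parts[OF R, of undefined] by (elim exE conjE)
      then show ?thesis unfolding image_Un X1 X2 by (simp only: Un_mono)
    qed
    have freeze: "reach ?J {v} t1 t2"
      if h: "reach E {} t1 t2" "v \<in> cl E' t1" "E \<union> E' = ?J" "E \<inter> E' = {}" "good t1" for E E' v t1 t2
    proof -
      obtain i where i: "i \<in> E'" "v = fst t1 i" using h(2) by blast
      have "reach (?J - {i}) {} t1 t2" using h(3,4) i by (intro reach_mono[OF h(1)]) auto
      then show ?thesis using reach_freezeI[OF h(5) _ JI] i h(3) by blast
    qed
    have "conn ?J s"
      unfolding conn_def
    proof (intro allI impI, elim conjE)
      fix t t' v assume t: "reach ?J {} s t" "reach ?J {} s t'" and v: "v \<in> cl ?J t" "v \<in> cl ?J t'"
      obtain t1 t2 u where T: "reach J1 {} s t1" "reach J2 {} t1 t2" "reach J2 {} s u" "reach J1 {} u t2"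
       "reach ?J {v} t t2" "reach ?J {v} t2 t" "cl J1 t1 \<subseteq> X J1 p s ` L1 p" "cl J2 u \<subseteq> X J2 p s ` L2 p"
       "cl ?J t = cl J1 t1 \<union> cl J2 u"
        using parts[OF t(1), of v] by (elim exE conjE)
      obtain t1' t2' u' where T': "reach J1 {} s t1'" "reach J2 {} t1' t2'" "reach J2 {} s u'" "reach J1 {} u' t2'"
       "reach ?J {v} t' t2'" "reach ?J {v} t2' t'" "cl J1 t1' \<subseteq> X J1 p s ` L1 p" "cl J2 u' \<subseteq> X J2 p s ` L2 p"
       "cl ?J t' = cl J1 t1' \<union> cl J2 u'"
        using parts[OF t(2), of v] by (elim exE conjE)
      have g: "good t1" "good t1'" "good u" "good u'"
        using reach_good[OF T(1) s(1) J(1)] reach_good[OF T'(1) s(1) J(1)]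
          reach_good[OF T(3) s(1) J(2)] reach_good[OF T'(3) s(1) J(2)] by blast+
      have "v \<in> cl J1 t1 \<and> v \<in> cl J1 t1' \<or> v \<in> cl J2 u \<and> v \<in> cl J2 u'"
      proof -
        have *: "v \<in> A \<and> v \<in> A' \<or> v \<in> B \<and> v \<in> B'"
          if "v \<in> A \<union> B" "v \<in> A' \<union> B'" "A \<subseteq> V" "A' \<subseteq> V" "B \<subseteq> W" "B' \<subseteq> W" "V \<inter> W = {}" for A B A' B' V W
          using that by blast
        have "X J1 p s ` L1 p \<inter> X J2 p s ` L2 p = {}" using disj by (auto simp: disjoint_iff)
        then show ?thesis using v *[OF _ _ T(7) T'(7) T(8) T'(8)] unfolding T(9) T'(9) by simp
      qed
      then show "reach ?J {v} t t'"
      proof (elim disjE conjE)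
        assume v: "v \<in> cl J1 t1" "v \<in> cl J1 t1'"
        have 1: "reach ?J {v} t1 t2" "reach ?J {v} t1' t2'"
          using freeze[OF T(2) v(1)] freeze[OF T'(2) v(2)] g J(3) by blast+
        have "reach ?J {v} t2 t1" using reach_sym[OF g(1) JI _ 1(1)] v by blast
        moreover have "reach J1 {v} t1 t1'" using niceD(1)[OF n(1) s(1) b(1)] T(1) T'(1) v unfolding conn_def by blast
        then have "reach ?J {v} t1 t1'" by (rule reach_mono) auto
        ultimately show ?thesis using T(5) T'(6) 1(2) reach_trans by meson
      next
        assume v: "v \<in> cl J2 u" "v \<in> cl J2 u'"
        have 1: "reach ?J {v} u t2" "reach ?J {v} u' t2'"
          using freeze[OF T(4) v(1)] freeze[OF T'(4) v(2)] g J(3) by blast+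
        have "reach ?J {v} t2 u" using reach_sym[OF g(3) JI _ 1(1)] v by blast
        moreover have "reach J2 {v} u u'" using niceD(1)[OF n(2) s(1) b(2)] T(3) T'(3) v unfolding conn_def by blast
        then have "reach ?J {v} u u'" by (rule reach_mono) auto
        ultimately show ?thesis using T(5) T'(6) 1(2) reach_trans by meson
      qed
    qed
    moreover have "inj_on (X ?J p s) (L1 p \<union> L2 p)"
    proof (rule inj_onI)
      fix l l' assume l: "l \<in> L1 p \<union> L2 p" "l' \<in> L1 p \<union> L2 p" "X ?J p s l = X ?J p s l'"
      have a: "l \<in> L1 p \<Longrightarrow> X ?J p s l = X J1 p s l" "l \<in> L2 p \<Longrightarrow> X ?J p s l = X J2 p s l" for l
        using agree[of l J1] agree[of l J2] nice_valid[OF n(1), of l p] nice_valid[OF n(2), of l p]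
        by (simp_all add: valid_def)
      show "l = l'"
      proof -
        note i1 = inj_onD[OF niceD(3)[OF n(1) s(1) b(1), of p], of l l']
        note i2 = inj_onD[OF niceD(3)[OF n(2) s(1) b(2), of p], of l l']
        consider "l \<in> L1 p" "l' \<in> L1 p" | "l \<in> L1 p" "l' \<in> L2 p" | "l \<in> L2 p" "l' \<in> L1 p" | "l \<in> L2 p" "l' \<in> L2 p"
          using l by blast
        then show ?thesis
        proof cases
          case 1 then show ?thesis using i1 l(3) a(1) by simp
        next
          case 2 then show ?thesis using disj[of l l'] l(3) a by simp
        next
          case 3 then show ?thesis using disj[of l' l] l(3) a by simp
        next
          case 4 then show ?thesis using i2 l(3) a(2) by simp
        qed
      qed
    qed
    ultimately show ?thesis using cover by blast
  qed
  have "valid ?J p l" if "l \<in> L1 p \<union> L2 p" for p l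
    using nice_valid[OF n(1), of l p] nice_valid[OF n(2), of l p] that by (auto simp: valid_def)
  then show ?thesis unfolding nice_def using main by blast
qed

end

subsection \<open>Rank two belts with coefficients\<close>

text \<open>Frozen variables enter a rank two belt through exponents \<open>p, q\<close> that evolve piecewise linearly; on each
  linearity region periodicity is an identity of rational functions.\<close>

lemma regions_A2:
  fixes p q :: int
  assumes "q1 = q + max p 0" "p2 = - p + max q1 0" "q3 = - q1 + max p2 0" "p4 = - p2 + max q3 0"
  shows "(max p 0 = 0 \<and> max q1 0 = 0 \<and> max p2 0 = - p \<and> max q3 0 = - p - q \<and> max p4 0 = - q) \<or>
     (max p 0 = 0 \<and> max q1 0 = q \<and> max p2 0 = - p + q \<and> max q3 0 = - p \<and> max p4 0 = 0) \<or>
     (max p 0 = p \<and> max q1 0 = 0 \<and> max p2 0 = 0 \<and> max q3 0 = - p - q \<and> max p4 0 = - q) \<or>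
     (max p 0 = p \<and> max q1 0 = p + q \<and> max p2 0 = q \<and> max q3 0 = 0 \<and> max p4 0 = 0) \<or>
     (max p 0 = p \<and> max q1 0 = p + q \<and> max p2 0 = 0 \<and> max q3 0 = 0 \<and> max p4 0 = - q)"
proof -
  \<comment> \<open>These are the five cones of the cluster fan of type A2. All the maxima are
    linear on each of them.\<close>
  consider "p \<le> 0" "q \<le> 0" | "p \<le> 0" "q > 0" | "p > 0" "p + q \<le> 0" | "p > 0" "p + q > 0" "q \<le> 0" | "p > 0" "q > 0" by linarith
  then show ?thesis
  proof cases
    case 1
    have m0: "max p 0 = 0" using 1 assms(1-1) by simp
    have m1: "max q1 0 = 0" using 1 assms(1-1) m0 by simp
    have m2: "max p2 0 = - p" using 1 assms(1-2) m0 m1 by simp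
    have m3: "max q3 0 = - p - q" using 1 assms(1-3) m0 m1 m2 by simp
    have m4: "max p4 0 = - q" using 1 assms(1-4) m0 m1 m2 m3 by simp
    show ?thesis using m0 m1 m2 m3 m4 by blast
  next
    case 2
    have m0: "max p 0 = 0" using 2 assms(1-1) by simp
    have m1: "max q1 0 = q" using 2 assms(1-1) m0 by simp
    have m2: "max p2 0 = - p + q" using 2 assms(1-2) m0 m1 by simp
    have m3: "max q3 0 = - p" using 2 assms(1-3) m0 m1 m2 by simp
    have m4: "max p4 0 = 0" using 2 assms(1-4) m0 m1 m2 m3 by simp
    show ?thesis using m0 m1 m2 m3 m4 by blast
  next
    case 3
    have m0: "max p 0 = p" using 3 assms(1-1) by simp
    have m1: "max q1 0 = 0" using 3 assms(1-1) m0 by simp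
    have m2: "max p2 0 = 0" using 3 assms(1-2) m0 m1 by simp
    have m3: "max q3 0 = - p - q" using 3 assms(1-3) m0 m1 m2 by simp
    have m4: "max p4 0 = - q" using 3 assms(1-4) m0 m1 m2 m3 by simp
    show ?thesis using m0 m1 m2 m3 m4 by blast
  next
    case 4
    have m0: "max p 0 = p" using 4 assms(1-1) by simp
    have m1: "max q1 0 = p + q" using 4 assms(1-1) m0 by simp
    have m2: "max p2 0 = 0" using 4 assms(1-2) m0 m1 by simp
    have m3: "max q3 0 = 0" using 4 assms(1-3) m0 m1 m2 by simp
    have m4: "max p4 0 = - q" using 4 assms(1-4) m0 m1 m2 m3 by simp
    show ?thesis using m0 m1 m2 m3 m4 by blast
  next
    case 5
    have m0: "max p 0 = p" using 5 assms(1-1) by simp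
    have m1: "max q1 0 = p + q" using 5 assms(1-1) m0 by simp
    have m2: "max p2 0 = q" using 5 assms(1-2) m0 m1 by simp
    have m3: "max q3 0 = 0" using 5 assms(1-3) m0 m1 m2 by simp
    have m4: "max p4 0 = 0" using 5 assms(1-4) m0 m1 m2 m3 by simp
    show ?thesis using m0 m1 m2 m3 m4 by blast
  qed
qed

lemma regions_B2:
  fixes p q :: int
  assumes "q1 = q + 2 * max p 0" "p2 = - p + max q1 0" "q3 = - q1 + 2 * max p2 0" "p4 = - p2 + max q3 0" "q5 = - q3 + 2 * max p4 0"
  shows "(max p 0 = 0 \<and> max q1 0 = 0 \<and> max p2 0 = - p \<and> max q3 0 = -2 * p - q \<and> max p4 0 = - p - q \<and> max q5 0 = - q) \<or>
     (max p 0 = 0 \<and> max q1 0 = q \<and> max p2 0 = - p + q \<and> max q3 0 = -2 * p + q \<and> max p4 0 = - p \<and> max q5 0 = 0) \<or>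
     (max p 0 = p \<and> max q1 0 = 0 \<and> max p2 0 = 0 \<and> max q3 0 = -2 * p - q \<and> max p4 0 = - p - q \<and> max q5 0 = - q) \<or>
     (max p 0 = p \<and> max q1 0 = 2 * p + q \<and> max p2 0 = p + q \<and> max q3 0 = q \<and> max p4 0 = 0 \<and> max q5 0 = 0) \<or>
     (max p 0 = p \<and> max q1 0 = 2 * p + q \<and> max p2 0 = 0 \<and> max q3 0 = 0 \<and> max p4 0 = - p - q \<and> max q5 0 = - q) \<or>
     (max p 0 = p \<and> max q1 0 = 2 * p + q \<and> max p2 0 = p + q \<and> max q3 0 = 0 \<and> max p4 0 = 0 \<and> max q5 0 = - q)"
proof -
  consider "p \<le> 0" "q \<le> 0" | "p \<le> 0" "q > 0" | "p > 0" "2 * p + q \<le> 0" | "p > 0" "2 * p + q > 0" "p + q \<le> 0" | "p > 0" "p + q > 0" "q \<le> 0" | "p > 0" "q > 0" by linarith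
  then show ?thesis
  proof cases
    case 1
    have m0: "max p 0 = 0" using 1 assms(1-1) by simp
    have m1: "max q1 0 = 0" using 1 assms(1-1) m0 by simp
    have m2: "max p2 0 = - p" using 1 assms(1-2) m0 m1 by simp
    have m3: "max q3 0 = -2 * p - q" using 1 assms(1-3) m0 m1 m2 by simp
    have m4: "max p4 0 = - p - q" using 1 assms(1-4) m0 m1 m2 m3 by simp
    have m5: "max q5 0 = - q" using 1 assms(1-5) m0 m1 m2 m3 m4 by simp
    show ?thesis using m0 m1 m2 m3 m4 m5 by blast
  next
    case 2
    have m0: "max p 0 = 0" using 2 assms(1-1) by simp
    have m1: "max q1 0 = q" using 2 assms(1-1) m0 by simp
    have m2: "max p2 0 = - p + q" using 2 assms(1-2) m0 m1 by simp
    have m3: "max q3 0 = -2 * p + q" using 2 assms(1-3) m0 m1 m2 by simp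
    have m4: "max p4 0 = - p" using 2 assms(1-4) m0 m1 m2 m3 by simp
    have m5: "max q5 0 = 0" using 2 assms(1-5) m0 m1 m2 m3 m4 by simp
    show ?thesis using m0 m1 m2 m3 m4 m5 by blast
  next
    case 3
    have m0: "max p 0 = p" using 3 assms(1-1) by simp
    have m1: "max q1 0 = 0" using 3 assms(1-1) m0 by simp
    have m2: "max p2 0 = 0" using 3 assms(1-2) m0 m1 by simp
    have m3: "max q3 0 = -2 * p - q" using 3 assms(1-3) m0 m1 m2 by simp
    have m4: "max p4 0 = - p - q" using 3 assms(1-4) m0 m1 m2 m3 by simp
    have m5: "max q5 0 = - q" using 3 assms(1-5) m0 m1 m2 m3 m4 by simp
    show ?thesis using m0 m1 m2 m3 m4 m5 by blast
  next
    case 4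
    have m0: "max p 0 = p" using 4 assms(1-1) by simp
    have m1: "max q1 0 = 2 * p + q" using 4 assms(1-1) m0 by simp
    have m2: "max p2 0 = 0" using 4 assms(1-2) m0 m1 by simp
    have m3: "max q3 0 = 0" using 4 assms(1-3) m0 m1 m2 by simp
    have m4: "max p4 0 = - p - q" using 4 assms(1-4) m0 m1 m2 m3 by simp
    have m5: "max q5 0 = - q" using 4 assms(1-5) m0 m1 m2 m3 m4 by simp
    show ?thesis using m0 m1 m2 m3 m4 m5 by blast
  next
    case 5
    have m0: "max p 0 = p" using 5 assms(1-1) by simp
    have m1: "max q1 0 = 2 * p + q" using 5 assms(1-1) m0 by simp
    have m2: "max p2 0 = p + q" using 5 assms(1-2) m0 m1 by simp
    have m3: "max q3 0 = 0" using 5 assms(1-3) m0 m1 m2 by simp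
    have m4: "max p4 0 = 0" using 5 assms(1-4) m0 m1 m2 m3 by simp
    have m5: "max q5 0 = - q" using 5 assms(1-5) m0 m1 m2 m3 m4 by simp
    show ?thesis using m0 m1 m2 m3 m4 m5 by blast
  next
    case 6
    have m0: "max p 0 = p" using 6 assms(1-1) by simp
    have m1: "max q1 0 = 2 * p + q" using 6 assms(1-1) m0 by simp
    have m2: "max p2 0 = p + q" using 6 assms(1-2) m0 m1 by simp
    have m3: "max q3 0 = q" using 6 assms(1-3) m0 m1 m2 by simp
    have m4: "max p4 0 = 0" using 6 assms(1-4) m0 m1 m2 m3 by simp
    have m5: "max q5 0 = 0" using 6 assms(1-5) m0 m1 m2 m3 m4 by simp
    show ?thesis using m0 m1 m2 m3 m4 m5 by blast
  qed
qed

lemma regions_C2: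
  fixes p q :: int
  assumes "q1 = q + max p 0" "p2 = - p + 2 * max q1 0" "q3 = - q1 + max p2 0" "p4 = - p2 + 2 * max q3 0" "q5 = - q3 + max p4 0"
  shows "(max p 0 = 0 \<and> max q1 0 = 0 \<and> max p2 0 = - p \<and> max q3 0 = - p - q \<and> max p4 0 = - p - 2 * q \<and> max q5 0 = - q) \<or>
     (max p 0 = 0 \<and> max q1 0 = q \<and> max p2 0 = - p + 2 * q \<and> max q3 0 = - p + q \<and> max p4 0 = - p \<and> max q5 0 = 0) \<or>
     (max p 0 = p \<and> max q1 0 = 0 \<and> max p2 0 = 0 \<and> max q3 0 = - p - q \<and> max p4 0 = - p - 2 * q \<and> max q5 0 = - q) \<or>
     (max p 0 = p \<and> max q1 0 = p + q \<and> max p2 0 = p + 2 * q \<and> max q3 0 = q \<and> max p4 0 = 0 \<and> max q5 0 = 0) \<or>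
     (max p 0 = p \<and> max q1 0 = p + q \<and> max p2 0 = 0 \<and> max q3 0 = 0 \<and> max p4 0 = - p - 2 * q \<and> max q5 0 = - q) \<or>
     (max p 0 = p \<and> max q1 0 = p + q \<and> max p2 0 = p + 2 * q \<and> max q3 0 = 0 \<and> max p4 0 = 0 \<and> max q5 0 = - q)"
proof -
  consider "p \<le> 0" "q \<le> 0" | "p \<le> 0" "q > 0" | "p > 0" "p + q \<le> 0" | "p > 0" "p + q > 0" "p + 2 * q \<le> 0" | "p > 0" "p + 2 * q > 0" "q \<le> 0" | "p > 0" "q > 0" by linarith
  then show ?thesis
  proof cases
    case 1
    have m0: "max p 0 = 0" using 1 assms(1-1) by simp
    have m1: "max q1 0 = 0" using 1 assms(1-1) m0 by simp
    have m2: "max p2 0 = - p" using 1 assms(1-2) m0 m1 by simp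
    have m3: "max q3 0 = - p - q" using 1 assms(1-3) m0 m1 m2 by simp
    have m4: "max p4 0 = - p - 2 * q" using 1 assms(1-4) m0 m1 m2 m3 by simp
    have m5: "max q5 0 = - q" using 1 assms(1-5) m0 m1 m2 m3 m4 by simp
    show ?thesis using m0 m1 m2 m3 m4 m5 by blast
  next
    case 2
    have m0: "max p 0 = 0" using 2 assms(1-1) by simp
    have m1: "max q1 0 = q" using 2 assms(1-1) m0 by simp
    have m2: "max p2 0 = - p + 2 * q" using 2 assms(1-2) m0 m1 by simp
    have m3: "max q3 0 = - p + q" using 2 assms(1-3) m0 m1 m2 by simp
    have m4: "max p4 0 = - p" using 2 assms(1-4) m0 m1 m2 m3 by simp
    have m5: "max q5 0 = 0" using 2 assms(1-5) m0 m1 m2 m3 m4 by simp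
    show ?thesis using m0 m1 m2 m3 m4 m5 by blast
  next
    case 3
    have m0: "max p 0 = p" using 3 assms(1-1) by simp
    have m1: "max q1 0 = 0" using 3 assms(1-1) m0 by simp
    have m2: "max p2 0 = 0" using 3 assms(1-2) m0 m1 by simp
    have m3: "max q3 0 = - p - q" using 3 assms(1-3) m0 m1 m2 by simp
    have m4: "max p4 0 = - p - 2 * q" using 3 assms(1-4) m0 m1 m2 m3 by simp
    have m5: "max q5 0 = - q" using 3 assms(1-5) m0 m1 m2 m3 m4 by simp
    show ?thesis using m0 m1 m2 m3 m4 m5 by blast
  next
    case 4
    have m0: "max p 0 = p" using 4 assms(1-1) by simp
    have m1: "max q1 0 = p + q" using 4 assms(1-1) m0 by simp
    have m2: "max p2 0 = 0" using 4 assms(1-2) m0 m1 by simp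
    have m3: "max q3 0 = 0" using 4 assms(1-3) m0 m1 m2 by simp
    have m4: "max p4 0 = - p - 2 * q" using 4 assms(1-4) m0 m1 m2 m3 by simp
    have m5: "max q5 0 = - q" using 4 assms(1-5) m0 m1 m2 m3 m4 by simp
    show ?thesis using m0 m1 m2 m3 m4 m5 by blast
  next
    case 5
    have m0: "max p 0 = p" using 5 assms(1-1) by simp
    have m1: "max q1 0 = p + q" using 5 assms(1-1) m0 by simp
    have m2: "max p2 0 = p + 2 * q" using 5 assms(1-2) m0 m1 by simp
    have m3: "max q3 0 = 0" using 5 assms(1-3) m0 m1 m2 by simp
    have m4: "max p4 0 = 0" using 5 assms(1-4) m0 m1 m2 m3 by simp
    have m5: "max q5 0 = - q" using 5 assms(1-5) m0 m1 m2 m3 m4 by simp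
    show ?thesis using m0 m1 m2 m3 m4 m5 by blast
  next
    case 6
    have m0: "max p 0 = p" using 6 assms(1-1) by simp
    have m1: "max q1 0 = p + q" using 6 assms(1-1) m0 by simp
    have m2: "max p2 0 = p + 2 * q" using 6 assms(1-2) m0 m1 by simp
    have m3: "max q3 0 = q" using 6 assms(1-3) m0 m1 m2 by simp
    have m4: "max p4 0 = 0" using 6 assms(1-4) m0 m1 m2 m3 by simp
    have m5: "max q5 0 = 0" using 6 assms(1-5) m0 m1 m2 m3 m4 by simp
    show ?thesis using m0 m1 m2 m3 m4 m5 by blast
  qed
qed

text \<open>Each summand is the change of an entry between two outside nodes under one of the five
  mutations; \<open>p, q\<close> come from the columns and \<open>r, t\<close> from the negated
  rows. On every pair of cones the total change cancels.\<close>

lemma cocycle_A2: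
  fixes p q r t :: int
  assumes "q1 = q + x0" "p2 = - p + x1" "q3 = - q1 + x2" "p4 = - p2 + x3"
    and "t1 = t + y0" "r2 = - r + y1" "t3 = - t1 + y2" "r4 = - r2 + y3"
    and "(x0 = 0 \<and> x1 = 0 \<and> x2 = - p \<and> x3 = - p - q \<and> x4 = - q) \<or>
     (x0 = 0 \<and> x1 = q \<and> x2 = - p + q \<and> x3 = - p \<and> x4 = 0) \<or>
     (x0 = p \<and> x1 = 0 \<and> x2 = 0 \<and> x3 = - p - q \<and> x4 = - q) \<or>
     (x0 = p \<and> x1 = p + q \<and> x2 = q \<and> x3 = 0 \<and> x4 = 0) \<or>
     (x0 = p \<and> x1 = p + q \<and> x2 = 0 \<and> x3 = 0 \<and> x4 = - q)"
    and "(y0 = 0 \<and> y1 = 0 \<and> y2 = - r \<and> y3 = - r - t \<and> y4 = - t) \<or>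
     (y0 = 0 \<and> y1 = t \<and> y2 = - r + t \<and> y3 = - r \<and> y4 = 0) \<or>
     (y0 = r \<and> y1 = 0 \<and> y2 = 0 \<and> y3 = - r - t \<and> y4 = - t) \<or>
     (y0 = r \<and> y1 = r + t \<and> y2 = t \<and> y3 = 0 \<and> y4 = 0) \<or>
     (y0 = r \<and> y1 = r + t \<and> y2 = 0 \<and> y3 = 0 \<and> y4 = - t)"
  shows "(p * y0 - x0 * r) + (q1 * y1 - x1 * t1) + (p2 * y2 - x2 * r2) + (q3 * y3 - x3 * t3) + (p4 * y4 - x4 * r4) = 0"
  using assms(9,10) unfolding assms(1-8) by (elim disjE conjE; hypsubst_thin; simp add: algebra_simps)

lemma cocycle_B2:
  fixes p q r t :: int
  assumes "q1 = q + 2 * x0" "p2 = - p + x1" "q3 = - q1 + 2 * x2" "p4 = - p2 + x3" "q5 = - q3 + 2 * x4"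
    and "t1 = t + y0" "r2 = - r + 2 * y1" "t3 = - t1 + y2" "r4 = - r2 + 2 * y3" "t5 = - t3 + y4"
    and "(x0 = 0 \<and> x1 = 0 \<and> x2 = - p \<and> x3 = -2 * p - q \<and> x4 = - p - q \<and> x5 = - q) \<or>
     (x0 = 0 \<and> x1 = q \<and> x2 = - p + q \<and> x3 = -2 * p + q \<and> x4 = - p \<and> x5 = 0) \<or>
     (x0 = p \<and> x1 = 0 \<and> x2 = 0 \<and> x3 = -2 * p - q \<and> x4 = - p - q \<and> x5 = - q) \<or>
     (x0 = p \<and> x1 = 2 * p + q \<and> x2 = p + q \<and> x3 = q \<and> x4 = 0 \<and> x5 = 0) \<or>
     (x0 = p \<and> x1 = 2 * p + q \<and> x2 = 0 \<and> x3 = 0 \<and> x4 = - p - q \<and> x5 = - q) \<or>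
     (x0 = p \<and> x1 = 2 * p + q \<and> x2 = p + q \<and> x3 = 0 \<and> x4 = 0 \<and> x5 = - q)"
    and "(y0 = 0 \<and> y1 = 0 \<and> y2 = - r \<and> y3 = - r - t \<and> y4 = - r - 2 * t \<and> y5 = - t) \<or>
     (y0 = 0 \<and> y1 = t \<and> y2 = - r + 2 * t \<and> y3 = - r + t \<and> y4 = - r \<and> y5 = 0) \<or>
     (y0 = r \<and> y1 = 0 \<and> y2 = 0 \<and> y3 = - r - t \<and> y4 = - r - 2 * t \<and> y5 = - t) \<or>
     (y0 = r \<and> y1 = r + t \<and> y2 = r + 2 * t \<and> y3 = t \<and> y4 = 0 \<and> y5 = 0) \<or>
     (y0 = r \<and> y1 = r + t \<and> y2 = 0 \<and> y3 = 0 \<and> y4 = - r - 2 * t \<and> y5 = - t) \<or>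
     (y0 = r \<and> y1 = r + t \<and> y2 = r + 2 * t \<and> y3 = 0 \<and> y4 = 0 \<and> y5 = - t)"
  shows "(p * y0 - x0 * r) + (q1 * y1 - x1 * t1) + (p2 * y2 - x2 * r2) + (q3 * y3 - x3 * t3) + (p4 * y4 - x4 * r4) + (q5 * y5 - x5 * t5) = 0"
  using assms(11,12) unfolding assms(1-10) by (elim disjE conjE; hypsubst_thin; simp add: algebra_simps)

lemma cocycle_C2:
  fixes p q r t :: int
  assumes "q1 = q + x0" "p2 = - p + 2 * x1" "q3 = - q1 + x2" "p4 = - p2 + 2 * x3" "q5 = - q3 + x4"
    and "t1 = t + 2 * y0" "r2 = - r + y1" "t3 = - t1 + 2 * y2" "r4 = - r2 + y3" "t5 = - t3 + 2 * y4"
    and "(x0 = 0 \<and> x1 = 0 \<and> x2 = - p \<and> x3 = - p - q \<and> x4 = - p - 2 * q \<and> x5 = - q) \<or>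
     (x0 = 0 \<and> x1 = q \<and> x2 = - p + 2 * q \<and> x3 = - p + q \<and> x4 = - p \<and> x5 = 0) \<or>
     (x0 = p \<and> x1 = 0 \<and> x2 = 0 \<and> x3 = - p - q \<and> x4 = - p - 2 * q \<and> x5 = - q) \<or>
     (x0 = p \<and> x1 = p + q \<and> x2 = p + 2 * q \<and> x3 = q \<and> x4 = 0 \<and> x5 = 0) \<or>
     (x0 = p \<and> x1 = p + q \<and> x2 = 0 \<and> x3 = 0 \<and> x4 = - p - 2 * q \<and> x5 = - q) \<or>
     (x0 = p \<and> x1 = p + q \<and> x2 = p + 2 * q \<and> x3 = 0 \<and> x4 = 0 \<and> x5 = - q)"
    and "(y0 = 0 \<and> y1 = 0 \<and> y2 = - r \<and> y3 = -2 * r - t \<and> y4 = - r - t \<and> y5 = - t) \<or>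
     (y0 = 0 \<and> y1 = t \<and> y2 = - r + t \<and> y3 = -2 * r + t \<and> y4 = - r \<and> y5 = 0) \<or>
     (y0 = r \<and> y1 = 0 \<and> y2 = 0 \<and> y3 = -2 * r - t \<and> y4 = - r - t \<and> y5 = - t) \<or>
     (y0 = r \<and> y1 = 2 * r + t \<and> y2 = r + t \<and> y3 = t \<and> y4 = 0 \<and> y5 = 0) \<or>
     (y0 = r \<and> y1 = 2 * r + t \<and> y2 = 0 \<and> y3 = 0 \<and> y4 = - r - t \<and> y5 = - t) \<or>
     (y0 = r \<and> y1 = 2 * r + t \<and> y2 = r + t \<and> y3 = 0 \<and> y4 = 0 \<and> y5 = - t)"
  shows "(p * y0 - x0 * r) + (q1 * y1 - x1 * t1) + (p2 * y2 - x2 * r2) + (q3 * y3 - x3 * t3) + (p4 * y4 - x4 * r4) + (q5 * y5 - x5 * t5) = 0"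
  using assms(11,12) unfolding assms(1-10) by (elim disjE conjE; hypsubst_thin; simp add: algebra_simps)

text \<open>The first six equations are the exponents of the coefficient identities that
  \<open>pentagon_field\<close> requires. The last two say that the columns return with the two
  nodes exchanged.\<close>

lemma exponents_A2:
  fixes p q :: int
  assumes "q1 = q + max p 0" "p2 = - p + max q1 0" "q3 = - q1 + max p2 0" "p4 = - p2 + max q3 0"
  shows "max (- q3) 0 + max (- p2) 0 = max p 0" "max (- p) 0 + max (- q1) 0 = max q3 0" "max (- q3) 0 + max p2 0 = max (- p) 0 + max q1 0" "max (- p2) 0 + max (- q1) 0 = max p4 0" "max (- p4) 0 + max (- p) 0 = max p2 0" "max (- p4) 0 + max p 0 = max (- p2) 0 + max q1 0" "- p4 = q" "- q3 + max p4 0 = p"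
proof -
  have neg: "max (- x) 0 = max x 0 - x" for x :: int by simp
  \<comment> \<open>The maxima are replaced by unknowns that satisfy one of the linear alternatives
    from \<open>regions_A2\<close>, so only linear equations remain.\<close>
  have aux: "(x3 - q3) + (x2 - p2) = x0" "(x0 - p) + (x1 - q1) = x3" "(x3 - q3) + x2 = (x0 - p) + x1" "(x2 - p2) + (x1 - q1) = x4" "(x4 - p4) + (x0 - p) = x2" "(x4 - p4) + x0 = (x2 - p2) + x1" "- p4 = q" "- q3 + x4 = p"
    if "(x0 = 0 \<and> x1 = 0 \<and> x2 = - p \<and> x3 = - p - q \<and> x4 = - q) \<or> (x0 = 0 \<and> x1 = q \<and> x2 = - p + q \<and> x3 = - p \<and> x4 = 0) \<or> (x0 = p \<and> x1 = 0 \<and> x2 = 0 \<and> x3 = - p - q \<and> x4 = - q) \<or> (x0 = p \<and> x1 = p + q \<and> x2 = q \<and> x3 = 0 \<and> x4 = 0) \<or> (x0 = p \<and> x1 = p + q \<and> x2 = 0 \<and> x3 = 0 \<and> x4 = - q)" "q1 = q + x0" "p2 = - p + x1" "q3 = - q1 + x2" "p4 = - p2 + x3" for x0 x1 x2 x3 x4 :: int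
    using that by (elim disjE conjE; hypsubst_thin; simp add: algebra_simps)+
  show "max (- q3) 0 + max (- p2) 0 = max p 0" "max (- p) 0 + max (- q1) 0 = max q3 0" "max (- q3) 0 + max p2 0 = max (- p) 0 + max q1 0" "max (- p2) 0 + max (- q1) 0 = max p4 0" "max (- p4) 0 + max (- p) 0 = max p2 0" "max (- p4) 0 + max p 0 = max (- p2) 0 + max q1 0" "- p4 = q" "- q3 + max p4 0 = p"
    unfolding neg by (rule aux[OF regions_A2[OF assms] assms])+
qed

lemma exponents_B2:
  fixes p q :: int
  assumes "q1 = q + 2 * max p 0" "p2 = - p + max q1 0" "q3 = - q1 + 2 * max p2 0" "p4 = - p2 + max q3 0" "q5 = - q3 + 2 * max p4 0"
  shows "max (- p4) 0 + max (- q5) 0 + max (- p) 0 = max p2 0" "max (- p4) 0 + max (- q5) 0 + max p 0 = max (- p2) 0 + max q1 0" "max (- p4) 0 + max q5 0 = max (- p2) 0 + max (- q1) 0 + max p 0" "max (- p2) 0 + max (- q1) 0 + max (- p) 0 = max p4 0" "max (- q3) 0 + max (- p2) 0 + max (- p2) 0 + max (- q1) 0 = max q5 0" "max (- q3) 0 + max (- p2) 0 + max (- p2) 0 + max q1 0 = max (- q5) 0 + max p 0 + max p 0" "max (- q5) 0 + max (- p) 0 + max (- p) 0 + max (- q1) 0 = max q3 0" "max (- q3) 0 + max p2 0 + max (- p2) 0 = max (- q5) 0 + max p 0 + max (- p) 0" "max (- q3) 0 + max p2 0 + max p2 0 = max (- q5) 0 + max (- p) 0 + max (- p) 0 + max q1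 0" "- p4 + max q5 0 = p" "- q5 = q"
proof -
  have neg: "max (- x) 0 = max x 0 - x" for x :: int by simp
  have aux: "(x4 - p4) + (x5 - q5) + (x0 - p) = x2" "(x4 - p4) + (x5 - q5) + x0 = (x2 - p2) + x1" "(x4 - p4) + x5 = (x2 - p2) + (x1 - q1) + x0" "(x2 - p2) + (x1 - q1) + (x0 - p) = x4" "(x3 - q3) + (x2 - p2) + (x2 - p2) + (x1 - q1) = x5" "(x3 - q3) + (x2 - p2) + (x2 - p2) + x1 = (x5 - q5) + x0 + x0" "(x5 - q5) + (x0 - p) + (x0 - p) + (x1 - q1) = x3" "(x3 - q3) + x2 + (x2 - p2) = (x5 - q5) + x0 + (x0 - p)" "(x3 - q3) + x2 + x2 = (x5 - q5) + (x0 - p) + (x0 - p) + x1" "- p4 + x5 = p" "- q5 = q"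
    if "(x0 = 0 \<and> x1 = 0 \<and> x2 = - p \<and> x3 = -2 * p - q \<and> x4 = - p - q \<and> x5 = - q) \<or> (x0 = 0 \<and> x1 = q \<and> x2 = - p + q \<and> x3 = -2 * p + q \<and> x4 = - p \<and> x5 = 0) \<or> (x0 = p \<and> x1 = 0 \<and> x2 = 0 \<and> x3 = -2 * p - q \<and> x4 = - p - q \<and> x5 = - q) \<or> (x0 = p \<and> x1 = 2 * p + q \<and> x2 = p + q \<and> x3 = q \<and> x4 = 0 \<and> x5 = 0) \<or> (x0 = p \<and> x1 = 2 * p + q \<and> x2 = 0 \<and> x3 = 0 \<and> x4 = - p - q \<and> x5 = - q) \<or> (x0 = p \<and> x1 = 2 * p + q \<and> x2 = p + q \<and> x3 = 0 \<and> x4 = 0 \<and> x5 = - q)" "q1 = q + 2 * x0" "p2 = - p + x1" "q3 = - q1 + 2 * x2" "p4 = - p2 + x3" "q5 = - q3 + 2 * x4" for x0 x1 x2 x3 x4 x5 :: int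
    using that by (elim disjE conjE; hypsubst_thin; simp add: algebra_simps)+
  show "max (- p4) 0 + max (- q5) 0 + max (- p) 0 = max p2 0" "max (- p4) 0 + max (- q5) 0 + max p 0 = max (- p2) 0 + max q1 0" "max (- p4) 0 + max q5 0 = max (- p2) 0 + max (- q1) 0 + max p 0" "max (- p2) 0 + max (- q1) 0 + max (- p) 0 = max p4 0" "max (- q3) 0 + max (- p2) 0 + max (- p2) 0 + max (- q1) 0 = max q5 0" "max (- q3) 0 + max (- p2) 0 + max (- p2) 0 + max q1 0 = max (- q5) 0 + max p 0 + max p 0" "max (- q5) 0 + max (- p) 0 + max (- p) 0 + max (- q1) 0 = max q3 0" "max (- q3) 0 + max p2 0 + max (- p2) 0 = max (- q5) 0 + max p 0 + max (- p) 0" "max (- q3) 0 + max p2 0 + max p2 0 = max (- q5) 0 + max (- p) 0 + max (- p) 0 + max q1 0" "- p4 + max q5 0 = p" "- q5 = q"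
    unfolding neg by (rule aux[OF regions_B2[OF assms] assms])+
qed

lemma exponents_C2:
  fixes p q :: int
  assumes "q1 = q + max p 0" "p2 = - p + 2 * max q1 0" "q3 = - q1 + max p2 0" "p4 = - p2 + 2 * max q3 0" "q5 = - q3 + max p4 0"
  shows "max (- q3) 0 + max (- p2) 0 + max (- q1) 0 = max q5 0" "max (- q3) 0 + max (- p2) 0 + max q1 0 = max (- q5) 0 + max p 0" "max (- q3) 0 + max p2 0 = max (- q5) 0 + max (- p) 0 + max q1 0" "max (- q5) 0 + max (- p) 0 + max (- q1) 0 = max q3 0" "max (- p4) 0 + max (- q5) 0 + max (- q5) 0 + max (- p) 0 = max p2 0" "max (- p4) 0 + max (- q5) 0 + max (- q5) 0 + max p 0 = max (- p2) 0 + max q1 0 + max q1 0" "max (- p4) 0 + max q5 0 + max (- q5) 0 = max (- p2) 0 + max q1 0 + max (- q1) 0" "max (- p4) 0 + max q5 0 + max q5 0 = max (- p2) 0 + max (- q1) 0 + max (- q1) 0 + max p 0" "max (- p2) 0 + max (- q1) 0 + max (- q1) 0 + max (- p) 0 = max p4 0" "- p4 + 2 * max q5 0 = p" "- q5 = q"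
proof -
  have neg: "max (- x) 0 = max x 0 - x" for x :: int by simp
  have aux: "(x3 - q3) + (x2 - p2) + (x1 - q1) = x5" "(x3 - q3) + (x2 - p2) + x1 = (x5 - q5) + x0" "(x3 - q3) + x2 = (x5 - q5) + (x0 - p) + x1" "(x5 - q5) + (x0 - p) + (x1 - q1) = x3" "(x4 - p4) + (x5 - q5) + (x5 - q5) + (x0 - p) = x2" "(x4 - p4) + (x5 - q5) + (x5 - q5) + x0 = (x2 - p2) + x1 + x1" "(x4 - p4) + x5 + (x5 - q5) = (x2 - p2) + x1 + (x1 - q1)" "(x4 - p4) + x5 + x5 = (x2 - p2) + (x1 - q1) + (x1 - q1) + x0" "(x2 - p2) + (x1 - q1) + (x1 - q1) + (x0 - p) = x4" "- p4 + 2 * x5 = p" "- q5 = q"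
    if "(x0 = 0 \<and> x1 = 0 \<and> x2 = - p \<and> x3 = - p - q \<and> x4 = - p - 2 * q \<and> x5 = - q) \<or> (x0 = 0 \<and> x1 = q \<and> x2 = - p + 2 * q \<and> x3 = - p + q \<and> x4 = - p \<and> x5 = 0) \<or> (x0 = p \<and> x1 = 0 \<and> x2 = 0 \<and> x3 = - p - q \<and> x4 = - p - 2 * q \<and> x5 = - q) \<or> (x0 = p \<and> x1 = p + q \<and> x2 = p + 2 * q \<and> x3 = q \<and> x4 = 0 \<and> x5 = 0) \<or> (x0 = p \<and> x1 = p + q \<and> x2 = 0 \<and> x3 = 0 \<and> x4 = - p - 2 * q \<and> x5 = - q) \<or> (x0 = p \<and> x1 = p + q \<and> x2 = p + 2 * q \<and> x3 = 0 \<and> x4 = 0 \<and> x5 = - q)" "q1 = q + x0" "p2 = - p + 2 * x1" "q3 = - q1 + x2" "p4 = - p2 + 2 * x3" "q5 = - q3 + x4" for x0 x1 x2 x3 x4 x5 :: int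
    using that by (elim disjE conjE; hypsubst_thin; simp add: algebra_simps)+
  show "max (- q3) 0 + max (- p2) 0 + max (- q1) 0 = max q5 0" "max (- q3) 0 + max (- p2) 0 + max q1 0 = max (- q5) 0 + max p 0" "max (- q3) 0 + max p2 0 = max (- q5) 0 + max (- p) 0 + max q1 0" "max (- q5) 0 + max (- p) 0 + max (- q1) 0 = max q3 0" "max (- p4) 0 + max (- q5) 0 + max (- q5) 0 + max (- p) 0 = max p2 0" "max (- p4) 0 + max (- q5) 0 + max (- q5) 0 + max p 0 = max (- p2) 0 + max q1 0 + max q1 0" "max (- p4) 0 + max q5 0 + max (- q5) 0 = max (- p2) 0 + max q1 0 + max (- q1) 0" "max (- p4) 0 + max q5 0 + max q5 0 = max (- p2) 0 + max (- q1) 0 + max (- q1) 0 + max p 0" "max (- p2) 0 + max (- q1) 0 + max (- q1) 0 + max (- p) 0 = max p4 0" "- p4 + 2 * max q5 0 = p" "- q5 = q"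
    unfolding neg by (rule aux[OF regions_C2[OF assms] assms])+
qed

text \<open>\<open>y4\<close> and \<open>y5\<close> are multiplied by the nonzero products that
  clear their denominators, and the exchange relations then serve as rewrite rules. The equations
  \<open>c\<close> are the agreements of coefficient monomials that let the expansions
  match.\<close>

lemma pentagon_field:
  fixes a b :: "'a::field"
  assumes y: "y1 * a = A + B * b" "y2 * b = C + D * y1" "y3 * y1 = E + F * y2" "y4 * y2 = G + H * y3" "y5 * y3 = K + L * y4"
    and nz: "y1 \<noteq> 0" "y2 \<noteq> 0" "y3 \<noteq> 0"
    and c: "H * F = A" "B * D = G" "H * E = B * C" "F * D = K" "L * B = E" "L * A = F * C"
  shows "y4 = a" "y5 = b"
proof -
  have "y4 * (y2 * y1) = (y4 * y2) * y1" by algebra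
  also have "\<dots> = G * y1 + H * (y3 * y1)" unfolding y(4) by algebra
  also have "\<dots> = G * y1 + (H * E) + (H * F) * y2" unfolding y(3) by algebra
  also have "\<dots> = B * (C + D * y1) + A * y2" unfolding c(1,3) c(2)[symmetric] by algebra
  also have "\<dots> = (A + B * b) * y2" unfolding y(2)[symmetric] by algebra
  also have "\<dots> = a * (y2 * y1)" unfolding y(1)[symmetric] by algebra
  finally show y4: "y4 = a" using nz by simp
  have "y5 * (y3 * y1) = (y5 * y3) * y1" by algebra
  also have "\<dots> = K * y1 + L * (y1 * a)" unfolding y(5) y4 by algebra
  also have "\<dots> = K * y1 + L * A + (L * B) * b" unfolding y(1) by algebra
  also have "\<dots> = F * (C + D * y1) + E * b" unfolding c(5,6) c(4)[symmetric] by algebra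
  also have "\<dots> = (E + F * y2) * b" unfolding y(2)[symmetric] by algebra
  also have "\<dots> = b * (y3 * y1)" unfolding y(3)[symmetric] by algebra
  finally show "y5 = b" using nz by simp
qed

lemma hexagon_field1:
  fixes a b :: "'a::field"
  assumes y: "y1 * a = A + B * b" "y2 * b = C + D * y1^2" "y3 * y1 = E + F * y2" "y4 * y2 = G + H * y3^2" "y5 * y3 = K + L * y4" "y6 * y4 = M + N * y5^2"
    and nz: "y1 \<noteq> 0" "y2 \<noteq> 0" "y3 \<noteq> 0" "y4 \<noteq> 0" "b \<noteq> 0"
    and c: "L * N * B = E" "L * N * A = F * C" "L * M = F * D * A" "F * D * B = K"
      "H * F^2 * D = M" "H * F^2 * C = N * A^2" "N * B^2 * D = G" "H * E * F = N * A * B" "H * E^2 = N * B^2 * C"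
  shows "y5 = a" "y6 = b"
proof -
  \<comment> \<open>If the period holds, then \<open>y5 = a\<close> and \<open>y6 = b\<close>, and
    the last relation read backwards predicts \<open>y4\<close>. This prediction is proved first;
    \<open>y5\<close> and \<open>y6\<close> follow from it.\<close>
  define z where "z = (M + N * a^2) / b"
  have z: "z * b = M + N * a^2" using nz by (simp add: z_def)
  have "y4 * (y2 * b^2 * y1^2) = (y4 * y2) * b^2 * y1^2" by algebra
  also have "\<dots> = G * b^2 * y1^2 + H * (b * (y3 * y1))^2" unfolding y(4) by algebra
  also have "\<dots> = G * b^2 * y1^2 + H * (b * E + F * (y2 * b))^2" unfolding y(3) by algebra
  also have "\<dots> = G * b^2 * y1^2 + (H * E^2) * b^2 + 2 * (H * E * F) * b * (C + D * y1^2) + (H * F^2 * C) * (C + 2 * D * y1^2) + (H * F^2 * D) * D * y1^4"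
    unfolding y(2) by algebra
  also have "\<dots> = N * (A + B * b)^2 * (C + D * y1^2) + M * D * y1^4 + (H * F^2 * C) * D * y1^2"
    unfolding c(5,6,8,9) c(7)[symmetric] by algebra
  also have "(H * F^2 * C) * D * y1^2 = (H * F^2 * D) * C * y1^2" by algebra
  also have "N * (A + B * b)^2 * (C + D * y1^2) + M * D * y1^4 + (H * F^2 * D) * C * y1^2 = (M + N * a^2) * (C + D * y1^2) * y1^2"
    unfolding c(5) y(1)[symmetric] by algebra
  also have "\<dots> = z * (y2 * b^2 * y1^2)" unfolding z[symmetric] y(2)[symmetric] by algebra
  finally have y4: "y4 = z" using nz by simp
  have "y5 * (y3 * y1 * b) = (y5 * y3) * y1 * b" by algebra
  also have "\<dots> = K * y1 * b + L * y1 * (z * b)" unfolding y(5) y4 by algebra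
  also have "\<dots> = K * y1 * b + (L * M) * y1 + L * N * (y1 * a) * a" unfolding z by algebra
  also have "\<dots> = K * y1 * b + (L * M) * y1 + (L * N * A) * a + (L * N * B) * a * b" unfolding y(1) by algebra
  also have "\<dots> = F * D * y1 * (A + B * b) + F * C * a + E * a * b" unfolding c(1,2,3) c(4)[symmetric] by algebra
  also have "\<dots> = a * (E * b + F * (C + D * y1^2))" unfolding y(1)[symmetric] by algebra
  also have "\<dots> = a * (E + F * y2) * b" unfolding y(2)[symmetric] by algebra
  also have "\<dots> = a * (y3 * y1 * b)" unfolding y(3)[symmetric] by algebra
  finally show y5: "y5 = a" using nz by simp
  have "y6 * y4 = b * y4" using y(6) z y4 y5 by (simp add: mult.commute)
  then show "y6 = b" using nz by simp
qed

lemma hexagon_field2: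
  fixes a b :: "'a::field"
  assumes y: "y1 * a = A + B * b^2" "y2 * b = C + D * y1" "y3 * y1 = E + F * y2^2" "y4 * y2 = G + H * y3" "y5 * y3 = K + L * y4^2" "y6 * y4 = M + N * y5"
    and nz: "y1 \<noteq> 0" "y2 \<noteq> 0" "y3 \<noteq> 0" "y4 \<noteq> 0" "b \<noteq> 0"
    and c: "H * F * D = M" "H * F * C = N * A" "H * E = N * B * C" "N * B * D = G"
      "L * N^2 * B = E" "L * N^2 * A = F * C^2" "L * M * N = F * C * D" "L * M^2 = F * D^2 * A" "F * D^2 * B = K"
  shows "y5 = a" "y6 = b"
proof -
  define z where "z = (M + N * a) / b"
  have z: "z * b = M + N * a" using nz by (simp add: z_def)
  have "y4 * (y2 * b^2 * y1) = (y4 * y2) * b^2 * y1" by algebra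
  also have "\<dots> = G * b^2 * y1 + H * b^2 * (y3 * y1)" unfolding y(4) by algebra
  also have "\<dots> = G * b^2 * y1 + (H * E) * b^2 + H * F * (y2 * b)^2" unfolding y(3) by algebra
  also have "\<dots> = G * b^2 * y1 + (H * E) * b^2 + (H * F * C) * (C + D * y1) + (H * F * D) * (C + D * y1) * y1"
    unfolding y(2) by algebra
  also have "\<dots> = (N * (A + B * b^2) + M * y1) * (C + D * y1)"
    unfolding c(1,2,3) c(4)[symmetric] by algebra
  also have "\<dots> = (M + N * a) * (C + D * y1) * y1" unfolding y(1)[symmetric] by algebra
  also have "\<dots> = z * (y2 * b^2 * y1)" unfolding z[symmetric] y(2)[symmetric] by algebra
  finally have y4: "y4 = z" using nz by simp
  have "y5 * (y3 * y1 * b^2) = (y5 * y3) * y1 * b^2" by algebra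
  also have "\<dots> = K * y1 * b^2 + L * y1 * (z * b)^2" unfolding y(5) y4 by algebra
  also have "\<dots> = K * y1 * b^2 + (L * M^2) * y1 + (2 * (L * M * N) + L * N^2 * a) * (y1 * a)" unfolding z by algebra
  also have "\<dots> = K * y1 * b^2 + (L * M^2) * y1 + 2 * (L * M * N) * (A + B * b^2) + (L * N^2 * A) * a + (L * N^2 * B) * a * b^2"
    unfolding y(1) by algebra
  also have "\<dots> = F * D^2 * y1 * (A + B * b^2) + 2 * F * C * D * (A + B * b^2) + F * C^2 * a + E * a * b^2"
    unfolding c(5-8) c(9)[symmetric] by algebra
  also have "\<dots> = a * (E * b^2 + F * (C + D * y1)^2)" unfolding y(1)[symmetric] by algebra
  also have "\<dots> = a * (E + F * y2^2) * b^2" unfolding y(2)[symmetric] by algebra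
  also have "\<dots> = a * (y3 * y1 * b^2)" unfolding y(3)[symmetric] by algebra
  finally show y5: "y5 = a" using nz by simp
  have "y6 * y4 = b * y4" using y(6) z y4 y5 by (simp add: mult.commute)
  then show "y6 = b" using nz by simp
qed

lemma eq_divide_cancel:
  fixes y :: "'a::field"
  shows "(y * c - n) * m = 0 \<Longrightarrow> m \<noteq> 0 \<Longrightarrow> c \<noteq> 0 \<Longrightarrow> y = n / c"
  by (simp add: eq_divide_eq)

text \<open>With no coefficients the successive variables can be written out as Laurent polynomials
  in \<open>a\<close> and \<open>b\<close>. Each new one is found by cancelling the numerator of the
  variable two places before it, which is nonzero because that variable is.\<close>

lemma octagon_field1:
  fixes a b :: "'a::field"
  assumes y: "y1 * a = 1 + b^3" "y2 * b = 1 + y1" "y3 * y1 = 1 + y2^3" "y4 * y2 = 1 + y3" "y5 * y3 = 1 + y4^3" "y6 * y4 = 1 + y5" "y7 * y5 = 1 + y6^3" "y8 * y6 = 1 + y7"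
    and nz: "a \<noteq> 0" "b \<noteq> 0" "y1 \<noteq> 0" "y2 \<noteq> 0" "y3 \<noteq> 0" "y4 \<noteq> 0" "y5 \<noteq> 0" "y6 \<noteq> 0"
  shows "y7 = a" "y8 = b"
proof -
  have y1: "y1 = (1 + b^3) / a" using y(1) nz by (simp add: eq_divide_eq)
  have "y2 * b = 1 + ((1 + b^3) / a)" using y(2) unfolding y1 .
  then have "(y2 * (a * b) - (1 + a + b^3)) * b = 0" using nz by (simp add: divide_simps) algebra
  then have y2: "y2 = (1 + a + b^3) / (a * b)" by (rule eq_divide_cancel) (use nz in auto)
  have n3: "1 + b^3 \<noteq> 0" using nz y1 by force
  have "y3 * ((1 + b^3) / (a)) = 1 + ((1 + a + b^3) / (a * b))^3" using y(3) unfolding y1 y2 .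
  then have "(y3 * (a^2 * b^3) - (1 + 3*a + 3*a^2 + a^3 + 2*b^3 + 3*a*b^3 + b^6)) * (1 + b^3) = 0" using nz by (simp add: divide_simps) algebra
  then have y3: "y3 = (1 + 3*a + 3*a^2 + a^3 + 2*b^3 + 3*a*b^3 + b^6) / (a^2 * b^3)" by (rule eq_divide_cancel) (use nz n3 in auto)
  have n4: "1 + a + b^3 \<noteq> 0" using nz y2 by force
  have "y4 * ((1 + a + b^3) / (a * b)) = 1 + ((1 + 3*a + 3*a^2 + a^3 + 2*b^3 + 3*a*b^3 + b^6) / (a^2 * b^3))" using y(4) unfolding y2 y3 .
  then have "(y4 * (a * b^2) - ((1 + a)^2 + b^3)) * (1 + a + b^3) = 0" using nz by (simp add: divide_simps) algebra
  then have y4: "y4 = ((1 + a)^2 + b^3) / (a * b^2)" by (rule eq_divide_cancel) (use nz n4 in auto)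
  have n5: "1 + 3*a + 3*a^2 + a^3 + 2*b^3 + 3*a*b^3 + b^6 \<noteq> 0" using nz y3 by force
  have "y5 * ((1 + 3*a + 3*a^2 + a^3 + 2*b^3 + 3*a*b^3 + b^6) / (a^2 * b^3)) = 1 + (((1 + a)^2 + b^3) / (a * b^2))^3" using y(5) unfolding y3 y4 .
  then have "(y5 * (a * b^3) - ((1 + a)^3 + b^3)) * (1 + 3*a + 3*a^2 + a^3 + 2*b^3 + 3*a*b^3 + b^6) = 0" using nz by (simp add: divide_simps) algebra
  then have y5: "y5 = ((1 + a)^3 + b^3) / (a * b^3)" by (rule eq_divide_cancel) (use nz n5 in auto)
  have n6: "(1 + a)^2 + b^3 \<noteq> 0" using nz y4 by force
  have "y6 * (((1 + a)^2 + b^3) / (a * b^2)) = 1 + (((1 + a)^3 + b^3) / (a * b^3))" using y(6) unfolding y4 y5 .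
  then have "(y6 * (b) - (1 + a)) * ((1 + a)^2 + b^3) = 0" using nz by (simp add: divide_simps) algebra
  then have y6: "y6 = (1 + a) / (b)" by (rule eq_divide_cancel) (use nz n6 in auto)
  have n7: "(1 + a)^3 + b^3 \<noteq> 0" using nz y5 by force
  have "y7 * (((1 + a)^3 + b^3) / (a * b^3)) = 1 + ((1 + a) / (b))^3" using y(7) unfolding y5 y6 .
  then have "(y7 * (1) - (a)) * ((1 + a)^3 + b^3) = 0" using nz by (simp add: divide_simps) algebra
  then have y7: "y7 = (a) / (1)" by (rule eq_divide_cancel) (use nz n7 in auto)
  show "y7 = a" using y7 by simp
  have "y8 * y6 = b * y6" using y(8) nz unfolding y7 y6 by simp
  then show "y8 = b" using nz by simp
qed

lemma octagon_field2:
  fixes a b :: "'a::field"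
  assumes y: "y1 * a = 1 + b" "y2 * b = 1 + y1^3" "y3 * y1 = 1 + y2" "y4 * y2 = 1 + y3^3" "y5 * y3 = 1 + y4" "y6 * y4 = 1 + y5^3" "y7 * y5 = 1 + y6" "y8 * y6 = 1 + y7^3"
    and nz: "a \<noteq> 0" "b \<noteq> 0" "y1 \<noteq> 0" "y2 \<noteq> 0" "y3 \<noteq> 0" "y4 \<noteq> 0" "y5 \<noteq> 0" "y6 \<noteq> 0"
  shows "y7 = a" "y8 = b"
proof -
  have y1: "y1 = (1 + b) / a" using y(1) nz by (simp add: eq_divide_eq)
  have "y2 * b = 1 + ((1 + b) / a)^3" using y(2) unfolding y1 .
  then have "(y2 * (b * a^3) - ((1 + b)^3 + a^3)) * b = 0" using nz by (simp add: divide_simps) algebra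
  then have y2: "y2 = ((1 + b)^3 + a^3) / (b * a^3)" by (rule eq_divide_cancel) (use nz in auto)
  have n3: "1 + b \<noteq> 0" using nz y1 by force
  have "y3 * ((1 + b) / (a)) = 1 + (((1 + b)^3 + a^3) / (b * a^3))" using y(3) unfolding y1 y2 .
  then have "(y3 * (b * a^2) - ((1 + b)^2 + a^3)) * (1 + b) = 0" using nz by (simp add: divide_simps) algebra
  then have y3: "y3 = ((1 + b)^2 + a^3) / (b * a^2)" by (rule eq_divide_cancel) (use nz n3 in auto)
  have n4: "(1 + b)^3 + a^3 \<noteq> 0" using nz y2 by force
  have "y4 * (((1 + b)^3 + a^3) / (b * a^3)) = 1 + (((1 + b)^2 + a^3) / (b * a^2))^3" using y(4) unfolding y2 y3 .
  then have "(y4 * (b^2 * a^3) - (1 + 3*b + 3*b^2 + b^3 + 2*a^3 + 3*b*a^3 + a^6)) * ((1 + b)^3 + a^3) = 0" using nz by (simp add: divide_simps) algebra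
  then have y4: "y4 = (1 + 3*b + 3*b^2 + b^3 + 2*a^3 + 3*b*a^3 + a^6) / (b^2 * a^3)" by (rule eq_divide_cancel) (use nz n4 in auto)
  have n5: "(1 + b)^2 + a^3 \<noteq> 0" using nz y3 by force
  have "y5 * (((1 + b)^2 + a^3) / (b * a^2)) = 1 + ((1 + 3*b + 3*b^2 + b^3 + 2*a^3 + 3*b*a^3 + a^6) / (b^2 * a^3))" using y(5) unfolding y3 y4 .
  then have "(y5 * (b * a) - (1 + b + a^3)) * ((1 + b)^2 + a^3) = 0" using nz by (simp add: divide_simps) algebra
  then have y5: "y5 = (1 + b + a^3) / (b * a)" by (rule eq_divide_cancel) (use nz n5 in auto)
  have n6: "1 + 3*b + 3*b^2 + b^3 + 2*a^3 + 3*b*a^3 + a^6 \<noteq> 0" using nz y4 by force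
  have "y6 * ((1 + 3*b + 3*b^2 + b^3 + 2*a^3 + 3*b*a^3 + a^6) / (b^2 * a^3)) = 1 + ((1 + b + a^3) / (b * a))^3" using y(6) unfolding y4 y5 .
  then have "(y6 * (b) - (1 + a^3)) * (1 + 3*b + 3*b^2 + b^3 + 2*a^3 + 3*b*a^3 + a^6) = 0" using nz by (simp add: divide_simps) algebra
  then have y6: "y6 = (1 + a^3) / (b)" by (rule eq_divide_cancel) (use nz n6 in auto)
  have n7: "1 + b + a^3 \<noteq> 0" using nz y5 by force
  have "y7 * ((1 + b + a^3) / (b * a)) = 1 + ((1 + a^3) / (b))" using y(7) unfolding y5 y6 .
  then have "(y7 * (1) - (a)) * (1 + b + a^3) = 0" using nz by (simp add: divide_simps) algebra
  then have y7: "y7 = (a) / (1)" by (rule eq_divide_cancel) (use nz n7 in auto)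
  show "y7 = a" using y7 by simp
  have "y8 * y6 = b * y6" using y(8) nz unfolding y7 y6 by simp
  then show "y8 = b" using nz by simp
qed

text \<open>All arrows are reversed. Mutation commutes with this operation, so the rank two periods
  have to be computed for one sign of the orientation only.\<close>

definition neg :: "'a fseed \<Rightarrow> 'a fseed" where
  "neg s = (fst s, \<lambda>i j. - snd s i j)"

context semifield_seeds
begin

definition frz :: "nat set \<Rightarrow> (nat \<Rightarrow> 'a) \<Rightarrow> (nat \<Rightarrow> int) \<Rightarrow> 'a" where
  "frz K x e = (\<Prod>i\<in>I - K. x i ^ nat (e i))"

lemma mon_pair:
  assumes "k \<in> I" "l \<in> I" "k \<noteq> l"
  shows "mon x e = x k ^ nat (e k) * (x l ^ nat (e l) * frz {k, l} x e)"
proof -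
  have "I = insert k (insert l (I - {k, l}))" using assms by auto
  then have "mon x e = (\<Prod>i\<in>insert k (insert l (I - {k, l})). x i ^ nat (e i))" by (simp add: mon_def)
  then show ?thesis using assms(3) by (simp add: frz_def)
qed

lemma frz_cong: "(\<And>i. i \<in> I - K \<Longrightarrow> x i = y i) \<Longrightarrow> (\<And>i. i \<in> I - K \<Longrightarrow> e i = f i) \<Longrightarrow> frz K x e = frz K y f"
  unfolding frz_def by (rule prod.cong) auto

lemma prod_list_frz: "prod_list (map (frz K x) es) = (\<Prod>i\<in>I - K. x i ^ nat (sum_list (map (\<lambda>e. max (e i) 0) es)))"
proof (induction es)
  case (Cons e es)
  have "0 \<le> sum_list (map (\<lambda>e. max (e i) 0) es)" for i by (induction es) auto
  then have "nat (max (e i) 0 + sum_list (map (\<lambda>e. max (e i) 0) es)) = nat (e i) + nat (sum_list (map (\<lambda>e. max (e i) 0) es))" for i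
    by (simp add: nat_add_distrib)
  then show ?case using Cons by (simp add: frz_def power_add prod.distrib)
qed simp

lemma frz_eq:
  assumes "\<And>i. i \<in> I - K \<Longrightarrow> sum_list (map (\<lambda>e. max (e i) 0) es) = sum_list (map (\<lambda>e. max (e i) 0) fs)"
  shows "prod_list (map (frz K x) es) = prod_list (map (frz K x) fs)"
  unfolding prod_list_frz using assms by (intro prod.cong) auto

text \<open>The effect of one mutation inside the pair, stated so that its conclusions are the
  hypotheses for mutating at the other node. The periods are obtained by chaining such
  steps.\<close>

lemma mut_rank2:
  assumes "good s" and k: "k \<in> I" "l \<in> I" "k \<noteq> l" "K = {k, l}" and b: "snd s k l = u" "snd s l k = - v" "0 \<le> u" "0 \<le> v"
  shows "fst (mut k s) k * fst s k = frz K (fst s) (\<lambda>i. snd s i k) + frz K (fst s) (\<lambda>i. - snd s i k) * fst s l ^ nat v"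
    and "fst (mut k s) l = fst s l"
    and "frz K (fst (mut k s)) e = frz K (fst s) e"
    and "snd (mut k s) l k = v" "snd (mut k s) k l = - u" "good (mut k s)" "fst (mut k s) k \<noteq> 0"
    and "i \<notin> K \<Longrightarrow> snd (mut k s) i k = - snd s i k"
    and "i \<notin> K \<Longrightarrow> snd (mut k s) i l = snd s i l + u * max (snd s i k) 0"
    and "i \<notin> K \<Longrightarrow> snd (mut k s) k i = - snd s k i"
    and "i \<notin> K \<Longrightarrow> snd (mut k s) l i = snd s l i - v * max (- snd s k i) 0"
    and "i \<notin> K \<Longrightarrow> j \<notin> K \<Longrightarrow> snd (mut k s) i j = snd s i j + (snd s k j * max (snd s i k) 0 + snd s i k * max (- snd s k j) 0)"
proof -
  have kk: "snd s k k = 0" using goodD(3)[OF assms(1)] .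
  show "fst (mut k s) k * fst s k = frz K (fst s) (\<lambda>i. snd s i k) + frz K (fst s) (\<lambda>i. - snd s i k) * fst s l ^ nat v"
    using goodD(2)[OF assms(1) k(1)] kk b
    by (simp add: fst_mut_eq mon_pair[OF k(1-3)] k(4) mult.commute)
  show "frz K (fst (mut k s)) e = frz K (fst s) e" by (rule frz_cong) (auto simp: k(4))
  show "good (mut k s)" using assms good_mut by blast
  then show "fst (mut k s) k \<noteq> 0" using goodD(2) k by blast
qed (use k b in \<open>auto simp: mutm_def\<close>)

lemma mut_neg:
  shows "mut k (neg s) = neg (mut k s)"
proof -
  have "mutm k (\<lambda>i j. - snd s i j) = (\<lambda>i j. - mutm k (snd s) i j)"
    by (intro ext) (auto simp: mutm_def max_def algebra_simps)
  then show ?thesis by (simp add: neg_def mut_def add.commute)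
qed

lemma mutw_neg: "mutw ks (neg s) = neg (mutw ks s)"
  by (induction ks arbitrary: s) (simp_all add: mut_neg)

lemma good_neg: "good s \<Longrightarrow> good (neg s)"
  unfolding good_def neg_def by (simp del: neg_equal_iff_equal add: minus_mult_right[symmetric]) metis

lemma neg_neg: "neg (neg s) = s"
  by (simp add: neg_def)

lemma pentagon_pos:
  assumes g: "good s" and k: "k \<in> I" "l \<in> I" "k \<noteq> l" and b: "snd s k l = 1" "snd s l k = - 1"
  shows "mutw [k, l, k, l, k] s = prm (transpose k l) s"
proof -
  define K where "K = {k, l}"
  have K: "K = {k, l}" "K = {l, k}" by (auto simp: K_def)
  define s1 s2 s3 s4 s5 where s: "s1 = mut k s" "s2 = mut l s1" "s3 = mut k s2" "s4 = mut l s3" "s5 = mut k s4"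
  note r1 = mut_rank2[where u = 1 and v = 1, OF g k K(1) b zero_le_one zero_le_one, folded s]
  note r2 = mut_rank2[where u = 1 and v = 1, OF r1(6) k(2,1) k(3)[symmetric] K(2) r1(4,5) zero_le_one zero_le_one, folded s]
  note r3 = mut_rank2[where u = 1 and v = 1, OF r2(6) k K(1) r2(4,5) zero_le_one zero_le_one, folded s]
  note r4 = mut_rank2[where u = 1 and v = 1, OF r3(6) k(2,1) k(3)[symmetric] K(2) r3(4,5) zero_le_one zero_le_one, folded s]
  note r5 = mut_rank2[where u = 1 and v = 1, OF r4(6) k K(1) r4(4,5) zero_le_one zero_le_one, folded s]
  define p q where pq: "p = (\<lambda>i. snd s i k)" "q = (\<lambda>i. snd s i l)"
  define q1 p2 q3 p4 where seq: "q1 = (\<lambda>i. snd s1 i l)" "p2 = (\<lambda>i. snd s2 i k)" "q3 = (\<lambda>i. snd s3 i l)" "p4 = (\<lambda>i. snd s4 i k)"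
  have rec: "q1 i = q i + max (p i) 0" "p2 i = - p i + max (q1 i) 0" "q3 i = - q1 i + max (p2 i) 0" "p4 i = - p2 i + max (q3 i) 0"
    if "i \<notin> K" for i
    unfolding pq seq
    by (fact r1(9)[OF that, unfolded mult_1] r2(9)[OF that, unfolded mult_1 r1(8)[OF that]]
      r3(9)[OF that, unfolded mult_1 r2(8)[OF that]] r4(9)[OF that, unfolded mult_1 r3(8)[OF that]])+
  note ex = exponents_A2[OF rec]
  define M where "M = frz K (fst s)"
  define N where "N e = (\<lambda>i::nat. - e i :: int)" for e :: "nat \<Rightarrow> int"
  have y: "fst s1 k * fst s k = M p + M (N p) * fst s l" "fst s2 l * fst s l = M q1 + M (N q1) * fst s1 k"
    "fst s3 k * fst s1 k = M p2 + M (N p2) * fst s2 l" "fst s4 l * fst s2 l = M q3 + M (N q3) * fst s3 k"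
    "fst s5 k * fst s3 k = M p4 + M (N p4) * fst s4 l"
    using r1(1) r2(1) r3(1) r4(1) r5(1) unfolding N_def M_def seq pq r1(3) r2(3) r3(3) r4(3) r5(3) r1(2) r2(2) r3(2) r4(2) r5(2) by simp_all
  have c: "M (N q3) * M (N p2) = M p" "M (N p) * M (N q1) = M q3" "M (N q3) * M p2 = M (N p) * M q1"
      "M (N p2) * M (N q1) = M p4" "M (N p4) * M (N p) = M p2" "M (N p4) * M p = M (N p2) * M q1"
    using ex frz_eq[of K "[N q3, N p2]" "[p]" "fst s"] frz_eq[of K "[N p, N q1]" "[q3]" "fst s"] frz_eq[of K "[N q3, p2]" "[N p, q1]" "fst s"]
      frz_eq[of K "[N p2, N q1]" "[p4]" "fst s"] frz_eq[of K "[N p4, N p]" "[p2]" "fst s"] frz_eq[of K "[N p4, p]" "[N p2, q1]" "fst s"]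
    by (simp_all add: M_def N_def)
  note x = pentagon_field[OF y r1(7) r2(7) r3(7) c]
  have fst: "fst s5 i = fst s (transpose k l i)" for i
    using x r5(2) k(3) by (cases "i = k"; cases "i = l") (auto simp: s transpose_def)
  have snd: "snd s5 i j = snd s (transpose k l i) (transpose k l j)" for i j
  proof -
    have kl: "snd s5 l k = 1" "snd s5 k l = - 1" "snd s5 k k = 0" "snd s5 l l = 0" "snd s k k = 0" "snd s l l = 0"
      using r5(4,5) goodD(3)[OF r5(6)] goodD(3)[OF g] by auto
    have out: "snd s5 i k = snd s i l" "snd s5 i l = snd s i k" if "i \<notin> K" for i
      using r5(8,9)[OF that] r4(8)[OF that] ex(7,8)[OF that that that that] by (simp_all add: pq seq)
    define t r where tr: "t = (\<lambda>j. - snd s l j)" "r = (\<lambda>j. - snd s k j)"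
    define t1 r2' t3 r4' where seq': "t1 = (\<lambda>j. - snd s1 l j)" "r2' = (\<lambda>j. - snd s2 k j)" "t3 = (\<lambda>j. - snd s3 l j)" "r4' = (\<lambda>j. - snd s4 k j)"
    \<comment> \<open>The negated rows obey the same recursion as the columns, so the A2 lemmas
      serve for both.\<close>
    have rec': "t1 j = t j + max (r j) 0" "r2' j = - r j + max (t1 j) 0" "t3 j = - t1 j + max (r2' j) 0" "r4' j = - r2' j + max (t3 j) 0"
      if "j \<notin> K" for j
    proof -
      show "t1 j = t j + max (r j) 0" unfolding tr seq' r1(11)[OF that] by simp
      show "r2' j = - r j + max (t1 j) 0" unfolding tr seq' r2(11)[OF that] r1(10)[OF that] by simp
      show "t3 j = - t1 j + max (r2' j) 0" unfolding tr seq' r3(11)[OF that] r2(10)[OF that] by simp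
      show "r4' j = - r2' j + max (t3 j) 0" unfolding tr seq' r4(11)[OF that] r3(10)[OF that] by simp
    qed
    note ex' = exponents_A2(7,8)[OF rec']
    have out': "snd s5 k j = snd s l j" "snd s5 l j = snd s k j" if "j \<notin> K" for j
      using r5(10,11)[OF that] r4(10)[OF that] ex'[OF that that that that] by (simp_all add: tr seq')
    have both: "snd s5 i j = snd s i j" if ij: "i \<notin> K" "j \<notin> K" for i j
    proof -
      have e: "snd s k j = - r j" "snd s1 l j = - t1 j" "snd s2 k j = - r2' j" "snd s3 l j = - t3 j" "snd s4 k j = - r4' j"
        "snd s i k = p i" "snd s1 i l = q1 i" "snd s2 i k = p2 i" "snd s3 i l = q3 i" "snd s4 i k = p4 i"
        by (simp_all add: tr seq' pq seq)
      show ?thesis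
        using cocycle_A2[OF rec[OF ij(1)] rec'[OF ij(2)] regions_A2[OF rec[OF ij(1)]] regions_A2[OF rec'[OF ij(2)]]]
        unfolding r5(12)[OF ij] r4(12)[OF ij] r3(12)[OF ij] r2(12)[OF ij] r1(12)[OF ij] e
        by (simp add: algebra_simps)
    qed
    have tK: "transpose k l m = m" if "m \<notin> K" for m using that by (simp add: K_def transpose_def)
    consider "i \<notin> K" "j \<notin> K" | "i \<notin> K" "j = k" | "i \<notin> K" "j = l" | "i = k" "j \<notin> K" | "i = l" "j \<notin> K" | "i \<in> K" "j \<in> K"
      using K by blast
    then show ?thesis
    proof cases
      case 1 then show ?thesis using both tK by simp
    next
      case 2 then show ?thesis using out(1)[of i] tK[of i] by simp
    next
      case 3 then show ?thesis using out(2)[of i] tK[of i] by simp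
    next
      case 4 then show ?thesis using out'(1)[of j] tK[of j] by simp
    next
      case 5 then show ?thesis using out'(2)[of j] tK[of j] by simp
    next
      case 6
      then have "(i = k \<or> i = l) \<and> (j = k \<or> j = l)" by (simp add: K_def)
      then show ?thesis using kl b by (elim conjE disjE) simp_all
    qed
  qed
  have "s5 = prm (transpose k l) s" using fst snd by (simp add: prod_eq_iff fun_eq_iff)
  then show ?thesis by (simp add: s)
qed

lemma pentagon:
  assumes g: "good s" and k: "k \<in> I" "l \<in> I" "k \<noteq> l" and b: "\<bar>\<sigma>\<bar> = 1" "snd s k l = \<sigma>" "snd s l k = - \<sigma>"
  shows "mutw [k, l, k, l, k] s = prm (transpose k l) s"
proof (cases "\<sigma> = 1")
  case True
  then show ?thesis using pentagon_pos[OF g k] b by simp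
next
  case False
  then have "\<sigma> = - 1" using b(1) by auto
  then have "mutw [k, l, k, l, k] (neg s) = prm (transpose k l) (neg s)"
    using pentagon_pos[OF good_neg[OF g] k] b by (simp add: neg_def)
  then have "neg (mutw [k, l, k, l, k] s) = neg (prm (transpose k l) s)"
    unfolding mutw_neg by (simp add: neg_def prm_def)
  then show ?thesis by (metis neg_neg)
qed

lemma hexagon_pos:
  assumes g: "good s" and k: "k \<in> I" "l \<in> I" "k \<noteq> l" and b: "snd s k l = u" "snd s l k = - v" and uv: "u = 2 \<and> v = 1 \<or> u = 1 \<and> v = 2"
  shows "mutw [k, l, k, l, k, l] s = s"
proof -
  define K where "K = {k, l}"
  have K: "K = {k, l}" "K = {l, k}" by (auto simp: K_def)
  have uv0: "0 \<le> u" "0 \<le> v" using uv by auto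
  define s1 s2 s3 s4 s5 s6 where s: "s1 = mut k s" "s2 = mut l s1" "s3 = mut k s2" "s4 = mut l s3" "s5 = mut k s4" "s6 = mut l s5"
  note r1 = mut_rank2[where u = u and v = v, OF g k K(1) b uv0, folded s]
  note r2 = mut_rank2[where u = v and v = u, OF r1(6) k(2,1) k(3)[symmetric] K(2) r1(4,5) uv0(2,1), folded s]
  note r3 = mut_rank2[where u = u and v = v, OF r2(6) k K(1) r2(4,5) uv0, folded s]
  note r4 = mut_rank2[where u = v and v = u, OF r3(6) k(2,1) k(3)[symmetric] K(2) r3(4,5) uv0(2,1), folded s]
  note r5 = mut_rank2[where u = u and v = v, OF r4(6) k K(1) r4(4,5) uv0, folded s]
  note r6 = mut_rank2[where u = v and v = u, OF r5(6) k(2,1) k(3)[symmetric] K(2) r5(4,5) uv0(2,1), folded s]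
  define p q where pq: "p = (\<lambda>i. snd s i k)" "q = (\<lambda>i. snd s i l)"
  define q1 p2 q3 p4 q5 where seq: "q1 = (\<lambda>i. snd s1 i l)" "p2 = (\<lambda>i. snd s2 i k)" "q3 = (\<lambda>i. snd s3 i l)" "p4 = (\<lambda>i. snd s4 i k)" "q5 = (\<lambda>i. snd s5 i l)"
  have rec: "q1 i = q i + u * max (p i) 0" "p2 i = - p i + v * max (q1 i) 0" "q3 i = - q1 i + u * max (p2 i) 0" "p4 i = - p2 i + v * max (q3 i) 0"
     "q5 i = - q3 i + u * max (p4 i) 0"
    if "i \<notin> K" for i
    unfolding pq seq
    by (fact r1(9)[OF that] r2(9)[OF that, unfolded r1(8)[OF that]] r3(9)[OF that, unfolded r2(8)[OF that]]
      r4(9)[OF that, unfolded r3(8)[OF that]] r5(9)[OF that, unfolded r4(8)[OF that]])+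
  \<comment> \<open>For rows the two entries \<open>u\<close> and \<open>v\<close> change roles:
    where the columns follow the B2 recursion, the rows follow the C2 recursion, and
    conversely.\<close>
  define t r where tr: "t = (\<lambda>j. - snd s l j)" "r = (\<lambda>j. - snd s k j)"
  define t1 r2' t3 r4' t5 where seq': "t1 = (\<lambda>j. - snd s1 l j)" "r2' = (\<lambda>j. - snd s2 k j)" "t3 = (\<lambda>j. - snd s3 l j)" "r4' = (\<lambda>j. - snd s4 k j)" "t5 = (\<lambda>j. - snd s5 l j)"
  have rec': "t1 j = t j + v * max (r j) 0" "r2' j = - r j + u * max (t1 j) 0" "t3 j = - t1 j + v * max (r2' j) 0" "r4' j = - r2' j + u * max (t3 j) 0"
      "t5 j = - t3 j + v * max (r4' j) 0"
    if "j \<notin> K" for j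
  proof -
    show "t1 j = t j + v * max (r j) 0" unfolding tr seq' r1(11)[OF that] by simp
    show "r2' j = - r j + u * max (t1 j) 0" unfolding tr seq' r2(11)[OF that] r1(10)[OF that] by simp
    show "t3 j = - t1 j + v * max (r2' j) 0" unfolding tr seq' r3(11)[OF that] r2(10)[OF that] by simp
    show "r4' j = - r2' j + u * max (t3 j) 0" unfolding tr seq' r4(11)[OF that] r3(10)[OF that] by simp
    show "t5 j = - t3 j + v * max (r4' j) 0" unfolding tr seq' r5(11)[OF that] r4(10)[OF that] by simp
  qed
  define M where "M = frz K (fst s)"
  define N where "N e = (\<lambda>i::nat. - e i :: int)" for e :: "nat \<Rightarrow> int"
  have y: "fst s1 k * fst s k = M p + M (N p) * fst s l ^ nat v" "fst s2 l * fst s l = M q1 + M (N q1) * fst s1 k ^ nat u"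
    "fst s3 k * fst s1 k = M p2 + M (N p2) * fst s2 l ^ nat v" "fst s4 l * fst s2 l = M q3 + M (N q3) * fst s3 k ^ nat u"
    "fst s5 k * fst s3 k = M p4 + M (N p4) * fst s4 l ^ nat v" "fst s6 l * fst s4 l = M q5 + M (N q5) * fst s5 k ^ nat u"
    using r1(1) r2(1) r3(1) r4(1) r5(1) r6(1)
    unfolding N_def M_def seq pq r1(3) r2(3) r3(3) r4(3) r5(3) r6(3) r1(2) r2(2) r3(2) r4(2) r5(2) r6(2) by simp_all
  have e: "snd s k j = - r j" "snd s1 l j = - t1 j" "snd s2 k j = - r2' j" "snd s3 l j = - t3 j" "snd s4 k j = - r4' j" "snd s5 l j = - t5 j"
    "snd s i k = p i" "snd s1 i l = q1 i" "snd s2 i k = p2 i" "snd s3 i l = q3 i" "snd s4 i k = p4 i" "snd s5 i l = q5 i" for i j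
    by (simp_all add: tr seq' pq seq)
  have bz: "fst s l \<noteq> 0" using goodD(2)[OF g k(2)] .
  have main: "fst s5 k = fst s k \<and> fst s6 l = fst s l \<and>
     (\<forall>i. i \<notin> K \<longrightarrow> - p4 i + v * max (q5 i) 0 = p i \<and> - q5 i = q i \<and> - r4' i + u * max (t5 i) 0 = r i \<and> - t5 i = t i) \<and>
     (\<forall>i j. i \<notin> K \<longrightarrow> j \<notin> K \<longrightarrow> snd s6 i j = snd s i j)"
    using uv
  proof (elim disjE conjE)
    assume uv: "u = 2" "v = 1"
    note rc = rec[unfolded uv mult_1] and rc' = rec'[unfolded uv mult_1]
    have "nat u = 2" "nat v = 1" using uv by auto
    note yy = y[unfolded this power_one_right]
    have ex: "max (N p4 i) 0 + max (N q5 i) 0 + max (N p i) 0 = max (p2 i) 0" if "i \<notin> K" for i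
      using exponents_B2(1)[OF rc] that by (simp add: N_def)
    have c: "M (N p4) * M (N q5) * M (N p) = M p2" "M (N p4) * M (N q5) * M p = M (N p2) * M q1" "M (N p4) * M q5 = M (N p2) * M (N q1) * M p" "M (N p2) * M (N q1) * M (N p) = M p4" "M (N q3) * (M (N p2))^2 * M (N q1) = M q5" "M (N q3) * (M (N p2))^2 * M q1 = M (N q5) * (M p)^2" "M (N q5) * (M (N p))^2 * M (N q1) = M q3" "M (N q3) * M p2 * M (N p2) = M (N q5) * M p * M (N p)" "M (N q3) * (M p2)^2 = M (N q5) * (M (N p))^2 * M q1"
    proof -
      show "M (N p4) * M (N q5) * M (N p) = M p2"
        using frz_eq[of K "[N p4, N q5, N p]" "[p2]" "fst s"] exponents_B2(1)[OF rc] by (simp add: M_def N_def power2_eq_square mult.assoc add.assoc)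
      show "M (N p4) * M (N q5) * M p = M (N p2) * M q1"
        using frz_eq[of K "[N p4, N q5, p]" "[N p2, q1]" "fst s"] exponents_B2(2)[OF rc] by (simp add: M_def N_def power2_eq_square mult.assoc add.assoc)
      show "M (N p4) * M q5 = M (N p2) * M (N q1) * M p"
        using frz_eq[of K "[N p4, q5]" "[N p2, N q1, p]" "fst s"] exponents_B2(3)[OF rc] by (simp add: M_def N_def power2_eq_square mult.assoc add.assoc)
      show "M (N p2) * M (N q1) * M (N p) = M p4"
        using frz_eq[of K "[N p2, N q1, N p]" "[p4]" "fst s"] exponents_B2(4)[OF rc] by (simp add: M_def N_def power2_eq_square mult.assoc add.assoc)
      show "M (N q3) * (M (N p2))^2 * M (N q1) = M q5"
        using frz_eq[of K "[N q3, N p2, N p2, N q1]" "[q5]" "fst s"] exponents_B2(5)[OF rc] by (simp add: M_def N_def power2_eq_square mult.assoc add.assoc)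
      show "M (N q3) * (M (N p2))^2 * M q1 = M (N q5) * (M p)^2"
        using frz_eq[of K "[N q3, N p2, N p2, q1]" "[N q5, p, p]" "fst s"] exponents_B2(6)[OF rc] by (simp add: M_def N_def power2_eq_square mult.assoc add.assoc)
      show "M (N q5) * (M (N p))^2 * M (N q1) = M q3"
        using frz_eq[of K "[N q5, N p, N p, N q1]" "[q3]" "fst s"] exponents_B2(7)[OF rc] by (simp add: M_def N_def power2_eq_square mult.assoc add.assoc)
      show "M (N q3) * M p2 * M (N p2) = M (N q5) * M p * M (N p)"
        using frz_eq[of K "[N q3, p2, N p2]" "[N q5, p, N p]" "fst s"] exponents_B2(8)[OF rc] by (simp add: M_def N_def power2_eq_square mult.assoc add.assoc)
      show "M (N q3) * (M p2)^2 = M (N q5) * (M (N p))^2 * M q1"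
        using frz_eq[of K "[N q3, p2, p2]" "[N q5, N p, N p, q1]" "fst s"] exponents_B2(9)[OF rc] by (simp add: M_def N_def power2_eq_square mult.assoc add.assoc)
    qed
    have x: "fst s5 k = fst s k" "fst s6 l = fst s l"
      using hexagon_field1[OF yy r1(7) r2(7) r3(7) r4(7) bz c] by blast+
    have both: "snd s6 i j = snd s i j" if ij: "i \<notin> K" "j \<notin> K" for i j
      using cocycle_B2[OF rc[OF ij(1)] rc'[OF ij(2)] regions_B2[OF rc[OF ij(1)]] regions_C2[OF rc'[OF ij(2)]]]
      unfolding r6(12)[OF ij] r5(12)[OF ij] r4(12)[OF ij] r3(12)[OF ij] r2(12)[OF ij] r1(12)[OF ij] e
      by (simp add: algebra_simps)
    show ?thesis
      using x both exponents_B2(10,11)[OF rc] exponents_C2(10,11)[OF rc'] unfolding uv mult_1 by blast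
  next
    assume uv: "u = 1" "v = 2"
    note rc = rec[unfolded uv mult_1] and rc' = rec'[unfolded uv mult_1]
    have "nat u = 1" "nat v = 2" using uv by auto
    note yy = y[unfolded this power_one_right]
    have c: "M (N q3) * M (N p2) * M (N q1) = M q5" "M (N q3) * M (N p2) * M q1 = M (N q5) * M p" "M (N q3) * M p2 = M (N q5) * M (N p) * M q1" "M (N q5) * M (N p) * M (N q1) = M q3" "M (N p4) * (M (N q5))^2 * M (N p) = M p2" "M (N p4) * (M (N q5))^2 * M p = M (N p2) * (M q1)^2" "M (N p4) * M q5 * M (N q5) = M (N p2) * M q1 * M (N q1)" "M (N p4) * (M q5)^2 = M (N p2) * (M (N q1))^2 * M p" "M (N p2) * (M (N q1))^2 * M (N p) = M p4"
    proof -
      show "M (N q3) * M (N p2) * M (N q1) = M q5"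
        using frz_eq[of K "[N q3, N p2, N q1]" "[q5]" "fst s"] exponents_C2(1)[OF rc] by (simp add: M_def N_def power2_eq_square mult.assoc add.assoc)
      show "M (N q3) * M (N p2) * M q1 = M (N q5) * M p"
        using frz_eq[of K "[N q3, N p2, q1]" "[N q5, p]" "fst s"] exponents_C2(2)[OF rc] by (simp add: M_def N_def power2_eq_square mult.assoc add.assoc)
      show "M (N q3) * M p2 = M (N q5) * M (N p) * M q1"
        using frz_eq[of K "[N q3, p2]" "[N q5, N p, q1]" "fst s"] exponents_C2(3)[OF rc] by (simp add: M_def N_def power2_eq_square mult.assoc add.assoc)
      show "M (N q5) * M (N p) * M (N q1) = M q3"
        using frz_eq[of K "[N q5, N p, N q1]" "[q3]" "fst s"] exponents_C2(4)[OF rc] by (simp add: M_def N_def power2_eq_square mult.assoc add.assoc)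
      show "M (N p4) * (M (N q5))^2 * M (N p) = M p2"
        using frz_eq[of K "[N p4, N q5, N q5, N p]" "[p2]" "fst s"] exponents_C2(5)[OF rc] by (simp add: M_def N_def power2_eq_square mult.assoc add.assoc)
      show "M (N p4) * (M (N q5))^2 * M p = M (N p2) * (M q1)^2"
        using frz_eq[of K "[N p4, N q5, N q5, p]" "[N p2, q1, q1]" "fst s"] exponents_C2(6)[OF rc] by (simp add: M_def N_def power2_eq_square mult.assoc add.assoc)
      show "M (N p4) * M q5 * M (N q5) = M (N p2) * M q1 * M (N q1)"
        using frz_eq[of K "[N p4, q5, N q5]" "[N p2, q1, N q1]" "fst s"] exponents_C2(7)[OF rc] by (simp add: M_def N_def power2_eq_square mult.assoc add.assoc)
      show "M (N p4) * (M q5)^2 = M (N p2) * (M (N q1))^2 * M p"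
        using frz_eq[of K "[N p4, q5, q5]" "[N p2, N q1, N q1, p]" "fst s"] exponents_C2(8)[OF rc] by (simp add: M_def N_def power2_eq_square mult.assoc add.assoc)
      show "M (N p2) * (M (N q1))^2 * M (N p) = M p4"
        using frz_eq[of K "[N p2, N q1, N q1, N p]" "[p4]" "fst s"] exponents_C2(9)[OF rc] by (simp add: M_def N_def power2_eq_square mult.assoc add.assoc)
    qed
    have x: "fst s5 k = fst s k" "fst s6 l = fst s l"
      using hexagon_field2[OF yy r1(7) r2(7) r3(7) r4(7) bz c] by blast+
    have both: "snd s6 i j = snd s i j" if ij: "i \<notin> K" "j \<notin> K" for i j
      using cocycle_C2[OF rc[OF ij(1)] rc'[OF ij(2)] regions_C2[OF rc[OF ij(1)]] regions_B2[OF rc'[OF ij(2)]]]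
      unfolding r6(12)[OF ij] r5(12)[OF ij] r4(12)[OF ij] r3(12)[OF ij] r2(12)[OF ij] r1(12)[OF ij] e
      by (simp add: algebra_simps)
    show ?thesis
      using x both exponents_C2(10,11)[OF rc] exponents_B2(10,11)[OF rc'] unfolding uv mult_1 by blast
  qed
  have fst: "fst s6 i = fst s i" for i
    using main r6(2) k(3) by (cases "i = k"; cases "i = l") (auto simp: s)
  have snd: "snd s6 i j = snd s i j" for i j
  proof -
    have kl: "snd s6 k l = u" "snd s6 l k = - v" "snd s6 k k = 0" "snd s6 l l = 0" "snd s k k = 0" "snd s l l = 0"
      using r6(4,5) goodD(3)[OF r6(6)] goodD(3)[OF g] by auto
    have out: "snd s6 i k = snd s i k" "snd s6 i l = snd s i l" if "i \<notin> K" for i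
      using r6(8,9)[OF that] r5(8)[OF that] main that by (simp_all add: pq seq)
    have out': "snd s6 k j = snd s k j" "snd s6 l j = snd s l j" if "j \<notin> K" for j
    proof -
      have m: "- r4' j + u * max (t5 j) 0 = r j" "- t5 j = t j" using main that by blast+
      show "snd s6 l j = snd s l j" using r6(10)[OF that] m(2) by (simp add: tr seq')
      show "snd s6 k j = snd s k j" using r6(11)[OF that] r5(10)[OF that] m(1) unfolding tr seq' by linarith
    qed
    consider "i \<notin> K" "j \<notin> K" | "i \<notin> K" "j = k" | "i \<notin> K" "j = l" | "i = k" "j \<notin> K" | "i = l" "j \<notin> K" | "i \<in> K" "j \<in> K"
      using K by blast
    then show ?thesis
    proof cases
      case 1 then show ?thesis using main by blast
    next
      case 2 then show ?thesis using out(1)[of i] by simp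
    next
      case 3 then show ?thesis using out(2)[of i] by simp
    next
      case 4 then show ?thesis using out'(1)[of j] by simp
    next
      case 5 then show ?thesis using out'(2)[of j] by simp
    next
      case 6
      then have "(i = k \<or> i = l) \<and> (j = k \<or> j = l)" by (simp add: K_def)
      then show ?thesis using kl b by (elim conjE disjE) simp_all
    qed
  qed
  have "s6 = s" using fst snd by (simp add: prod_eq_iff fun_eq_iff)
  then show ?thesis by (simp add: s)
qed

lemma hexagon:
  assumes g: "good s" and k: "k \<in> I" "l \<in> I" "k \<noteq> l" and b: "\<bar>\<sigma>\<bar> = 1" "snd s k l = \<sigma> * u" "snd s l k = - (\<sigma> * v)"
    and uv: "u = 2 \<and> v = 1 \<or> u = 1 \<and> v = 2"
  shows "mutw [k, l, k, l, k, l] s = s"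
proof (cases "\<sigma> = 1")
  case True
  then show ?thesis using hexagon_pos[OF g k _ _ uv] b by simp
next
  case False
  then have "\<sigma> = - 1" using b(1) by auto
  then have "mutw [k, l, k, l, k, l] (neg s) = neg s"
    using hexagon_pos[OF good_neg[OF g] k _ _ uv] b by (simp add: neg_def)
  then show ?thesis unfolding mutw_neg by (metis neg_neg)
qed

lemma octagon:
  assumes g: "good s" and k: "k \<noteq> l" "I = {k, l}" and b: "\<bar>\<sigma>\<bar> = 1" "snd s k l = \<sigma> * u" "snd s l k = - (\<sigma> * v)"
    and uv: "u = 3 \<and> v = 1 \<or> u = 1 \<and> v = 3"
  shows "mutw [k, l, k, l, k, l, k, l] s = s"
proof -
  have pos: "mutw [k, l, k, l, k, l, k, l] s = s" if g: "good s" and b: "snd s k l = u" "snd s l k = - v" for s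
  proof -
    have kI: "k \<in> I" "l \<in> I" using k by auto
    have K: "I = {l, k}" using k by auto
    have uv0: "0 \<le> u" "0 \<le> v" using uv by auto
    define s1 s2 s3 s4 s5 s6 s7 s8 where s: "s1 = mut k s" "s2 = mut l s1" "s3 = mut k s2" "s4 = mut l s3" "s5 = mut k s4" "s6 = mut l s5" "s7 = mut k s6" "s8 = mut l s7"
    note r1 = mut_rank2[where u = u and v = v, OF g kI k b uv0, folded s]
    note r2 = mut_rank2[where u = v and v = u, OF r1(6) kI(2,1) k(1)[symmetric] K r1(4,5) uv0(2,1), folded s]
    note r3 = mut_rank2[where u = u and v = v, OF r2(6) kI k r2(4,5) uv0, folded s]
    note r4 = mut_rank2[where u = v and v = u, OF r3(6) kI(2,1) k(1)[symmetric] K r3(4,5) uv0(2,1), folded s]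
    note r5 = mut_rank2[where u = u and v = v, OF r4(6) kI k r4(4,5) uv0, folded s]
    note r6 = mut_rank2[where u = v and v = u, OF r5(6) kI(2,1) k(1)[symmetric] K r5(4,5) uv0(2,1), folded s]
    note r7 = mut_rank2[where u = u and v = v, OF r6(6) kI k r6(4,5) uv0, folded s]
    note r8 = mut_rank2[where u = v and v = u, OF r7(6) kI(2,1) k(1)[symmetric] K r7(4,5) uv0(2,1), folded s]
    \<comment> \<open>\<open>I\<close> has no node besides \<open>k\<close> and \<open>l\<close>, so
      the coefficients are empty products.\<close>
    have f: "frz I x e = 1" for x e by (simp add: frz_def)
    have y: "fst s1 k * fst s k = 1 + fst s l ^ nat v" "fst s2 l * fst s l = 1 + fst s1 k ^ nat u"
      "fst s3 k * fst s1 k = 1 + fst s2 l ^ nat v" "fst s4 l * fst s2 l = 1 + fst s3 k ^ nat u"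
      "fst s5 k * fst s3 k = 1 + fst s4 l ^ nat v" "fst s6 l * fst s4 l = 1 + fst s5 k ^ nat u"
      "fst s7 k * fst s5 k = 1 + fst s6 l ^ nat v" "fst s8 l * fst s6 l = 1 + fst s7 k ^ nat u"
      using r1(1) r2(1) r3(1) r4(1) r5(1) r6(1) r7(1) r8(1) unfolding f r1(2) r2(2) r3(2) r4(2) r5(2) r6(2) r7(2) r8(2) by simp_all
    have nz: "fst s k \<noteq> 0" "fst s l \<noteq> 0" using goodD(2)[OF g] kI by blast+
    have x: "fst s7 k = fst s k \<and> fst s8 l = fst s l"
      using uv
    proof (elim disjE conjE)
      assume "u = 3" "v = 1"
      then have n: "nat u = 3" "nat v = 1" by auto
      show ?thesis using octagon_field2[OF y[unfolded n power_one_right] nz r1(7) r2(7) r3(7) r4(7) r5(7) r6(7)] by blast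
    next
      assume "u = 1" "v = 3"
      then have n: "nat u = 1" "nat v = 3" by auto
      show ?thesis using octagon_field1[OF y[unfolded n power_one_right] nz r1(7) r2(7) r3(7) r4(7) r5(7) r6(7)] by blast
    qed
    have "fst s8 i = fst s i" for i
      using x r8(2) k(1) by (cases "i = k"; cases "i = l") (auto simp: s)
    moreover have "snd s8 i j = snd s i j" for i j
      using r8(4,5) b goodD(3)[OF r8(6)] goodD(3)[OF g] goodD(6,7)[OF r8(6)] goodD(6,7)[OF g] k
      by (cases "i \<in> I"; cases "j \<in> I") auto
    ultimately have "s8 = s" by (simp add: prod_eq_iff fun_eq_iff)
    then show ?thesis by (simp add: s)
  qed
  show ?thesis
  proof (cases "\<sigma> = 1")
    case True
    then show ?thesis using pos[OF g] b by simp
  next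
    case False
    then have "\<sigma> = - 1" using b(1) by auto
    then have "mutw [k, l, k, l, k, l, k, l] (neg s) = neg s"
      using pos[OF good_neg[OF g]] b by (simp add: neg_def)
    then show ?thesis unfolding mutw_neg by (metis neg_neg)
  qed
qed

end

context dynkin_seeds
begin

lemma pair_belt:
  assumes "A k l \<noteq> 0"
  shows "belt {k, l} (col k) s 5 = mutw [k, l, k, l, k] s"
    and "belt {k, l} (col k) s 6 = mutw [k, l, k, l, k, l] s"
    and "belt {k, l} (col k) s 8 = mutw [k, l, k, l, k, l, k, l] s"
proof -
  have odd: "odd (col l + col k)" using A_col[OF assms] by simp
  have mutl: "mutl {k, l} (col k + int r) s = (if even r then mut k s else mut l s)" for r s
  proof -
    have "{j \<in> {k, l}. even (col j + (col k + int r))} = (if even r then {k} else {l})"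
      using odd by auto
    then show ?thesis by (auto simp: mutl_def layer_def)
  qed
  have "fwd {k, l} (col k) r s = mutw (map (\<lambda>n. if even n then k else l) [0..<r]) s" for r
    by (induction r) (simp_all add: mutl)
  then show "belt {k, l} (col k) s 5 = mutw [k, l, k, l, k] s" "belt {k, l} (col k) s 6 = mutw [k, l, k, l, k, l] s"
    "belt {k, l} (col k) s 8 = mutw [k, l, k, l, k, l, k, l] s"
    unfolding belt_def by (simp_all add: upt_rec)
qed

lemma bip_pair:
  assumes "bip {k, l} s" "A k l \<noteq> 0"
  shows "\<exists>\<sigma>. \<bar>\<sigma>\<bar> = 1 \<and> snd s k l = \<sigma> * A k l \<and> snd s l k = - (\<sigma> * A l k)"
proof -
  obtain \<sigma> where \<sigma>: "\<bar>\<sigma>\<bar> = 1" "oriented {k, l} \<sigma> (hb (col k)) s" using bip_oriented[OF assms(1)] by blast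
  have "hb (col k) k = 0" "hb (col k) l = 1" using A_col[OF assms(2)] by (auto simp: hb_def)
  then show ?thesis using \<sigma> by (intro exI[of _ \<sigma>]) (simp add: oriented_def)
qed

lemma per_A2:
  assumes "k \<in> I" "l \<in> I" "A k l = 1" "A l k = 1"
  shows "per {k, l} 5 (transpose k l) k"
proof -
  have kl: "k \<noteq> l" "A k l \<noteq> 0" using assms by auto
  have main: "belt {k, l} (col k) s 5 = prm (transpose k l) s" if s: "good s" "bip {k, l} s" for s
  proof -
    obtain \<sigma> where "\<bar>\<sigma>\<bar> = 1" "snd s k l = \<sigma>" "snd s l k = - \<sigma>" using bip_pair[OF s(2) kl(2)] assms by auto
    then show ?thesis using pentagon[OF s(1) assms(1,2) kl(1)] pair_belt(1)[OF kl(2)] by simp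
  qed
  have "transpose k l permutes {k, l}" by (rule permutes_swap_id) auto
  then show ?thesis
    unfolding per_def using main A_col[OF kl(2)] by (auto simp: X_def intro: reach.prm reach.refl)
qed

lemma per_B2:
  assumes "k \<in> I" "l \<in> I" "A k l = 2 \<and> A l k = 1 \<or> A k l = 1 \<and> A l k = 2"
  shows "per {k, l} 6 id k"
proof -
  have kl: "k \<noteq> l" "A k l \<noteq> 0" using assms by auto
  have main: "belt {k, l} (col k) s 6 = s" if s: "good s" "bip {k, l} s" for s
  proof -
    obtain \<sigma> where "\<bar>\<sigma>\<bar> = 1" "snd s k l = \<sigma> * A k l" "snd s l k = - (\<sigma> * A l k)" using bip_pair[OF s(2) kl(2)] by auto
    then show ?thesis using hexagon[OF s(1) assms(1,2) kl(1), of \<sigma> "A k l" "A l k"] assms(3) pair_belt(2)[OF kl(2)] by simp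
  qed
  show ?thesis unfolding per_def using main by (auto simp: X_def intro: reach.refl)
qed

lemma per_G2:
  assumes "I = {k, l}" "A k l = 3 \<and> A l k = 1 \<or> A k l = 1 \<and> A l k = 3"
  shows "per {k, l} 8 id k"
proof -
  have kl: "k \<noteq> l" "A k l \<noteq> 0" using assms by auto
  have main: "belt {k, l} (col k) s 8 = s" if s: "good s" "bip {k, l} s" for s
  proof -
    obtain \<sigma> where "\<bar>\<sigma>\<bar> = 1" "snd s k l = \<sigma> * A k l" "snd s l k = - (\<sigma> * A l k)" using bip_pair[OF s(2) kl(2)] by auto
    then show ?thesis using octagon[OF s(1) kl(1) assms(1), of \<sigma> "A k l" "A l k"] assms(2) pair_belt(3)[OF kl(2)] by simp
  qed
  show ?thesis unfolding per_def using main by (auto simp: X_def intro: reach.refl)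
qed

end

section \<open>Cluster complexes, links of vertices and face numbers\<close>

context semifield_seeds
begin

definition complex :: "nat set \<Rightarrow> 'a fseed \<Rightarrow> 'a set set" where
  "complex J s = {f. \<exists>t. reach J {} s t \<and> f \<subseteq> cl J t}"

lemma complex_reach:
  assumes "good s" "J \<subseteq> I" "reach J {} s t"
  shows "complex J t = complex J s"
proof -
  have "reach J {} t s" using reach_sym[OF assms(1,2) _ assms(3)] by blast
  then have "reach J {} t u \<longleftrightarrow> reach J {} s u" for u using assms(3) reach_trans by blast
  then show ?thesis by (simp add: complex_def)
qed

end

context dynkin_seeds
begin

lemma conn_reach:
  assumes "good s" "J \<subseteq> I" "reach J {} s t" "conn J t"
  shows "conn J s"
proof -
  have "reach J {} t s" using reach_sym[OF assms(1,2) _ assms(3)] by blast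
  then have "reach J {} t u \<longleftrightarrow> reach J {} s u" for u using assms(3) reach_trans by blast
  then show ?thesis using assms(4) by (simp add: conn_def)
qed

text \<open>Surjectivity rests on \<open>conn\<close>: a cluster that contains the variable, however
  it was reached, can also be reached with this variable frozen, and hence by mutations of
  \<open>J - {i}\<close> up to relabelling.\<close>

lemma link_bij:
  assumes s: "good s" "J \<subseteq> I" "conn J s" and t: "reach J {} s t" and i: "i \<in> J"
  shows "bij_betw (insert (fst t i)) (complex (J - {i}) t) {f \<in> complex J s. fst t i \<in> f}"
proof (rule bij_betwI[where g = "\<lambda>f. f - {fst t i}"])
  have gt: "good t" using reach_good[OF t s(1,2)] .
  have nin: "fst t i \<notin> f" if f: "f \<in> complex (J - {i}) t" for f
  proof
    assume "fst t i \<in> f"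
    then obtain u where u: "reach (J - {i}) {} t u" "fst t i \<in> cl (J - {i}) u" using f unfolding complex_def by blast
    then show False using cl_sub_neq[OF gt i s(2) u] by simp
  qed
  show "insert (fst t i) \<in> complex (J - {i}) t \<rightarrow> {f \<in> complex J s. fst t i \<in> f}"
  proof
    fix f assume "f \<in> complex (J - {i}) t"
    then obtain u where u: "reach (J - {i}) {} t u" "f \<subseteq> cl (J - {i}) u" by (auto simp: complex_def)
    have "reach J {} t u" using u(1) by (rule reach_mono) auto
    then have "reach J {} s u" using t reach_trans by blast
    moreover have "fst u i = fst t i" using reach_frozen[OF u(1), of i] by simp
    then have "insert (fst t i) f \<subseteq> cl J u" using u(2) i by (metis Diff_subset image_eqI image_mono insert_subset subset_trans)
    ultimately show "insert (fst t i) f \<in> {f \<in> complex J s. fst t i \<in> f}" unfolding complex_def by blast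
  qed
  show "(\<lambda>f. f - {fst t i}) \<in> {f \<in> complex J s. fst t i \<in> f} \<rightarrow> complex (J - {i}) t"
  proof
    fix f assume "f \<in> {f \<in> complex J s. fst t i \<in> f}"
    then obtain u where u: "reach J {} s u" "f \<subseteq> cl J u" "fst t i \<in> f" by (auto simp: complex_def)
    have "fst t i \<in> cl J t" "fst t i \<in> cl J u" using u i by auto
    then have "reach J {fst t i} t u" using s(3) t u(1) unfolding conn_def by blast
    then obtain \<sigma> u' where u': "\<sigma> permutes J" "reach (J - {i}) {} t u'" "u = prm \<sigma> u'"
      using reach_freeze_delete[OF i s(2)] by blast
    have "cl J u = cl J u'" using cl_prm[OF u'(1)] u'(3) by simp
    moreover have "fst u' i = fst t i" using reach_frozen[OF u'(2), of i] by simp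
    ultimately have "f - {fst t i} \<subseteq> cl (J - {i}) u'" using u(2) by auto
    then show "f - {fst t i} \<in> complex (J - {i}) t" using u'(2) unfolding complex_def by blast
  qed
  show "insert (fst t i) f - {fst t i} = f" if "f \<in> complex (J - {i}) t" for f using nin[OF that] by auto
  show "insert (fst t i) (f - {fst t i}) = f" if "f \<in> {f \<in> complex J s. fst t i \<in> f}" for f using that by auto
qed

lemma link_nin:
  assumes s: "good s" "J \<subseteq> I" and t: "reach J {} s t" and i: "i \<in> J" and f: "f \<in> complex (J - {i}) t"
  shows "fst t i \<notin> f"
proof
  have gt: "good t" using reach_good[OF t s(1,2)] .
  assume "fst t i \<in> f"
  then obtain u where u: "reach (J - {i}) {} t u" "fst t i \<in> cl (J - {i}) u" using f unfolding complex_def by blast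
  then show False using cl_sub_neq[OF gt i s(2) u] by simp
qed

lemma complex_finite_face: "J \<subseteq> I \<Longrightarrow> f \<in> complex J s \<Longrightarrow> finite f"
  unfolding complex_def using finite_subset_I by (auto intro: finite_subset)

lemma card_link:
  assumes s: "good s" "J \<subseteq> I" "conn J s" and t: "reach J {} s t" and i: "i \<in> J"
    and R: "\<And>f. f \<in> complex (J - {i}) t \<Longrightarrow> R (insert (fst t i) f) = Q f"
  shows "card {f \<in> complex J s. fst t i \<in> f \<and> R f \<and> card f = Suc m} = card {f \<in> complex (J - {i}) t. Q f \<and> card f = m}"
proof -
  note b = link_bij[OF s t i]
  have c: "card (insert (fst t i) f) = Suc (card f)" if "f \<in> complex (J - {i}) t" for f
  proof -
    have "finite f" using that s(2) by (intro complex_finite_face[of "J - {i}"]) auto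
    then show ?thesis using link_nin[OF s(1,2) t i that] by simp
  qed
  have "bij_betw (insert (fst t i)) {f \<in> complex (J - {i}) t. Q f \<and> card f = m} {f \<in> complex J s. fst t i \<in> f \<and> R f \<and> card f = Suc m}"
    unfolding bij_betw_def
  proof
    show "inj_on (insert (fst t i)) {f \<in> complex (J - {i}) t. Q f \<and> card f = m}"
      using b unfolding bij_betw_def by (auto intro: inj_on_subset)
    show "insert (fst t i) ` {f \<in> complex (J - {i}) t. Q f \<and> card f = m} = {f \<in> complex J s. fst t i \<in> f \<and> R f \<and> card f = Suc m}"
    proof (intro equalityI subsetI)
      fix g assume "g \<in> insert (fst t i) ` {f \<in> complex (J - {i}) t. Q f \<and> card f = m}"
      then obtain f where f: "f \<in> complex (J - {i}) t" "Q f" "card f = m" "g = insert (fst t i) f" by blast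
      then show "g \<in> {f \<in> complex J s. fst t i \<in> f \<and> R f \<and> card f = Suc m}"
        using bij_betwE[OF b] c[OF f(1)] R[OF f(1)] by auto
    next
      fix g assume g: "g \<in> {f \<in> complex J s. fst t i \<in> f \<and> R f \<and> card f = Suc m}"
      then obtain f where f: "f \<in> complex (J - {i}) t" "g = insert (fst t i) f"
        using b unfolding bij_betw_def by blast
      then show "g \<in> insert (fst t i) ` {f \<in> complex (J - {i}) t. Q f \<and> card f = m}"
        using g c[OF f(1)] R[OF f(1)] by auto
    qed
  qed
  then show ?thesis by (rule bij_betw_same_card[symmetric])
qed

lemma face_count_step:
  assumes s: "good s" "bip J s" "J \<subseteq> I" and n: "nice J L" and fin: "finite (L p)"
  shows "Suc m * card {f \<in> complex J s. card f = Suc m} =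
    (\<Sum>l\<in>L p. card {f \<in> complex (J - {fst l}) (belt J p s (snd l)). card f = m})"
proof -
  let ?F = "{f \<in> complex J s. card f = Suc m}" and ?V = "X J p s ` L p"
  have sub: "f \<subseteq> ?V" if "f \<in> complex J s" for f
    using that niceD(2)[OF n s(1,2), of _ p] unfolding complex_def by blast
  have finV: "finite ?V" using fin by simp
  have finF: "finite ?F" using sub finV by (auto intro: finite_subset[of _ "Pow ?V"])
  have "Suc m * card ?F = (\<Sum>f\<in>?F. card f)" by simp
  also have "\<dots> = (\<Sum>f\<in>?F. \<Sum>v\<in>?V. if v \<in> f then 1 else 0)"
  proof (rule sum.cong)
    fix f assume "f \<in> ?F"
    then have "?V \<inter> f = f" using sub by blast
    then show "card f = (\<Sum>v\<in>?V. if v \<in> f then 1 else 0)"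
      using finV by (simp add: sum.If_cases Int_def[symmetric])
  qed simp
  also have "\<dots> = (\<Sum>v\<in>?V. \<Sum>f\<in>?F. if v \<in> f then 1 else 0)" by (rule sum.swap)
  also have "\<dots> = (\<Sum>v\<in>?V. card {f \<in> complex J s. v \<in> f \<and> card f = Suc m})"
  proof (rule sum.cong)
    fix v
    have "?F \<inter> {f. v \<in> f} = {f \<in> complex J s. v \<in> f \<and> card f = Suc m}" by blast
    then show "(\<Sum>f\<in>?F. if v \<in> f then 1 else 0) = card {f \<in> complex J s. v \<in> f \<and> card f = Suc m}"
      using finF by (simp add: sum.If_cases)
  qed simp
  also have "\<dots> = (\<Sum>l\<in>L p. card {f \<in> complex J s. X J p s l \<in> f \<and> card f = Suc m})"
    by (subst sum.reindex[OF niceD(3)[OF n s(1,2)]]) simp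
  also have "\<dots> = (\<Sum>l\<in>L p. card {f \<in> complex (J - {fst l}) (belt J p s (snd l)). card f = m})"
  proof (rule sum.cong)
    fix l assume "l \<in> L p"
    then have "fst l \<in> J" using nice_valid[OF n] by (simp add: valid_def)
    then show "card {f \<in> complex J s. X J p s l \<in> f \<and> card f = Suc m} =
      card {f \<in> complex (J - {fst l}) (belt J p s (snd l)). card f = m}"
      using card_link[where R = "\<lambda>_. True" and Q = "\<lambda>_. True", OF s(1,3) niceD(1)[OF n s(1,2)] reach_belt[OF s(3)]]
      by (simp add: X_def)
  qed simp
  finally show ?thesis .
qed

text \<open>Passing to a link lowers the size of the faces by one, so the recursion determines
  everything from the empty face. The result depends on \<open>J\<close> alone, although the links
  are taken at different seeds of the belt.\<close>

theorem face_count: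
  assumes D: "D \<subseteq> I" and n: "\<And>J. J \<subseteq> D \<Longrightarrow> nice J (L J)" and fin: "\<And>J. J \<subseteq> D \<Longrightarrow> finite (L J 0)"
    and cf0: "\<And>J. J \<subseteq> D \<Longrightarrow> cf J 0 = 1"
    and cf: "\<And>J m. J \<subseteq> D \<Longrightarrow> Suc m * cf J (Suc m) = (\<Sum>l\<in>L J 0. cf (J - {fst l}) m)"
    and "J \<subseteq> D" "good s" "bip J s"
  shows "card {f \<in> complex J s. card f = m} = cf J m"
  using assms(6-8)
proof (induction m arbitrary: J s)
  case 0
  have "{f \<in> complex J s. card f = 0} = {{}}"
  proof (intro equalityI subsetI)
    fix f assume f: "f \<in> {f \<in> complex J s. card f = 0}"
    then have "finite f" using complex_finite_face[of J f s] 0 D by auto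
    then show "f \<in> {{}}" using f by simp
  next
    fix f :: "'a set" assume "f \<in> {{}}"
    moreover have "{} \<in> complex J s" using reach.refl[of J "{}" s] unfolding complex_def by blast
    ultimately show "f \<in> {f \<in> complex J s. card f = 0}" by simp
  qed
  then show ?case using cf0[OF 0(1)] by simp
next
  case (Suc m)
  have JI: "J \<subseteq> I" using Suc.prems D by blast
  have "Suc m * card {f \<in> complex J s. card f = Suc m} =
    (\<Sum>l\<in>L J 0. card {f \<in> complex (J - {fst l}) (belt J 0 s (snd l)). card f = m})"
    using face_count_step[OF Suc.prems(2,3) JI n[OF Suc.prems(1)] fin[OF Suc.prems(1)]] .
  also have "\<dots> = (\<Sum>l\<in>L J 0. cf (J - {fst l}) m)"
  proof (rule sum.cong)
    fix l
    have "bip (J - {fst l}) (belt J 0 s (snd l))" using bip_belt[OF Suc.prems(3) JI] bip_mono by blast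
    then show "card {f \<in> complex (J - {fst l}) (belt J 0 s (snd l)). card f = m} = cf (J - {fst l}) m"
      using Suc.prems good_belt[OF _ JI] by (intro Suc.IH) auto
  qed simp
  also have "\<dots> = Suc m * cf J (Suc m)" using cf[OF Suc.prems(1)] by simp
  finally show ?case by (simp only: Suc_mult_cancel1)
qed

subsection \<open>Orientations of forests\<close>

text \<open>A common sign \<open>e\<close> for both entries of a pair fixes the valued graph and
  leaves the direction of each edge free.\<close>

definition forest_oriented :: "nat set \<Rightarrow> 'a fseed \<Rightarrow> bool" where
  "forest_oriented J s \<longleftrightarrow> (\<forall>i\<in>J. \<forall>j\<in>J. \<exists>e. \<bar>e\<bar> = 1 \<and> snd s i j = e * A i j \<and> snd s j i = - (e * A j i))"

text \<open>Every node has at most one neighbour further down the list, so building the graph from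
  the end attaches each node by at most one edge.\<close>

primrec forest :: "nat list \<Rightarrow> bool" where
  "forest [] = True"
| "forest (k # ks) = (forest ks \<and> k \<notin> set ks \<and> (\<forall>i\<in>set ks. \<forall>j\<in>set ks. A k i \<noteq> 0 \<longrightarrow> A k j \<noteq> 0 \<longrightarrow> i = j))"

lemma forest_filter: "forest ks \<Longrightarrow> forest (filter Q ks)"
  by (induction ks) auto

text \<open>Heights are assigned from the end of the list. At most one edge constrains a new node,
  so no conflict can arise; a cycle might admit no heights. Tying the parity of the heights to
  \<open>col\<close> later turns a two-level orientation into the bipartite one.\<close>

lemma forest_height:
  "forest ks \<Longrightarrow> forest_oriented (set ks) s \<Longrightarrow>
    \<exists>h. (\<forall>k. even (h k + col k)) \<and> oriented (set ks) 1 h s \<and> (\<forall>i\<in>set ks. \<forall>j\<in>set ks. A i j \<noteq> 0 \<longrightarrow> \<bar>h i - h j\<bar> = 1)"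
proof (induction ks)
  case Nil
  show ?case by (intro exI[of _ col]) (simp add: oriented_def)
next
  case (Cons k ks)
  have fo: "\<exists>e. \<bar>e\<bar> = 1 \<and> snd s i j = e * A i j \<and> snd s j i = - (e * A j i)" if "i \<in> set (k # ks)" "j \<in> set (k # ks)" for i j
    using Cons.prems(2) that unfolding forest_oriented_def by blast
  then have "forest_oriented (set ks) s" unfolding forest_oriented_def by auto
  then obtain h where h: "\<forall>k. even (h k + col k)" "oriented (set ks) 1 h s" "\<forall>i\<in>set ks. \<forall>j\<in>set ks. A i j \<noteq> 0 \<longrightarrow> \<bar>h i - h j\<bar> = 1"
    using Cons by auto
  have kn: "k \<notin> set ks" using Cons.prems(1) by simp
  have b: "snd s i j = sgn (h j - h i) * A i j" if "i \<in> set ks" "j \<in> set ks" for i j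
    using h(2) that unfolding oriented_def by simp
  show ?case
  proof (cases "\<exists>j\<in>set ks. A k j \<noteq> 0")
    case False
    then have no: "A k j = 0" "A j k = 0" if "j \<in> set ks" for j using that A_eq_0[of k j] by auto
    have z: "snd s k j = 0" "snd s j k = 0" if "j \<in> set (k # ks)" for j
      using fo[of k j] that no[of j] by (cases "j = k"; auto)+
    have no': "A k j = 0" "A j k = 0" if "j \<in> set (k # ks)" for j using no[of j] that by (cases "j = k"; simp)+
    have "oriented (set (k # ks)) 1 h s"
      unfolding oriented_def
    proof (intro ballI)
      fix a c assume ac: "a \<in> set (k # ks)" "c \<in> set (k # ks)"
      consider "a = k" | "c = k" | "a \<in> set ks" "c \<in> set ks" using ac by auto
      then show "snd s a c = 1 * sgn (h c - h a) * A a c"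
      proof cases
        case 1 then show ?thesis using z(1)[OF ac(2)] no'(1)[OF ac(2)] by simp
      next
        case 2 then show ?thesis using z(2)[OF ac(1)] no'(2)[OF ac(1)] by simp
      next
        case 3 then show ?thesis using b by simp
      qed
    qed
    moreover have "\<bar>h a - h c\<bar> = 1" if ac: "a \<in> set (k # ks)" "c \<in> set (k # ks)" "A a c \<noteq> 0" for a c
    proof -
      have "a \<noteq> k" "c \<noteq> k" using no'(1)[OF ac(2)] no'(2)[OF ac(1)] ac(3) by auto
      then show ?thesis using h(3) ac by simp
    qed
    ultimately show ?thesis using h(1) by blast
  next
    case True
    then obtain j where j: "j \<in> set ks" "A k j \<noteq> 0" by blast
    have uniq: "A k i = 0" "A i k = 0" if "i \<in> set ks" "i \<noteq> j" for i
      using Cons.prems(1) that j A_eq_0[of k i] by auto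
    obtain e where e: "\<bar>e\<bar> = 1" "snd s k j = e * A k j" "snd s j k = - (e * A j k)" using fo[of k j] j by auto
    have e1: "e = 1 \<or> e = - 1" using e(1) by auto
    \<comment> \<open>The new node is placed next to its only neighbour, below it or above it
      according to the direction of the arrow.\<close>
    define h' where "h' = h(k := h j - e)"
    have kk: "snd s k k = 0" using fo[of k k] by auto
    have par: "even (h' m + col m)" for m
    proof (cases "m = k")
      case True
      have "odd (col k + col j)" by (rule A_col[OF j(2)])
      moreover have "even (h j + col j)" using h(1) by blast
      moreover have "odd e" using e1 by auto
      ultimately have "even (h j - e + col k)" by presburger
      then show ?thesis using True by (simp add: h'_def)
    next
      case False
      then show ?thesis using h(1)[rule_format, of m] by (simp add: h'_def)
    qed
    have jk: "A j k \<noteq> 0" using j A_eq_0[of k j] by simp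
    have jn: "j \<noteq> k" using j kn by auto
    have "oriented (set (k # ks)) 1 h' s"
      unfolding oriented_def
    proof (intro ballI)
      fix a c assume ac: "a \<in> set (k # ks)" "c \<in> set (k # ks)"
      consider "a = k" "c = k" | "a = k" "c = j" | "a = k" "c \<in> set ks" "c \<noteq> j" | "a = j" "c = k" | "a \<in> set ks" "a \<noteq> j" "c = k"
        | "a \<in> set ks" "c \<in> set ks" using ac by auto
      then show "snd s a c = 1 * sgn (h' c - h' a) * A a c"
      proof cases
        case 1 then show ?thesis using kk by simp
      next
        case 2 then show ?thesis using e e1 jn by (auto simp: h'_def)
      next
        case 3
        then have "A k c = 0" "A c k = 0" using uniq[of c] by auto
        moreover obtain e' where "snd s k c = e' * A k c" using fo[of k c] 3 by auto
        ultimately show ?thesis using 3 by simp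
      next
        case 4 then show ?thesis using e e1 jn by (auto simp: h'_def)
      next
        case 5
        then have "A k a = 0" "A a k = 0" using uniq[of a] by auto
        moreover obtain e' where "snd s a k = e' * A a k" using fo[of a k] 5 by auto
        ultimately show ?thesis using 5 by simp
      next
        case 6
        then have "a \<noteq> k" "c \<noteq> k" using kn by auto
        then show ?thesis using b[OF 6] by (simp add: h'_def)
      qed
    qed
    moreover have "\<bar>h' a - h' c\<bar> = 1" if ac: "a \<in> set (k # ks)" "c \<in> set (k # ks)" "A a c \<noteq> 0" for a c
    proof -
      consider "a = k" "c = k" | "a = k" "c = j" | "a = k" "c \<in> set ks" "c \<noteq> j" | "a = j" "c = k" | "a \<in> set ks" "a \<noteq> j" "c = k"
        | "a \<in> set ks" "c \<in> set ks" using ac by auto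
      then show ?thesis
      proof cases
        case 1 then show ?thesis using ac by simp
      next
        case 6
        then have "a \<noteq> k" "c \<noteq> k" using kn by auto
        then show ?thesis using h(3) 6 ac(3) by (simp add: h'_def)
      next
        case 2 then show ?thesis using e1 jn by (auto simp: h'_def)
      next
        case 3 then show ?thesis using ac(3) uniq(1)[of c] by simp
      next
        case 4 then show ?thesis using e1 jn by (auto simp: h'_def)
      next
        case 5 then show ?thesis using ac(3) uniq(2)[of a] by simp
      qed
    qed
    ultimately show ?thesis using par by blast
  qed
qed

text \<open>A lowest node is a source whose neighbours lie one above it, and mutating there raises
  it by 2. This is repeated below the bound \<open>M\<close> until only the heights
  \<open>M - 1\<close> and \<open>M\<close> remain; the total distance to \<open>M\<close> decreases
  each time.\<close>

lemma oriented_reach_bip: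
  assumes J: "J \<subseteq> I" "J \<noteq> {}"
  shows "oriented J 1 h s \<Longrightarrow> \<forall>k. even (h k + col k) \<Longrightarrow> (\<forall>i\<in>J. \<forall>j\<in>J. A i j \<noteq> 0 \<longrightarrow> \<bar>h i - h j\<bar> = 1) \<Longrightarrow> (\<forall>k\<in>J. h k \<le> M) \<Longrightarrow>
    \<exists>t. reach J {} s t \<and> bip J t"
proof (induction "nat (\<Sum>k\<in>J. M - h k)" arbitrary: h s rule: less_induct)
  case less
  have fin: "finite J" using J finite_subset_I by blast
  show ?case
  proof (cases "\<forall>k\<in>J. M - 1 \<le> h k")
    case True
    have hv: "h k = M - hb M k" if "k \<in> J" for k
    proof -
      have "h k = M \<or> h k = M - 1" using True less.prems(4) that by force
      moreover have "even (h k + col k)" using less.prems(2) by blast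
      ultimately show ?thesis by (auto simp: hb_def)
    qed
    \<comment> \<open>By parity the nodes with \<open>hb M k = 0\<close> are those on the top level
      \<open>M\<close>. The two levels appear upside down, hence the sign.\<close>
    have "oriented J (- 1) (hb M) s"
      unfolding oriented_def
    proof (intro ballI)
      fix i j assume ij: "i \<in> J" "j \<in> J"
      have "snd s i j = 1 * sgn (h j - h i) * A i j" using less.prems(1) ij unfolding oriented_def by blast
      also have "h j - h i = - (hb M j - hb M i)" using hv ij by simp
      finally have "snd s i j = 1 * sgn (- (hb M j - hb M i)) * A i j" .
      then show "snd s i j = - 1 * sgn (hb M j - hb M i) * A i j" by (simp add: sgn_if)
    qed
    then have "bip J s" using oriented_bip[of "- 1" J M s] by simp
    then show ?thesis using reach.refl[of J "{}" s] by blast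
  next
    case False
    define c where "c = Min (h ` J)"
    have "c \<in> h ` J" unfolding c_def using fin J(2) by (intro Min_in) auto
    then obtain k where k: "k \<in> J" "h k = c" by (metis imageE)
    have min: "c \<le> h j" if "j \<in> J" for j using that fin by (simp add: c_def)
    have lt: "c < M - 1" using False min by force
    have nb: "h j = h k + 1" if "j \<in> J" "A k j \<noteq> 0" for j
      using less.prems(3) k min[OF that(1)] that by force
    define h' where "h' = h(k := h k + 2)"
    have o: "oriented J 1 h' (mut k s)" unfolding h'_def using oriented_mut[OF less.prems(1) k(1) nb] .
    have par: "\<forall>m. even (h' m + col m)"
    proof
      fix m
      show "even (h' m + col m)" using less.prems(2)[rule_format, of m] by (cases "m = k") (simp_all add: h'_def)
    qed
    have adj: "\<forall>i\<in>J. \<forall>j\<in>J. A i j \<noteq> 0 \<longrightarrow> \<bar>h' i - h' j\<bar> = 1"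
    proof (intro ballI impI)
      fix i j assume ij: "i \<in> J" "j \<in> J" "A i j \<noteq> 0"
      have ji: "A j i \<noteq> 0" using ij(3) A_eq_0[of i j] by simp
      have e: "\<bar>h i - h j\<bar> = 1" using less.prems(3) ij by blast
      consider "i = k" "j = k" | "i = k" "j \<noteq> k" | "i \<noteq> k" "j = k" | "i \<noteq> k" "j \<noteq> k" by blast
      then show "\<bar>h' i - h' j\<bar> = 1"
      proof cases
        case 1 then show ?thesis using e by simp
      next
        case 2 then show ?thesis using nb[OF ij(2)] ij(3) by (simp add: h'_def)
      next
        case 3 then show ?thesis using nb[OF ij(1)] ji by (simp add: h'_def)
      next
        case 4 then show ?thesis using e by (simp add: h'_def)
      qed
    qed
    have bound: "\<forall>m\<in>J. h' m \<le> M" using less.prems(4) k lt by (auto simp: h'_def)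
    have "(\<Sum>m\<in>J. M - h' m) = (\<Sum>m\<in>J. M - h m) - 2"
    proof -
      have "(\<Sum>m\<in>J. M - h' m) = (M - h' k) + (\<Sum>m\<in>J - {k}. M - h' m)" by (rule sum.remove[OF fin k(1)])
      also have "(\<Sum>m\<in>J - {k}. M - h' m) = (\<Sum>m\<in>J - {k}. M - h m)" by (rule sum.cong) (auto simp: h'_def)
      finally show ?thesis using sum.remove[OF fin k(1), of "\<lambda>m. M - h m"] by (simp add: h'_def)
    qed
    moreover have "0 \<le> (\<Sum>m\<in>J. M - h' m)" using bound by (intro sum_nonneg) auto
    ultimately have "nat (\<Sum>m\<in>J. M - h' m) < nat (\<Sum>m\<in>J. M - h m)" by simp
    from less.hyps[OF this o par adj bound] obtain t where "reach J {} (mut k s) t" "bip J t" by blast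
    moreover have "reach J {} s (mut k s)" using k by (intro reach.mut reach.refl) auto
    ultimately show ?thesis using reach_trans by blast
  qed
qed

lemma forest_reach_bip:
  assumes "set ks \<subseteq> I" "forest ks" "forest_oriented (set ks) s"
  shows "\<exists>t. reach (set ks) {} s t \<and> bip (set ks) t"
proof (cases "set ks = {}")
  case True
  have "bip {} s" unfolding bip_def by (intro exI[of _ 1]) (simp add: oriented_def)
  then show ?thesis using reach.refl[of "{}" "{}" s] unfolding True by blast
next
  case False
  obtain h where h: "\<forall>k. even (h k + col k)" "oriented (set ks) 1 h s" "\<forall>i\<in>set ks. \<forall>j\<in>set ks. A i j \<noteq> 0 \<longrightarrow> \<bar>h i - h j\<bar> = 1"
    using forest_height[OF assms(2,3)] by blast
  have "\<forall>k\<in>set ks. h k \<le> Max (h ` set ks)" by simp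
  then show ?thesis using oriented_reach_bip[OF assms(1) False h(2,1,3)] by blast
qed

subsection \<open>Faces avoiding the initial cluster\<close>

text \<open>Faces that contain the variable of \<open>k\<close> are faces of its link, so inclusion
  and exclusion proceeds one node at a time. In \<open>card_avoid\<close> the subtracted faces are
  among those counted before, so subtraction of natural numbers is exact.\<close>

fun avoid_count :: "(nat set \<Rightarrow> nat \<Rightarrow> nat) \<Rightarrow> nat list \<Rightarrow> nat set \<Rightarrow> nat \<Rightarrow> nat" where
  "avoid_count cf [] J m = cf J m"
| "avoid_count cf (k # S) J 0 = avoid_count cf S J 0"
| "avoid_count cf (k # S) J (Suc m) = avoid_count cf S J (Suc m) - avoid_count cf S (J - {k}) m"

lemma card_avoid:
  assumes D: "D \<subseteq> I" and s: "good s"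
    and c: "\<And>J. J \<subseteq> D \<Longrightarrow> conn J s" and fin: "\<And>J. J \<subseteq> D \<Longrightarrow> finite (complex J s)"
    and cf: "\<And>J m. J \<subseteq> D \<Longrightarrow> card {f \<in> complex J s. card f = m} = cf J m"
  shows "distinct S \<Longrightarrow> set S \<subseteq> J \<Longrightarrow> J \<subseteq> D \<Longrightarrow>
    card {f \<in> complex J s. f \<inter> fst s ` set S = {} \<and> card f = m} = avoid_count cf S J m"
proof (induction S arbitrary: J m)
  case Nil
  then show ?case using cf by simp
next
  case (Cons k S)
  have JI: "J \<subseteq> I" using Cons.prems D by blast
  have k: "k \<in> J" "k \<notin> set S" "set S \<subseteq> J - {k}" "J - {k} \<subseteq> D" using Cons.prems by auto
  have kS: "fst s k \<notin> fst s ` set S"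
  proof
    assume "fst s k \<in> fst s ` set S"
    then obtain l where "l \<in> set S" "fst s l = fst s k" by auto
    then show False using inj_onD[OF good_inj[OF s], of l k] k JI by auto
  qed
  show ?case
  proof (cases m)
    case 0
    have "{f \<in> complex J s. f \<inter> fst s ` set (k # S) = {} \<and> card f = 0} = {f \<in> complex J s. f \<inter> fst s ` set S = {} \<and> card f = 0}"
      using complex_finite_face[OF JI, of _ s] by fastforce
    then show ?thesis using Cons 0 by simp
  next
    case (Suc m')
    let ?A = "{f \<in> complex J s. f \<inter> fst s ` set (k # S) = {} \<and> card f = m}"
    let ?B = "{f \<in> complex J s. fst s k \<in> f \<and> f \<inter> fst s ` set S = {} \<and> card f = Suc m'}"
    let ?C = "{f \<in> complex J s. f \<inter> fst s ` set S = {} \<and> card f = m}"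
    have "?C = ?A \<union> ?B" using Suc by auto
    moreover have "?A \<inter> ?B = {}" by auto
    ultimately have "card ?C = card ?A + card ?B"
      using fin[OF Cons.prems(3)] by (simp add: card_Un_disjoint)
    moreover have "card ?B = card {f \<in> complex (J - {k}) s. f \<inter> fst s ` set S = {} \<and> card f = m'}"
      by (rule card_link[OF s JI c[OF Cons.prems(3)] reach.refl k(1)]) (use kS in auto)
    moreover have "card ?C = avoid_count cf S J m" using Cons.prems by (intro Cons.IH) auto
    moreover have "card {f \<in> complex (J - {k}) s. f \<inter> fst s ` set S = {} \<and> card f = m'} = avoid_count cf S (J - {k}) m'"
      using Cons.prems k by (intro Cons.IH) auto
    ultimately show ?thesis using Suc by simp
  qed
qed

theorem positive_face_count:
  assumes D: "set ks \<subseteq> I" "forest ks" and n: "\<And>J. J \<subseteq> set ks \<Longrightarrow> nice J (L J)" and fin: "\<And>J. J \<subseteq> set ks \<Longrightarrow> finite (L J 0)"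
    and cf0: "\<And>J. J \<subseteq> set ks \<Longrightarrow> cf J 0 = 1"
    and cf: "\<And>J m. J \<subseteq> set ks \<Longrightarrow> Suc m * cf J (Suc m) = (\<Sum>l\<in>L J 0. cf (J - {fst l}) m)"
    and s: "good s" "forest_oriented (set ks) s"
  shows "card {f \<in> complex (set ks) s. f \<inter> cl (set ks) s = {} \<and> card f = m} = avoid_count cf ks (set ks) m"
proof -
  \<comment> \<open>The initial seed may carry any orientation. Each \<open>J\<close> has its own
    bipartite seed reachable from it, and the complex and its connectedness are invariant along the
    path.\<close>
  have *: "\<exists>t. reach J {} s t \<and> bip J t" if J: "J \<subseteq> set ks" for J
  proof -
    have f: "set (filter (\<lambda>k. k \<in> J) ks) = J" using J by auto
    have "forest_oriented J s" using s(2) J unfolding forest_oriented_def by blast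
    then show ?thesis
      using forest_reach_bip[of "filter (\<lambda>k. k \<in> J) ks" s] forest_filter[OF D(2)] D(1) J unfolding f by blast
  qed
  have main: "conn J s \<and> finite (complex J s) \<and> (\<forall>m. card {f \<in> complex J s. card f = m} = cf J m)" if J: "J \<subseteq> set ks" for J
  proof -
    have JI: "J \<subseteq> I" using J D by blast
    obtain t where t: "reach J {} s t" "bip J t" using *[OF J] by blast
    have g: "good t" using reach_good[OF t(1) s(1) JI] .
    have K: "complex J t = complex J s" using complex_reach[OF s(1) JI t(1)] .
    have "conn J s" using conn_reach[OF s(1) JI t(1) niceD(1)[OF n[OF J] g t(2)]] .
    moreover have "complex J t \<subseteq> Pow (X J 0 t ` L J 0)"
      using niceD(2)[OF n[OF J] g t(2), of _ 0] unfolding complex_def by blast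
    then have "finite (complex J s)" unfolding K using fin[OF J] by (meson finite_Pow_iff finite_imageI finite_subset)
    moreover have "card {f \<in> complex J s. card f = m} = cf J m" for m
      using face_count[OF D(1) n fin cf0 cf J g t(2)] unfolding K by blast
    ultimately show ?thesis by blast
  qed
  have "distinct ks" using D(2) by (induction ks) auto
  then show ?thesis using main by (intro card_avoid[OF D(1) s(1)]) auto
qed

end

subsection \<open>Certificates\<close>

text \<open>A step \<open>(i, e, l, v, j, c, eu, ev, m)\<close> claims that \<open>known D i e l\<close>, with common tropical value \<open>v\<close>. Its evidence
  is a third variable, at node \<open>j\<close> after \<open>c\<close> steps: seen from there, the variables \<open>(i, 0)\<close> and \<open>l\<close> are the
  variables \<open>eu\<close> and \<open>ev\<close> of \<open>D - {j}\<close>, and these are already known to be joined once \<open>ev\<close> is shifted by \<open>m\<close> periods.\<close>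

type_synonym lab = "nat \<times> int"

type_synonym step = "nat \<times> lab \<times> lab \<times> int \<times> nat \<times> int \<times> lab \<times> lab \<times> int"

text \<open>\<open>weight\<close> is a weight vector that is generic enough for the tropical values of the variables of every
  connected subdiagram to be nonzero and distinct. In a table, \<open>hof\<close> and \<open>stof\<close> give the period and the
  involution of the belt; \<open>perof\<close> gives a node \<open>i\<close> and label \<open>e\<close> that match both \<open>(k, c)\<close> and its shift by one
  period, followed by the tropical values at the other nodes. A period of \<open>0\<close> marks a missing entry.\<close>

datatype diagram = Diagram (rank: nat) (colour: "nat \<Rightarrow> int") (neighbours: "nat \<Rightarrow> (nat \<times> int) list")
  (distance: "nat \<Rightarrow> nat \<Rightarrow> nat") (weight: "nat \<Rightarrow> int")

datatype table = Table (hof: "nat list \<Rightarrow> int") (stof: "nat list \<Rightarrow> nat list")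
  (stepsof: "nat list \<Rightarrow> step list") (perof: "nat list \<Rightarrow> nat \<times> lab \<times> lab \<times> int list")

definition lookup :: "'b \<Rightarrow> ('a \<times> 'b) list \<Rightarrow> 'a \<Rightarrow> 'b" where
  "lookup d xs a = (case map_of xs a of None \<Rightarrow> d | Some b \<Rightarrow> b)"

definition dcol :: "diagram \<Rightarrow> nat \<Rightarrow> int" where
  "dcol G k = (if k < rank G then colour G k else 0)"

text \<open>The list stored at \<open>k\<close> holds column \<open>k\<close>, that is, the entries
  that enter the exchange relation at \<open>k\<close>.\<close>

definition dA :: "diagram \<Rightarrow> nat \<Rightarrow> nat \<Rightarrow> int" where
  "dA G j k = (if k < rank G then (case map_of (neighbours G k) j of None \<Rightarrow> 0 | Some a \<Rightarrow> a) else 0)"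

definition wf_edge :: "diagram \<Rightarrow> nat \<Rightarrow> nat \<times> int \<Rightarrow> bool" where
  "wf_edge G k = (\<lambda>(j, a). j < rank G \<and> a > 0 \<and> odd (dcol G j + dcol G k) \<and> k \<in> fst ` set (neighbours G j) \<and>
     list_all (\<lambda>i. distance G i k \<le> Suc (distance G i j)) [0..<rank G])"

definition wf_node :: "diagram \<Rightarrow> nat \<Rightarrow> bool" where
  "wf_node G k \<longleftrightarrow> distinct (map fst (neighbours G k)) \<and> list_all (wf_edge G k) (neighbours G k) \<and> distance G k k = 0"

definition wf_diagram :: "diagram \<Rightarrow> bool" where
  "wf_diagram G \<longleftrightarrow> list_all (wf_node G) [0..<rank G]"

definition insert_node :: "diagram \<Rightarrow> nat \<Rightarrow> nat list list \<Rightarrow> nat list list" where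
  "insert_node G k Cs = (k # concat (filter (list_ex (\<lambda>j. dA G k j \<noteq> 0)) Cs)) #
     filter (\<lambda>C. \<not> list_ex (\<lambda>j. dA G k j \<noteq> 0) C) Cs"

definition components :: "diagram \<Rightarrow> nat list \<Rightarrow> nat list list" where
  "components G J = map sort (foldr (insert_node G) J [])"

definition label_list :: "diagram \<Rightarrow> nat list \<Rightarrow> int \<Rightarrow> int \<Rightarrow> lab list" where
  "label_list G J h p = concat (map (\<lambda>k. map (Pair k) (filter (\<lambda>c. even (dcol G k + p + c)) [0..h - 1])) J)"

definition entry_labels :: "diagram \<Rightarrow> table \<Rightarrow> int \<Rightarrow> nat list \<Rightarrow> lab list" where
  "entry_labels G T p E = label_list G E (hof T E) p"

definition all_labels :: "diagram \<Rightarrow> table \<Rightarrow> nat list \<Rightarrow> int \<Rightarrow> lab list" where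
  "all_labels G T J p = concat (map (entry_labels G T p) (components G J))"

text \<open>Tables are passed around as partially applied constants rather than as abstractions, since the
  simplifier would otherwise evaluate the body of the abstraction symbolically.\<close>

definition layers :: "diagram \<Rightarrow> nat list \<Rightarrow> int \<Rightarrow> (nat \<times> int) list option list" where
  "layers G J q = map (\<lambda>k. if k \<in> set J \<and> even (dcol G k + q) then Some (neighbours G k) else None) [0..<rank G]"

definition trop_step :: "(nat \<times> int) list option list \<Rightarrow> int list \<Rightarrow> int list" where
  "trop_step fl v = map2 (\<lambda>f x. case f of None \<Rightarrow> x
     | Some nb \<Rightarrow> max 0 (sum_list (map (\<lambda>(j, a). a * v ! j) nb)) - x) fl v"

fun trop_table :: "(nat \<times> int) list option list \<Rightarrow> (nat \<times> int) list option list \<Rightarrow> nat \<Rightarrow> int list \<Rightarrow> int list list" where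
  "trop_table f g 0 v = [v]"
| "trop_table f g (Suc r) v = v # trop_table g f r (trop_step f v)"

definition weight_vector :: "diagram \<Rightarrow> nat list \<Rightarrow> int list" where
  "weight_vector G J = map (\<lambda>k. if k \<in> set J then weight G k else 0) [0..<rank G]"

definition max_of :: "('b \<Rightarrow> nat) \<Rightarrow> 'b list \<Rightarrow> nat" where
  "max_of f xs = foldr (\<lambda>x. max (f x)) xs 0"

definition period_pairs :: "table \<Rightarrow> nat list \<Rightarrow> (nat \<times> int) list" where
  "period_pairs T E = map (\<lambda>k. (k, hof T E)) E"

definition periods :: "diagram \<Rightarrow> table \<Rightarrow> nat list \<Rightarrow> int list" where
  "periods G T J = map (lookup 0 (concat (map (period_pairs T) (components G J)))) [0..<rank G]"

definition row_values :: "(nat \<times> int) list option list \<Rightarrow> int list \<Rightarrow> int \<Rightarrow> int list \<Rightarrow> int list" where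
  "row_values f hs c u = map ((!) u) (filter (\<lambda>k. f ! k \<noteq> None \<and> c < hs ! k) [0..<length hs])"

primrec label_values :: "int list \<Rightarrow> int list list \<Rightarrow> (nat \<times> int) list option list \<Rightarrow> (nat \<times> int) list option list \<Rightarrow> int \<Rightarrow> int list" where
  "label_values hs [] f g c = []"
| "label_values hs (u # us) f g c = row_values f hs c u @ label_values hs us g f (c + 1)"

text \<open>Claims are compared while the table is traversed once, and each is dropped after its
  row. Since nothing may be left over, no claim can refer to a row outside the table.\<close>

primrec match_rows :: "int list list \<Rightarrow> int \<Rightarrow> (nat \<times> int \<times> int) list \<Rightarrow> bool" where
  "match_rows [] c xs = (xs = [])"
| "match_rows (u # us) c xs = (list_all (\<lambda>(k, a, v). a = c \<longrightarrow> u ! k = v) xs \<and>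
     match_rows us (c + 1) (filter (\<lambda>(k, a, v). a \<noteq> c) xs))"

text \<open>The recursion pattern of quicksort keeps the evaluation on long lists cheap.\<close>

fun quick_distinct :: "int list \<Rightarrow> bool" where
  "quick_distinct [] = True"
| "quick_distinct (x # xs) = (x \<notin> set xs \<and> quick_distinct (filter (\<lambda>y. y < x) xs) \<and> quick_distinct (filter (\<lambda>y. x < y) xs))"

text \<open>The labels inside the light cone of \<open>(i, 0)\<close>, in both directions of time.
  Distances of the whole diagram serve all its subdiagrams, because they change by at most 1 along
  every edge.\<close>

definition coslice :: "diagram \<Rightarrow> nat \<Rightarrow> lab \<Rightarrow> bool" where
  "coslice G i l \<longleftrightarrow> fst l \<noteq> i \<and> \<bar>snd l\<bar> \<le> int (distance G i (fst l)) \<and> even (dcol G (fst l) + dcol G i + snd l)"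

text \<open>As \<open>st\<close> is an involution, only the parity of the number of periods affects
  the node.\<close>

definition shift :: "nat list \<Rightarrow> int \<Rightarrow> int \<Rightarrow> lab \<Rightarrow> lab" where
  "shift st h m l = (if even m then fst l else st ! fst l, snd l + m * h)"

text \<open>This consults the finished entry of a smaller diagram \<open>E\<close>, whereas
  \<open>is_known\<close> consults the earlier steps for the same diagram.\<close>

definition is_joined :: "diagram \<Rightarrow> table \<Rightarrow> nat list \<Rightarrow> nat \<Rightarrow> lab \<Rightarrow> bool" where
  "is_joined G T E i l \<longleftrightarrow> coslice G i l \<or> list_ex (\<lambda>(i', _, l', _). i' = i \<and> l' = l) (stepsof T E)"

definition is_known :: "diagram \<Rightarrow> (nat \<times> lab \<times> lab) list \<Rightarrow> nat \<Rightarrow> lab \<Rightarrow> lab \<Rightarrow> bool" where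
  "is_known G prev j e l \<longleftrightarrow> e = l \<and> coslice G j l \<or> (j, e, l) \<in> set prev"

text \<open>The entry of \<open>E\<close> describes pairs whose first label is at time 0. Hence
  \<open>ev\<close> is moved by \<open>m\<close> periods and then measured from the time of
  \<open>eu\<close>.\<close>

definition joined_in :: "diagram \<Rightarrow> table \<Rightarrow> nat \<Rightarrow> lab \<Rightarrow> lab \<Rightarrow> int \<Rightarrow> nat list \<Rightarrow> bool" where
  "joined_in G T j eu ev m E \<longleftrightarrow> fst eu \<in> set E \<and> fst ev \<in> set E \<and>
     even (dcol G (fst eu) + dcol G j + snd eu) \<and> even (dcol G (fst ev) + dcol G j + snd ev) \<and>
     is_joined G T E (fst eu) (let f = shift (stof T E) (hof T E) m ev in (fst f, snd f - snd eu))"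

definition check_triangle :: "diagram \<Rightarrow> table \<Rightarrow> nat list \<Rightarrow> (nat \<times> lab \<times> lab) list \<Rightarrow> step \<Rightarrow> bool" where
  "check_triangle G T D prev = (\<lambda>(i, e, l, v, j, c, eu, ev, m).
     j \<in> set D \<and> is_known G prev j eu (i, - c) \<and> is_known G prev j ev (fst l, snd l - c) \<and>
     list_ex (joined_in G T j eu ev m) (components G (remove1 j D)))"

definition check_step :: "diagram \<Rightarrow> table \<Rightarrow> nat list \<Rightarrow> (nat \<times> lab \<times> lab) list \<Rightarrow> step \<Rightarrow> bool" where
  "check_step G T D prev x = (case x of (i, e, l, _) \<Rightarrow>
     i \<in> set D \<and> fst l \<in> set D \<and> even (dcol G (fst l) + dcol G i + snd l) \<and>
     (coslice G i l \<or> check_triangle G T D prev x))"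

definition triple :: "step \<Rightarrow> nat \<times> lab \<times> lab" where
  "triple = (\<lambda>(i, e, l, _). (i, e, l))"

definition steps_at :: "table \<Rightarrow> nat list \<Rightarrow> nat \<Rightarrow> (lab \<times> lab \<times> int) list" where
  "steps_at T D i = map (\<lambda>(i, e, l, v, _). (e, l, v)) (filter (\<lambda>x. fst x = i) (stepsof T D))"

fun check_steps :: "diagram \<Rightarrow> table \<Rightarrow> nat list \<Rightarrow> (nat \<times> lab \<times> lab) list \<Rightarrow> step list \<Rightarrow> bool" where
  "check_steps G T D prev [] = True"
| "check_steps G T D prev (x # xs) = (check_step G T D prev x \<and> check_steps G T D (triple x # prev) xs)"

definition is_label :: "diagram \<Rightarrow> nat list \<Rightarrow> int list \<Rightarrow> int \<Rightarrow> lab \<Rightarrow> bool" where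
  "is_label G J hs p e \<longleftrightarrow> fst e \<in> set J \<and> 0 \<le> snd e \<and> snd e < hs ! fst e \<and> even (dcol G (fst e) + p + snd e)"

definition max_row :: "(nat \<times> int \<times> int) list \<Rightarrow> nat" where
  "max_row xs = max_of (\<lambda>x. nat (fst (snd x))) xs"

definition check_rows where
  "check_rows f g hs es us \<longleftrightarrow> quick_distinct (label_values hs us f g 0) \<and> match_rows us 0 es"

definition check_match :: "diagram \<Rightarrow> nat list \<Rightarrow> nat list \<Rightarrow> int \<Rightarrow> int list \<Rightarrow> (lab \<times> lab \<times> int) list \<Rightarrow>
    (nat \<times> int \<times> int) list \<Rightarrow> (nat \<times> int \<times> int) list \<Rightarrow> bool" where
  "check_match G D J p hs xs ps ns \<longleftrightarrow> list_all (\<lambda>(e, l, v). is_label G J hs p e \<and> v \<noteq> 0) xs \<and>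
     check_rows (layers G J p) (layers G J (p + 1)) hs (map (\<lambda>(e, l, v). (fst e, snd e, v)) xs)
       (trop_table (layers G J p) (layers G J (p + 1)) (max_of nat hs) (weight_vector G J)) \<and>
     match_rows (trop_table (layers G D p) (layers G D (p + 1)) (max_row ps) (weight_vector G J)) 0 ps \<and>
     match_rows (trop_table (layers G D (p + 1)) (layers G D p) (max_row ns) (weight_vector G J)) 0 ns"

definition check_trop :: "diagram \<Rightarrow> table \<Rightarrow> nat list \<Rightarrow> nat \<Rightarrow> (lab \<times> lab \<times> int) list \<Rightarrow> bool" where
  "check_trop G T D i xs = check_match G D (remove1 i D) (dcol G i) (periods G T (remove1 i D)) xs
     (map (\<lambda>(e, l, v). (fst l, snd l, v)) (filter (\<lambda>(e, l, v). 0 \<le> snd l) xs))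
     (map (\<lambda>(e, l, v). (fst l, - snd l, v)) (filter (\<lambda>(e, l, v). snd l < 0) xs))"

definition nonzero_distinct :: "int list \<Rightarrow> bool" where
  "nonzero_distinct xs \<longleftrightarrow> 0 \<notin> set xs \<and> quick_distinct xs"

definition check_inj :: "diagram \<Rightarrow> table \<Rightarrow> nat list \<Rightarrow> int \<Rightarrow> bool" where
  "check_inj G T D p = nonzero_distinct (label_values (map (lookup 0 (period_pairs T D)) [0..<rank G])
     (trop_table (layers G D p) (layers G D (p + 1)) (nat (hof T D)) (weight_vector G D)) (layers G D p) (layers G D (p + 1)) 0)"

text \<open>A window of labels contains nonnegative times only. A variable that meets the light cone
  at a negative time is recognized after going back by one period.\<close>

definition covered :: "diagram \<Rightarrow> lab list \<Rightarrow> nat \<Rightarrow> nat list \<Rightarrow> int \<Rightarrow> lab \<Rightarrow> bool" where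
  "covered G es i st h e \<longleftrightarrow> coslice G i e \<or> coslice G i (shift st h (- 1) e) \<or> e \<in> set es"

definition covered_entry :: "diagram \<Rightarrow> table \<Rightarrow> lab list \<Rightarrow> nat \<Rightarrow> nat list \<Rightarrow> bool" where
  "covered_entry G T es i E \<longleftrightarrow> list_all (covered G es i (stof T E) (hof T E)) (entry_labels G T (dcol G i) E)"

definition check_cover :: "diagram \<Rightarrow> table \<Rightarrow> nat list \<Rightarrow> nat \<Rightarrow> bool" where
  "check_cover G T D i \<longleftrightarrow>
     list_all (covered_entry G T (map fst (steps_at T D i)) i) (components G (remove1 i D))"

definition check_trop_steps :: "diagram \<Rightarrow> table \<Rightarrow> nat list \<Rightarrow> nat \<Rightarrow> bool" where
  "check_trop_steps G T D i \<longleftrightarrow>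
     check_trop G T D i (steps_at T D i)"

definition check_components :: "diagram \<Rightarrow> table \<Rightarrow> nat list \<Rightarrow> nat \<Rightarrow> bool" where
  "check_components G T D i \<longleftrightarrow> list_all (\<lambda>E. hof T E > 0) (components G (remove1 i D))"

text \<open>Periodicity is found at a single node \<open>k\<close>, from a link label
  \<open>e\<close> that is matched twice. It spreads to each other node \<open>j\<close> through the
  label at time \<open>distance G k j\<close>, the latest one inside the light cone of
  \<open>k\<close>.\<close>

definition check_anchor where
  "check_anchor G T D i e k c vs X st h \<longleftrightarrow>
     i \<in> set D \<and> k \<in> set D \<and> is_known G X i e (k, c) \<and> is_known G X i e (st ! k, c + h) \<and>
     list_all (\<lambda>j. j = k \<or> coslice G k (j, int (distance G k j)) \<and> coslice G (st ! k) (st ! j, int (distance G k j))) D \<and>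
     length vs = length (remove1 k D) \<and>
     check_trop G T D k (map2 (\<lambda>j v. ((j, int (distance G k j)), (st ! j, int (distance G k j) + h), v)) (remove1 k D) vs)"

text \<open>Up to rank two the period is the result of direct computation; from rank three on it is
  read off an anchor. The condition \<open>rank G = 2\<close> ensures that the G2 belt has no
  coefficients.\<close>

definition check_per :: "diagram \<Rightarrow> table \<Rightarrow> nat list \<Rightarrow> bool" where
  "check_per G T D = (case D of [k] \<Rightarrow> hof T D = 4 \<and> stof T D ! k = k
    | [k, l] \<Rightarrow> (dA G k l = 1 \<and> dA G l k = 1 \<and> hof T D = 5 \<and> stof T D ! k = l \<and> stof T D ! l = k) \<or>
        ((dA G k l = 2 \<and> dA G l k = 1 \<or> dA G k l = 1 \<and> dA G l k = 2) \<and> hof T D = 6 \<and> stof T D ! k = k \<and> stof T D ! l = l) \<or>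
        ((dA G k l = 3 \<and> dA G l k = 1 \<or> dA G k l = 1 \<and> dA G l k = 3) \<and> rank G = 2 \<and> hof T D = 8 \<and> stof T D ! k = k \<and> stof T D ! l = l)
    | _ \<Rightarrow> (case perof T D of (i, e, (k, c), vs) \<Rightarrow> check_anchor G T D i e k c vs (map triple (stepsof T D)) (stof T D) (hof T D)))"

definition check_entry :: "diagram \<Rightarrow> table \<Rightarrow> nat list \<Rightarrow> bool" where
  "check_entry G T D \<longleftrightarrow> distinct D \<and> list_all (\<lambda>k. k < rank G) D \<and> hof T D > 0 \<and>
     list_all (\<lambda>k. stof T D ! k \<in> set D \<and> stof T D ! (stof T D ! k) = k) D \<and>
     list_all (check_components G T D) D \<and> check_inj G T D 0 \<and> check_inj G T D 1 \<and>
     (stepsof T D = [] \<or> list_all (check_trop_steps G T D) D) \<and>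
     check_steps G T D [] (stepsof T D) \<and> list_all (check_cover G T D) D \<and> check_per G T D"

section \<open>Soundness of components and of tropical tables\<close>

lemma components_Union: "\<Union>(set ` set (components G J)) = set J"
proof -
  have "\<Union>(set ` set (foldr (insert_node G) J [])) = set J"
    by (induction J) (auto simp: insert_node_def)
  then show ?thesis by (simp add: components_def)
qed

primrec sep :: "diagram \<Rightarrow> nat list list \<Rightarrow> bool" where
  "sep G [] = True"
| "sep G (C # Cs) = (sep G Cs \<and> (\<forall>C'\<in>set Cs. \<forall>a\<in>set C. \<forall>b\<in>set C'. a \<noteq> b \<and> dA G a b = 0 \<and> dA G b a = 0))"

lemma sep_filter: "sep G Cs \<Longrightarrow> sep G (filter Q Cs)"
  by (induction Cs) auto

lemma sep_split: "sep G Cs \<Longrightarrow> C \<in> set (filter Q Cs) \<Longrightarrow> C' \<in> set (filter (\<lambda>C. \<not> Q C) Cs) \<Longrightarrow> a \<in> set C \<Longrightarrow> b \<in> set C' \<Longrightarrow>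
    a \<noteq> b \<and> dA G a b = 0 \<and> dA G b a = 0"
proof (induction Cs)
  case (Cons D Cs)
  then show ?case by (auto split: if_splits)
qed simp

lemma sep_insert_node:
  assumes sym: "\<And>i j. dA G i j = 0 \<longleftrightarrow> dA G j i = 0" and "sep G Cs" "k \<notin> \<Union>(set ` set Cs)"
  shows "sep G (insert_node G k Cs)"
proof -
  let ?Q = "list_ex (\<lambda>j. dA G k j \<noteq> 0)"
  have "a \<noteq> b \<and> dA G a b = 0 \<and> dA G b a = 0"
    if R: "C' \<in> set (filter (\<lambda>C. \<not> ?Q C) Cs)" "a \<in> set (k # concat (filter ?Q Cs))" "b \<in> set C'" for C' a b
  proof (cases "a = k")
    case True
    have "dA G k b = 0" using R(1,3) by (auto simp: list_ex_iff)
    moreover have "b \<noteq> k" using R(1,3) assms(3) by auto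
    ultimately show ?thesis using True sym by blast
  next
    case False
    then obtain C where "C \<in> set (filter ?Q Cs)" "a \<in> set C" using R(2) by auto
    then show ?thesis using sep_split[OF assms(2) _ R(1)] R(3) by blast
  qed
  then show ?thesis unfolding insert_node_def sep.simps using sep_filter[OF assms(2)] by blast
qed

lemma sep_components:
  assumes sym: "\<And>i j. dA G i j = 0 \<longleftrightarrow> dA G j i = 0" and "distinct J"
  shows "sep G (components G J)"
proof -
  have "sep G (foldr (insert_node G) J [])"
    using assms(2)
  proof (induction J)
    case (Cons k J)
    have "\<Union>(set ` set (foldr (insert_node G) J [])) = set J"
      by (induction J) (auto simp: insert_node_def)
    then have "k \<notin> \<Union>(set ` set (foldr (insert_node G) J []))" using Cons.prems by simp
    then show ?case using sep_insert_node[OF sym, of "foldr (insert_node G) J []" k] Cons by simp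
  qed simp
  moreover have "sep G (map sort Cs) = sep G Cs" for Cs by (induction Cs) auto
  ultimately show ?thesis by (simp add: components_def)
qed

lemma wf_diagramD:
  assumes "wf_diagram G"
  shows "dA G i j \<ge> 0" "dA G i j = 0 \<longleftrightarrow> dA G j i = 0" "dA G i j \<noteq> 0 \<Longrightarrow> odd (dcol G i + dcol G j)"
    "dA G i j \<noteq> 0 \<Longrightarrow> i < rank G \<and> j < rank G"
    "dA G j k \<noteq> 0 \<Longrightarrow> i < rank G \<Longrightarrow> distance G i k \<le> Suc (distance G i j)"
    "i < rank G \<Longrightarrow> distance G i i = 0"
    "k < rank G \<Longrightarrow> (j, a) \<in> set (neighbours G k) \<Longrightarrow> dA G j k = a"
    "k < rank G \<Longrightarrow> distinct (map fst (neighbours G k))"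
    "k < rank G \<Longrightarrow> (j, a) \<in> set (neighbours G k) \<Longrightarrow> j < rank G"
proof -
  have nb: "distinct (map fst (neighbours G k))" "distance G k k = 0"
    "(j, a) \<in> set (neighbours G k) \<Longrightarrow> j < rank G \<and> a > 0 \<and> odd (dcol G j + dcol G k) \<and> k \<in> fst ` set (neighbours G j) \<and>
         (\<forall>i<rank G. distance G i k \<le> Suc (distance G i j))" if k: "k < rank G" for k j a
  proof -
    have n: "wf_node G k" using assms k unfolding wf_diagram_def list_all_iff by simp
    then show "distinct (map fst (neighbours G k))" "distance G k k = 0" unfolding wf_node_def by blast+
    assume "(j, a) \<in> set (neighbours G k)"
    then have "wf_edge G k (j, a)" using n unfolding wf_node_def list_all_iff by blast
    then show "j < rank G \<and> a > 0 \<and> odd (dcol G j + dcol G k) \<and> k \<in> fst ` set (neighbours G j) \<and>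
         (\<forall>i<rank G. distance G i k \<le> Suc (distance G i j))"
      unfolding wf_edge_def list_all_iff by simp
  qed
  have ex: "\<exists>a. (i, a) \<in> set (neighbours G j) \<and> dA G i j = a" if "dA G i j \<noteq> 0" for i j
    using that by (auto simp: dA_def split: if_splits option.splits dest: map_of_SomeD)
  have lt: "j < rank G" if "dA G i j \<noteq> 0" for i j
    using that by (auto simp: dA_def split: if_splits)
  show A: "k < rank G \<Longrightarrow> (j, a) \<in> set (neighbours G k) \<Longrightarrow> dA G j k = a" for k j a
    using nb(1) by (simp add: dA_def map_of_eq_Some_iff)
  have imp: "dA G j i \<noteq> 0" if n: "dA G i j \<noteq> 0" for i j
  proof -
    obtain a where "(i, a) \<in> set (neighbours G j)" using ex[OF n] by blast
    then have i: "i < rank G" "j \<in> fst ` set (neighbours G i)" using nb(3)[OF lt[OF n]] by blast+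
    then obtain b where "(j, b) \<in> set (neighbours G i)" by auto
    then show ?thesis using A[OF i(1)] nb(3)[OF i(1)] by fastforce
  qed
  then show "dA G i j = 0 \<longleftrightarrow> dA G j i = 0" by blast
  show "dA G i j \<ge> 0" using ex[of i j] nb(3)[of j i "dA G i j"] lt[of i j] by (cases "dA G i j = 0") auto
  show "dA G i j \<noteq> 0 \<Longrightarrow> odd (dcol G i + dcol G j)" using ex[of i j] nb(3)[of j i "dA G i j"] lt[of i j] by auto
  show "dA G i j \<noteq> 0 \<Longrightarrow> i < rank G \<and> j < rank G" using ex[of i j] nb(3)[of j i "dA G i j"] lt[of i j] by auto
  show "dA G j k \<noteq> 0 \<Longrightarrow> i < rank G \<Longrightarrow> distance G i k \<le> Suc (distance G i j)"
    using ex[of j k] nb(3)[of k j "dA G j k"] lt[of j k] by auto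
  show "i < rank G \<Longrightarrow> distance G i i = 0" using nb(2) .
  show "k < rank G \<Longrightarrow> distinct (map fst (neighbours G k))" using nb(1) .
  show "k < rank G \<Longrightarrow> (j, a) \<in> set (neighbours G k) \<Longrightarrow> j < rank G" using nb(3) by blast
qed

text \<open>\<open>N\<close> may be smaller than the rank, so that seeds of types E6 and E7 can be
  treated with the diagram and the table of E8.\<close>

locale diagram_seeds = semifield_seeds "{..<N}" P for N and P :: "'a::field set" and G :: diagram +
  assumes wf: "wf_diagram G" and N_le: "N \<le> rank G"
begin

sublocale dynkin_seeds "{..<N}" P "dcol G" "dA G"
  by unfold_locales (use wf_diagramD[OF wf] in blast)+

lemma trop_step_correct:
  assumes J: "set J \<subseteq> {..<rank G}" and v: "length v = rank G" "\<And>k. k < rank G \<Longrightarrow> k \<notin> set J \<Longrightarrow> v ! k = 0" and k: "k < rank G"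
  shows "trop_step (layers G J q) v ! k = tstep (set J) q (\<lambda>k. v ! k) k"
proof -
  have "sum_list (map (\<lambda>(j, a). a * v ! j) (neighbours G k)) = (\<Sum>j\<in>set J. dA G j k * v ! j)"
  proof -
    note d = wf_diagramD(8)[OF wf k]
    have "sum_list (map (\<lambda>(j, a). a * v ! j) (neighbours G k)) = (\<Sum>x\<in>set (neighbours G k). case x of (j, a) \<Rightarrow> a * v ! j)"
      using d by (intro sum_list_distinct_conv_sum_set) (auto simp: distinct_map)
    also have "\<dots> = (\<Sum>x\<in>set (neighbours G k). dA G (fst x) k * v ! fst x)"
      using wf_diagramD(7)[OF wf k] by (intro sum.cong) auto
    also have "\<dots> = (\<Sum>j\<in>fst ` set (neighbours G k). dA G j k * v ! j)"
      using d by (subst sum.reindex) (auto simp: distinct_map)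
    also have "\<dots> = (\<Sum>j\<in>set J. dA G j k * v ! j)"
    proof (rule sum.mono_neutral_cong)
      fix j assume "j \<in> set J - fst ` set (neighbours G k)"
      then have "map_of (neighbours G k) j = None" by (simp add: map_of_eq_None_iff)
      then show "dA G j k * v ! j = 0" using k by (simp add: dA_def)
    next
      fix j assume "j \<in> fst ` set (neighbours G k) - set J"
      then show "dA G j k * v ! j = 0" using v(2)[of j] wf_diagramD(9)[OF wf k] by auto
    qed auto
    finally show ?thesis .
  qed
  then show ?thesis
    using k v(1) by (simp add: trop_step_def layers_def tstep_def)
qed

lemma trop_table_correct:
  assumes J: "set J \<subseteq> {..<rank G}"
  shows "length v = rank G \<Longrightarrow> (\<And>k. k < rank G \<Longrightarrow> k \<notin> set J \<Longrightarrow> v ! k = 0) \<Longrightarrow> k < rank G \<Longrightarrow> r' \<le> r \<Longrightarrow>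
    trop_table (layers G J q) (layers G J (q + 1)) r v ! r' ! k = tfwd (set J) q r' (\<lambda>k. v ! k) k"
proof (induction r arbitrary: v q r' k)
  case 0
  then show ?case by simp
next
  case (Suc r)
  have layers2: "layers G J (q + 1 + 1) = layers G J q" by (simp add: layers_def)
  let ?v = "trop_step (layers G J q) v"
  have step: "?v ! k = tstep (set J) q (\<lambda>k. v ! k) k" if "k < rank G" for k
    using trop_step_correct[OF J Suc.prems(1,2) that] by blast
  have len: "length ?v = rank G" using Suc.prems(1) by (simp add: trop_step_def layers_def)
  have zero: "?v ! k = 0" if "k < rank G" "k \<notin> set J" for k
    using step[OF that(1)] Suc.prems(2)[OF that] that by (simp add: tstep_def)
  show ?case
  proof (cases r')
    case 0
    then show ?thesis by simp
  next
    case (Suc r'')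
    \<comment> \<open>\<open>tfwd\<close> appends its steps at the end, while
      \<open>trop_table\<close> takes them off at the front with the two colours exchanged.\<close>
    have gen: "tfwd (set J) q (Suc m) w = tfwd (set J) (q + 1) m (tstep (set J) q w)" for m w
      by (induction m) (simp_all add: add_ac)
    have "trop_table (layers G J q) (layers G J (q + 1)) (Suc r) v ! r' ! k =
        trop_table (layers G J (q + 1)) (layers G J (q + 1 + 1)) r ?v ! r'' ! k"
      unfolding layers2 by (simp add: Suc)
    also have "\<dots> = tfwd (set J) (q + 1) r'' (\<lambda>k. ?v ! k) k"
      using Suc.prems Suc by (intro Suc.IH len zero) auto
    also have "\<dots> = tfwd (set J) (q + 1) r'' (tstep (set J) q (\<lambda>k. v ! k)) k"
    proof (cases "k \<in> set J")
      case True
      then show ?thesis using step J by (intro tfwd_cong) auto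
    next
      case False
      have "tfwd (set J) q' m w k = w k" for q' m w using False by (induction m) (simp_all add: tstep_def)
      then show ?thesis using step Suc.prems(3) by simp
    qed
    finally show ?thesis unfolding gen[symmetric] Suc .
  qed
qed

lemma weight_vector_props:
  "length (weight_vector G J) = rank G"
  "k < rank G \<Longrightarrow> weight_vector G J ! k = (if k \<in> set J then weight G k else 0)"
  by (simp_all add: weight_vector_def)

lemma set_label_list: "set (label_list G J h p) = labels (set J) h p"
proof -
  have "(k, c) \<in> set (label_list G J h p) \<longleftrightarrow> (k, c) \<in> labels (set J) h p" for k c
    by (auto simp: label_list_def labels_def valid_def)
  then show ?thesis by auto
qed

lemma tX_cong: "(\<And>j. j \<in> J \<Longrightarrow> v j = w j) \<Longrightarrow> fst l \<in> J \<Longrightarrow> tX J p v l = tX J p w l"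
  unfolding tX_def using tfwd_cong[of J v w] by auto

lemma tX_parity: "even (p - p') \<Longrightarrow> tX J p v l = tX J p' v l"
proof -
  have step: "even (q - q') \<Longrightarrow> tstep J q = tstep J q'" for q q'
    by (intro ext) (auto simp: tstep_def)
  have "even (q - q') \<Longrightarrow> tfwd J q r v = tfwd J q' r v" for q q' r
  proof (induction r)
    case (Suc r)
    then have "tstep J (q + int r) = tstep J (q' + int r)" by (intro step) simp
    then show ?case using Suc by simp
  qed simp
  from this[of p p'] this[of "p + 1" "p' + 1"] show "even (p - p') \<Longrightarrow> tX J p v l = tX J p' v l" by (simp add: tX_def)
qed

lemma labels_parity: "even (p - p') \<Longrightarrow> labels J h p = labels J h p'"
proof -
  assume "even (p - p')"
  then have "even (a + p + c) \<longleftrightarrow> even (a + p' + c)" for a c by presburger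
  then show ?thesis by (simp add: labels_def valid_def)
qed

lemma X_component:
  assumes F: "F \<subseteq> {..<N}" "E \<subseteq> F" and no: "\<And>i j. i \<in> E \<Longrightarrow> j \<in> F - E \<Longrightarrow> dA G i j = 0"
    and s: "good s" "bip F s" and l: "fst l \<in> E"
  shows "X F p s l = X E p s l"
proof -
  define d where "d = (\<lambda>k. if k \<in> E then nat \<bar>snd l\<bar> else 0)"
  have d: "d i \<le> Suc (d j)" if "i \<in> F" "j \<in> F" "dA G i j \<noteq> 0" for i j
    using no[of i j] that by (auto simp: d_def)
  have d0: "d k = 0" if "k \<in> F - E" for k using that by (simp add: d_def)
  show ?thesis using belt_subset_agree(1)[where d = d, OF s F(1,2) d0 d l, of "snd l" p] l by (auto simp: d_def)
qed

abbreviation st_fun :: "table \<Rightarrow> nat list \<Rightarrow> nat \<Rightarrow> nat" where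
  "st_fun T D k \<equiv> stof T D ! k"

text \<open>What larger diagrams may rely on. The joined pairs are evidence for triangles, and the
  nonzero tropical values are what \<open>nice_Un\<close> needs to separate components.\<close>

definition certified :: "table \<Rightarrow> nat list \<Rightarrow> bool" where
  "certified T D \<longleftrightarrow> set D \<subseteq> {..<N} \<and> hof T D > 0 \<and> nice (set D) (labels (set D) (hof T D)) \<and>
     (\<forall>k\<in>set D. per (set D) (hof T D) (st_fun T D) k \<and> st_fun T D k \<in> set D \<and> st_fun T D (st_fun T D k) = k) \<and>
     (\<forall>(i, _, l, _)\<in>set (stepsof T D). i \<in> set D \<and> fst l \<in> set D \<and>
        (\<forall>s. good s \<longrightarrow> bip (set D) s \<longrightarrow> joined (set D) (dcol G i) s (i, 0) l)) \<and>
     (\<forall>p. \<forall>l\<in>labels (set D) (hof T D) p. tX (set D) p (weight G) l \<noteq> 0)"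

lemma set_all_labels: "set (all_labels G T J p) = (\<Union>E\<in>set (components G J). labels (set E) (hof T E) p)"
  by (simp add: all_labels_def entry_labels_def set_label_list)

lemma nice_components:
  assumes J: "distinct J" "set J \<subseteq> {..<N}" and ok: "\<And>E. E \<in> set (components G J) \<Longrightarrow> certified T E"
  shows "nice (set J) (\<lambda>p. set (all_labels G T J p))"
proof -
  have "nice (\<Union>(set ` set Cs)) (\<lambda>p. \<Union>E\<in>set Cs. labels (set E) (hof T E) p)"
    if "sep G Cs" "\<And>E. E \<in> set Cs \<Longrightarrow> certified T E" for Cs
    using that
  proof (induction Cs)
    case Nil
    then show ?case using nice_empty by simp
  next
    case (Cons C Cs)
    have c: "certified T E" if "E \<in> set (C # Cs)" for E using Cons.prems(2) that by blast
    have sub: "set E \<subseteq> {..<N}" if "E \<in> set (C # Cs)" for E using c[OF that] unfolding certified_def by blast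
    have "nice (set C \<union> \<Union>(set ` set Cs)) (\<lambda>p. labels (set C) (hof T C) p \<union> (\<Union>E\<in>set Cs. labels (set E) (hof T E) p))"
    proof (rule nice_Un)
      show "set C \<subseteq> {..<N}" "\<Union>(set ` set Cs) \<subseteq> {..<N}" using sub by auto
      show "set C \<inter> \<Union>(set ` set Cs) = {}" using Cons.prems(1) by fastforce
      show "dA G i j = 0" if "i \<in> set C" "j \<in> \<Union>(set ` set Cs)" for i j using Cons.prems(1) that by auto
      show "nice (set C) (labels (set C) (hof T C))" using c unfolding certified_def by auto
      show "nice (\<Union>(set ` set Cs)) (\<lambda>p. \<Union>E\<in>set Cs. labels (set E) (hof T E) p)" using Cons by auto
      show "tX (set C) p (weight G) l \<noteq> 0" if "l \<in> labels (set C) (hof T C) p" for p l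
        using c[of C] that unfolding certified_def by auto
    qed
    then show ?case by simp
  qed
  from this[OF sep_components[OF wf_diagramD(2)[OF wf] J(1)] ok] show ?thesis
    unfolding components_Union set_all_labels .
qed

end

section \<open>From successful checks to statements about seeds\<close>

context diagram_seeds
begin

lemma sep_orth: "sep G Cs \<Longrightarrow> E \<in> set Cs \<Longrightarrow> C \<in> set Cs \<Longrightarrow> a \<in> set E \<Longrightarrow> b \<in> set C \<Longrightarrow> b \<notin> set E \<Longrightarrow> dA G a b = 0"
  by (induction Cs) auto

lemma component_orth:
  assumes "distinct J" "E \<in> set (components G J)" "a \<in> set E" "b \<in> set J - set E"
  shows "dA G a b = 0"
proof -
  obtain C where "C \<in> set (components G J)" "b \<in> set C" using assms(4) components_Union[of G J] by blast
  then show ?thesis using sep_orth[OF sep_components[OF wf_diagramD(2)[OF wf] assms(1)] assms(2) _ assms(3)] assms(4) by blast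
qed

lemma coslice_known:
  assumes D: "D \<subseteq> {..<N}" "i \<in> D" and l: "fst l \<in> D" "coslice G i l"
  shows "known D i l l"
proof -
  have "known D i (fst l, snd l) (fst l, snd l)"
  proof (rule known_coslice[where d = "\<lambda>k. distance G i k"])
    show "distance G i i = 0" using wf_diagramD(6)[OF wf] D N_le by auto
    show "distance G i a \<le> Suc (distance G i b)" if "a \<in> D" "b \<in> D" "dA G a b \<noteq> 0" for a b
      using wf_diagramD(5)[OF wf, of b a i] wf_diagramD(2)[OF wf, of a b] that D N_le by auto
    show "fst l \<in> D - {i}" "\<bar>snd l\<bar> \<le> int (distance G i (fst l))" "even (dcol G (fst l) + dcol G i + snd l)"
      using l unfolding coslice_def by auto
  qed (rule D)+
  then show ?thesis by simp
qed

lemma trop_table_ge: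
  assumes J: "set J \<subseteq> {..<rank G}" "set K \<subseteq> set J" "k \<in> set J" "r' \<le> r"
  shows "trop_table (layers G J q) (layers G J (q + 1)) r (weight_vector G K) ! r' ! k =
    tfwd (set J) q r' (\<lambda>k. if k \<in> set K then weight G k else 0) k"
proof -
  have k: "k < rank G" using J by blast
  have "trop_table (layers G J q) (layers G J (q + 1)) r (weight_vector G K) ! r' ! k =
    tfwd (set J) q r' (\<lambda>k. weight_vector G K ! k) k"
  proof (rule trop_table_correct[OF J(1) weight_vector_props(1) _ k J(4)])
    fix j assume "j < rank G" "j \<notin> set J"
    then show "weight_vector G K ! j = 0" using weight_vector_props(2) J(2) by auto
  qed
  also have "\<dots> = tfwd (set J) q r' (\<lambda>k. if k \<in> set K then weight G k else 0) k"
    using J weight_vector_props(2) by (intro tfwd_cong) auto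
  finally show ?thesis .
qed

lemma length_trop_table: "length (trop_table f g r v) = Suc r"
  by (induction r arbitrary: f g v) auto

lemma trop_table_label:
  assumes J: "set J \<subseteq> {..<rank G}" "set K \<subseteq> set J" "k \<in> set J" "nat c \<le> r" "nat (- c) \<le> r'"
  shows "tX (set J) p (\<lambda>k. if k \<in> set K then weight G k else 0) (k, c) =
    (if c \<ge> 0 then trop_table (layers G J p) (layers G J (p + 1)) r (weight_vector G K) ! nat c ! k
     else trop_table (layers G J (p + 1)) (layers G J p) r' (weight_vector G K) ! nat (- c) ! k)"
proof -
  have "layers G J (p + 1 + 1) = layers G J p" by (simp add: layers_def)
  then show ?thesis
    using trop_table_ge[OF J(1-3), of "nat c" r p] trop_table_ge[OF J(1-3), of "nat (- c)" r' "p + 1"] J(4,5)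
    by (simp add: tX_def)
qed

lemma max_of_ge: "x \<in> set xs \<Longrightarrow> f x \<le> max_of f xs"
  by (induction xs) (auto simp: max_of_def le_max_iff_disj)

lemma quick_distinct: "quick_distinct xs \<Longrightarrow> distinct xs"
proof (induction xs rule: quick_distinct.induct)
  case (2 x xs)
  have split: "distinct (filter (\<lambda>y. y < x) ys) \<Longrightarrow> distinct (filter (\<lambda>y. x < y) ys) \<Longrightarrow> x \<notin> set ys \<Longrightarrow> distinct ys" for ys
    by (induction ys) (auto simp: neq_iff split: if_splits)
  show ?case using 2 split[of xs] by simp
qed simp

lemma match_rows: "match_rows us c xs \<Longrightarrow> (k, a, v) \<in> set xs \<Longrightarrow> \<exists>i<length us. a = c + int i \<and> us ! i ! k = v"
proof (induction us arbitrary: c xs)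
  case (Cons u us)
  show ?case
  proof (cases "a = c")
    case True
    then show ?thesis using Cons.prems by (intro exI[of _ 0]) (auto simp: list_all_iff)
  next
    case False
    then have "(k, a, v) \<in> set (filter (\<lambda>(k, a, v). a \<noteq> c) xs)" using Cons.prems(2) by simp
    moreover have "match_rows us (c + 1) (filter (\<lambda>(k, a, v). a \<noteq> c) xs)" using Cons.prems(1) by simp
    ultimately obtain i where "i < length us" "a = c + 1 + int i" "us ! i ! k = v" using Cons.IH by blast
    then show ?thesis by (intro exI[of _ "Suc i"]) simp
  qed
qed simp

lemma label_values_mem:
  "i < length us \<Longrightarrow> k < length hs \<Longrightarrow> (if even i then f else g) ! k \<noteq> None \<Longrightarrow> c + int i < hs ! k \<Longrightarrow>
    us ! i ! k \<in> set (label_values hs us f g c)"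
proof (induction us arbitrary: i f g c)
  case (Cons u us)
  show ?case
  proof (cases i)
    case 0
    then show ?thesis using Cons.prems by (auto simp: row_values_def)
  next
    case (Suc j)
    then show ?thesis using Cons.prems Cons.IH[of j g f "c + 1"] by (auto split: if_splits)
  qed
qed simp

text \<open>Distinct entries of the concatenation sit at distinct positions. The arguments
  \<open>f\<close> and \<open>g\<close> trade places from row to row, as the colour of the valid
  labels alternates.\<close>

lemma label_values_inj:
  "distinct (label_values hs us f g c) \<Longrightarrow> i < length us \<Longrightarrow> k < length hs \<Longrightarrow> (if even i then f else g) ! k \<noteq> None \<Longrightarrow>
    c + int i < hs ! k \<Longrightarrow> i' < length us \<Longrightarrow> k' < length hs \<Longrightarrow> (if even i' then f else g) ! k' \<noteq> None \<Longrightarrow>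
    c + int i' < hs ! k' \<Longrightarrow> us ! i ! k = us ! i' ! k' \<Longrightarrow> i = i' \<and> k = k'"
proof (induction us arbitrary: i i' f g c)
  case (Cons u us)
  have d: "distinct (row_values f hs c u)" "distinct (label_values hs us g f (c + 1))"
    "set (row_values f hs c u) \<inter> set (label_values hs us g f (c + 1)) = {}"
    using Cons.prems(1) by simp_all
  have active: "u ! k \<in> set (row_values f hs c u)" if "k < length hs" "f ! k \<noteq> None" "c < hs ! k" for k
    using that by (auto simp: row_values_def)
  have rest: "us ! j ! k \<in> set (label_values hs us g f (c + 1))"
    if "Suc j < length (u # us)" "k < length hs" "(if even (Suc j) then f else g) ! k \<noteq> None" "c + int (Suc j) < hs ! k" for j k
    using label_values_mem[of j us k hs g f "c + 1"] that by (auto split: if_splits)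
  show ?case
  proof (cases i; cases i')
    assume i: "i = 0" "i' = 0"
    have "inj_on ((!) u) (set (filter (\<lambda>k. f ! k \<noteq> None \<and> c < hs ! k) [0..<length hs]))"
      using d(1) unfolding row_values_def distinct_map by blast
    then show ?thesis using Cons.prems i by (auto dest: inj_onD)
  next
    fix j assume i: "i = 0" "i' = Suc j"
    have "u ! k \<in> set (row_values f hs c u)" using active[OF Cons.prems(3)] Cons.prems(4,5) i(1) by simp
    moreover have "us ! j ! k' \<in> set (label_values hs us g f (c + 1))" using rest[of j k'] Cons.prems(6-9) i by simp
    ultimately show ?thesis using d(3) Cons.prems(10) unfolding i by (simp add: disjoint_iff)
  next
    fix j assume i: "i = Suc j" "i' = 0"
    have "u ! k' \<in> set (row_values f hs c u)" using active[OF Cons.prems(7)] Cons.prems(8,9) i(2) by simp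
    moreover have "us ! j ! k \<in> set (label_values hs us g f (c + 1))" using rest[of j k] Cons.prems(2-5) i by simp
    ultimately show ?thesis using d(3) Cons.prems(10) unfolding i by (simp add: disjoint_iff)
  next
    fix j j' assume i: "i = Suc j" "i' = Suc j'"
    then show ?thesis using Cons.IH[OF d(2), of j j'] Cons.prems by (auto split: if_splits)
  qed
qed simp

lemma component_unique: "sep G Cs \<Longrightarrow> E \<in> set Cs \<Longrightarrow> C \<in> set Cs \<Longrightarrow> k \<in> set E \<Longrightarrow> k \<in> set C \<Longrightarrow> E = C"
  by (induction Cs) fastforce+

text \<open>Components may have different periods, but they are disjoint, so looking up a node finds
  the window of the component it belongs to.\<close>

lemma lookup_pairs:
  assumes "sep G Cs"
  shows "(k, c) \<in> (\<Union>E\<in>set Cs. labels (set E) (hof T E) p) \<longleftrightarrow>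
    k \<in> \<Union>(set ` set Cs) \<and> 0 \<le> c \<and> c < lookup 0 (concat (map (period_pairs T) Cs)) k \<and> even (dcol G k + p + c)"
proof (cases "k \<in> \<Union>(set ` set Cs)")
  case False
  then show ?thesis by (auto simp: labels_def valid_def)
next
  case True
  then obtain E where E: "E \<in> set Cs" "k \<in> set E" by blast
  have uniq: "C = E" if "C \<in> set Cs" "k \<in> set C" for C using component_unique[OF assms that(1) E(1) that(2) E(2)] .
  have look: "lookup 0 (concat (map (period_pairs T) Cs)) k = hof T E"
  proof (cases "map_of (concat (map (period_pairs T) Cs)) k")
    case None
    then show ?thesis using E by (force simp: map_of_eq_None_iff period_pairs_def)
  next
    case (Some h)
    then have "(k, h) \<in> set (concat (map (period_pairs T) Cs))" by (rule map_of_SomeD)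
    then obtain C where "C \<in> set Cs" "k \<in> set C" "h = hof T C" by (auto simp: period_pairs_def)
    then show ?thesis using uniq Some by (simp add: lookup_def)
  qed
  have "(k, c) \<in> (\<Union>E\<in>set Cs. labels (set E) (hof T E) p) \<longleftrightarrow> (k, c) \<in> labels (set E) (hof T E) p"
  proof
    assume "(k, c) \<in> (\<Union>E\<in>set Cs. labels (set E) (hof T E) p)"
    then obtain C where C: "C \<in> set Cs" "(k, c) \<in> labels (set C) (hof T C) p" by blast
    then have "k \<in> set C" by (simp add: labels_def valid_def)
    then show "(k, c) \<in> labels (set E) (hof T E) p" using uniq[OF C(1)] C(2) by simp
  qed (use E in blast)
  then show ?thesis using E True unfolding look by (simp add: labels_def valid_def) blast
qed

lemma tX_inj_values:
  assumes J: "set J \<subseteq> {..<rank G}" and L: "\<And>k c. (k, c) \<in> L \<longleftrightarrow> k \<in> set J \<and> 0 \<le> c \<and> c < hs ! k \<and> even (dcol G k + p + c)"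
    and hs: "length hs = rank G" and r: "\<And>k. k < rank G \<Longrightarrow> nat (hs ! k) \<le> Suc r"
    and d: "distinct (label_values hs (trop_table (layers G J p) (layers G J (p + 1)) r (weight_vector G J)) (layers G J p) (layers G J (p + 1)) 0)"
  shows "inj_on (tX (set J) p (\<lambda>k. if k \<in> set J then weight G k else 0)) L"
    "l \<in> L \<Longrightarrow> tX (set J) p (\<lambda>k. if k \<in> set J then weight G k else 0) l \<in>
      set (label_values hs (trop_table (layers G J p) (layers G J (p + 1)) r (weight_vector G J)) (layers G J p) (layers G J (p + 1)) 0)"
proof -
  let ?R = "trop_table (layers G J p) (layers G J (p + 1)) r (weight_vector G J)"
  have *: "k < length hs \<and> nat c < length ?R \<and> (if even (nat c) then layers G J p else layers G J (p + 1)) ! k \<noteq> None \<and> 0 + int (nat c) < hs ! k \<and>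
      tX (set J) p (\<lambda>k. if k \<in> set J then weight G k else 0) (k, c) = ?R ! nat c ! k" if "(k, c) \<in> L" for k c
  proof -
    have l: "k \<in> set J" "0 \<le> c" "c < hs ! k" "even (dcol G k + p + c)" using that L by blast+
    have k: "k < rank G" using l J by blast
    have ev: "even (nat c) \<longleftrightarrow> even c" using l(2) by (simp add: even_nat_iff)
    have "nat c \<le> r" using r[OF k] l by linarith
    then show ?thesis
      using l k ev hs trop_table_label[OF J order.refl l(1), of c r "nat (- c)" p] by (auto simp: length_trop_table layers_def)
  qed
  show "inj_on (tX (set J) p (\<lambda>k. if k \<in> set J then weight G k else 0)) L"
  proof (rule inj_onI)
    fix l l' assume l: "l \<in> L" "l' \<in> L" "tX (set J) p (\<lambda>k. if k \<in> set J then weight G k else 0) l = tX (set J) p (\<lambda>k. if k \<in> set J then weight G k else 0) l'"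
    obtain k c k' c' where kc: "l = (k, c)" "l' = (k', c')" by fastforce
    note a = *[of k c] and b = *[of k' c']
    have "nat c = nat c' \<and> k = k'"
      using label_values_inj[OF d, of "nat c" k "nat c'" k'] a b l unfolding kc by simp
    then show "l = l'" using L l unfolding kc by auto
  qed
  show "tX (set J) p (\<lambda>k. if k \<in> set J then weight G k else 0) l \<in> set (label_values hs ?R (layers G J p) (layers G J (p + 1)) 0)" if "l \<in> L"
  proof -
    obtain k c where kc: "l = (k, c)" by fastforce
    show ?thesis using *[of k c] that label_values_mem[of "nat c" ?R k hs "layers G J p" "layers G J (p + 1)" 0] unfolding kc by simp
  qed
qed

text \<open>The valuation is the global weight restricted to \<open>D - {i}\<close>. It has value 0
  at \<open>i\<close>, as \<open>tX_match\<close> demands, and the same starting values are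
  propagated through the belt of \<open>D\<close> and through that of
  \<open>D - {i}\<close>.\<close>

lemma check_tropD:
  assumes c: "check_trop G T D i xs" and D: "distinct D" "set D \<subseteq> {..<rank G}" "i \<in> set D"
  defines "L \<equiv> set (all_labels G T (remove1 i D) (dcol G i))"
  obtains \<omega> where "\<omega> i = 0" "inj_on (tX (set D - {i}) (dcol G i) \<omega>) L"
    "\<And>e l v. (e, l, v) \<in> set xs \<Longrightarrow> fst l \<in> set D \<Longrightarrow> e \<in> L \<and> tX (set D - {i}) (dcol G i) \<omega> e \<noteq> 0 \<and>
       tX (set D - {i}) (dcol G i) \<omega> e = tX (set D) (dcol G i) \<omega> l"
proof -
  define J where "J = remove1 i D"
  define p where "p = dcol G i"
  define hs where "hs = periods G T J"
  define ps where "ps = map (\<lambda>(e :: lab, l :: lab, v :: int). (fst l, snd l, v)) (filter (\<lambda>(e, l, v). 0 \<le> snd l) xs)"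
  define ns where "ns = map (\<lambda>(e :: lab, l :: lab, v :: int). (fst l, - snd l, v)) (filter (\<lambda>(e, l, v). snd l < 0) xs)"
  define TJ where "TJ = trop_table (layers G J p) (layers G J (p + 1)) (max_of nat hs) (weight_vector G J)"
  define F where "F = trop_table (layers G D p) (layers G D (p + 1)) (max_row ps) (weight_vector G J)"
  define B where "B = trop_table (layers G D (p + 1)) (layers G D p) (max_row ns) (weight_vector G J)"
  define \<omega> where "\<omega> = (\<lambda>k. if k \<in> set J then weight G k else 0)"
  have J: "set J = set D - {i}" "set J \<subseteq> {..<rank G}" "set J \<subseteq> set D" "distinct J" using D by (auto simp: J_def)
  have c': "list_all (\<lambda>(e, l, v). is_label G J hs p e \<and> v \<noteq> 0) xs"
    "quick_distinct (label_values hs TJ (layers G J p) (layers G J (p + 1)) 0)"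
    "match_rows TJ 0 (map (\<lambda>(e, l, v). (fst e, snd e, v)) xs)" "match_rows F 0 ps" "match_rows B 0 ns"
    using c unfolding check_trop_def check_match_def check_rows_def J_def[symmetric] p_def[symmetric] hs_def[symmetric]
      ps_def[symmetric] ns_def[symmetric] TJ_def[symmetric] F_def[symmetric] B_def[symmetric] by blast+
  have len: "length hs = rank G" by (simp add: hs_def periods_def)
  have L: "(k, c) \<in> L \<longleftrightarrow> k \<in> set J \<and> 0 \<le> c \<and> c < hs ! k \<and> even (dcol G k + p + c)" for k c
  proof -
    have "hs ! k = lookup 0 (concat (map (period_pairs T) (components G J))) k" if "k \<in> set J"
    proof -
      have "k < rank G" using that J(2) by blast
      then show ?thesis by (simp add: hs_def periods_def)
    qed
    moreover have "(k, c) \<in> L \<longleftrightarrow> k \<in> set J \<and> 0 \<le> c \<and> c < lookup 0 (concat (map (period_pairs T) (components G J))) k \<and> even (dcol G k + p + c)"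
      using lookup_pairs[OF sep_components[OF wf_diagramD(2)[OF wf] J(4)], of k c T p]
      unfolding L_def set_all_labels components_Union J_def[symmetric] p_def[symmetric] .
    ultimately show ?thesis by auto
  qed
  have r: "nat (hs ! k) \<le> Suc (max_of nat hs)" if "k < rank G" for k
    using max_of_ge[of "hs ! k" hs nat] that len by simp
  have inj: "inj_on (tX (set J) p \<omega>) L"
    unfolding \<omega>_def by (rule tX_inj_values(1)[OF J(2) L len r quick_distinct]) (use c'(2) in \<open>simp_all add: TJ_def\<close>)
  show ?thesis
  proof (rule that)
    show "\<omega> i = 0" using J by (simp add: \<omega>_def)
    show "inj_on (tX (set D - {i}) (dcol G i) \<omega>) L" using inj unfolding J(1) p_def .
    fix e l v assume el: "(e, l, v) \<in> set xs" "fst l \<in> set D"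
    obtain k a where l: "l = (k, a)" by fastforce
    obtain k' a' where e: "e = (k', a')" by fastforce
    have lab: "is_label G J hs p e" "v \<noteq> 0" using c'(1) el(1) unfolding list_all_iff by auto
    have eL: "e \<in> L" using lab(1) unfolding e L is_label_def by simp
    have a': "k' \<in> set J" "0 \<le> a'" "a' < hs ! k'" using eL unfolding e L by auto
    have "(k', a', v) \<in> set (map (\<lambda>(e, l, v). (fst e, snd e, v)) xs)" using el(1) unfolding e by force
    then obtain n where "n < length TJ" "a' = 0 + int n" "TJ ! n ! k' = v" using match_rows[OF c'(3)] by blast
    then have "TJ ! nat a' ! k' = v" "nat a' \<le> max_of nat hs" by (auto simp: TJ_def length_trop_table)
    then have tJ: "tX (set J) p \<omega> e = v"
      unfolding \<omega>_def e TJ_def using trop_table_label[OF J(2) order.refl a'(1), of a' "max_of nat hs" "nat (- a')" p] a'(2) by simp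
    have "tX (set D) p \<omega> l = v"
    proof (cases "a \<ge> 0")
      case True
      then have "(k, a, v) \<in> set ps" using el(1) unfolding l ps_def by force
      then obtain n where "n < length F" "a = 0 + int n" "F ! n ! k = v" using match_rows[OF c'(4)] by blast
      then have "F ! nat a ! k = v" "nat a \<le> max_row ps" by (auto simp: F_def length_trop_table)
      then show ?thesis
        unfolding \<omega>_def l F_def using trop_table_label[OF D(2) J(3), of k a "max_row ps" "nat (- a)" p] el(2) True unfolding l by simp
    next
      case False
      then have "(k, - a, v) \<in> set ns" using el(1) unfolding l ns_def by force
      then obtain n where "n < length B" "- a = 0 + int n" "B ! n ! k = v" using match_rows[OF c'(5)] by blast
      then have "B ! nat (- a) ! k = v" "nat (- a) \<le> max_row ns" by (auto simp: B_def length_trop_table)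
      then show ?thesis
        unfolding \<omega>_def l B_def using trop_table_label[OF D(2) J(3), of k a "nat a" "max_row ns" p] el(2) False unfolding l by simp
    qed
    then show "e \<in> L \<and> tX (set D - {i}) (dcol G i) \<omega> e \<noteq> 0 \<and> tX (set D - {i}) (dcol G i) \<omega> e = tX (set D) (dcol G i) \<omega> l"
      using tJ lab(2) eL unfolding J(1) p_def by simp
  qed
qed

lemma per_cong: "st k = st' k \<Longrightarrow> per D h st k = per D h st' k"
  by (simp add: per_def)

lemma certifiedD:
  assumes "certified T E"
  shows "set E \<subseteq> {..<N}" "hof T E > 0" "nice (set E) (labels (set E) (hof T E))"
    "k \<in> set E \<Longrightarrow> per (set E) (hof T E) (st_fun T E) k" "k \<in> set E \<Longrightarrow> st_fun T E k \<in> set E"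
    "k \<in> set E \<Longrightarrow> st_fun T E (st_fun T E k) = k"
    "(i, e, l, y) \<in> set (stepsof T E) \<Longrightarrow> i \<in> set E" "(i, e, l, y) \<in> set (stepsof T E) \<Longrightarrow> fst l \<in> set E"
    "(i, e, l, y) \<in> set (stepsof T E) \<Longrightarrow> good s \<Longrightarrow> bip (set E) s \<Longrightarrow> joined (set E) (dcol G i) s (i, 0) l"
  using assms unfolding certified_def by blast+

lemma shift_props:
  assumes E: "certified T E" and v: "valid (set E) p l" and s: "good s" "bip (set E) s"
  shows "valid (set E) p (shift (stof T E) (hof T E) m l)" "X (set E) p s (shift (stof T E) (hof T E) m l) = X (set E) p s l"
    "joined (set E) p s x (shift (stof T E) (hof T E) m l) \<longleftrightarrow> joined (set E) p s x l"
proof -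
  note c = certifiedD[OF E]
  have k: "fst l \<in> set E" using v by (simp add: valid_def)
  have sv: "valid (set E) p (shift (stof T E) (hof T E) m l)" for m
  proof (cases "even m")
    case True
    then show ?thesis using v by (simp add: shift_def valid_def)
  next
    case False
    have "even (dcol G (st_fun T E (fst l)) + dcol G (fst l) + hof T E)" using c(4)[OF k] unfolding per_def by blast
    moreover have "even (dcol G (fst l) + p + snd l)" using v by (simp add: valid_def)
    ultimately have "even (dcol G (st_fun T E (fst l)) + p + (snd l + m * hof T E))" using False by auto
    then show ?thesis using False c(5)[OF k] by (simp add: shift_def valid_def)
  qed
  show "valid (set E) p (shift (stof T E) (hof T E) m l)" by (rule sv)
  have one: "X (set E) p s (shift (stof T E) (hof T E) (m + 1) l) = X (set E) p s (shift (stof T E) (hof T E) m l)"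
     "joined (set E) p s x (shift (stof T E) (hof T E) (m + 1) l) \<longleftrightarrow> joined (set E) p s x (shift (stof T E) (hof T E) m l)" for m
  proof -
    obtain k' c' where kc: "shift (stof T E) (hof T E) m l = (k', c')" by fastforce
    have k': "k' \<in> set E" using sv[of m] kc by (simp add: valid_def)
    have "shift (stof T E) (hof T E) (m + 1) l = (st_fun T E k', c' + hof T E)"
      using kc c(6)[OF k] by (auto simp: shift_def algebra_simps)
    then show "X (set E) p s (shift (stof T E) (hof T E) (m + 1) l) = X (set E) p s (shift (stof T E) (hof T E) m l)"
      "joined (set E) p s x (shift (stof T E) (hof T E) (m + 1) l) \<longleftrightarrow> joined (set E) p s x (shift (stof T E) (hof T E) m l)"
      using perD(1)[OF c(4)[OF k'] s c(1), of p c'] joined_per[OF c(4)[OF k'] s c(1), of p c'] sv[of m] unfolding kc by auto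
  qed
  have "X (set E) p s (shift (stof T E) (hof T E) m l) = X (set E) p s l \<and> (joined (set E) p s x (shift (stof T E) (hof T E) m l) \<longleftrightarrow> joined (set E) p s x l)"
  proof (induction m rule: int_induct[where k = 0])
    case base
    show ?case by (simp add: shift_def)
  next
    case (step1 m)
    then show ?case using one[of m] by simp
  next
    case (step2 m)
    then show ?case using one[of "m - 1"] by simp
  qed
  then show "X (set E) p s (shift (stof T E) (hof T E) m l) = X (set E) p s l"
    "joined (set E) p s x (shift (stof T E) (hof T E) m l) \<longleftrightarrow> joined (set E) p s x l" by blast+
qed

text \<open>The claim is moved to the belt position of \<open>eu\<close>, where either the light
  cone or the entry of \<open>E\<close> settles it. It is then moved back, the periods are removed
  from \<open>ev\<close>, and \<open>joined_mono\<close> passes from the component to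
  \<open>F\<close>.\<close>

lemma joined_in_correct:
  assumes E: "certified T E" and F: "F \<subseteq> {..<N}" "set E \<subseteq> F" and no: "\<And>i j. i \<in> set E \<Longrightarrow> j \<in> F - set E \<Longrightarrow> dA G i j = 0"
    and c: "joined_in G T j eu ev m E" and s: "good s" "bip F s"
  shows "joined F (dcol G j) s eu ev"
proof (rule joined_mono[OF F no s])
  note cE = certifiedD[OF E]
  let ?f = "shift (stof T E) (hof T E) m ev"
  have c': "fst eu \<in> set E" "fst ev \<in> set E" "even (dcol G (fst eu) + dcol G j + snd eu)" "even (dcol G (fst ev) + dcol G j + snd ev)"
    "is_joined G T E (fst eu) (fst ?f, snd ?f - snd eu)"
    using c unfolding joined_in_def Let_def by auto
  show "fst eu \<in> set E" "fst ev \<in> set E" using c' by auto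
  have bE: "bip (set E) s" using bip_mono[OF s(2) F(2)] .
  define w where "w = belt (set E) (dcol G j) s (snd eu)"
  have w: "good w" "bip (set E) w" using good_belt[OF s(1) cE(1)] bip_belt[OF bE cE(1)] by (auto simp: w_def)
  have v: "valid (set E) (dcol G j) ev" using c' by (simp add: valid_def)
  note sp = shift_props[OF E v s(1) bE, where m = m]
  have fE: "fst ?f \<in> set E" using sp(1) by (simp add: valid_def)
  have "joined (set E) (dcol G (fst eu)) w (fst eu, 0) (fst ?f, snd ?f - snd eu)"
  proof (cases "coslice G (fst eu) (fst ?f, snd ?f - snd eu)")
    case True
    then have "known (set E) (fst eu) (fst ?f, snd ?f - snd eu) (fst ?f, snd ?f - snd eu)"
      using fE c'(1) by (intro coslice_known[OF cE(1)]) auto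
    then show ?thesis using w unfolding known_def by blast
  next
    case False
    then obtain e y where "(fst eu, e, (fst ?f, snd ?f - snd eu), y) \<in> set (stepsof T E)"
      using c'(5) unfolding is_joined_def list_ex_iff by fastforce
    then show ?thesis using cE(9) w by blast
  qed
  moreover have "even (dcol G (fst eu) - (dcol G j + snd eu))" using c'(3) by presburger
  ultimately have "joined (set E) (dcol G j + snd eu) w (fst eu, 0) (fst ?f, snd ?f - snd eu)"
    using joined_parity by blast
  then have "joined (set E) (dcol G j) s eu ?f"
    unfolding w_def joined_shift[OF s(1) bE cE(1)] by simp
  then show "joined (set E) (dcol G j) s eu ev" using sp(3) by simp
qed

end

section \<open>Soundness of one table entry\<close>

locale certificate = diagram_seeds N P G for N and P :: "'a::field set" and G :: diagram +
  fixes T :: table and D :: "nat list"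
  assumes sub: "set D \<subseteq> {..<N}" and chk: "check_entry G T D"
    and smaller: "\<And>i E. i \<in> set D \<Longrightarrow> E \<in> set (components G (remove1 i D)) \<Longrightarrow> certified T E"
begin

lemma D: "distinct D" "set D \<subseteq> {..<N}" and D_rank: "set D \<subseteq> {..<rank G}"
  using chk sub unfolding check_entry_def list_all_iff by auto

lemma remove: "set (remove1 i D) = set D - {i}" "distinct (remove1 i D)"
  using D by auto

lemma nice_remove: "i \<in> set D \<Longrightarrow> nice (set D - {i}) (\<lambda>p. set (all_labels G T (remove1 i D) p))"
proof -
  assume i: "i \<in> set D"
  have "nice (set (remove1 i D)) (\<lambda>p. set (all_labels G T (remove1 i D) p))"
    using D(2) remove(1)[of i] by (intro nice_components[OF remove(2)] smaller[OF i]) auto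
  then show ?thesis unfolding remove(1) .
qed

lemma known_trop:
  assumes c: "check_trop G T D i xs" "(e, l, v) \<in> set xs" and i: "i \<in> set D" and l: "valid (set D) (dcol G i) l"
    and j: "\<And>s. good s \<Longrightarrow> bip (set D) s \<Longrightarrow> joined (set D) (dcol G i) s (i, 0) l"
  shows "known (set D) i e l"
proof -
  obtain \<omega> where w: "\<omega> i = 0" "inj_on (tX (set D - {i}) (dcol G i) \<omega>) (set (all_labels G T (remove1 i D) (dcol G i)))"
    "\<And>e l v. (e, l, v) \<in> set xs \<Longrightarrow> fst l \<in> set D \<Longrightarrow> e \<in> set (all_labels G T (remove1 i D) (dcol G i)) \<and>
       tX (set D - {i}) (dcol G i) \<omega> e \<noteq> 0 \<and> tX (set D - {i}) (dcol G i) \<omega> e = tX (set D) (dcol G i) \<omega> l"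
    using check_tropD[OF c(1) D(1) D_rank i] by blast
  have "fst l \<in> set D" using l by (simp add: valid_def)
  then show ?thesis using known_match[OF D(2) i nice_remove[OF i] j l _ w(2) _ _ w(1)] w(3)[OF c(2)] by blast
qed

lemma is_known_correct:
  assumes "is_known G prev j e l" "\<forall>(j, e, l)\<in>set prev. known (set D) j e l" "j \<in> set D" "fst l \<in> set D"
  shows "known (set D) j e l"
  using assms coslice_known[OF D(2)] unfolding is_known_def by fastforce

lemma triangle_joined:
  assumes c: "check_triangle G T D prev (i, e, l, v, j, c, eu, ev, m)" and i: "i \<in> set D" and l: "fst l \<in> set D"
    and prev: "\<forall>(j, e, l)\<in>set prev. known (set D) j e l" and s: "good s" "bip (set D) s"
  shows "joined (set D) (dcol G i) s (i, 0) l"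
proof -
  obtain E where E: "E \<in> set (components G (remove1 j D))" "joined_in G T j eu ev m E" and j: "j \<in> set D"
    and u: "is_known G prev j eu (i, - c)" and w: "is_known G prev j ev (fst l, snd l - c)"
    using c unfolding check_triangle_def list_ex_iff by auto
  have sub: "set E \<subseteq> set D - {j}" using components_Union[of G "remove1 j D"] E(1) remove(1)[of j] by blast
  have "joined (set D) (dcol G i) s (i, 0) (fst l, snd l)"
  proof (rule triangle[OF D(2) i j l nice_remove[OF j] _ _ _ s])
    show "known (set D) j eu (i, - c)" using is_known_correct[OF u prev j] i by simp
    show "known (set D) j ev (fst l, snd l - c)" using is_known_correct[OF w prev j] l by simp
    fix s assume s: "good s" "bip (set D - {j}) s"
    show "joined (set D - {j}) (dcol G j) s eu ev"
    proof (rule joined_in_correct[OF smaller[OF j E(1)] _ sub _ E(2) s])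
      show "set D - {j} \<subseteq> {..<N}" using D by blast
      show "dA G a b = 0" if "a \<in> set E" "b \<in> set D - {j} - set E" for a b
        using component_orth[OF remove(2) E(1)] that remove(1)[of j] by blast
    qed
  qed
  then show ?thesis by simp
qed

text \<open>A step may appeal only to triples established before it, so induction along the list
  excludes circular evidence.\<close>

lemma check_steps_known:
  "check_steps G T D prev xs \<Longrightarrow> \<forall>(j, e, l)\<in>set prev. known (set D) j e l \<Longrightarrow> set xs \<subseteq> set (stepsof T D) \<Longrightarrow>
    \<forall>(j, e, l)\<in>triple ` set xs. known (set D) j e l"
proof (induction xs arbitrary: prev)
  case (Cons x xs)
  obtain i e l v j c eu ev m where x: "x = (i, e, l, v, j, c, eu, ev, m)" by (cases x) auto
  have c: "i \<in> set D" "fst l \<in> set D" "even (dcol G (fst l) + dcol G i + snd l)" "coslice G i l \<or> check_triangle G T D prev x"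
    "check_steps G T D (triple x # prev) xs"
    using Cons.prems(1) by (auto simp: check_step_def x)
  have "stepsof T D \<noteq> []" using Cons.prems(3) by auto
  then have "check_trop_steps G T D i" using chk c(1) unfolding check_entry_def list_all_iff by blast
  then have t: "check_trop G T D i (steps_at T D i)"
    unfolding check_trop_steps_def .
  have "x \<in> set (filter (\<lambda>x. fst x = i) (stepsof T D))" using Cons.prems(3) by (simp add: x)
  then have "(\<lambda>(i, e, l, v, _). (e, l, v)) x \<in> set (steps_at T D i)" unfolding steps_at_def set_map by (rule imageI)
  then have "(e, l, v) \<in> set (steps_at T D i)" by (simp add: x)
  then have "known (set D) i e l"
  proof (rule known_trop[OF t _ c(1)])
    show "valid (set D) (dcol G i) l" using c by (simp add: valid_def)
    fix s assume s: "good s" "bip (set D) s"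
    show "joined (set D) (dcol G i) s (i, 0) l"
    proof (cases "coslice G i l")
      case True
      then show ?thesis using coslice_known[OF D(2) c(1,2)] s unfolding known_def by blast
    next
      case False
      then show ?thesis using triangle_joined[OF _ c(1,2) Cons.prems(2) s] c(4) unfolding x by blast
    qed
  qed
  then have k: "\<forall>(j, e, l)\<in>set (triple x # prev). known (set D) j e l"
    using Cons.prems(2) by (simp add: x triple_def)
  then show ?case using Cons.IH[OF c(5) k] Cons.prems(3) by auto
qed simp

lemma steps_known: "(j, e, l) \<in> triple ` set (stepsof T D) \<Longrightarrow> known (set D) j e l"
  using check_steps_known[of "[]" "stepsof T D"] chk unfolding check_entry_def by auto

lemma st: "k \<in> set D \<Longrightarrow> st_fun T D k \<in> set D" "k \<in> set D \<Longrightarrow> st_fun T D (st_fun T D k) = k" and h: "hof T D > 0"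
  using chk unfolding check_entry_def list_all_iff by auto

lemma per_rank1: assumes "D = [k]" "check_per G T D" shows "per (set D) (hof T D) (st_fun T D) k"
  using nice_singleton(2)[of k] assms D(2) per_cong[of id k "st_fun T D"] by (simp add: check_per_def)

lemma per_rank2:
  assumes Dkl: "D = [k, l]" and c: "check_per G T D" and j: "j \<in> set D"
  shows "per (set D) (hof T D) (st_fun T D) j"
proof -
  have kl: "k < N" "l < N" "k \<noteq> l" using D unfolding Dkl by auto
  have two: "{k, l} = {l, k}" by auto
  consider "dA G k l = 1" "dA G l k = 1" "hof T D = 5" "st_fun T D k = l" "st_fun T D l = k"
    | "dA G k l = 2 \<and> dA G l k = 1 \<or> dA G k l = 1 \<and> dA G l k = 2" "hof T D = 6" "st_fun T D k = k" "st_fun T D l = l"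
    | "dA G k l = 3 \<and> dA G l k = 1 \<or> dA G k l = 1 \<and> dA G l k = 3" "rank G = 2" "hof T D = 8" "st_fun T D k = k" "st_fun T D l = l"
    using c unfolding Dkl check_per_def by auto
  then have "per {k, l} (hof T D) (st_fun T D) k \<and> per {l, k} (hof T D) (st_fun T D) l"
  proof cases
    case 1
    then show ?thesis
      using per_A2[of k l] per_A2[of l k] kl per_cong[of "transpose k l" k "st_fun T D"] per_cong[of "transpose l k" l "st_fun T D"] by simp
  next
    case 2
    then show ?thesis
      using per_B2[of k l] per_B2[of l k] kl per_cong[of id k "st_fun T D"] per_cong[of id l "st_fun T D"] by auto
  next
    case 3
    \<comment> \<open>The index set is exactly the pair, as the computation without coefficients
      requires.\<close>
    then have "N = 2" using kl N_le by simp
    then have I: "{..<N} = {k, l}" using kl by auto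
    then have I': "{..<N} = {l, k}" using two by simp
    show ?thesis
      using per_G2[OF I] per_G2[OF I'] 3 per_cong[of id k "st_fun T D"] per_cong[of id l "st_fun T D"] by auto
  qed
  then show ?thesis using j unfolding Dkl two[symmetric] by auto
qed

lemma per_general:
  assumes c: "case perof T D of (i, e, (k, c), vs) \<Rightarrow> check_anchor G T D i e k c vs (map triple (stepsof T D)) (stof T D) (hof T D)"
    and j: "j \<in> set D"
  shows "per (set D) (hof T D) (st_fun T D) j"
proof -
  let ?X = "map triple (stepsof T D)"
  obtain i e k a vs where "perof T D = (i, e, (k, a), vs)" by (cases "perof T D") auto
  define ys where "ys = map2 (\<lambda>j v. ((j, int (distance G k j)), (st_fun T D j, int (distance G k j) + hof T D), v)) (remove1 k D) vs"
  have c: "i \<in> set D" "k \<in> set D" "is_known G ?X i e (k, a)" "is_known G ?X i e (st_fun T D k, a + hof T D)"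
    "\<And>j. j \<in> set D \<Longrightarrow> j \<noteq> k \<Longrightarrow> coslice G k (j, int (distance G k j)) \<and> coslice G (st_fun T D k) (st_fun T D j, int (distance G k j))"
    "length vs = length (remove1 k D)" "check_trop G T D k ys"
    using c unfolding \<open>perof T D = _\<close> check_anchor_def list_all_iff ys_def by auto
  have X: "\<forall>(j, e, l)\<in>set ?X. known (set D) j e l" unfolding set_map using steps_known by blast
  have known: "known (set D) i e (k, a)" "known (set D) i e (st_fun T D k, a + hof T D)"
    using is_known_correct[OF c(3) X c(1)] is_known_correct[OF c(4) X c(1)] c(2) st(1) by simp_all
  have Pk: "per (set D) (hof T D) (st_fun T D) k"
    by (rule per_known[where st = "st_fun T D" and h = "hof T D", OF D(2) c(1) nice_remove[OF c(1)] known])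
  show ?thesis
  proof (cases "j = k")
    case False
    let ?d = "int (distance G k j)"
    obtain \<omega> where w: "\<omega> k = 0" "inj_on (tX (set D - {k}) (dcol G k) \<omega>) (set (all_labels G T (remove1 k D) (dcol G k)))"
      "\<And>e l v. (e, l, v) \<in> set ys \<Longrightarrow>
         fst l \<in> set D \<Longrightarrow> e \<in> set (all_labels G T (remove1 k D) (dcol G k)) \<and>
         tX (set D - {k}) (dcol G k) \<omega> e \<noteq> 0 \<and> tX (set D - {k}) (dcol G k) \<omega> e = tX (set D) (dcol G k) \<omega> l"
      using check_tropD[OF c(7) D(1) D_rank c(2)] by blast
    have "j \<in> set (remove1 k D)" using False j remove(1)[of k] by blast
    then obtain m where m: "m < length (remove1 k D)" "j = remove1 k D ! m" by (metis in_set_conv_nth)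
    then have "ys ! m = ((j, ?d), (st_fun T D j, ?d + hof T D), vs ! m)" "m < length ys"
      using c(6) by (simp_all add: ys_def)
    then have in_list: "((j, ?d), (st_fun T D j, ?d + hof T D), vs ! m) \<in> set ys" by (metis nth_mem)
    note w3 = w(3)[OF in_list]
    show ?thesis
    proof (rule per_propagate[OF D(2) c(2) nice_remove[OF c(2)] Pk _ _ _ w(2) _ _ w(1)])
      show "known (set D) k (j, ?d) (j, ?d)" using coslice_known[OF D(2) c(2)] c(5)[OF j False] j by simp
      show "known (set D) (st_fun T D k) (st_fun T D j, ?d) (st_fun T D j, ?d)"
        using coslice_known[OF D(2) st(1)[OF c(2)]] c(5)[OF j False] st(1)[OF j] by simp
    qed (use w3 st(1)[OF j] in auto)
  qed (use Pk in simp)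
qed

lemma per_all:
  assumes j: "j \<in> set D"
  shows "per (set D) (hof T D) (st_fun T D) j"
proof -
  have c: "check_per G T D" using chk unfolding check_entry_def by blast
  consider k where "D = [k]" | k l where "D = [k, l]" | k l m xs where "D = k # l # m # xs"
    using j by (metis empty_iff empty_set neq_Nil_conv)
  then show ?thesis
  proof cases
    case 1 then show ?thesis using per_rank1[OF 1 c] j by simp
  next
    case 2 then show ?thesis using per_rank2[OF 2 c j] by simp
  next
    case 3
    then show ?thesis using per_general[OF _ j] c unfolding check_per_def by simp
  qed
qed

lemma tX_labels:
  "inj_on (tX (set D) p (weight G)) (labels (set D) (hof T D) p)"
  "l \<in> labels (set D) (hof T D) p \<Longrightarrow> tX (set D) p (weight G) l \<noteq> 0"
proof -
  let ?t = "\<lambda>p. tX (set D) p (weight G)"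
  have c: "inj_on (?t q) (labels (set D) (hof T D) q) \<and> (\<forall>l\<in>labels (set D) (hof T D) q. ?t q l \<noteq> 0)" if "check_inj G T D q" for q
  proof -
    let ?hs = "map (lookup 0 (period_pairs T D)) [0..<rank G]"
    let ?V = "label_values ?hs (trop_table (layers G D q) (layers G D (q + 1)) (nat (hof T D)) (weight_vector G D)) (layers G D q) (layers G D (q + 1)) 0"
    have d: "0 \<notin> set ?V" "distinct ?V" using that quick_distinct unfolding check_inj_def nonzero_distinct_def by auto
    have look: "?hs ! k = (if k \<in> set D then hof T D else 0)" if "k < rank G" for k
    proof (cases "k \<in> set D")
      case True
      then have "lookup 0 (period_pairs T D) k = hof T D"
        by (simp add: lookup_def period_pairs_def map_of_map_restrict)
      then show ?thesis using that True by simp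
    next
      case False
      then have "map_of (period_pairs T D) k = None" by (auto simp: period_pairs_def map_of_eq_None_iff)
      then show ?thesis using that False by (simp add: lookup_def)
    qed
    have L: "(k, c) \<in> labels (set D) (hof T D) q \<longleftrightarrow> k \<in> set D \<and> 0 \<le> c \<and> c < ?hs ! k \<and> even (dcol G k + q + c)" for k c
      using look[of k] D_rank by (auto simp: labels_def valid_def)
    have r: "nat (?hs ! k) \<le> Suc (nat (hof T D))" if "k < rank G" for k using look[OF that] by simp
    have len: "length ?hs = rank G" by simp
    note v = tX_inj_values[OF D_rank L len r d(2)]
    have eq: "?t q l = tX (set D) q (\<lambda>k. if k \<in> set D then weight G k else 0) l" if "l \<in> labels (set D) (hof T D) q" for l
      using that by (intro tX_cong) (auto simp: labels_def valid_def)
    have "inj_on (?t q) (labels (set D) (hof T D) q) \<longleftrightarrow>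
        inj_on (tX (set D) q (\<lambda>k. if k \<in> set D then weight G k else 0)) (labels (set D) (hof T D) q)"
      by (rule inj_on_cong) (rule eq)
    then have "inj_on (?t q) (labels (set D) (hof T D) q)" using v(1) by simp
    moreover have "?t q l \<noteq> 0" if "l \<in> labels (set D) (hof T D) q" for l
    proof -
      have "?t q l \<in> set ?V" unfolding eq[OF that] by (rule v(2)[OF _ that])
      then show ?thesis using d(1) by metis
    qed
    ultimately show ?thesis by blast
  qed
  \<comment> \<open>Labels and tropical belts depend only on the parity of the base, so the two
    evaluated cases cover every \<open>p\<close>.\<close>
  define q where "q = p mod 2"
  have q: "q = 0 \<or> q = 1" "even (p - q)" by (auto simp: q_def)
  have "check_inj G T D q" using q(1) chk unfolding check_entry_def by blast
  then show "inj_on (?t p) (labels (set D) (hof T D) p)" "l \<in> labels (set D) (hof T D) p \<Longrightarrow> ?t p l \<noteq> 0"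
    using c[of q] tX_parity[OF q(2), of "set D"] labels_parity[OF q(2)] by (auto simp: inj_on_def)
qed

lemma covered_label:
  assumes i: "i \<in> set D" and e: "e \<in> set (all_labels G T (remove1 i D) (dcol G i))"
  shows "\<exists>l. valid (set D) (dcol G i) l \<and> (\<forall>s. good s \<longrightarrow> bip (set D) s \<longrightarrow> joined (set D) (dcol G i) s (i, 0) l \<and>
    X (set D - {i}) (dcol G i) s e = X (set D) (dcol G i) s l)"
proof -
  have known: ?thesis if "known (set D) i e l" for l using that unfolding known_def by blast
  obtain E where E: "E \<in> set (components G (remove1 i D))" "e \<in> labels (set E) (hof T E) (dcol G i)"
    using e unfolding set_all_labels by blast
  have sub: "set E \<subseteq> set D - {i}" using components_Union[of G "remove1 i D"] E(1) remove(1)[of i] by blast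
  have ve: "valid (set E) (dcol G i) e" using E(2) by (simp add: labels_def)
  have eD: "fst e \<in> set D" "fst e \<in> set E" using ve sub by (auto simp: valid_def)
  have "covered_entry G T (map fst (steps_at T D i)) i E" using chk i E(1) unfolding check_entry_def check_cover_def list_all_iff by blast
  then have "covered G (map fst (steps_at T D i)) i (stof T E) (hof T E) e" using E(2) unfolding covered_entry_def entry_labels_def list_all_iff set_label_list by blast
  then consider "coslice G i e" | "coslice G i (shift (stof T E) (hof T E) (- 1) e)" | "e \<in> fst ` set (steps_at T D i)"
    unfolding covered_def by auto
  then show ?thesis
  proof cases
    case 1
    then show ?thesis using known coslice_known[OF D(2) i eD(1)] by blast
  next
    case 2
    let ?l = "shift (stof T E) (hof T E) (- 1) e"
    note cE = smaller[OF i E(1)]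
    have X: "X (set D - {i}) (dcol G i) s l = X (set E) (dcol G i) s l" if "good s" "bip (set D) s" "fst l \<in> set E" for s l
    proof (rule X_component[OF _ sub _ that(1) _ that(3)])
      show "set D - {i} \<subseteq> {..<N}" using D by blast
      show "bip (set D - {i}) s" using bip_mono[OF that(2)] by blast
      show "dA G a b = 0" if "a \<in> set E" "b \<in> set D - {i} - set E" for a b
        using component_orth[OF remove(2) E(1)] that remove(1)[of i] by blast
    qed
    have eq: "valid (set E) (dcol G i) ?l \<and> X (set E) (dcol G i) s ?l = X (set E) (dcol G i) s e" if s: "good s" "bip (set D) s" for s
    proof -
      have "bip (set E) s" using bip_mono[OF s(2)] sub by blast
      then show ?thesis using shift_props[OF cE ve s(1)] by blast
    qed
    have lE: "fst ?l \<in> set E" using certifiedD(5)[OF cE eD(2)] by (simp add: shift_def)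
    have kl: "known (set D) i ?l ?l" using coslice_known[OF D(2) i _ 2] sub lE by blast
    show ?thesis
    proof (intro exI[of _ ?l] conjI allI impI)
      show "valid (set D) (dcol G i) ?l" using kl unfolding known_def by blast
      fix s assume s: "good s" "bip (set D) s"
      show "joined (set D) (dcol G i) s (i, 0) ?l" using kl s unfolding known_def by blast
      have "X (set D - {i}) (dcol G i) s ?l = X (set D) (dcol G i) s ?l" using kl s unfolding known_def by blast
      then show "X (set D - {i}) (dcol G i) s e = X (set D) (dcol G i) s ?l" using X[OF s lE] X[OF s eD(2)] eq[OF s] by simp
    qed
  next
    case 3
    then obtain l v x where "(i, e, l, v, x) \<in> set (stepsof T D)" unfolding steps_at_def by auto
    moreover have "triple (i, e, l, v, x) = (i, e, l)" by (simp add: triple_def)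
    ultimately have "(i, e, l) \<in> triple ` set (stepsof T D)" by (metis image_eqI)
    then show ?thesis using known steps_known by blast
  qed
qed

theorem certified: "certified T D"
proof -
  have "nice (set D) (labels (set D) (hof T D))"
  proof (cases "\<exists>k. D = [k]")
    case True
    then obtain k where k: "D = [k]" by blast
    have "hof T D = 4" using chk unfolding check_entry_def check_per_def k by simp
    then show ?thesis using nice_singleton(1)[of k] D(2) unfolding k by simp
  next
    case False
    show ?thesis
    proof (rule nice_step[where L = "\<lambda>i p. set (all_labels G T (remove1 i D) p)"])
      show "\<exists>l\<in>set D. l \<noteq> k" if "k \<in> set D" for k
        using D(1) that False by (metis distinct.simps(2) list.set_intros(1,2) neq_Nil_conv empty_iff empty_set)
      show "st_fun T D ` set D = set D" using st by (metis (no_types, lifting) image_iff subsetI subset_antisym image_subsetI)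
    qed (use D(2) per_all h nice_remove covered_label tX_labels(1) in blast)+
  qed
  moreover have "i \<in> set D \<and> fst l \<in> set D \<and> (\<forall>s. good s \<longrightarrow> bip (set D) s \<longrightarrow> joined (set D) (dcol G i) s (i, 0) l)"
    if x: "(i, e, l, y) \<in> set (stepsof T D)" for i e l y
  proof -
    have "triple (i, e, l, y) = (i, e, l)" by (simp add: triple_def)
    then have "(i, e, l) \<in> triple ` set (stepsof T D)" using x by (metis image_eqI)
    then have k: "known (set D) i e l" using steps_known by blast
    have "check_steps G T D prev xs \<Longrightarrow> (i, e, l, y) \<in> set xs \<Longrightarrow> i \<in> set D" for prev xs
      by (induction xs arbitrary: prev) (auto simp: check_step_def)
    then have "i \<in> set D" using chk x unfolding check_entry_def by blast
    then show ?thesis using k unfolding known_def by (simp add: valid_def)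
  qed
  ultimately show ?thesis using D(2) h per_all st tX_labels(2) unfolding certified_def by auto
qed

end

context diagram_seeds
begin

text \<open>The components left after deleting a node are shorter lists, and
  \<open>check_components\<close> guarantees that they are entries of the table themselves.\<close>

theorem certified_table:
  assumes "\<And>D. hof T D > 0 \<Longrightarrow> check_entry G T D"
  shows "hof T D > 0 \<Longrightarrow> set D \<subseteq> {..<N} \<Longrightarrow> certified T D"
proof (induction "length D" arbitrary: D rule: less_induct)
  case less
  have chk: "check_entry G T D" using assms less.prems(1) by blast
  have D: "distinct D" using chk unfolding check_entry_def by blast
  show ?case
  proof (rule certificate.certified, unfold_locales)
    show "check_entry G T D" by (rule chk)
    show "set D \<subseteq> {..<N}" by (rule less.prems(2))
    fix i E assume i: "i \<in> set D" and E: "E \<in> set (components G (remove1 i D))"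
    have "check_components G T D i" using chk i unfolding check_entry_def list_all_iff by blast
    then have E': "hof T E > 0" using E unfolding check_components_def list_all_iff by blast
    then have "distinct E" using assms unfolding check_entry_def by blast
    moreover have sub: "set E \<subseteq> set D - {i}" using components_Union[of G "remove1 i D"] E D by auto
    then have "card (set E) < card (set D)" using i by (intro psubset_card_mono) auto
    ultimately have "length E < length D" using D by (simp add: distinct_card)
    moreover have "set E \<subseteq> {..<N}" using sub less.prems(2) by blast
    ultimately show "certified T E" using less.hyps E' by blast
  qed
qed

end

subsection \<open>Counting faces\<close>

definition label_count :: "diagram \<Rightarrow> int list \<Rightarrow> nat \<Rightarrow> nat" where
  "label_count G hs k = length (filter (\<lambda>c. even (dcol G k + c)) [0..hs ! k - 1])"

fun add_lists :: "int list \<Rightarrow> int list \<Rightarrow> int list" where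
  "add_lists [] ys = ys"
| "add_lists (x # xs) [] = x # xs"
| "add_lists (x # xs) (y # ys) = (x + y) # add_lists xs ys"

text \<open>Cutting off at 0 imitates the subtraction of natural numbers in
  \<open>avoid_count\<close>, so the two recursions agree at every stage.\<close>

fun sub_lists :: "int list \<Rightarrow> int list \<Rightarrow> int list" where
  "sub_lists [] ys = []"
| "sub_lists (x # xs) [] = x # xs"
| "sub_lists (x # xs) (y # ys) = max 0 (x - y) # sub_lists xs ys"

primrec deriv_list :: "int \<Rightarrow> int list \<Rightarrow> int list" where
  "deriv_list n [] = []"
| "deriv_list n (x # xs) = n * x # deriv_list (n + 1) xs"

primrec link_sum :: "diagram \<Rightarrow> (nat list \<Rightarrow> int list) \<Rightarrow> int list \<Rightarrow> nat list \<Rightarrow> nat list \<Rightarrow> int list" where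
  "link_sum G fa hs J [] = []"
| "link_sum G fa hs J (k # ks) = add_lists (map ((*) (int (label_count G hs k))) (fa (remove1 k J))) (link_sum G fa hs J ks)"

definition certified_entry :: "table \<Rightarrow> nat list \<Rightarrow> bool" where
  "certified_entry T E \<longleftrightarrow> hof T E > 0"

text \<open>The \<open>f\<close>-polynomial of a complex has as derivative the sum of the \<open>f\<close>-polynomials of its vertex links.\<close>

definition check_face_list :: "int list \<Rightarrow> int list \<Rightarrow> bool" where
  "check_face_list fs gs \<longleftrightarrow> list_all (\<lambda>x. 0 \<le> x) fs \<and> (case fs of [] \<Rightarrow> False | x # xs \<Rightarrow> x = 1 \<and> deriv_list 1 xs = gs)"

definition check_faces :: "diagram \<Rightarrow> table \<Rightarrow> (nat list \<Rightarrow> int list) \<Rightarrow> nat list \<Rightarrow> bool" where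
  "check_faces G T fa J \<longleftrightarrow> list_all (certified_entry T) (components G J) \<and>
     check_face_list (fa J) (link_sum G fa (periods G T J) J J)"

primrec avoid_list :: "(nat list \<Rightarrow> int list) \<Rightarrow> nat list \<Rightarrow> nat list \<Rightarrow> int list" where
  "avoid_list fa [] J = fa J"
| "avoid_list fa (k # S) J = sub_lists (avoid_list fa S J) (0 # avoid_list fa S (remove1 k J))"

primrec is_forest :: "diagram \<Rightarrow> nat list \<Rightarrow> bool" where
  "is_forest G [] = True"
| "is_forest G (k # ks) = (is_forest G ks \<and> k \<notin> set ks \<and>
     (case filter (\<lambda>j. dA G k j \<noteq> 0) ks of [] \<Rightarrow> True | [j] \<Rightarrow> True | _ \<Rightarrow> False))"

lemma nth_default_add: "nth_default 0 (add_lists xs ys) m = nth_default 0 xs m + nth_default 0 ys m"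
  by (induction xs ys arbitrary: m rule: add_lists.induct) (auto simp: nth_default_Cons split: nat.splits)

lemma nth_default_sub:
  "(\<And>m. 0 \<le> nth_default 0 xs m) \<Longrightarrow> (\<And>m. 0 \<le> nth_default 0 ys m) \<Longrightarrow>
    nth_default 0 (sub_lists xs ys) m = max 0 (nth_default 0 xs m - nth_default 0 ys m)"
proof (induction xs ys arbitrary: m rule: sub_lists.induct)
  case (3 x xs y ys)
  have "0 \<le> nth_default 0 xs m" "0 \<le> nth_default 0 ys m" for m
    using 3(2)[of "Suc m"] 3(3)[of "Suc m"] by (simp_all add: nth_default_Cons)
  then show ?case using 3(1) by (cases m) (simp_all add: nth_default_Cons)
qed (auto simp: max_def intro: antisym)

lemma nth_default_deriv: "nth_default 0 (deriv_list n xs) m = (n + int m) * nth_default 0 xs m"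
  by (induction xs arbitrary: n m) (auto simp: nth_default_Cons algebra_simps split: nat.splits)

lemma nth_default_scale: "nth_default 0 (map ((*) (a::int)) xs) m = a * nth_default 0 xs m"
  by (induction xs arbitrary: m) (auto simp: nth_default_Cons split: nat.splits)

lemma nth_default_link_sum:
  "distinct ks \<Longrightarrow> nth_default 0 (link_sum G fa hs J ks) m =
     (\<Sum>k\<in>set ks. int (label_count G hs k) * nth_default 0 (fa (remove1 k J)) m)"
  by (induction ks) (simp_all add: nth_default_add nth_default_scale)

lemma nth_default_nonneg: "list_all (\<lambda>x. 0 \<le> x) xs \<Longrightarrow> 0 \<le> nth_default (0 :: int) xs m"
  by (auto simp: nth_default_def list_all_length)

text \<open>Increasing lists serve as canonical names of subsets and match the keys of the
  tables.\<close>

definition sublist :: "nat \<Rightarrow> nat set \<Rightarrow> nat list" where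
  "sublist n J = filter (\<lambda>k. k \<in> J) [0..<n]"

lemma sublist_props: "distinct (sublist n J)" "J \<subseteq> {..<n} \<Longrightarrow> set (sublist n J) = J"
  "sublist n J \<in> set (subseqs [0..<n])" "sublist n {..<n} = [0..<n]"
proof -
  have "filter Q xs \<in> set (subseqs xs)" for Q and xs :: "nat list"
    by (induction xs) (auto simp: Let_def)
  then show "sublist n J \<in> set (subseqs [0..<n])" unfolding sublist_def .
qed (auto simp: sublist_def intro!: filter_True)

lemma remove1_sublist: "remove1 k (sublist n J) = sublist n (J - {k})"
proof -
  have "distinct xs \<Longrightarrow> remove1 k (filter (\<lambda>k. k \<in> J) xs) = filter (\<lambda>j. j \<in> J - {k}) xs" for xs
    by (simp add: distinct_remove1_removeAll removeAll_filter_not_eq) (metis (mono_tags, lifting))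
  then show ?thesis unfolding sublist_def using distinct_upt by blast
qed

context diagram_seeds
begin

lemma case_at_most_one: "(case F of [] \<Rightarrow> True | [j] \<Rightarrow> True | _ \<Rightarrow> False) \<Longrightarrow> i \<in> set F \<Longrightarrow> j \<in> set F \<Longrightarrow> i = j"
  by (auto split: list.splits)

lemma is_forest: "is_forest G ks \<Longrightarrow> forest ks"
proof (induction ks)
  case (Cons k ks)
  have "i = j" if "i \<in> set ks" "j \<in> set ks" "dA G k i \<noteq> 0" "dA G k j \<noteq> 0" for i j
  proof -
    have "i \<in> set (filter (\<lambda>j. dA G k j \<noteq> 0) ks)" "j \<in> set (filter (\<lambda>j. dA G k j \<noteq> 0) ks)" using that by auto
    moreover have "case filter (\<lambda>j. dA G k j \<noteq> 0) ks of [] \<Rightarrow> True | [j] \<Rightarrow> True | _ \<Rightarrow> False" using Cons.prems by simp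
    ultimately show ?thesis using case_at_most_one by metis
  qed
  then show ?case using Cons by simp
qed simp

theorem positive_faces:
  assumes T: "\<And>E. hof T E > 0 \<Longrightarrow> set E \<subseteq> {..<N} \<Longrightarrow> certified T E"
    and chk: "\<And>J. J \<in> set (subseqs [0..<N]) \<Longrightarrow> check_faces G T fa J"
    and ks: "set ks = {..<N}" "is_forest G ks" and s: "good s" "forest_oriented {..<N} s"
  shows "int (card {f \<in> complex {..<N} s. f \<inter> cl {..<N} s = {} \<and> card f = m}) = nth_default 0 (avoid_list fa ks [0..<N]) m"
proof -
  define L where "L = (\<lambda>J p. set (all_labels G T (sublist N J) p))"
  define cf where "cf = (\<lambda>J m. nat (nth_default 0 (fa (sublist N J)) m))"
  have chk': "check_faces G T fa (sublist N J)" for J using chk sublist_props(3) by blast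
  have comp: "certified T E" if "J \<subseteq> {..<N}" "E \<in> set (components G (sublist N J))" for J E
  proof -
    have "hof T E > 0" using chk'[of J] that(2) unfolding check_faces_def certified_entry_def list_all_iff by blast
    moreover have "set E \<subseteq> {..<N}"
      using components_Union[of G "sublist N J"] that sublist_props(2)[OF that(1)] by auto
    ultimately show ?thesis by (rule T)
  qed
  have nice: "nice J (L J)" if J: "J \<subseteq> {..<N}" for J
    using nice_components[OF sublist_props(1)[of N J] _ comp[OF J]] sublist_props(2)[OF J] J unfolding L_def by simp
  have int_cf: "int (cf J m) = nth_default 0 (fa (sublist N J)) m" for J m
    using chk'[of J] nth_default_nonneg[of "fa (sublist N J)" m] unfolding check_faces_def check_face_list_def cf_def by simp
  have cf0: "cf J 0 = 1" for J
    using chk'[of J] unfolding check_faces_def check_face_list_def cf_def by (auto split: list.splits)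
  have cf: "Suc m * cf J (Suc m) = (\<Sum>l\<in>L J 0. cf (J - {fst l}) m)" if J: "J \<subseteq> {..<N}" for J m
  proof -
    let ?hs = "periods G T (sublist N J)"
    obtain fs where fs: "fa (sublist N J) = 1 # fs" "deriv_list 1 fs = link_sum G fa ?hs (sublist N J) (sublist N J)"
      using chk'[of J] unfolding check_faces_def check_face_list_def by (auto split: list.splits)
    \<comment> \<open>Labels are grouped by their node, since the type of the link depends on the
      node and not on the time.\<close>
    have LJ: "L J 0 = (SIGMA k:J. set (filter (\<lambda>c. even (dcol G k + c)) [0..?hs ! k - 1]))"
    proof (rule set_eqI)
      fix l :: lab
      obtain k c where l: "l = (k, c)" by fastforce
      have "?hs ! k = lookup 0 (concat (map (period_pairs T) (components G (sublist N J)))) k" if "k \<in> J"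
      proof -
        have "k < rank G" using that J N_le by auto
        then show ?thesis by (simp add: periods_def)
      qed
      then show "l \<in> L J 0 \<longleftrightarrow> l \<in> (SIGMA k:J. set (filter (\<lambda>c. even (dcol G k + c)) [0..?hs ! k - 1]))"
        using lookup_pairs[OF sep_components[OF wf_diagramD(2)[OF wf] sublist_props(1)], of k c T 0 N J]
        unfolding L_def set_all_labels components_Union sublist_props(2)[OF J] l by auto
    qed
    have fin: "finite J" using J by (rule finite_subset) simp
    have "(\<Sum>l\<in>L J 0. cf (J - {fst l}) m) = (\<Sum>k\<in>J. \<Sum>c\<in>set (filter (\<lambda>c. even (dcol G k + c)) [0..?hs ! k - 1]). cf (J - {k}) m)"
    proof -
      have "\<forall>k\<in>J. finite (set (filter (\<lambda>c. even (dcol G k + c)) [0..?hs ! k - 1]))" using finite_set by blast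
      then show ?thesis unfolding LJ by (simp only: sum.Sigma[OF fin] case_prod_unfold)
    qed
    also have "\<dots> = (\<Sum>k\<in>J. label_count G ?hs k * cf (J - {k}) m)"
    proof (rule sum.cong)
      fix k
      have "distinct (filter (\<lambda>c. even (dcol G k + c)) [0..?hs ! k - 1])" by simp
      then have "card (set (filter (\<lambda>c. even (dcol G k + c)) [0..?hs ! k - 1])) = label_count G ?hs k"
        unfolding label_count_def by (rule distinct_card)
      then show "(\<Sum>c\<in>set (filter (\<lambda>c. even (dcol G k + c)) [0..?hs ! k - 1]). cf (J - {k}) m) = label_count G ?hs k * cf (J - {k}) m"
        by simp
    qed simp
    finally have "int (\<Sum>l\<in>L J 0. cf (J - {fst l}) m) = (\<Sum>k\<in>J. int (label_count G ?hs k) * int (cf (J - {k}) m))" by simp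
    also have "\<dots> = nth_default 0 (deriv_list 1 fs) m"
      unfolding fs(2) nth_default_link_sum[OF sublist_props(1)] sublist_props(2)[OF J] int_cf by (simp add: remove1_sublist)
    also have "\<dots> = int (Suc m * cf J (Suc m))" unfolding nth_default_deriv of_nat_mult int_cf fs(1) by (simp add: nth_default_Cons)
    finally show ?thesis by (simp only: of_nat_eq_iff)
  qed
  have av: "int (avoid_count cf S J m) = nth_default 0 (avoid_list fa S (sublist N J)) m" for S J m
  proof (induction S arbitrary: J m)
    case (Cons k S)
    have nn: "0 \<le> nth_default 0 (avoid_list fa S (sublist N J)) m" for J m using Cons[of J m] by (metis of_nat_0_le_iff)
    have nn': "0 \<le> nth_default 0 (0 # avoid_list fa S (sublist N (J - {k}))) m" for m using nn by (cases m) (simp_all add: nth_default_Cons)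
    show ?case
      unfolding avoid_list.simps remove1_sublist nth_default_sub[OF nn nn']
      by (cases m) (simp_all add: Cons[symmetric] nth_default_Cons)
  qed (simp add: int_cf)
  have "card {f \<in> complex (set ks) s. f \<inter> cl (set ks) s = {} \<and> card f = m} = avoid_count cf ks (set ks) m"
  proof (rule positive_face_count[where L = L])
    show "forest ks" using is_forest[OF ks(2)] .
    show "finite (L J 0)" for J by (simp add: L_def)
  qed (use ks s nice cf0 cf in auto)
  then show ?thesis using av[of ks "{..<N}" m] unfolding ks(1) sublist_props(4) by simp
qed

end

subsection \<open>Positive rational functions and their tropical valuations\<close>

definition monomial :: "'a::field_char_0 ^ 'n::finite \<Rightarrow> ('n \<Rightarrow>\<^sub>0 nat) \<Rightarrow> 'a" where
  "monomial x m = (\<Prod>i\<in>UNIV. (x $ i) ^ Poly_Mapping.lookup m i)"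

text \<open>A polynomial with positive integer coefficients is kept as a list of monomials, where
  repetition encodes the coefficient.\<close>

definition msum :: "'a::field_char_0 ^ 'n::finite \<Rightarrow> ('n \<Rightarrow>\<^sub>0 nat) list \<Rightarrow> 'a" where
  "msum x ms = sum_list (map (monomial x) ms)"

definition poly_of :: "('n \<Rightarrow>\<^sub>0 nat) list \<Rightarrow> 'n::finite rat_mpoly" where
  "poly_of ms = sum_list (map (\<lambda>m. Poly_Mapping.single m 1) ms)"

definition mmult :: "('n \<Rightarrow>\<^sub>0 nat) list \<Rightarrow> ('n \<Rightarrow>\<^sub>0 nat) list \<Rightarrow> ('n \<Rightarrow>\<^sub>0 nat) list" where
  "mmult A C = concat (map (\<lambda>m. map ((+) m) C) A)"

definition wt :: "('n::finite \<Rightarrow> int) \<Rightarrow> ('n \<Rightarrow>\<^sub>0 nat) \<Rightarrow> int" where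
  "wt \<omega> m = (\<Sum>i\<in>UNIV. \<omega> i * int (Poly_Mapping.lookup m i))"

definition trop :: "('n::finite \<Rightarrow> int) \<Rightarrow> ('n \<Rightarrow>\<^sub>0 nat) list \<Rightarrow> int" where
  "trop \<omega> A = Max (wt \<omega> ` set A)"

definition positive :: "'a::field_char_0 ^ 'n::finite \<Rightarrow> 'a set" where
  "positive x = {msum x A / msum x C | A C. A \<noteq> [] \<and> C \<noteq> []}"

text \<open>One representation as a quotient is chosen; \<open>valuation_eq\<close> shows that all
  of them give the same value.\<close>

definition valuation :: "'a::field_char_0 ^ 'n::finite \<Rightarrow> ('n \<Rightarrow> int) \<Rightarrow> 'a \<Rightarrow> int" where
  "valuation x \<omega> f = (let (A, C) = SOME (A, C). A \<noteq> [] \<and> C \<noteq> [] \<and> f = msum x A / msum x C in trop \<omega> A - trop \<omega> C)"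

lemma mpoly_eval_superset:
  assumes "finite S" "Poly_Mapping.keys p \<subseteq> S"
  shows "mpoly_eval p x = (\<Sum>m\<in>S. of_rat (Poly_Mapping.lookup p m) * monomial x m)"
  unfolding mpoly_eval_def monomial_def using assms
  by (intro sum.mono_neutral_left) (auto simp: in_keys_iff)

lemma mpoly_eval_add: "mpoly_eval (p + q) x = mpoly_eval p x + mpoly_eval q x"
proof -
  define S where "S = Poly_Mapping.keys p \<union> Poly_Mapping.keys q \<union> Poly_Mapping.keys (p + q)"
  have S: "finite S" "Poly_Mapping.keys p \<subseteq> S" "Poly_Mapping.keys q \<subseteq> S" "Poly_Mapping.keys (p + q) \<subseteq> S" by (auto simp: S_def)
  show ?thesis
    unfolding mpoly_eval_superset[OF S(1,2)] mpoly_eval_superset[OF S(1,3)] mpoly_eval_superset[OF S(1,4)]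
    by (simp add: lookup_add of_rat_add distrib_right sum.distrib)
qed

lemma mpoly_eval_diff: "mpoly_eval (p - q) x = mpoly_eval p x - mpoly_eval q x"
  using mpoly_eval_add[of "p - q" q x] by simp

lemma mpoly_eval_poly_of: "mpoly_eval (poly_of ms) x = msum x ms"
proof (induction ms)
  case Nil
  show ?case by (simp add: poly_of_def msum_def mpoly_eval_def)
next
  case (Cons m ms)
  have "mpoly_eval (Poly_Mapping.single m 1) x = monomial x m"
    by (subst mpoly_eval_superset[of "{m}"]) auto
  then show ?case using Cons by (simp add: poly_of_def msum_def mpoly_eval_add)
qed

lemma lookup_poly_of: "Poly_Mapping.lookup (poly_of ms) m = of_nat (count_list ms m)"
  by (induction ms) (auto simp: poly_of_def lookup_add lookup_single when_def)

text \<open>By algebraic independence the polynomials agree. Their coefficients are multiplicities,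
  which are nonzero rationals exactly on the support, so the support can be recovered from the
  value.\<close>

lemma msum_eq_imp_set_eq:
  assumes "alg_independent x" "msum x A = msum x C"
  shows "set A = set C"
proof -
  have "mpoly_eval (poly_of A - poly_of C) x = 0" using assms(2) by (simp add: mpoly_eval_diff mpoly_eval_poly_of)
  then have eq: "poly_of A = poly_of C" using assms(1) unfolding alg_independent_def by (metis right_minus_eq)
  have "count_list A m = count_list C m" for m
    using arg_cong[OF eq, of "\<lambda>p. Poly_Mapping.lookup p m"] unfolding lookup_poly_of by simp
  then have "m \<in> set A \<longleftrightarrow> m \<in> set C" for m by (metis count_list_0_iff)
  then show ?thesis by blast
qed

lemma msum_nonzero: "alg_independent x \<Longrightarrow> A \<noteq> [] \<Longrightarrow> msum x A \<noteq> 0"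
  using msum_eq_imp_set_eq[of x A "[]"] by (auto simp: msum_def)

lemma monomial_add: "monomial x (m + m') = monomial x m * monomial x m'"
  by (simp add: monomial_def lookup_add power_add prod.distrib)

lemma msum_append: "msum x (A @ C) = msum x A + msum x C"
  by (simp add: msum_def)

lemma msum_mmult: "msum x (mmult A C) = msum x A * msum x C"
proof (induction A)
  case (Cons m A)
  have "msum x (map ((+) m) C) = monomial x m * msum x C"
    by (simp add: msum_def o_def monomial_add sum_list_const_mult)
  moreover have "mmult (m # A) C = map ((+) m) C @ mmult A C" by (simp add: mmult_def)
  ultimately show ?case using Cons by (simp add: msum_append distrib_right) (simp add: msum_def distrib_right)
qed (simp add: mmult_def msum_def)

lemma mmult_Nil: "mmult A C = [] \<longleftrightarrow> A = [] \<or> C = []"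
  by (cases A) (auto simp: mmult_def)

lemma wt_add: "wt \<omega> (m + m') = wt \<omega> m + wt \<omega> m'"
  by (simp add: wt_def lookup_add distrib_left sum.distrib)

lemma trop_append: "A \<noteq> [] \<Longrightarrow> C \<noteq> [] \<Longrightarrow> trop \<omega> (A @ C) = max (trop \<omega> A) (trop \<omega> C)"
  unfolding trop_def by (simp add: image_Un Max_Un)

text \<open>Positive coefficients never cancel, so the support of a product consists of all sums of
  exponents, and the sum of two maximizers is a maximizer.\<close>

lemma trop_mmult:
  assumes "A \<noteq> []" "C \<noteq> []"
  shows "trop \<omega> (mmult A C) = trop \<omega> A + trop \<omega> C"
proof -
  have "\<exists>a\<in>set A. wt \<omega> a = trop \<omega> A" if "A \<noteq> []" for A
    using Max_in[of "wt \<omega> ` set A"] that unfolding trop_def by fastforce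
  then obtain a c where ac: "a \<in> set A" "wt \<omega> a = trop \<omega> A" "c \<in> set C" "wt \<omega> c = trop \<omega> C" using assms by meson
  have le: "wt \<omega> m \<le> trop \<omega> B" if "m \<in> set B" for m B using that unfolding trop_def by simp
  show ?thesis
    unfolding trop_def[of \<omega> "mmult A C"]
  proof (rule Max_eqI)
    fix y assume "y \<in> wt \<omega> ` set (mmult A C)"
    then obtain m m' where "m \<in> set A" "m' \<in> set C" "y = wt \<omega> (m + m')" by (auto simp: mmult_def)
    then show "y \<le> trop \<omega> A + trop \<omega> C" using le[of m A] le[of m' C] by (simp add: wt_add)
  next
    have "a + c \<in> set (mmult A C)" using ac by (auto simp: mmult_def)
    then show "trop \<omega> A + trop \<omega> C \<in> wt \<omega> ` set (mmult A C)" using ac by (metis image_eqI wt_add)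
  qed simp
qed

context
  fixes x :: "'a::field_char_0 ^ 'n::finite"
  assumes ind: "alg_independent x"
begin

text \<open>After cross-multiplication two representations become equal sums of monomials. Equal
  sums have equal supports, and \<open>trop\<close> depends on nothing else.\<close>

lemma valuation_eq:
  assumes "A \<noteq> []" "C \<noteq> []"
  shows "valuation x \<omega> (msum x A / msum x C) = trop \<omega> A - trop \<omega> C"
proof -
  define Q where "Q = (\<lambda>(A', C'). A' \<noteq> [] \<and> C' \<noteq> [] \<and> msum x A / msum x C = msum x A' / msum x C')"
  have "Q (SOME y. Q y)" by (rule someI[of Q "(A, C)"]) (use assms in \<open>simp add: Q_def\<close>)
  moreover obtain A' C' where ac: "(SOME y. Q y) = (A', C')" by fastforce
  ultimately have Q: "A' \<noteq> []" "C' \<noteq> []" "msum x A / msum x C = msum x A' / msum x C'" unfolding Q_def by auto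
  have "msum x (mmult A C') = msum x (mmult A' C)"
    using Q(3) msum_nonzero[OF ind assms(2)] msum_nonzero[OF ind Q(2)] by (simp add: msum_mmult frac_eq_eq)
  then have "set (mmult A C') = set (mmult A' C)" by (rule msum_eq_imp_set_eq[OF ind])
  then have "trop \<omega> (mmult A C') = trop \<omega> (mmult A' C)" by (simp add: trop_def)
  then have "trop \<omega> A' - trop \<omega> C' = trop \<omega> A - trop \<omega> C" using assms Q by (simp add: trop_mmult)
  moreover have "valuation x \<omega> (msum x A / msum x C) = trop \<omega> A' - trop \<omega> C'"
    using ac unfolding valuation_def Q_def by simp
  ultimately show ?thesis by simp
qed

lemma positive_add:
  assumes "A \<noteq> []" "C \<noteq> []" "A' \<noteq> []" "C' \<noteq> []"
  shows "msum x A / msum x C + msum x A' / msum x C' = msum x (mmult A C' @ mmult A' C) / msum x (mmult C C')"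
  using msum_nonzero[OF ind assms(2)] msum_nonzero[OF ind assms(4)] by (simp add: msum_append msum_mmult add_frac_eq)

lemma positive_mult: "msum x A / msum x C * (msum x A' / msum x C') = msum x (mmult A A') / msum x (mmult C C')"
  by (simp add: msum_mmult)

lemma semifield_positive: "semifield_seeds {..<N} (positive x)"
proof
  have one: "msum x [0] = 1" by (simp add: msum_def monomial_def)
  show "1 \<in> positive x" unfolding positive_def using one by (metis (mono_tags, lifting) div_by_1 mem_Collect_eq not_Cons_self2)
  fix f g assume "f \<in> positive x" "g \<in> positive x"
  then obtain A C A' C' where *: "A \<noteq> []" "C \<noteq> []" "A' \<noteq> []" "C' \<noteq> []" "f = msum x A / msum x C" "g = msum x A' / msum x C'"
    unfolding positive_def by blast
  have "f + g = msum x (mmult A C' @ mmult A' C) / msum x (mmult C C')" unfolding *(5,6) using positive_add *(1-4) .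
  moreover have "mmult A C' @ mmult A' C \<noteq> []" "mmult C C' \<noteq> []" using * by (auto simp: mmult_Nil)
  ultimately show "f + g \<in> positive x" unfolding positive_def by blast
  have "f * g = msum x (mmult A A') / msum x (mmult C C')" unfolding *(5,6) by (rule positive_mult)
  moreover have "mmult A A' \<noteq> []" "mmult C C' \<noteq> []" using * by (auto simp: mmult_Nil)
  ultimately show "f * g \<in> positive x" unfolding positive_def by blast
  have "f / g = msum x (mmult A C') / msum x (mmult C A')" unfolding *(5,6) by (simp add: msum_mmult)
  moreover have "mmult A C' \<noteq> []" "mmult C A' \<noteq> []" using * by (auto simp: mmult_Nil)
  ultimately show "f / g \<in> positive x" unfolding positive_def by blast
next
  show "0 \<notin> positive x" unfolding positive_def using msum_nonzero[OF ind] by auto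
qed simp

lemma trop_hom_valuation: "semifield_seeds.trop_hom (positive x) (valuation x \<omega>)"
proof -
  interpret semifield_seeds "{..<0}" "positive x" by (rule semifield_positive)
  show ?thesis
    unfolding trop_hom_def
  proof (intro ballI)
    fix f g assume "f \<in> positive x" "g \<in> positive x"
    then obtain A C A' C' where *: "A \<noteq> []" "C \<noteq> []" "A' \<noteq> []" "C' \<noteq> []" "f = msum x A / msum x C" "g = msum x A' / msum x C'"
      unfolding positive_def by blast
    have 1: "f + g = msum x (mmult A C' @ mmult A' C) / msum x (mmult C C')" unfolding *(5,6) using positive_add *(1-4) .
    have 2: "f * g = msum x (mmult A A') / msum x (mmult C C')" unfolding *(5,6) by (rule positive_mult)
    have nn: "mmult A C' \<noteq> []" "mmult A' C \<noteq> []" "mmult C C' \<noteq> []" "mmult A A' \<noteq> []" using * by (auto simp: mmult_Nil)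
    have "valuation x \<omega> (f + g) = trop \<omega> (mmult A C' @ mmult A' C) - trop \<omega> (mmult C C')"
      unfolding 1 using nn by (intro valuation_eq) auto
    moreover have "valuation x \<omega> (f * g) = trop \<omega> (mmult A A') - trop \<omega> (mmult C C')"
      unfolding 2 using nn by (intro valuation_eq) auto
    moreover have "valuation x \<omega> f = trop \<omega> A - trop \<omega> C" "valuation x \<omega> g = trop \<omega> A' - trop \<omega> C'"
      unfolding *(5,6) using * by (auto intro: valuation_eq)
    ultimately show "valuation x \<omega> (f * g) = valuation x \<omega> f + valuation x \<omega> g \<and>
        valuation x \<omega> (f + g) = max (valuation x \<omega> f) (valuation x \<omega> g)"
      using * nn by (simp add: trop_append trop_mmult max_def)
  qed
qed

lemma variable_props: "x $ i \<in> positive x" "valuation x \<omega> (x $ i) = \<omega> i"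
proof -
  have one: "msum x [0] = 1" by (simp add: msum_def monomial_def)
  have "(x $ j) ^ Poly_Mapping.lookup (Poly_Mapping.single i 1) j = (if j = i then x $ i else 1)" for j
    by (simp add: lookup_single when_def)
  then have xi: "msum x [Poly_Mapping.single i 1] = x $ i" by (simp add: msum_def monomial_def)
  have eq: "x $ i = msum x [Poly_Mapping.single i 1] / msum x [0]" by (simp only: xi one div_by_1)
  show "x $ i \<in> positive x" unfolding positive_def using eq by blast
  have "\<omega> j * int (Poly_Mapping.lookup (Poly_Mapping.single i 1) j) = (if j = i then \<omega> i else 0)" for j
    by (simp add: lookup_single when_def)
  then have "wt \<omega> (Poly_Mapping.single i 1) = \<omega> i" by (simp add: wt_def)
  moreover have "wt \<omega> 0 = 0" by (simp add: wt_def)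
  ultimately show "valuation x \<omega> (x $ i) = \<omega> i"
    using valuation_eq[of "[Poly_Mapping.single i 1]" "[0]" \<omega>] unfolding eq[symmetric] by (simp add: trop_def)
qed

end

subsection \<open>Seeds indexed by a finite type\<close>

text \<open>Beyond the first \<open>N\<close> nodes the variables are 1 and the entries 0. This
  gives the matrix the support that \<open>good\<close> asks for and lets mutated seeds agree as
  total functions.\<close>

definition numbered :: "(nat \<Rightarrow> 'n) \<Rightarrow> nat \<Rightarrow> ('a::field_char_0, 'n::finite) seed \<Rightarrow> 'a fseed" where
  "numbered \<iota> N s = ((\<lambda>k. if k < N then fst s $ \<iota> k else 1), (\<lambda>i j. if i < N \<and> j < N then snd s $ \<iota> i $ \<iota> j else 0))"

locale numbered_seeds = semifield_seeds "{..<N}" P for N :: nat and P :: "'a::field_char_0 set" +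
  fixes \<iota> :: "nat \<Rightarrow> 'n::finite"
  assumes bij: "bij_betw \<iota> {..<N} UNIV"
begin

lemma nat_pos_part: "nat (pos_part b) = nat b"
  by (simp add: pos_part_def max_def)

lemma mon_numbered: "mon (fst (numbered \<iota> N s)) (\<lambda>i. e (\<iota> i)) = (\<Prod>i\<in>UNIV. (fst s $ i) ^ nat (e i))"
  unfolding mon_def using prod.reindex_bij_betw[OF bij, of "\<lambda>i. (fst s $ i) ^ nat (e i)"] by (simp add: numbered_def)

lemma mut_numbered:
  assumes k: "k < N"
  shows "mut k (numbered \<iota> N s) = numbered \<iota> N (mutate (\<iota> k) s)"
proof -
  have inj: "\<iota> i = \<iota> j \<longleftrightarrow> i = j" if "i < N" "j < N" for i j
    using bij that unfolding bij_betw_def inj_on_def by blast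
  have mon: "mon (fst (numbered \<iota> N s)) (\<lambda>i. snd (numbered \<iota> N s) i k) = (\<Prod>i\<in>UNIV. (fst s $ i) ^ nat (snd s $ i $ \<iota> k))"
    "mon (fst (numbered \<iota> N s)) (\<lambda>i. - snd (numbered \<iota> N s) i k) = (\<Prod>i\<in>UNIV. (fst s $ i) ^ nat (- (snd s $ i $ \<iota> k)))"
  proof -
    have "mon (fst (numbered \<iota> N s)) (\<lambda>i. snd (numbered \<iota> N s) i k) = mon (fst (numbered \<iota> N s)) (\<lambda>i. snd s $ \<iota> i $ \<iota> k)"
      "mon (fst (numbered \<iota> N s)) (\<lambda>i. - snd (numbered \<iota> N s) i k) = mon (fst (numbered \<iota> N s)) (\<lambda>i. - (snd s $ \<iota> i $ \<iota> k))"
      unfolding mon_def by (rule prod.cong; use k in \<open>simp add: numbered_def\<close>)+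
    then show "mon (fst (numbered \<iota> N s)) (\<lambda>i. snd (numbered \<iota> N s) i k) = (\<Prod>i\<in>UNIV. (fst s $ i) ^ nat (snd s $ i $ \<iota> k))"
      "mon (fst (numbered \<iota> N s)) (\<lambda>i. - snd (numbered \<iota> N s) i k) = (\<Prod>i\<in>UNIV. (fst s $ i) ^ nat (- (snd s $ i $ \<iota> k)))"
      using mon_numbered[of s "\<lambda>i. snd s $ i $ \<iota> k"] mon_numbered[of s "\<lambda>i. - (snd s $ i $ \<iota> k)"] by simp_all
  qed
  have "fst (mut k (numbered \<iota> N s)) l = fst (numbered \<iota> N (mutate (\<iota> k) s)) l" for l
  proof (cases "l = k")
    case True
    then show ?thesis using k
      by (simp add: fst_mut_eq mon) (simp add: numbered_def mutate_def mutate_cluster_def nat_pos_part)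
  next
    case False
    then show ?thesis using k inj[of l k] by (simp add: numbered_def mutate_def mutate_cluster_def)
  qed
  moreover have "snd (mut k (numbered \<iota> N s)) i j = snd (numbered \<iota> N (mutate (\<iota> k) s)) i j" for i j
  proof -
    consider "i < N" "j < N" | "\<not> i < N" | "\<not> j < N" by blast
    then show ?thesis
    proof cases
      case 1
      then show ?thesis using k inj[OF 1(1) k] inj[OF 1(2) k]
        by (simp add: numbered_def mutate_def mutate_matrix_def mutm_def pos_part_def)
    next
      case 2
      then show ?thesis using k by (simp add: numbered_def mutm_def)
    next
      case 3
      then show ?thesis using k by (simp add: numbered_def mutm_def)
    qed
  qed
  ultimately show ?thesis by (simp add: prod_eq_iff ext)
qed

lemma mutation_class_reach: "t \<in> mutation_class s \<Longrightarrow> reach {..<N} {} (numbered \<iota> N s) (numbered \<iota> N t)"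
proof (induction rule: mutation_class.induct)
  case initial
  show ?case by (rule reach.refl)
next
  case (step t k)
  obtain m where m: "m < N" "k = \<iota> m" using bij unfolding bij_betw_def by (metis UNIV_I imageE lessThan_iff)
  show ?case using reach.mut[OF step.IH, of m] m(1) mut_numbered[OF m(1), of t] m(2) by simp
qed

text \<open>Mutation classes contain no relabelling steps, so these are collected in one
  permutation; clusters as sets do not see it.\<close>

lemma reach_mutation_class:
  "reach {..<N} {} (numbered \<iota> N s) t \<Longrightarrow> \<exists>\<sigma> u. \<sigma> permutes {..<N} \<and> u \<in> mutation_class s \<and> t = prm \<sigma> (numbered \<iota> N u)"
proof (induction rule: reach.induct)
  case refl
  have "numbered \<iota> N s = prm id (numbered \<iota> N s)" by simp
  then show ?case using permutes_id mutation_class.initial by blast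
next
  case (mut t k)
  then obtain \<sigma> u where u: "\<sigma> permutes {..<N}" "u \<in> mutation_class s" "t = prm \<sigma> (numbered \<iota> N u)" by blast
  have "\<sigma> k < N" using permutes_in_image[OF u(1), of k] mut.hyps(2) by simp
  then have "mut k t = prm \<sigma> (numbered \<iota> N (mutate (\<iota> (\<sigma> k)) u))"
    unfolding u(3) mut_prm[OF u(1) order.refl] using mut_numbered by simp
  then show ?case using u mutation_class.step by blast
next
  case (prm t \<rho>)
  then obtain \<sigma> u where u: "\<sigma> permutes {..<N}" "u \<in> mutation_class s" "t = prm \<sigma> (numbered \<iota> N u)" by blast
  have "prm \<rho> t = prm (\<sigma> \<circ> \<rho>) (numbered \<iota> N u)" unfolding u(3) by (rule prm_prm)
  then show ?case using u permutes_compose[OF prm.hyps(2) u(1)] by blast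
qed

lemma cl_numbered: "cl {..<N} (numbered \<iota> N s) = cluster s"
proof -
  have "cl {..<N} (numbered \<iota> N s) = (($) (fst s)) ` \<iota> ` {..<N}"
    unfolding image_image by (rule image_cong) (simp_all add: numbered_def)
  then show ?thesis using bij unfolding bij_betw_def cluster_def by simp
qed

lemma complex_numbered: "complex {..<N} (numbered \<iota> N s) = cluster_complex s"
proof (intro equalityI subsetI)
  fix f assume "f \<in> complex {..<N} (numbered \<iota> N s)"
  then obtain t where t: "reach {..<N} {} (numbered \<iota> N s) t" "f \<subseteq> cl {..<N} t" unfolding complex_def by blast
  obtain \<sigma> u where u: "\<sigma> permutes {..<N}" "u \<in> mutation_class s" "t = prm \<sigma> (numbered \<iota> N u)" using reach_mutation_class[OF t(1)] by (elim exE conjE) (rule that)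
  have "cl {..<N} t = cl {..<N} (prm \<sigma> (numbered \<iota> N u))" by (simp only: u(3))
  also have "\<dots> = cl {..<N} (numbered \<iota> N u)" by (rule cl_prm[OF u(1)])
  also have "\<dots> = cluster u" by (rule cl_numbered)
  finally have "f \<in> Pow (cluster u)" using t(2) by simp
  then show "f \<in> cluster_complex s" using u(2) unfolding cluster_complex_def by (rule UN_I[rotated])
next
  fix f assume "f \<in> cluster_complex s"
  then obtain t where t: "t \<in> mutation_class s" "f \<subseteq> cluster t" unfolding cluster_complex_def by blast
  have "f \<subseteq> cl {..<N} (numbered \<iota> N t)" unfolding cl_numbered by (rule t(2))
  then show "f \<in> complex {..<N} (numbered \<iota> N s)"
    using mutation_class_reach[OF t(1)] unfolding complex_def by blast
qed

lemma positive_complex_numbered: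
  "positive_cluster_complex s = {f \<in> complex {..<N} (numbered \<iota> N s). f \<inter> cl {..<N} (numbered \<iota> N s) = {}}"
  unfolding complex_numbered cl_numbered positive_cluster_complex_def full_subcomplex_def
  by (auto simp: cluster_complex_def cluster_variables_def)

lemma face_vector_numbered:
  "face_vector N (positive_cluster_complex s) =
    map (\<lambda>m. card {f \<in> complex {..<N} (numbered \<iota> N s). f \<inter> cl {..<N} (numbered \<iota> N s) = {} \<and> card f = m}) [0..<Suc N]"
proof -
  have "finite f" if "f \<in> complex {..<N} (numbered \<iota> N s)" for f
    using that unfolding complex_def by (auto intro: finite_subset)
  then have "face_number (positive_cluster_complex s) (int m - 1) =
      card {f \<in> complex {..<N} (numbered \<iota> N s). f \<inter> cl {..<N} (numbered \<iota> N s) = {} \<and> card f = m}" for m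
    unfolding face_number_def positive_complex_numbered by (intro arg_cong[of _ _ card]) auto
  \<comment> \<open>A simplex of dimension \<open>m - 1\<close> has \<open>m\<close> vertices, so
    dimensions from \<open>- 1\<close> to \<open>N - 1\<close> correspond to cardinalities from 0 to
    \<open>N\<close>.\<close>
  moreover have "[-1..int N - 1] = map (\<lambda>m. int m - 1) [0..<Suc N]"
    by (rule nth_equalityI) (auto simp: nth_upto simp del: upt_Suc)
  ultimately show ?thesis unfolding face_vector_def by simp
qed

end

text \<open>The initial cluster is algebraically independent, so arbitrary weights on it extend to
  tropical valuations. The diagonal of a symmetrizing matrix provides the positive
  multipliers.\<close>

lemma good_numbered:
  fixes x :: "'a::field_char_0 ^ 'n::finite"
  assumes ind: "alg_independent x" and B: "skew_symmetrizable B" and bij: "bij_betw \<iota> {..<N} UNIV"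
  shows "semifield_seeds.good {..<N} (positive x) (numbered \<iota> N (x, B))"
proof -
  interpret semifield_seeds "{..<N}" "positive x" by (rule semifield_positive[OF ind])
  obtain S where S: "\<And>i. S $ i $ i > 0" "\<And>i j. i \<noteq> j \<Longrightarrow> S $ i $ j = 0" "Finite_Cartesian_Product.transpose (S ** B) = - (S ** B)"
    using B unfolding skew_symmetrizable_def by blast
  have SB: "(S ** B) $ i $ j = S $ i $ i * B $ i $ j" for i j
  proof -
    have "(\<Sum>k\<in>UNIV. S $ i $ k * B $ k $ j) = (\<Sum>k\<in>UNIV. if k = i then S $ i $ i * B $ i $ j else 0)"
      by (rule sum.cong) (auto simp: S(2))
    then show ?thesis by (simp add: matrix_matrix_mult_def)
  qed
  have skew: "S $ i $ i * B $ i $ j = - (S $ j $ j * B $ j $ i)" for i j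
  proof -
    have "(Finite_Cartesian_Product.transpose (S ** B)) $ j $ i = - ((S ** B) $ j $ i)" using S(3) by simp
    then show ?thesis by (simp add: Finite_Cartesian_Product.transpose_def SB)
  qed
  have "\<exists>d. \<forall>i j. d i > 0 \<and> d i * snd (numbered \<iota> N (x, B)) i j = - (d j * snd (numbered \<iota> N (x, B)) j i)"
  proof (intro exI allI conjI)
    fix i j
    show "0 < S $ \<iota> i $ \<iota> i" by (rule S(1))
    show "S $ \<iota> i $ \<iota> i * snd (numbered \<iota> N (x, B)) i j = - (S $ \<iota> j $ \<iota> j * snd (numbered \<iota> N (x, B)) j i)"
      using skew[of "\<iota> i" "\<iota> j"] by (cases "i < N \<and> j < N") (auto simp: numbered_def)
  qed
  moreover have "\<exists>\<tau>. trop_hom \<tau> \<and> (\<forall>i\<in>{..<N}. \<tau> (fst (numbered \<iota> N (x, B)) i) = \<omega> i)" for \<omega>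
  proof (intro exI conjI ballI)
    show "trop_hom (valuation x (\<lambda>i. \<omega> (inv_into {..<N} \<iota> i)))" by (rule trop_hom_valuation[OF ind])
    fix i assume "i \<in> {..<N}"
    then show "valuation x (\<lambda>i. \<omega> (inv_into {..<N} \<iota> i)) (fst (numbered \<iota> N (x, B)) i) = \<omega> i"
      using bij by (simp add: numbered_def variable_props[OF ind] bij_betw_def)
  qed
  moreover have "fst (numbered \<iota> N (x, B)) i \<in> positive x" if "i \<in> {..<N}" for i
    using that variable_props(1)[OF ind] by (simp add: numbered_def)
  moreover have "i \<in> {..<N} \<and> j \<in> {..<N}" if "snd (numbered \<iota> N (x, B)) i j \<noteq> 0" for i j
    using that by (auto simp: numbered_def split: if_splits)
  ultimately show ?thesis unfolding good_def by blast
qed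

lemma subseqs_append: "xs \<in> set (subseqs ys) \<Longrightarrow> xs \<in> set (subseqs (ys @ zs))"
proof (induction ys arbitrary: xs)
  case Nil
  then show ?case by (induction zs) (auto simp: Let_def)
qed (auto simp: Let_def)

lemma sign_pair:
  fixes a b :: int
  assumes "\<bar>a\<bar> = \<alpha>" "\<bar>b\<bar> = \<beta>" "a > 0 \<longleftrightarrow> b < 0" "b > 0 \<longleftrightarrow> a < 0"
  shows "\<exists>e. \<bar>e\<bar> = 1 \<and> a = e * \<alpha> \<and> b = - (e * \<beta>)"
proof (cases "a > 0")
  case True
  then show ?thesis using assms by (intro exI[of _ 1]) simp
next
  case False
  then show ?thesis using assms by (intro exI[of _ "- 1"]) simp
qed

theorem face_vector_positive:
  fixes x :: "'a::field_char_0 ^ 'n::finite" and B :: "int ^ 'n ^ 'n"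
  assumes seed: "is_seed (x, B)" and X: "bij_betw \<pi> (UNIV :: 'n set) {..<N}"
    "\<And>i j. cartan_counterpart B $ i $ j = M ! \<pi> i ! \<pi> j"
    and G: "wf_diagram G" "N \<le> rank G" and M: "\<And>i j. i < N \<Longrightarrow> j < N \<Longrightarrow> i \<noteq> j \<Longrightarrow> M ! i ! j = - dA G i j"
    and T: "\<And>D. hof T D > 0 \<Longrightarrow> check_entry G T D"
    and faces: "list_all (check_faces G T fa) (subseqs [0..<rank G])"
    and ks: "set ks = {..<N}" "is_forest G ks" and fv: "avoid_list fa ks [0..<N] = map int fv" "length fv = Suc N"
  shows "face_vector CARD('n) (positive_cluster_complex (x, B)) = fv"
proof -
  define \<iota> where "\<iota> = inv_into UNIV \<pi>"
  have bij: "bij_betw \<iota> {..<N} UNIV" unfolding \<iota>_def using X(1) by (rule bij_betw_inv_into)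
  have \<pi>\<iota>: "\<pi> (\<iota> k) = k" if "k < N" for k
    using X(1) that unfolding \<iota>_def bij_betw_def by (simp add: f_inv_into_f)
  have card: "CARD('n) = N" using bij_betw_same_card[OF X(1)] by simp
  have ind: "alg_independent x" and B: "skew_symmetrizable B"
    using seed by (simp_all add: is_seed_def free_generating_def)
  interpret numbered_seeds N "positive x" \<iota>
    using semifield_positive[OF ind] bij by (simp add: numbered_seeds_def numbered_seeds_axioms_def)
  interpret diagram_seeds N "positive x" G
    using semifield_positive[OF ind] G by (simp add: diagram_seeds_def diagram_seeds_axioms_def)
  let ?s = "numbered \<iota> N (x, B)"
  have good: "good ?s" by (rule good_numbered[OF ind B bij])
  have abs: "\<bar>snd ?s i j\<bar> = dA G i j" if "i < N" "j < N" "i \<noteq> j" for i j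
  proof -
    have "\<iota> i \<noteq> \<iota> j" using \<pi>\<iota> that by metis
    then have "- \<bar>B $ \<iota> i $ \<iota> j\<bar> = M ! i ! j" using X(2)[of "\<iota> i" "\<iota> j"] \<pi>\<iota> that by (simp add: cartan_counterpart_def)
    then show ?thesis using M[OF that] that by (simp add: numbered_def)
  qed
  \<comment> \<open>The Cartan counterpart determines absolute values only. Skew-symmetrizability
    makes the two signs of a pair opposite, which leaves an arbitrary orientation of the
    tree.\<close>
  have fo: "forest_oriented {..<N} ?s"
    unfolding forest_oriented_def
  proof (intro ballI)
    fix i j assume "i \<in> {..<N}" "j \<in> {..<N}"
    then have ij: "i < N" "j < N" by auto
    show "\<exists>e. \<bar>e\<bar> = 1 \<and> snd ?s i j = e * dA G i j \<and> snd ?s j i = - (e * dA G j i)"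
    proof (cases "i = j")
      case True
      then show ?thesis using goodD(3)[OF good] by (intro exI[of _ 1]) simp
    next
      case False
      show ?thesis
        by (rule sign_pair[OF abs[OF ij False] abs[OF ij(2,1) False[symmetric]] goodD(4)[OF good] goodD(4)[OF good]])
    qed
  qed
  have cf: "check_faces G T fa J" if "J \<in> set (subseqs [0..<N])" for J
  proof -
    have "[0..<rank G] = [0..<N] @ [N..<rank G]" using G(2) upt_add_eq_append[of 0 N "rank G - N"] by simp
    then show ?thesis using faces subseqs_append[OF that, of "[N..<rank G]"] unfolding list_all_iff by simp
  qed
  have c: "int (card {f \<in> complex {..<N} ?s. f \<inter> cl {..<N} ?s = {} \<and> card f = m}) = nth_default 0 (map int fv) m" for m
    unfolding fv(1)[symmetric]
  proof (rule positive_faces[where T = T])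
    fix E assume "hof T E > 0" "set E \<subseteq> {..<N}"
    then show "certified T E" by (intro certified_table T)
  qed (rule cf ks good fo; assumption?)+
  have "card {f \<in> complex {..<N} ?s. f \<inter> cl {..<N} ?s = {} \<and> card f = m} = nth_default 0 fv m" for m
    using c[of m] nth_default_map_eq[of int 0 0 fv m] by simp
  then have "face_vector N (positive_cluster_complex (x, B)) = map (nth_default 0 fv) [0..<length fv]"
    unfolding face_vector_numbered fv(2) by simp
  also have "\<dots> = fv" by (rule nth_equalityI) (auto simp: nth_default_def)
  finally show ?thesis unfolding card .
qed

subsection \<open>Certificates for the exceptional diagrams\<close>

definition colour_E8 :: "nat \<Rightarrow> int" where
  "colour_E8 k = [0, 1, 1, 0, 1, 0, 1, 0] ! k"

definition neighbours_E8 :: "nat \<Rightarrow> (nat \<times> int) list" where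
  "neighbours_E8 k = [[(2, 1)], [(3, 1)], [(0, 1), (3, 1)], [(1, 1), (2, 1), (4, 1)], [(3, 1), (5, 1)], [(4, 1), (6, 1)], [(5, 1), (7, 1)], [(6, 1)]] ! k"

definition distance_E8 :: "nat \<Rightarrow> nat \<Rightarrow> nat" where
  "distance_E8 i =
    (if i = 0 then (!) [0, 3, 1, 2, 3, 4, 5, 6] else
     (if i = 1 then (!) [3, 0, 2, 1, 2, 3, 4, 5] else
     (if i = 2 then (!) [1, 2, 0, 1, 2, 3, 4, 5] else
     (if i = 3 then (!) [2, 1, 1, 0, 1, 2, 3, 4] else
     (if i = 4 then (!) [3, 2, 2, 1, 0, 1, 2, 3] else
     (if i = 5 then (!) [4, 3, 3, 2, 1, 0, 1, 2] else
     (if i = 6 then (!) [5, 4, 4, 3, 2, 1, 0, 1] else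
     (!) [6, 5, 5, 4, 3, 2, 1, 0])))))))"

definition weight_E8 :: "nat \<Rightarrow> int" where
  "weight_E8 k = [- 70, 67, 34, 16, 24, - 56, - 65, - 6] ! k"

definition diagram_E8 :: diagram where
  "diagram_E8 = Diagram 8 colour_E8 neighbours_E8 distance_E8 weight_E8"

text \<open>The keys with a nonzero value are the 44 connected subdiagrams, of types A, D and E. The
  value is the Coxeter number plus 2, the number of steps after which the belt returns up to the
  involution.\<close>

definition period_E8 :: "nat list \<Rightarrow> int" where
  "period_E8 E = (
    if E = [0] then 4
    else if E = [1] then 4
    else if E = [2] then 4
    else if E = [3] then 4
    else if E = [4] then 4
    else if E = [5] then 4
    else if E = [6] then 4
    else if E = [7] then 4
    else if E = [0, 2] then 5
    else if E = [1, 3] then 5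
    else if E = [2, 3] then 5
    else if E = [3, 4] then 5
    else if E = [4, 5] then 5
    else if E = [5, 6] then 5
    else if E = [6, 7] then 5
    else if E = [0, 2, 3] then 6
    else if E = [1, 2, 3] then 6
    else if E = [1, 3, 4] then 6
    else if E = [2, 3, 4] then 6
    else if E = [3, 4, 5] then 6
    else if E = [4, 5, 6] then 6
    else if E = [5, 6, 7] then 6
    else if E = [0, 1, 2, 3] then 7
    else if E = [0, 2, 3, 4] then 7
    else if E = [1, 2, 3, 4] then 8
    else if E = [1, 3, 4, 5] then 7
    else if E = [2, 3, 4, 5] then 7
    else if E = [3, 4, 5, 6] then 7
    else if E = [4, 5, 6, 7] then 7
    else if E = [0, 1, 2, 3, 4] then 10
    else if E = [0, 2, 3, 4, 5] then 8
    else if E = [1, 2, 3, 4, 5] then 10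
    else if E = [1, 3, 4, 5, 6] then 8
    else if E = [2, 3, 4, 5, 6] then 8
    else if E = [3, 4, 5, 6, 7] then 8
    else if E = [0, 1, 2, 3, 4, 5] then 14
    else if E = [0, 2, 3, 4, 5, 6] then 9
    else if E = [1, 2, 3, 4, 5, 6] then 12
    else if E = [1, 3, 4, 5, 6, 7] then 9
    else if E = [2, 3, 4, 5, 6, 7] then 9
    else if E = [0, 1, 2, 3, 4, 5, 6] then 20
    else if E = [0, 2, 3, 4, 5, 6, 7] then 10
    else if E = [1, 2, 3, 4, 5, 6, 7] then 14
    else if E = [0, 1, 2, 3, 4, 5, 6, 7] then 32
    else 0)"

text \<open>The automorphism that the negative of the longest Weyl group element induces on the
  diagram: the flip in type A and in E6, the exchange of two short legs in D5 and D7, and the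
  identity for D4, D6, E7 and E8.\<close>

definition involution_E8 :: "nat list \<Rightarrow> nat list" where
  "involution_E8 E = (
    if E = [0, 2] then [2, 1, 0]
    else if E = [1, 3] then [0, 3, 2, 1]
    else if E = [2, 3] then [0, 1, 3, 2]
    else if E = [3, 4] then [0, 1, 2, 4, 3]
    else if E = [4, 5] then [0, 1, 2, 3, 5, 4]
    else if E = [5, 6] then [0, 1, 2, 3, 4, 6, 5]
    else if E = [6, 7] then [0, 1, 2, 3, 4, 5, 7, 6]
    else if E = [0, 2, 3] then [3, 1, 2, 0]
    else if E = [1, 2, 3] then [0, 2, 1, 3]
    else if E = [1, 3, 4] then [0, 4, 2, 3, 1]
    else if E = [2, 3, 4] then [0, 1, 4, 3, 2]
    else if E = [3, 4, 5] then [0, 1, 2, 5, 4, 3]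
    else if E = [4, 5, 6] then [0, 1, 2, 3, 6, 5, 4]
    else if E = [5, 6, 7] then [0, 1, 2, 3, 4, 7, 6, 5]
    else if E = [0, 1, 2, 3] then [1, 0, 3, 2]
    else if E = [0, 2, 3, 4] then [4, 1, 3, 2, 0]
    else if E = [1, 3, 4, 5] then [0, 5, 2, 4, 3, 1]
    else if E = [2, 3, 4, 5] then [0, 1, 5, 4, 3, 2]
    else if E = [3, 4, 5, 6] then [0, 1, 2, 6, 5, 4, 3]
    else if E = [4, 5, 6, 7] then [0, 1, 2, 3, 7, 6, 5, 4]
    else if E = [0, 1, 2, 3, 4] then [0, 4, 2, 3, 1]
    else if E = [0, 2, 3, 4, 5] then [5, 1, 4, 3, 2, 0]
    else if E = [1, 2, 3, 4, 5] then [0, 2, 1, 3, 4, 5]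
    else if E = [1, 3, 4, 5, 6] then [0, 6, 2, 5, 4, 3, 1]
    else if E = [2, 3, 4, 5, 6] then [0, 1, 6, 5, 4, 3, 2]
    else if E = [3, 4, 5, 6, 7] then [0, 1, 2, 7, 6, 5, 4, 3]
    else if E = [0, 1, 2, 3, 4, 5] then [5, 1, 4, 3, 2, 0]
    else if E = [0, 2, 3, 4, 5, 6] then [6, 1, 5, 4, 3, 2, 0]
    else if E = [1, 3, 4, 5, 6, 7] then [0, 7, 2, 6, 5, 4, 3, 1]
    else if E = [2, 3, 4, 5, 6, 7] then [0, 1, 7, 6, 5, 4, 3, 2]
    else if E = [0, 2, 3, 4, 5, 6, 7] then [7, 1, 6, 5, 4, 3, 2, 0]
    else if E = [1, 2, 3, 4, 5, 6, 7] then [0, 2, 1, 3, 4, 5, 6, 7]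
    else [0..<8])"

text \<open>A step whose evidence consists of zeros has its label in the light cone. It is listed to
  translate this label into the label \<open>e\<close> inside the window. Another step matches the
  same \<open>e\<close> with the label one period later, and the two together give the anchor of the
  diagram.\<close>

definition steps_E8 :: "nat list \<Rightarrow> step list" where
  "steps_E8 E = (
    if E = [0, 2, 3] then
     [(0, (2, 3), (0, 4), - 16, 3, 2, (0, - 2), (0, 2), - 1), (0, (2, 3), (3, - 2), - 16, 0, 0, (0, 0), (0, 0), 0)]
    else if E = [1, 2, 3] then
     [(1, (3, 3), (1, 4), - 16, 2, 2, (1, - 2), (1, 2), - 1), (1, (3, 3), (2, - 2), - 16, 0, 0, (0, 0), (0, 0), 0)]
    else if E = [1, 3, 4] then
     [(1, (3, 3), (1, 4), - 16, 4, 2, (1, - 2), (1, 2), - 1), (1, (3, 3), (4, - 2), - 16, 0, 0, (0, 0), (0, 0), 0)]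
    else if E = [2, 3, 4] then
     [(2, (3, 3), (2, 4), - 16, 4, 2, (2, - 2), (2, 2), - 1), (2, (3, 3), (4, - 2), - 16, 0, 0, (0, 0), (0, 0), 0)]
    else if E = [3, 4, 5] then
     [(3, (4, 3), (3, 4), 56, 5, 2, (3, - 2), (3, 2), - 1), (3, (4, 3), (5, - 2), 56, 0, 0, (0, 0), (0, 0), 0)]
    else if E = [4, 5, 6] then
     [(4, (5, 3), (4, 4), 121, 6, 2, (4, - 2), (4, 2), - 1), (4, (5, 3), (6, - 2), 121, 0, 0, (0, 0), (0, 0), 0)]
    else if E = [5, 6, 7] then
     [(5, (6, 3), (5, 4), 71, 7, 2, (5, - 2), (5, 2), - 1), (5, (6, 3), (7, - 2), 71, 0, 0, (0, 0), (0, 0), 0)]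
    else if E = [0, 1, 2, 3] then
     [(0, (2, 5), (0, 6), - 51, 1, 3, (0, - 3), (0, 3), - 1), (0, (2, 5), (1, - 1), - 51, 0, 0, (0, 0), (0, 0), 0)]
    else if E = [0, 2, 3, 4] then
     [(0, (2, 5), (0, 6), - 8, 4, 3, (0, - 3), (0, 3), - 1), (0, (2, 5), (4, - 1), - 8, 0, 0, (0, 0), (0, 0), 0)]
    else if E = [1, 2, 3, 4] then
     [(1, (3, 3), (1, - 4), - 16, 2, - 2, (1, 2), (1, - 2), 1),
      (2, (3, 3), (2, - 4), - 16, 1, - 2, (2, 2), (2, - 2), 1),
      (4, (3, 3), (4, - 4), - 16, 1, - 2, (4, 2), (4, - 2), 1), (1, (2, 2), (2, - 6), - 18, 2, - 2, (1, 2), (3, 3), 0)]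
    else if E = [1, 3, 4, 5] then
     [(1, (3, 5), (1, 6), 80, 5, 3, (1, - 3), (1, 3), - 1), (1, (3, 5), (5, - 1), 80, 0, 0, (0, 0), (0, 0), 0)]
    else if E = [2, 3, 4, 5] then
     [(2, (3, 5), (2, 6), 80, 5, 3, (2, - 3), (2, 3), - 1), (2, (3, 5), (5, - 1), 80, 0, 0, (0, 0), (0, 0), 0)]
    else if E = [3, 4, 5, 6] then
     [(3, (4, 5), (3, 6), 65, 6, 3, (3, - 3), (3, 3), - 1), (3, (4, 5), (6, - 1), 65, 0, 0, (0, 0), (0, 0), 0)]
    else if E = [4, 5, 6, 7] then
     [(4, (5, 5), (4, 6), 6, 7, 3, (4, - 3), (4, 3), - 1), (4, (5, 5), (7, - 1), 6, 0, 0, (0, 0), (0, 0), 0)]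
    else if E = [0, 1, 2, 3, 4] then
     [(0, (2, 3), (0, 4), 75, 1, 1, (0, - 1), (0, 3), - 1), (0, (2, 5), (0, - 4), 18, 1, - 3, (0, 3), (0, - 1), 1),
      (0, (3, 4), (2, - 5), 93, 1, - 3, (0, 3), (2, - 2), 1), (1, (2, 4), (1, - 4), 88, 0, - 3, (1, 3), (1, - 1), 0),
      (1, (3, 3), (1, 4), - 16, 0, 1, (1, - 1), (1, 3), - 1), (2, (3, 3), (0, - 5), - 16, 0, - 1, (2, 1), (2, 5), - 1),
      (4, (2, 4), (4, - 4), 88, 0, - 3, (4, 3), (4, - 1), 0), (4, (3, 3), (4, 4), - 16, 0, 1, (4, - 1), (4, 3), - 1),
      (0, (1, 5), (4, 7), 51, 2, 5, (3, 3), (4, 2), 0), (0, (1, 5), (1, - 3), 51, 0, 0, (0, 0), (0, 0), 0)]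
    else if E = [0, 2, 3, 4, 5] then
     [(0, (5, 0), (0, 8), - 56, 5, 4, (0, - 4), (0, 4), - 1)]
    else if E = [1, 2, 3, 4, 5] then
     [(1, (3, 3), (1, 4), - 16, 2, 2, (1, - 2), (1, 2), - 1), (1, (4, 4), (1, - 4), 64, 2, - 2, (1, 2), (1, - 2), 1),
      (2, (3, 3), (2, 4), - 16, 1, 2, (2, - 2), (2, 2), - 1), (2, (4, 4), (2, - 4), 64, 1, - 2, (2, 2), (2, - 2), 1),
      (4, (3, 3), (5, - 5), - 16, 1, - 2, (4, 2), (5, - 3), 1), (5, (3, 4), (4, - 5), 93, 1, - 3, (5, 3), (4, - 2), 1),
      (5, (4, 3), (5, 4), 85, 1, 1, (5, - 1), (5, 3), - 1), (5, (4, 5), (5, - 4), 8, 1, - 3, (5, 3), (5, - 1), 1),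
      (1, (4, 2), (4, - 8), - 24, 5, - 3, (1, 3), (3, 4), 0)]
    else if E = [1, 3, 4, 5, 6] then
     [(1, (6, 0), (1, 8), - 65, 6, 4, (1, - 4), (1, 4), - 1)]
    else if E = [2, 3, 4, 5, 6] then
     [(2, (6, 0), (2, 8), - 65, 6, 4, (2, - 4), (2, 4), - 1)]
    else if E = [3, 4, 5, 6, 7] then
     [(3, (7, 0), (3, 8), - 6, 7, 4, (3, - 4), (3, 4), - 1)]
    else if E = [0, 1, 2, 3, 4, 5] then
     [(0, (1, 5), (0, - 6), 131, 1, - 3, (0, 3), (0, - 3), 1), (0, (1, 7), (0, - 4), 18, 1, - 3, (0, 3), (0, - 1), 1),
      (0, (2, 3), (0, 4), 75, 1, 1, (0, - 1), (0, 3), - 1), (0, (2, 5), (0, 6), 98, 1, 3, (0, - 3), (0, 3), - 1),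
      (0, (3, 4), (2, 5), 173, 1, 3, (0, - 3), (2, 2), - 1), (0, (3, 6), (2, - 5), 149, 1, - 3, (0, 3), (2, - 2), 1),
      (0, (4, 5), (1, - 7), 93, 5, - 4, (0, 4), (1, - 3), 1), (1, (2, 4), (0, - 7), 88, 0, - 3, (1, 3), (1, 7), 0),
      (1, (3, 3), (1, 4), - 16, 0, 1, (1, - 1), (1, 3), 0), (1, (3, 5), (1, - 4), 168, 0, - 3, (1, 3), (1, - 1), 0),
      (1, (4, 4), (0, 7), 64, 0, 1, (1, - 1), (2, 5), - 1), (2, (3, 3), (0, 5), - 16, 0, - 1, (2, 1), (2, 5), 0),
      (2, (4, 4), (0, - 5), 64, 0, - 1, (2, 1), (1, 7), - 1), (4, (2, 4), (5, - 5), 88, 0, - 3, (4, 3), (5, - 2), 0),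
      (4, (3, 3), (5, 5), - 16, 0, 1, (4, - 1), (5, 4), - 1), (5, (1, 5), (5, - 6), 155, 0, - 4, (5, 4), (5, - 2), 1),
      (5, (1, 7), (5, - 4), 8, 0, - 4, (5, 4), (5, 0), 0), (5, (2, 5), (1, - 7), 93, 0, - 4, (5, 4), (1, - 3), 1),
      (5, (3, 4), (4, 5), 197, 0, 2, (5, - 2), (4, 3), - 1), (5, (3, 6), (4, - 5), 163, 0, - 4, (5, 4), (4, - 1), 0),
      (5, (4, 3), (5, 4), 85, 0, 0, (5, 0), (5, 4), 0), (5, (4, 5), (5, 6), 112, 0, 2, (5, - 2), (5, 4), - 1),
      (0, (5, 0), (0, 14), - 56, 1, 7, (2, 4), (4, 4), 0)]
    else if E = [0, 2, 3, 4, 5, 6] then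
     [(0, (5, 0), (2, 9), - 56, 6, 5, (0, - 5), (2, 4), - 1)]
    else if E = [1, 2, 3, 4, 5, 6] then
     [(1, (3, 3), (1, 4), - 16, 2, 2, (1, - 2), (1, 2), - 1), (1, (4, 4), (2, - 6), 105, 5, - 3, (1, 3), (2, - 3), 1),
      (1, (5, 5), (1, - 4), 40, 2, - 2, (1, 2), (1, - 2), 1), (2, (3, 3), (2, 4), - 16, 1, 2, (2, - 2), (2, 2), - 1),
      (2, (4, 4), (1, - 6), 105, 1, - 2, (2, 2), (5, 5), 0), (2, (5, 5), (2, - 4), 40, 1, - 2, (2, 2), (2, - 2), 1),
      (4, (3, 3), (6, - 6), - 16, 1, - 2, (4, 2), (6, - 4), 1), (5, (3, 4), (5, - 6), 93, 1, - 3, (5, 3), (5, - 3), 1),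
      (5, (4, 3), (6, 5), 85, 1, 1, (5, - 1), (6, 4), - 1), (5, (4, 5), (6, - 5), 8, 1, - 3, (5, 3), (6, - 2), 1),
      (6, (3, 5), (4, - 6), 149, 1, - 4, (6, 4), (4, - 2), 1), (6, (4, 4), (5, 5), 64, 1, 2, (6, - 2), (5, 3), - 1),
      (6, (4, 6), (5, - 5), 93, 1, - 4, (6, 4), (5, - 1), 1), (6, (5, 3), (6, 4), 56, 1, 0, (6, 0), (6, 4), - 1),
      (6, (5, 5), (6, - 6), 8, 1, - 4, (6, 4), (6, - 2), 1), (6, (5, 7), (6, - 4), 85, 1, - 4, (6, 4), (6, 0), 1),
      (1, (6, 6), (2, 10), 8, 2, 6, (4, 4), (3, 3), 0), (1, (6, 6), (2, - 2), 8, 0, 0, (0, 0), (0, 0), 0)]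
    else if E = [1, 3, 4, 5, 6, 7] then
     [(1, (6, 0), (3, 9), - 65, 7, 5, (1, - 5), (3, 4), - 1)]
    else if E = [2, 3, 4, 5, 6, 7] then
     [(2, (6, 0), (3, 9), - 65, 7, 5, (2, - 5), (3, 4), - 1)]
    else if E = [0, 1, 2, 3, 4, 5, 6] then
     [(0, (2, 3), (0, 4), 75, 1, 1, (0, - 1), (0, 3), - 1), (0, (2, 5), (0, 6), 74, 1, 3, (0, - 3), (0, 3), - 1),
      (0, (2, 7), (0, - 6), 172, 1, - 3, (0, 3), (0, - 3), 1), (0, (2, 9), (0, - 4), 18, 1, - 3, (0, 3), (0, - 1), 1),
      (0, (3, 4), (2, 5), 149, 1, 3, (0, - 3), (2, 2), - 1), (0, (3, 8), (2, - 5), 190, 1, - 3, (0, 3), (2, - 2), 1),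
      (0, (4, 5), (1, 7), 214, 5, 4, (0, - 4), (1, 3), - 1), (0, (4, 7), (1, - 7), 125, 5, - 4, (0, 4), (1, - 3), 1),
      (0, (5, 6), (0, - 10), 93, 6, - 5, (0, 5), (0, - 5), 1), (1, (2, 4), (6, 8), 88, 0, 3, (1, - 3), (6, 5), - 1),
      (0, (1, 5), (6, 9), 107, 1, 1, (0, - 1), (2, 4), - 1), (0, (1, 7), (6, 11), 139, 1, 3, (0, - 3), (2, 4), - 1),
      (1, (3, 3), (1, 4), - 16, 0, - 3, (1, 3), (4, 5), 0), (1, (3, 5), (0, - 7), 209, 0, - 3, (1, 3), (2, 9), - 1),
      (0, (3, 6), (5, 10), 246, 1, 7, (3, 5), (5, 3), 0), (1, (4, 4), (0, 7), 105, 0, 1, (1, - 1), (2, 5), - 1),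
      (1, (4, 6), (1, - 4), 144, 0, - 7, (4, 5), (1, 3), 0), (1, (5, 5), (6, - 8), 40, 0, - 7, (4, 5), (6, - 1), 0),
      (2, (3, 3), (0, 5), - 16, 0, - 1, (2, 1), (2, 5), 0), (2, (4, 4), (6, - 10), 105, 0, - 5, (3, 4), (6, - 5), 1),
      (2, (5, 5), (0, - 5), 40, 0, - 1, (2, 1), (2, 9), - 1), (4, (2, 4), (6, - 6), 88, 0, - 3, (4, 3), (6, - 3), 0),
      (4, (3, 3), (6, 6), - 16, 0, - 3, (4, 3), (1, 5), 0), (5, (1, 5), (6, - 7), 155, 0, - 10, (3, 6), (6, 3), 0),
      (5, (1, 7), (6, - 5), 8, 0, - 10, (3, 6), (6, 5), 0), (5, (2, 5), (0, - 10), 93, 0, - 4, (5, 4), (2, 7), 0),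
      (5, (3, 4), (5, 6), 197, 0, - 4, (5, 4), (3, 6), 0), (5, (3, 6), (5, - 6), 163, 0, - 10, (3, 6), (5, 4), 0),
      (5, (4, 3), (6, 5), 85, 0, - 4, (5, 4), (1, 5), 0), (5, (4, 5), (6, 7), 112, 0, - 4, (5, 4), (1, 7), 0),
      (6, (0, 7), (6, - 8), 131, 0, - 11, (1, 7), (6, 3), 0), (6, (0, 9), (6, - 6), 112, 0, - 11, (1, 7), (6, 5), 0),
      (6, (0, 11), (6, - 4), 85, 0, - 9, (1, 5), (6, 5), 0), (6, (1, 6), (0, 9), 168, 0, 3, (6, - 3), (2, 5), - 1),
      (6, (1, 8), (0, - 9), 93, 0, - 5, (6, 5), (2, 9), 0), (6, (2, 6), (1, 8), 149, 0, 1, (6, - 1), (4, 5), - 1),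
      (6, (2, 8), (5, - 7), 243, 0, - 11, (1, 7), (5, 4), 0), (6, (2, 10), (5, - 5), 197, 0, - 9, (1, 5), (5, 4), 0),
      (6, (3, 5), (4, 6), 219, 0, 3, (6, - 3), (4, 3), - 1), (6, (3, 7), (2, - 10), 261, 0, - 11, (1, 7), (2, 1), 0),
      (6, (3, 9), (4, - 6), 328, 0, - 9, (1, 5), (4, 3), 0), (6, (4, 4), (5, 5), 64, 0, - 5, (6, 5), (3, 6), 0),
      (6, (4, 6), (5, 7), 163, 0, - 3, (6, 3), (3, 6), 0), (6, (4, 8), (1, - 8), 253, 0, - 11, (1, 7), (1, 3), 0),
      (6, (5, 3), (6, 4), 56, 0, - 5, (6, 5), (1, 5), 0), (6, (5, 5), (6, 6), 8, 0, - 5, (6, 5), (1, 7), 0),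
      (6, (5, 7), (6, 8), 155, 0, - 3, (6, 3), (1, 7), 0), (0, (2, 1), (2, - 19), 34, 6, - 9, (1, 6), (3, 7), 0)]
    else if E = [0, 2, 3, 4, 5, 6, 7] then
     [(0, (5, 0), (3, 10), - 56, 7, 6, (0, - 6), (3, 4), - 1)]
    else if E = [1, 2, 3, 4, 5, 6, 7] then
     [(1, (3, 3), (1, 4), - 16, 2, 2, (1, - 2), (1, 2), - 1), (1, (4, 4), (2, 6), 105, 5, 3, (1, - 3), (2, 3), - 1),
      (1, (5, 5), (2, - 6), 111, 5, - 3, (1, 3), (2, - 3), 1), (1, (6, 6), (1, - 4), 40, 2, - 2, (1, 2), (1, - 2), 1),
      (2, (3, 3), (2, 4), - 16, 1, - 2, (2, 2), (4, 4), 0), (2, (4, 4), (1, 6), 105, 1, 2, (2, - 2), (3, 3), - 1),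
      (2, (5, 5), (1, - 6), 111, 1, - 2, (2, 2), (6, 6), 0), (2, (6, 6), (2, - 4), 40, 1, - 6, (4, 4), (2, 2), 0),
      (4, (3, 3), (7, - 7), - 16, 1, - 2, (4, 2), (7, - 5), 1), (5, (3, 4), (6, - 7), 93, 1, - 3, (5, 3), (6, - 4), 1),
      (5, (4, 3), (7, 6), 85, 1, 1, (5, - 1), (7, 5), - 1), (5, (4, 5), (7, - 6), 8, 1, - 3, (5, 3), (7, - 3), 1),
      (6, (3, 5), (5, - 7), 149, 1, - 4, (6, 4), (5, - 3), 1), (6, (4, 4), (6, 6), 64, 1, 2, (6, - 2), (6, 4), - 1),
      (6, (4, 6), (6, - 6), 93, 1, - 4, (6, 4), (6, - 2), 1), (6, (5, 3), (7, 5), 56, 1, 0, (6, 0), (7, 5), - 1),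
      (6, (5, 5), (7, - 7), 8, 1, - 4, (6, 4), (7, - 3), 1), (6, (5, 7), (7, - 5), 85, 1, - 4, (6, 4), (7, - 1), 1),
      (7, (3, 6), (4, - 7), 246, 1, - 5, (7, 5), (4, - 2), 1), (7, (4, 5), (5, 6), 214, 1, 3, (7, - 3), (5, 3), - 1),
      (7, (4, 7), (5, - 6), 125, 1, - 5, (7, 5), (5, - 1), 1), (7, (5, 4), (6, 5), 206, 1, 1, (7, - 1), (6, 4), - 1),
      (7, (5, 6), (6, - 7), 93, 1, - 5, (7, 5), (6, - 2), 1), (7, (5, 8), (6, - 5), 40, 1, - 5, (7, 5), (6, 0), 1),
      (7, (6, 3), (7, 4), 121, 1, - 1, (7, 1), (7, 5), - 1), (7, (6, 5), (7, 6), 85, 1, 1, (7, - 1), (7, 5), - 1),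
      (7, (6, 7), (7, - 6), 8, 1, - 5, (7, 5), (7, - 1), 1), (7, (6, 9), (7, - 4), 32, 1, - 5, (7, 5), (7, 1), 1),
      (1, (7, 7), (1, 12), 8, 2, 6, (5, 5), (4, 4), 0), (1, (7, 7), (2, - 2), 8, 0, 0, (0, 0), (0, 0), 0)]
    else if E = [0, 1, 2, 3, 4, 5, 6, 7] then
     [(0, (1, 9), (0, - 6), 172, 1, - 3, (0, 3), (0, - 3), 1), (0, (1, 11), (0, - 4), 18, 1, - 3, (0, 3), (0, - 1), 1),
      (0, (2, 3), (0, 4), 75, 1, 1, (0, - 1), (0, 3), - 1), (0, (2, 5), (0, 6), 74, 1, 3, (0, - 3), (0, 3), - 1),
      (0, (3, 4), (2, 5), 149, 1, 3, (0, - 3), (2, 2), - 1), (0, (3, 10), (2, - 5), 190, 1, - 3, (0, 3), (2, - 2), 1),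
      (0, (4, 5), (1, 7), 220, 5, 4, (0, - 4), (1, 3), - 1), (0, (4, 9), (1, - 7), 196, 5, - 4, (0, 4), (1, - 3), 1),
      (0, (5, 6), (0, 10), 214, 6, 5, (0, - 5), (0, 5), - 1), (0, (5, 8), (0, - 10), 125, 6, - 5, (0, 5), (0, - 5), 1),
      (1, (2, 4), (7, 9), 88, 0, 3, (1, - 3), (7, 6), - 1), (0, (1, 5), (7, 10), 107, 1, 1, (0, - 1), (2, 4), - 1),
      (0, (1, 7), (7, 12), 145, 1, 3, (0, - 3), (2, 4), - 1), (1, (3, 3), (1, 4), - 16, 0, - 3, (1, 3), (4, 5), 0),
      (1, (3, 5), (7, - 13), 209, 0, - 7, (4, 5), (7, - 6), 1),
      (0, (2, 7), (7, - 12), 178, 1, 1, (0, - 1), (3, 5), - 1),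
      (0, (2, 9), (7, - 10), 139, 1, 3, (0, - 3), (3, 5), - 1), (0, (6, 7), (7, - 16), 93, 1, - 3, (0, 3), (3, 5), 0),
      (1, (4, 4), (0, 7), 105, 0, - 3, (1, 3), (5, 6), 0), (0, (3, 8), (6, - 11), 317, 1, - 7, (4, 4), (6, - 4), 1),
      (1, (4, 6), (0, - 7), 215, 0, - 3, (1, 3), (1, 11), - 1), (0, (3, 6), (6, 11), 252, 1, 7, (4, 6), (6, 4), 0),
      (1, (5, 5), (7, 13), 111, 0, 1, (1, - 1), (1, 7), - 1), (1, (5, 7), (1, - 4), 144, 0, - 7, (4, 5), (1, 3), 0),
      (1, (6, 6), (7, - 9), 40, 0, - 7, (4, 5), (7, - 2), 0), (2, (3, 3), (0, 5), - 16, 0, - 5, (3, 4), (5, 6), 0),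
      (2, (4, 4), (7, 11), 105, 0, - 1, (2, 1), (1, 7), 0), (2, (5, 5), (7, - 11), 111, 0, - 5, (3, 4), (7, - 6), 1),
      (2, (6, 6), (0, - 5), 40, 0, - 1, (2, 1), (1, 11), - 1), (4, (2, 4), (7, - 7), 88, 0, - 3, (4, 3), (7, - 4), 0),
      (4, (3, 3), (7, 7), - 16, 0, - 3, (4, 3), (1, 5), 0), (5, (1, 5), (7, - 8), 155, 0, - 4, (5, 4), (7, - 4), 1),
      (5, (1, 7), (7, - 6), 8, 0, - 4, (5, 4), (7, - 2), 0), (5, (2, 5), (7, - 16), 93, 0, - 4, (5, 4), (2, 7), 0),
      (5, (3, 4), (6, 7), 197, 0, - 4, (5, 4), (3, 6), 0), (5, (3, 6), (6, - 7), 163, 0, - 4, (5, 4), (6, - 3), 0),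
      (5, (4, 3), (7, 6), 85, 0, - 4, (5, 4), (1, 5), 0), (5, (4, 5), (7, 8), 112, 0, - 4, (5, 4), (1, 7), 0),
      (6, (0, 7), (7, - 9), 131, 0, - 11, (3, 6), (7, 2), 0), (6, (0, 9), (7, - 7), 112, 0, - 11, (3, 6), (7, 4), 0),
      (6, (0, 11), (7, - 5), 85, 0, - 11, (3, 6), (7, 6), 0), (6, (1, 6), (7, 15), 168, 0, 3, (6, - 3), (1, 7), - 1),
      (6, (1, 8), (7, - 15), 93, 0, - 11, (3, 6), (7, - 4), 1), (6, (2, 6), (0, 11), 149, 0, 1, (6, - 1), (5, 6), - 1),
      (0, (4, 7), (0, - 16), 246, 6, - 11, (2, 6), (0, - 5), 1),
      (6, (2, 8), (6, - 8), 243, 0, - 11, (3, 6), (6, 3), 0), (6, (2, 10), (6, - 6), 197, 0, - 11, (3, 6), (6, 5), 0),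
      (6, (3, 5), (5, 7), 219, 0, 3, (6, - 3), (5, 4), - 1), (6, (3, 7), (6, - 16), 261, 0, - 11, (3, 6), (6, - 5), 1),
      (6, (3, 9), (5, - 7), 328, 0, - 11, (3, 6), (5, 4), 0), (6, (4, 4), (6, 6), 64, 0, - 5, (6, 5), (3, 6), 0),
      (6, (4, 6), (6, 8), 163, 0, - 3, (6, 3), (3, 6), 0), (6, (4, 8), (0, - 11), 253, 0, - 5, (6, 5), (1, 9), 0),
      (6, (5, 3), (7, 5), 56, 0, - 5, (6, 5), (1, 5), 0), (6, (5, 5), (7, 7), 8, 0, - 5, (6, 5), (1, 7), 0),
      (6, (5, 7), (7, 9), 155, 0, - 3, (6, 3), (1, 7), 0), (7, (0, 8), (7, 14), 276, 0, 2, (7, - 2), (1, 7), - 1),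
      (7, (0, 10), (7, - 16), 93, 0, - 12, (1, 7), (7, - 4), 1),
      (7, (0, 12), (7, - 14), 144, 0, - 12, (1, 7), (7, - 2), 1), (7, (1, 7), (0, 10), 214, 0, 0, (7, 0), (5, 6), 0),
      (7, (1, 9), (0, 12), 229, 0, 2, (7, - 2), (5, 6), - 1), (7, (1, 11), (0, - 12), 284, 0, - 6, (7, 6), (1, 9), 0),
      (7, (1, 13), (0, - 10), 125, 0, - 6, (7, 6), (1, 11), 0), (7, (2, 7), (1, 9), 350, 0, 2, (7, - 2), (4, 5), - 1),
      (7, (2, 9), (6, 15), 369, 0, 4, (7, - 4), (3, 6), - 1),
      (7, (2, 11), (6, - 15), 237, 0, - 12, (1, 7), (6, - 3), 1),
      (7, (2, 13), (1, - 9), 316, 0, - 12, (1, 7), (1, 3), 0), (7, (3, 6), (4, 7), 425, 0, 4, (7, - 4), (4, 3), - 1),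
      (7, (3, 8), (2, 11), 443, 0, 6, (7, - 6), (3, 4), - 1),
      (7, (3, 10), (5, - 16), 513, 0, - 12, (1, 7), (5, - 4), 1),
      (7, (3, 12), (2, - 11), 409, 0, - 12, (1, 7), (2, 1), 0),
      (7, (3, 14), (4, - 7), 334, 0, - 10, (1, 5), (4, 3), 0), (7, (4, 5), (5, 6), 318, 0, 2, (7, - 2), (5, 4), 0),
      (7, (4, 7), (5, 8), 304, 0, 4, (7, - 4), (5, 4), - 1), (7, (4, 9), (1, 13), 358, 0, 6, (7, - 6), (4, 5), - 1),
      (7, (4, 11), (1, - 13), 401, 0, - 12, (1, 7), (1, - 1), 1),
      (7, (4, 13), (5, - 8), 302, 0, - 12, (1, 7), (5, 4), 0), (7, (4, 15), (5, - 6), 195, 0, - 10, (1, 5), (5, 4), 0),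
      (7, (5, 4), (6, 5), 206, 0, - 6, (7, 6), (3, 6), 0), (7, (5, 6), (6, 7), 197, 0, - 4, (7, 4), (3, 6), 0),
      (7, (5, 8), (6, 9), 219, 0, - 2, (7, 2), (3, 6), 0), (7, (5, 10), (0, - 16), 246, 0, - 12, (1, 7), (1, 11), 0),
      (7, (5, 12), (6, - 9), 294, 0, - 12, (1, 7), (6, 3), 0), (7, (5, 14), (6, - 7), 163, 0, - 12, (1, 7), (6, 5), 0),
      (7, (5, 16), (6, - 5), 40, 0, - 10, (1, 5), (6, 5), 0), (7, (6, 3), (7, 4), 121, 0, - 6, (7, 6), (1, 5), 0),
      (7, (6, 5), (7, 6), 85, 0, - 6, (7, 6), (1, 7), 0), (7, (6, 7), (7, 8), 112, 0, - 4, (7, 4), (1, 7), 0),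
      (7, (6, 9), (7, 10), 107, 0, - 2, (7, 2), (1, 7), 0), (7, (6, 11), (7, - 10), 139, 0, - 12, (1, 7), (7, 2), 0),
      (7, (6, 13), (7, - 8), 155, 0, - 12, (1, 7), (7, 4), 0), (7, (6, 15), (7, - 6), 8, 0, - 12, (1, 7), (7, 6), 0),
      (7, (6, 17), (7, - 4), 32, 0, - 10, (1, 5), (7, 6), 0), (0, (6, 13), (6, 31), 65, 7, 16, (5, 10), (2, 9), 0),
      (0, (6, 13), (6, - 1), 65, 0, 0, (0, 0), (0, 0), 0)]
    else [])"

definition anchor_E8 :: "nat list \<Rightarrow> nat \<times> lab \<times> lab \<times> int list" where
  "anchor_E8 E = (
    if E = [0, 2, 3] then (0, (2, 3), (3, - 2), [104, 34])
    else if E = [1, 2, 3] then (1, (3, 3), (2, - 2), [- 51, 16])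
    else if E = [1, 3, 4] then (1, (3, 3), (4, - 2), [- 51, 16])
    else if E = [2, 3, 4] then (2, (3, 3), (4, - 2), [- 18, 16])
    else if E = [3, 4, 5] then (3, (4, 3), (5, - 2), [8, 24])
    else if E = [4, 5, 6] then (4, (5, 3), (6, - 2), [- 24, - 56])
    else if E = [5, 6, 7] then (5, (6, 3), (7, - 2), [56, - 65])
    else if E = [0, 1, 2, 3] then (0, (2, 5), (1, - 1), [70, - 34, 16])
    else if E = [0, 2, 3, 4] then (0, (2, 5), (4, - 1), [70, - 34, 16])
    else if E = [1, 2, 3, 4] then (1, (2, 2), (2, - 6), [- 51, 16, - 8])
    else if E = [1, 3, 4, 5] then (1, (3, 5), (5, - 1), [8, 75, 24])
    else if E = [2, 3, 4, 5] then (2, (3, 5), (5, - 1), [8, 42, 24])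
    else if E = [3, 4, 5, 6] then (3, (4, 5), (6, - 1), [- 16, - 24, - 56])
    else if E = [4, 5, 6, 7] then (4, (5, 5), (7, - 1), [32, 56, - 65])
    else if E = [0, 1, 2, 3, 4] then (0, (1, 5), (1, - 3), [70, - 34, 16, - 8])
    else if E = [0, 2, 3, 4, 5] then (0, (5, 0), (5, 0), [8, 112, 42, 24])
    else if E = [1, 2, 3, 4, 5] then (1, (4, 2), (4, - 8), [- 51, - 18, 16, - 56])
    else if E = [1, 3, 4, 5, 6] then (1, (6, 0), (6, 0), [51, - 16, - 24, - 56])
    else if E = [2, 3, 4, 5, 6] then (2, (6, 0), (6, 0), [18, - 16, - 24, - 56])
    else if E = [3, 4, 5, 6, 7] then (3, (7, 0), (7, 0), [32, 40, 56, - 65])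
    else if E = [0, 1, 2, 3, 4, 5] then (0, (5, 0), (5, 0), [75, 42, 179, 109, 24])
    else if E = [0, 2, 3, 4, 5, 6] then (0, (5, 0), (5, 0), [8, 112, 42, 24, - 65])
    else if E = [1, 2, 3, 4, 5, 6] then (1, (6, 6), (2, - 2), [- 51, 16, - 24, 97, 32])
    else if E = [1, 3, 4, 5, 6, 7] then (1, (6, 0), (6, 0), [51, - 16, - 24, - 56, - 6])
    else if E = [2, 3, 4, 5, 6, 7] then (2, (6, 0), (6, 0), [18, - 16, - 24, - 56, - 6])
    else if E = [0, 1, 2, 3, 4, 5, 6] then (0, (2, 1), (2, - 19), [- 70, - 51, 16, - 24, 97, 32])
    else if E = [0, 2, 3, 4, 5, 6, 7] then (0, (5, 0), (5, 0), [8, 112, 42, 24, - 65, 6])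
    else if E = [1, 2, 3, 4, 5, 6, 7] then (1, (7, 7), (2, - 2), [- 51, 16, - 24, 97, 103, 32])
    else if E = [0, 1, 2, 3, 4, 5, 6, 7] then (0, (6, 13), (6, - 1), [18, 51, 88, - 16, - 24, - 56, - 6])
    else (0, (0, 0), (0, 0), []))"

definition table_E8 :: table where
  "table_E8 = Table period_E8 involution_E8 steps_E8 anchor_E8"

text \<open>The digits of the name record which of the nodes 0 to 3 lie in \<open>J\<close>; the
  nodes 4 to 7 are tested in the body. Each list starts with the empty face and ends with the number
  of clusters of the type of \<open>J\<close>.\<close>

definition faces_E8_0000 :: "nat list \<Rightarrow> int list" where
  "faces_E8_0000 J = (if 4 \<in> set J then (if 5 \<in> set J then (if 6 \<in> set J then (if 7 \<in> set J then [1, 14, 56, 84, 42] else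
    [1, 9, 21, 14]) else
    (if 7 \<in> set J then [1, 7, 15, 10] else
    [1, 5, 5])) else
    (if 6 \<in> set J then (if 7 \<in> set J then [1, 7, 15, 10] else
    [1, 4, 4]) else
    (if 7 \<in> set J then [1, 4, 4] else
    [1, 2]))) else
    (if 5 \<in> set J then (if 6 \<in> set J then (if 7 \<in> set J then [1, 9, 21, 14] else
    [1, 5, 5]) else
    (if 7 \<in> set J then [1, 4, 4] else
    [1, 2])) else
    (if 6 \<in> set J then (if 7 \<in> set J then [1, 5, 5] else
    [1, 2]) else
    (if 7 \<in> set J then [1, 2] else
    [1]))))"

definition faces_E8_0001 :: "nat list \<Rightarrow> int list" where
  "faces_E8_0001 J = (if 4 \<in> set J then (if 5 \<in> set J then (if 6 \<in> set J then (if 7 \<in> set J then [1, 20, 120, 300, 330, 132] else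
    [1, 14, 56, 84, 42]) else
    (if 7 \<in> set J then [1, 11, 39, 56, 28] else
    [1, 9, 21, 14])) else
    (if 6 \<in> set J then (if 7 \<in> set J then [1, 10, 35, 50, 25] else
    [1, 7, 15, 10]) else
    (if 7 \<in> set J then [1, 7, 15, 10] else
    [1, 5, 5]))) else
    (if 5 \<in> set J then (if 6 \<in> set J then (if 7 \<in> set J then [1, 11, 39, 56, 28] else
    [1, 7, 15, 10]) else
    (if 7 \<in> set J then [1, 6, 12, 8] else
    [1, 4, 4])) else
    (if 6 \<in> set J then (if 7 \<in> set J then [1, 7, 15, 10] else
    [1, 4, 4]) else
    (if 7 \<in> set J then [1, 4, 4] else
    [1, 2]))))"

definition faces_E8_0010 :: "nat list \<Rightarrow> int list" where
  "faces_E8_0010 J = (if 4 \<in> set J then (if 5 \<in> set J then (if 6 \<in> set J then (if 7 \<in> set J then [1, 16, 84, 196, 210, 84] else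
    [1, 11, 39, 56, 28]) else
    (if 7 \<in> set J then [1, 9, 29, 40, 20] else
    [1, 7, 15, 10])) else
    (if 6 \<in> set J then (if 7 \<in> set J then [1, 9, 29, 40, 20] else
    [1, 6, 12, 8]) else
    (if 7 \<in> set J then [1, 6, 12, 8] else
    [1, 4, 4]))) else
    (if 5 \<in> set J then (if 6 \<in> set J then (if 7 \<in> set J then [1, 11, 39, 56, 28] else
    [1, 7, 15, 10]) else
    (if 7 \<in> set J then [1, 6, 12, 8] else
    [1, 4, 4])) else
    (if 6 \<in> set J then (if 7 \<in> set J then [1, 7, 15, 10] else
    [1, 4, 4]) else
    (if 7 \<in> set J then [1, 4, 4] else
    [1, 2]))))"

definition faces_E8_0011 :: "nat list \<Rightarrow> int list" where
  "faces_E8_0011 J = (if 4 \<in> set J then (if 5 \<in> set J then (if 6 \<in> set J then (if 7 \<in> set J then [1, 27, 225, 825, 1485, 1287, 429] else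
    [1, 20, 120, 300, 330, 132]) else
    (if 7 \<in> set J then [1, 16, 84, 196, 210, 84] else
    [1, 14, 56, 84, 42])) else
    (if 6 \<in> set J then (if 7 \<in> set J then [1, 14, 71, 164, 175, 70] else
    [1, 11, 39, 56, 28]) else
    (if 7 \<in> set J then [1, 11, 39, 56, 28] else
    [1, 9, 21, 14]))) else
    (if 5 \<in> set J then (if 6 \<in> set J then (if 7 \<in> set J then [1, 14, 71, 164, 175, 70] else
    [1, 10, 35, 50, 25]) else
    (if 7 \<in> set J then [1, 9, 29, 40, 20] else
    [1, 7, 15, 10])) else
    (if 6 \<in> set J then (if 7 \<in> set J then [1, 10, 35, 50, 25] else
    [1, 7, 15, 10]) else
    (if 7 \<in> set J then [1, 7, 15, 10] else
    [1, 5, 5]))))"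

definition faces_E8_0100 :: "nat list \<Rightarrow> int list" where
  "faces_E8_0100 J = (if 4 \<in> set J then (if 5 \<in> set J then (if 6 \<in> set J then (if 7 \<in> set J then [1, 16, 84, 196, 210, 84] else
    [1, 11, 39, 56, 28]) else
    (if 7 \<in> set J then [1, 9, 29, 40, 20] else
    [1, 7, 15, 10])) else
    (if 6 \<in> set J then (if 7 \<in> set J then [1, 9, 29, 40, 20] else
    [1, 6, 12, 8]) else
    (if 7 \<in> set J then [1, 6, 12, 8] else
    [1, 4, 4]))) else
    (if 5 \<in> set J then (if 6 \<in> set J then (if 7 \<in> set J then [1, 11, 39, 56, 28] else
    [1, 7, 15, 10]) else
    (if 7 \<in> set J then [1, 6, 12, 8] else
    [1, 4, 4])) else
    (if 6 \<in> set J then (if 7 \<in> set J then [1, 7, 15, 10] else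
    [1, 4, 4]) else
    (if 7 \<in> set J then [1, 4, 4] else
    [1, 2]))))"

definition faces_E8_0101 :: "nat list \<Rightarrow> int list" where
  "faces_E8_0101 J = (if 4 \<in> set J then (if 5 \<in> set J then (if 6 \<in> set J then (if 7 \<in> set J then [1, 27, 225, 825, 1485, 1287, 429] else
    [1, 20, 120, 300, 330, 132]) else
    (if 7 \<in> set J then [1, 16, 84, 196, 210, 84] else
    [1, 14, 56, 84, 42])) else
    (if 6 \<in> set J then (if 7 \<in> set J then [1, 14, 71, 164, 175, 70] else
    [1, 11, 39, 56, 28]) else
    (if 7 \<in> set J then [1, 11, 39, 56, 28] else
    [1, 9, 21, 14]))) else
    (if 5 \<in> set J then (if 6 \<in> set J then (if 7 \<in> set J then [1, 14, 71, 164, 175, 70] else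
    [1, 10, 35, 50, 25]) else
    (if 7 \<in> set J then [1, 9, 29, 40, 20] else
    [1, 7, 15, 10])) else
    (if 6 \<in> set J then (if 7 \<in> set J then [1, 10, 35, 50, 25] else
    [1, 7, 15, 10]) else
    (if 7 \<in> set J then [1, 7, 15, 10] else
    [1, 5, 5]))))"

definition faces_E8_0110 :: "nat list \<Rightarrow> int list" where
  "faces_E8_0110 J = (if 4 \<in> set J then (if 5 \<in> set J then (if 6 \<in> set J then (if 7 \<in> set J then [1, 18, 116, 364, 602, 504, 168] else
    [1, 13, 61, 134, 140, 56]) else
    (if 7 \<in> set J then [1, 11, 47, 98, 100, 40] else
    [1, 9, 29, 40, 20])) else
    (if 6 \<in> set J then (if 7 \<in> set J then [1, 11, 47, 98, 100, 40] else
    [1, 8, 24, 32, 16]) else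
    (if 7 \<in> set J then [1, 8, 24, 32, 16] else
    [1, 6, 12, 8]))) else
    (if 5 \<in> set J then (if 6 \<in> set J then (if 7 \<in> set J then [1, 13, 61, 134, 140, 56] else
    [1, 9, 29, 40, 20]) else
    (if 7 \<in> set J then [1, 8, 24, 32, 16] else
    [1, 6, 12, 8])) else
    (if 6 \<in> set J then (if 7 \<in> set J then [1, 9, 29, 40, 20] else
    [1, 6, 12, 8]) else
    (if 7 \<in> set J then [1, 6, 12, 8] else
    [1, 4, 4]))))"

definition faces_E8_0111 :: "nat list \<Rightarrow> int list" where
  "faces_E8_0111 J = (if 4 \<in> set J then (if 5 \<in> set J then (if 6 \<in> set J then (if 7 \<in> set J then [1, 49, 609, 3220, 8610, 12222, 8778, 2508] else
    [1, 36, 330, 1260, 2310, 2016, 672]) else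
    (if 7 \<in> set J then [1, 27, 210, 730, 1275, 1092, 364] else
    [1, 25, 160, 410, 455, 182])) else
    (if 6 \<in> set J then (if 7 \<in> set J then [1, 21, 151, 510, 880, 750, 250] else
    [1, 18, 98, 232, 250, 100]) else
    (if 7 \<in> set J then [1, 18, 98, 232, 250, 100] else
    [1, 16, 66, 100, 50]))) else
    (if 5 \<in> set J then (if 6 \<in> set J then (if 7 \<in> set J then [1, 18, 123, 406, 693, 588, 196] else
    [1, 14, 71, 164, 175, 70]) else
    (if 7 \<in> set J then [1, 13, 61, 134, 140, 56] else
    [1, 11, 39, 56, 28])) else
    (if 6 \<in> set J then (if 7 \<in> set J then [1, 14, 71, 164, 175, 70] else
    [1, 11, 39, 56, 28]) else
    (if 7 \<in> set J then [1, 11, 39, 56, 28] else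
    [1, 9, 21, 14]))))"

definition faces_E8_1000 :: "nat list \<Rightarrow> int list" where
  "faces_E8_1000 J = (if 4 \<in> set J then (if 5 \<in> set J then (if 6 \<in> set J then (if 7 \<in> set J then [1, 16, 84, 196, 210, 84] else
    [1, 11, 39, 56, 28]) else
    (if 7 \<in> set J then [1, 9, 29, 40, 20] else
    [1, 7, 15, 10])) else
    (if 6 \<in> set J then (if 7 \<in> set J then [1, 9, 29, 40, 20] else
    [1, 6, 12, 8]) else
    (if 7 \<in> set J then [1, 6, 12, 8] else
    [1, 4, 4]))) else
    (if 5 \<in> set J then (if 6 \<in> set J then (if 7 \<in> set J then [1, 11, 39, 56, 28] else
    [1, 7, 15, 10]) else
    (if 7 \<in> set J then [1, 6, 12, 8] else
    [1, 4, 4])) else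
    (if 6 \<in> set J then (if 7 \<in> set J then [1, 7, 15, 10] else
    [1, 4, 4]) else
    (if 7 \<in> set J then [1, 4, 4] else
    [1, 2]))))"

definition faces_E8_1001 :: "nat list \<Rightarrow> int list" where
  "faces_E8_1001 J = (if 4 \<in> set J then (if 5 \<in> set J then (if 6 \<in> set J then (if 7 \<in> set J then [1, 22, 160, 540, 930, 792, 264] else
    [1, 16, 84, 196, 210, 84]) else
    (if 7 \<in> set J then [1, 13, 61, 134, 140, 56] else
    [1, 11, 39, 56, 28])) else
    (if 6 \<in> set J then (if 7 \<in> set J then [1, 12, 55, 120, 125, 50] else
    [1, 9, 29, 40, 20]) else
    (if 7 \<in> set J then [1, 9, 29, 40, 20] else
    [1, 7, 15, 10]))) else
    (if 5 \<in> set J then (if 6 \<in> set J then (if 7 \<in> set J then [1, 13, 61, 134, 140, 56] else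
    [1, 9, 29, 40, 20]) else
    (if 7 \<in> set J then [1, 8, 24, 32, 16] else
    [1, 6, 12, 8])) else
    (if 6 \<in> set J then (if 7 \<in> set J then [1, 9, 29, 40, 20] else
    [1, 6, 12, 8]) else
    (if 7 \<in> set J then [1, 6, 12, 8] else
    [1, 4, 4]))))"

definition faces_E8_1010 :: "nat list \<Rightarrow> int list" where
  "faces_E8_1010 J = (if 4 \<in> set J then (if 5 \<in> set J then (if 6 \<in> set J then (if 7 \<in> set J then [1, 19, 131, 434, 742, 630, 210] else
    [1, 14, 71, 164, 175, 70]) else
    (if 7 \<in> set J then [1, 12, 55, 120, 125, 50] else
    [1, 10, 35, 50, 25])) else
    (if 6 \<in> set J then (if 7 \<in> set J then [1, 12, 55, 120, 125, 50] else
    [1, 9, 29, 40, 20]) else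
    (if 7 \<in> set J then [1, 9, 29, 40, 20] else
    [1, 7, 15, 10]))) else
    (if 5 \<in> set J then (if 6 \<in> set J then (if 7 \<in> set J then [1, 14, 71, 164, 175, 70] else
    [1, 10, 35, 50, 25]) else
    (if 7 \<in> set J then [1, 9, 29, 40, 20] else
    [1, 7, 15, 10])) else
    (if 6 \<in> set J then (if 7 \<in> set J then [1, 10, 35, 50, 25] else
    [1, 7, 15, 10]) else
    (if 7 \<in> set J then [1, 7, 15, 10] else
    [1, 5, 5]))))"

definition faces_E8_1011 :: "nat list \<Rightarrow> int list" where
  "faces_E8_1011 J = (if 4 \<in> set J then (if 5 \<in> set J then (if 6 \<in> set J then (if 7 \<in> set J then [1, 35, 385, 1925, 5005, 7007, 5005, 1430] else
    [1, 27, 225, 825, 1485, 1287, 429]) else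
    (if 7 \<in> set J then [1, 22, 160, 540, 930, 792, 264] else
    [1, 20, 120, 300, 330, 132])) else
    (if 6 \<in> set J then (if 7 \<in> set J then [1, 19, 131, 434, 742, 630, 210] else
    [1, 16, 84, 196, 210, 84]) else
    (if 7 \<in> set J then [1, 16, 84, 196, 210, 84] else
    [1, 14, 56, 84, 42]))) else
    (if 5 \<in> set J then (if 6 \<in> set J then (if 7 \<in> set J then [1, 18, 123, 406, 693, 588, 196] else
    [1, 14, 71, 164, 175, 70]) else
    (if 7 \<in> set J then [1, 13, 61, 134, 140, 56] else
    [1, 11, 39, 56, 28])) else
    (if 6 \<in> set J then (if 7 \<in> set J then [1, 14, 71, 164, 175, 70] else
    [1, 11, 39, 56, 28]) else
    (if 7 \<in> set J then [1, 11, 39, 56, 28] else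
    [1, 9, 21, 14]))))"

definition faces_E8_1100 :: "nat list \<Rightarrow> int list" where
  "faces_E8_1100 J = (if 4 \<in> set J then (if 5 \<in> set J then (if 6 \<in> set J then (if 7 \<in> set J then [1, 18, 116, 364, 602, 504, 168] else
    [1, 13, 61, 134, 140, 56]) else
    (if 7 \<in> set J then [1, 11, 47, 98, 100, 40] else
    [1, 9, 29, 40, 20])) else
    (if 6 \<in> set J then (if 7 \<in> set J then [1, 11, 47, 98, 100, 40] else
    [1, 8, 24, 32, 16]) else
    (if 7 \<in> set J then [1, 8, 24, 32, 16] else
    [1, 6, 12, 8]))) else
    (if 5 \<in> set J then (if 6 \<in> set J then (if 7 \<in> set J then [1, 13, 61, 134, 140, 56] else
    [1, 9, 29, 40, 20]) else
    (if 7 \<in> set J then [1, 8, 24, 32, 16] else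
    [1, 6, 12, 8])) else
    (if 6 \<in> set J then (if 7 \<in> set J then [1, 9, 29, 40, 20] else
    [1, 6, 12, 8]) else
    (if 7 \<in> set J then [1, 6, 12, 8] else
    [1, 4, 4]))))"

definition faces_E8_1101 :: "nat list \<Rightarrow> int list" where
  "faces_E8_1101 J = (if 4 \<in> set J then (if 5 \<in> set J then (if 6 \<in> set J then (if 7 \<in> set J then [1, 29, 279, 1275, 3135, 4257, 3003, 858] else
    [1, 22, 160, 540, 930, 792, 264]) else
    (if 7 \<in> set J then [1, 18, 116, 364, 602, 504, 168] else
    [1, 16, 84, 196, 210, 84])) else
    (if 6 \<in> set J then (if 7 \<in> set J then [1, 16, 99, 306, 503, 420, 140] else
    [1, 13, 61, 134, 140, 56]) else
    (if 7 \<in> set J then [1, 13, 61, 134, 140, 56] else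
    [1, 11, 39, 56, 28]))) else
    (if 5 \<in> set J then (if 6 \<in> set J then (if 7 \<in> set J then [1, 16, 99, 306, 503, 420, 140] else
    [1, 12, 55, 120, 125, 50]) else
    (if 7 \<in> set J then [1, 11, 47, 98, 100, 40] else
    [1, 9, 29, 40, 20])) else
    (if 6 \<in> set J then (if 7 \<in> set J then [1, 12, 55, 120, 125, 50] else
    [1, 9, 29, 40, 20]) else
    (if 7 \<in> set J then [1, 9, 29, 40, 20] else
    [1, 7, 15, 10]))))"

definition faces_E8_1110 :: "nat list \<Rightarrow> int list" where
  "faces_E8_1110 J = (if 4 \<in> set J then (if 5 \<in> set J then (if 6 \<in> set J then (if 7 \<in> set J then [1, 21, 169, 696, 1610, 2114, 1470, 420] else
    [1, 16, 99, 306, 503, 420, 140]) else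
    (if 7 \<in> set J then [1, 14, 79, 230, 365, 300, 100] else
    [1, 12, 55, 120, 125, 50])) else
    (if 6 \<in> set J then (if 7 \<in> set J then [1, 14, 79, 230, 365, 300, 100] else
    [1, 11, 47, 98, 100, 40]) else
    (if 7 \<in> set J then [1, 11, 47, 98, 100, 40] else
    [1, 9, 29, 40, 20]))) else
    (if 5 \<in> set J then (if 6 \<in> set J then (if 7 \<in> set J then [1, 16, 99, 306, 503, 420, 140] else
    [1, 12, 55, 120, 125, 50]) else
    (if 7 \<in> set J then [1, 11, 47, 98, 100, 40] else
    [1, 9, 29, 40, 20])) else
    (if 6 \<in> set J then (if 7 \<in> set J then [1, 12, 55, 120, 125, 50] else
    [1, 9, 29, 40, 20]) else
    (if 7 \<in> set J then [1, 9, 29, 40, 20] else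
    [1, 7, 15, 10]))))"

definition faces_E8_1111 :: "nat list \<Rightarrow> int list" where
  "faces_E8_1111 J = (if 4 \<in> set J then (if 5 \<in> set J then (if 6 \<in> set J then (if 7 \<in> set J then [1, 128, 2408, 17936, 67488, 140448, 163856, 100320, 25080] else
    [1, 70, 945, 5180, 14105, 20202, 14560, 4160]) else
    (if 7 \<in> set J then [1, 44, 483, 2345, 5950, 8211, 5831, 1666] else
    [1, 42, 399, 1547, 2856, 2499, 833])) else
    (if 6 \<in> set J then (if 7 \<in> set J then [1, 30, 290, 1335, 3305, 4507, 3185, 910] else
    [1, 27, 210, 730, 1275, 1092, 364]) else
    (if 7 \<in> set J then [1, 27, 210, 730, 1275, 1092, 364] else
    [1, 25, 160, 410, 455, 182]))) else
    (if 5 \<in> set J then (if 6 \<in> set J then (if 7 \<in> set J then [1, 23, 203, 896, 2170, 2926, 2058, 588] else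
    [1, 19, 131, 434, 742, 630, 210]) else
    (if 7 \<in> set J then [1, 18, 116, 364, 602, 504, 168] else
    [1, 16, 84, 196, 210, 84])) else
    (if 6 \<in> set J then (if 7 \<in> set J then [1, 19, 131, 434, 742, 630, 210] else
    [1, 16, 84, 196, 210, 84]) else
    (if 7 \<in> set J then [1, 16, 84, 196, 210, 84] else
    [1, 14, 56, 84, 42]))))"

definition faces_E8 :: "nat list \<Rightarrow> int list" where
  "faces_E8 J = (if 0 \<in> set J then (if 1 \<in> set J then (if 2 \<in> set J then (if 3 \<in> set J then faces_E8_1111 J else
    faces_E8_1110 J) else
    (if 3 \<in> set J then faces_E8_1101 J else
    faces_E8_1100 J)) else
    (if 2 \<in> set J then (if 3 \<in> set J then faces_E8_1011 J else
    faces_E8_1010 J) else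
    (if 3 \<in> set J then faces_E8_1001 J else
    faces_E8_1000 J))) else
    (if 1 \<in> set J then (if 2 \<in> set J then (if 3 \<in> set J then faces_E8_0111 J else
    faces_E8_0110 J) else
    (if 3 \<in> set J then faces_E8_0101 J else
    faces_E8_0100 J)) else
    (if 2 \<in> set J then (if 3 \<in> set J then faces_E8_0011 J else
    faces_E8_0010 J) else
    (if 3 \<in> set J then faces_E8_0001 J else
    faces_E8_0000 J))))"

lemma wf_E8: "wf_diagram diagram_E8"
  by code_simp

lemma entries_E8_1:
  "check_entry diagram_E8 table_E8 [0]"
  "check_entry diagram_E8 table_E8 [1]"
  "check_entry diagram_E8 table_E8 [2]"
  "check_entry diagram_E8 table_E8 [3]"
  "check_entry diagram_E8 table_E8 [4]"
  "check_entry diagram_E8 table_E8 [5]"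
  "check_entry diagram_E8 table_E8 [6]"
  "check_entry diagram_E8 table_E8 [7]"
  by code_simp+

lemma entries_E8_2:
  "check_entry diagram_E8 table_E8 [0, 2]"
  "check_entry diagram_E8 table_E8 [1, 3]"
  "check_entry diagram_E8 table_E8 [2, 3]"
  "check_entry diagram_E8 table_E8 [3, 4]"
  "check_entry diagram_E8 table_E8 [4, 5]"
  "check_entry diagram_E8 table_E8 [5, 6]"
  "check_entry diagram_E8 table_E8 [6, 7]"
  by code_simp+

lemma entries_E8_3:
  "check_entry diagram_E8 table_E8 [0, 2, 3]"
  "check_entry diagram_E8 table_E8 [1, 2, 3]"
  "check_entry diagram_E8 table_E8 [1, 3, 4]"
  "check_entry diagram_E8 table_E8 [2, 3, 4]"
  "check_entry diagram_E8 table_E8 [3, 4, 5]"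
  "check_entry diagram_E8 table_E8 [4, 5, 6]"
  "check_entry diagram_E8 table_E8 [5, 6, 7]"
  by code_simp+

lemma entries_E8_4:
  "check_entry diagram_E8 table_E8 [0, 1, 2, 3]"
  "check_entry diagram_E8 table_E8 [0, 2, 3, 4]"
  "check_entry diagram_E8 table_E8 [1, 2, 3, 4]"
  "check_entry diagram_E8 table_E8 [1, 3, 4, 5]"
  "check_entry diagram_E8 table_E8 [2, 3, 4, 5]"
  "check_entry diagram_E8 table_E8 [3, 4, 5, 6]"
  "check_entry diagram_E8 table_E8 [4, 5, 6, 7]"
  by code_simp+

lemma entries_E8_5:
  "check_entry diagram_E8 table_E8 [0, 1, 2, 3, 4]"
  "check_entry diagram_E8 table_E8 [0, 2, 3, 4, 5]"
  "check_entry diagram_E8 table_E8 [1, 2, 3, 4, 5]"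
  "check_entry diagram_E8 table_E8 [1, 3, 4, 5, 6]"
  "check_entry diagram_E8 table_E8 [2, 3, 4, 5, 6]"
  "check_entry diagram_E8 table_E8 [3, 4, 5, 6, 7]"
  by code_simp+

lemma entries_E8_6:
  "check_entry diagram_E8 table_E8 [0, 1, 2, 3, 4, 5]"
  "check_entry diagram_E8 table_E8 [0, 2, 3, 4, 5, 6]"
  "check_entry diagram_E8 table_E8 [1, 2, 3, 4, 5, 6]"
  "check_entry diagram_E8 table_E8 [1, 3, 4, 5, 6, 7]"
  "check_entry diagram_E8 table_E8 [2, 3, 4, 5, 6, 7]"
  by code_simp+

lemma entries_E8_7:
  "check_entry diagram_E8 table_E8 [0, 1, 2, 3, 4, 5, 6]"
  "check_entry diagram_E8 table_E8 [0, 2, 3, 4, 5, 6, 7]"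
  "check_entry diagram_E8 table_E8 [1, 2, 3, 4, 5, 6, 7]"
  by code_simp+

lemma entries_E8_8:
  "check_entry diagram_E8 table_E8 [0, 1, 2, 3, 4, 5, 6, 7]"
  by code_simp+

lemmas entries_E8 = entries_E8_1 entries_E8_2 entries_E8_3 entries_E8_4 entries_E8_5 entries_E8_6 entries_E8_7 entries_E8_8

lemma table_E8:
  assumes "hof table_E8 D > 0"
  shows "check_entry diagram_E8 table_E8 D"
proof -
  have "D \<in> set [[0], [1], [2], [3], [4], [5], [6], [7], [0, 2], [1, 3], [2, 3], [3, 4], [4, 5], [5, 6], [6, 7], [0, 2, 3],
      [1, 2, 3], [1, 3, 4], [2, 3, 4], [3, 4, 5], [4, 5, 6], [5, 6, 7], [0, 1, 2, 3], [0, 2, 3, 4], [1, 2, 3, 4],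
      [1, 3, 4, 5], [2, 3, 4, 5], [3, 4, 5, 6], [4, 5, 6, 7], [0, 1, 2, 3, 4], [0, 2, 3, 4, 5], [1, 2, 3, 4, 5],
      [1, 3, 4, 5, 6], [2, 3, 4, 5, 6], [3, 4, 5, 6, 7], [0, 1, 2, 3, 4, 5], [0, 2, 3, 4, 5, 6], [1, 2, 3, 4, 5, 6],
      [1, 3, 4, 5, 6, 7], [2, 3, 4, 5, 6, 7], [0, 1, 2, 3, 4, 5, 6], [0, 2, 3, 4, 5, 6, 7], [1, 2, 3, 4, 5, 6, 7],
      [0, 1, 2, 3, 4, 5, 6, 7]]"
    using assms unfolding table_E8_def table.sel period_E8_def by (simp split: if_splits)
  then show ?thesis using entries_E8 by (simp only: list.set insert_iff empty_iff) blast
qed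

text \<open>All 256 subsets are checked, connected or not, because links and the inclusion-exclusion
  delete arbitrary nodes.\<close>

lemma faces_E8: "list_all (check_faces diagram_E8 table_E8 faces_E8) (subseqs [0..<8])"
  by code_simp

section \<open>Data for F4\<close>

definition colour_F4 :: "nat \<Rightarrow> int" where
  "colour_F4 k = [0, 1, 0, 1] ! k"

definition neighbours_F4 :: "nat \<Rightarrow> (nat \<times> int) list" where
  "neighbours_F4 k = [[(1, 1)], [(0, 1), (2, 1)], [(1, 2), (3, 1)], [(2, 1)]] ! k"

definition distance_F4 :: "nat \<Rightarrow> nat \<Rightarrow> nat" where
  "distance_F4 i =
    (if i = 0 then (!) [0, 1, 2, 3] else
     (if i = 1 then (!) [1, 0, 1, 2] else
     (if i = 2 then (!) [2, 1, 0, 1] else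
     (!) [3, 2, 1, 0])))"

definition weight_F4 :: "nat \<Rightarrow> int" where
  "weight_F4 k = [7, - 6, 3, 4] ! k"

definition diagram_F4 :: diagram where
  "diagram_F4 = Diagram 4 colour_F4 neighbours_F4 distance_F4 weight_F4"

text \<open>Coxeter number plus 2 again: the connected subdiagrams have types A1, A2, B2, B3 or C3,
  and F4.\<close>

definition period_F4 :: "nat list \<Rightarrow> int" where
  "period_F4 E = (
    if E = [0] then 4
    else if E = [1] then 4
    else if E = [2] then 4
    else if E = [3] then 4
    else if E = [0, 1] then 5
    else if E = [1, 2] then 6
    else if E = [2, 3] then 5
    else if E = [0, 1, 2] then 8
    else if E = [1, 2, 3] then 8
    else if E = [0, 1, 2, 3] then 14
    else 0)"

definition involution_F4 :: "nat list \<Rightarrow> nat list" where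
  "involution_F4 E = (
    if E = [0, 1] then [1, 0]
    else if E = [2, 3] then [0, 1, 3, 2]
    else [0..<4])"

definition steps_F4 :: "nat list \<Rightarrow> step list" where
  "steps_F4 E = (
    if E = [0, 1, 2] then
     [(0, (1, 3), (0, - 4), 6, 2, - 2, (0, 2), (0, - 2), 1), (0, (1, 3), (0, 4), 6, 2, 2, (0, - 2), (0, 2), - 1)]
    else if E = [1, 2, 3] then
     [(3, (2, 3), (3, - 4), 15, 1, - 2, (3, 2), (3, - 2), 1), (1, (3, 2), (3, - 6), - 1, 3, - 2, (1, 2), (2, 3), 0)]
    else if E = [0, 1, 2, 3] then
     [(0, (1, 3), (0, 4), 6, 2, 2, (0, - 2), (0, 2), - 1), (0, (1, 5), (0, - 4), 5, 2, - 2, (0, 2), (0, - 2), 1),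
      (3, (1, 4), (0, - 7), 22, 0, - 3, (3, 3), (1, 5), 0), (3, (2, 3), (3, 4), 29, 0, 1, (3, - 1), (3, 3), - 1),
      (0, (2, 4), (3, 7), 11, 3, 3, (0, - 3), (2, 3), - 1), (3, (2, 5), (3, - 4), 15, 0, - 7, (2, 4), (3, 3), 0),
      (0, (3, 5), (3, 11), 15, 3, 7, (1, 4), (2, 3), 0), (0, (3, 5), (3, - 3), 15, 0, 0, (0, 0), (0, 0), 0)]
    else [])"

definition anchor_F4 :: "nat list \<Rightarrow> nat \<times> lab \<times> lab \<times> int list" where
  "anchor_F4 E = (
    if E = [0, 1, 2] then (0, (1, 3), (0, - 4), [- 6, - 3])
    else if E = [1, 2, 3] then (1, (3, 2), (3, - 6), [9, 3])
    else if E = [0, 1, 2, 3] then (0, (3, 5), (3, - 3), [9, 16, 3])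
    else (0, (0, 0), (0, 0), []))"

definition table_F4 :: table where
  "table_F4 = Table period_F4 involution_F4 steps_F4 anchor_F4"

definition faces_F4 :: "nat list \<Rightarrow> int list" where
  "faces_F4 J = (if 0 \<in> set J then (if 1 \<in> set J then (if 2 \<in> set J then (if 3 \<in> set J then [1, 28, 133, 210, 105] else
    [1, 12, 30, 20]) else
    (if 3 \<in> set J then [1, 7, 15, 10] else
    [1, 5, 5])) else
    (if 2 \<in> set J then (if 3 \<in> set J then [1, 7, 15, 10] else
    [1, 4, 4]) else
    (if 3 \<in> set J then [1, 4, 4] else
    [1, 2]))) else
    (if 1 \<in> set J then (if 2 \<in> set J then (if 3 \<in> set J then [1, 12, 30, 20] else
    [1, 6, 6]) else
    (if 3 \<in> set J then [1, 4, 4] else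
    [1, 2])) else
    (if 2 \<in> set J then (if 3 \<in> set J then [1, 5, 5] else
    [1, 2]) else
    (if 3 \<in> set J then [1, 2] else
    [1]))))"

lemma wf_F4: "wf_diagram diagram_F4"
  by code_simp

lemma entries_F4_1:
  "check_entry diagram_F4 table_F4 [0]"
  "check_entry diagram_F4 table_F4 [1]"
  "check_entry diagram_F4 table_F4 [2]"
  "check_entry diagram_F4 table_F4 [3]"
  by code_simp+

lemma entries_F4_2:
  "check_entry diagram_F4 table_F4 [0, 1]"
  "check_entry diagram_F4 table_F4 [1, 2]"
  "check_entry diagram_F4 table_F4 [2, 3]"
  by code_simp+

lemma entries_F4_3:
  "check_entry diagram_F4 table_F4 [0, 1, 2]"
  "check_entry diagram_F4 table_F4 [1, 2, 3]"
  by code_simp+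

lemma entries_F4_4:
  "check_entry diagram_F4 table_F4 [0, 1, 2, 3]"
  by code_simp+

lemmas entries_F4 = entries_F4_1 entries_F4_2 entries_F4_3 entries_F4_4

lemma table_F4:
  assumes "hof table_F4 D > 0"
  shows "check_entry diagram_F4 table_F4 D"
proof -
  have "D \<in> set [[0], [1], [2], [3], [0, 1], [1, 2], [2, 3], [0, 1, 2], [1, 2, 3], [0, 1, 2, 3]]"
    using assms unfolding table_F4_def table.sel period_F4_def by (simp split: if_splits)
  then show ?thesis using entries_F4 by (simp only: list.set insert_iff empty_iff) blast
qed

lemma faces_F4: "list_all (check_faces diagram_F4 table_F4 faces_F4) (subseqs [0..<4])"
  by code_simp

section \<open>Data for G2\<close>

definition colour_G2 :: "nat \<Rightarrow> int" where
  "colour_G2 k = [0, 1] ! k"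

definition neighbours_G2 :: "nat \<Rightarrow> (nat \<times> int) list" where
  "neighbours_G2 k = [[(1, 3)], [(0, 1)]] ! k"

definition distance_G2 :: "nat \<Rightarrow> nat \<Rightarrow> nat" where
  "distance_G2 i =
    (if i = 0 then (!) [0, 1] else
     (!) [1, 0])"

definition weight_G2 :: "nat \<Rightarrow> int" where
  "weight_G2 k = [- 1, 2] ! k"

definition diagram_G2 :: diagram where
  "diagram_G2 = Diagram 2 colour_G2 neighbours_G2 distance_G2 weight_G2"

definition period_G2 :: "nat list \<Rightarrow> int" where
  "period_G2 E = (
    if E = [0] then 4
    else if E = [1] then 4
    else if E = [0, 1] then 8
    else 0)"

definition involution_G2 :: "nat list \<Rightarrow> nat list" where
  "involution_G2 E = (
    [0..<2])"

definition steps_G2 :: "nat list \<Rightarrow> step list" where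
  "steps_G2 E = (
    [])"

definition anchor_G2 :: "nat list \<Rightarrow> nat \<times> lab \<times> lab \<times> int list" where
  "anchor_G2 E = (
    (0, (0, 0), (0, 0), []))"

definition table_G2 :: table where
  "table_G2 = Table period_G2 involution_G2 steps_G2 anchor_G2"

definition faces_G2 :: "nat list \<Rightarrow> int list" where
  "faces_G2 J = (if 0 \<in> set J then (if 1 \<in> set J then [1, 8, 8] else
    [1, 2]) else
    (if 1 \<in> set J then [1, 2] else
    [1]))"

lemma wf_G2: "wf_diagram diagram_G2"
  by code_simp

lemma entries_G2_1:
  "check_entry diagram_G2 table_G2 [0]"
  "check_entry diagram_G2 table_G2 [1]"
  by code_simp+

lemma entries_G2_2:
  "check_entry diagram_G2 table_G2 [0, 1]"
  by code_simp+

lemmas entries_G2 = entries_G2_1 entries_G2_2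

lemma table_G2:
  assumes "hof table_G2 D > 0"
  shows "check_entry diagram_G2 table_G2 D"
proof -
  have "D \<in> set [[0], [1], [0, 1]]"
    using assms unfolding table_G2_def table.sel period_G2_def by (simp split: if_splits)
  then show ?thesis using entries_G2 by (simp only: list.set insert_iff empty_iff) blast
qed

lemma faces_G2: "list_all (check_faces diagram_G2 table_G2 faces_G2) (subseqs [0..<2])"
  by code_simp

section \<open>Numerical values and the comparison with the Cartan matrices\<close>

lemma avoid:
  "avoid_list faces_E8 [5, 4, 1, 3, 2, 0] [0..<6] = [1, 36, 300, 1035, 1720, 1368, 418]"
  "avoid_list faces_E8 [6, 5, 4, 1, 3, 2, 0] [0..<7] = [1, 63, 777, 3927, 9933, 13299, 9009, 2431]"
  "avoid_list faces_E8 [7, 6, 5, 4, 1, 3, 2, 0] [0..<8] = [1, 120, 2135, 15120, 54327, 108360, 121555, 71760, 17342]"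
  "avoid_list faces_F4 [3, 2, 1, 0] [0..<4] = [1, 24, 101, 144, 66]"
  "avoid_list faces_G2 [1, 0] [0..<2] = [1, 6, 5]"
  by code_simp+

lemma forests:
  "is_forest diagram_E8 [5, 4, 1, 3, 2, 0]" "is_forest diagram_E8 [6, 5, 4, 1, 3, 2, 0]"
  "is_forest diagram_E8 [7, 6, 5, 4, 1, 3, 2, 0]" "is_forest diagram_F4 [3, 2, 1, 0]" "is_forest diagram_G2 [1, 0]"
  by code_simp+

lemma matrices:
  "list_all (\<lambda>i. list_all (\<lambda>j. i = j \<or> cartan_matrix E6 ! i ! j = - dA diagram_E8 i j) [0..<6]) [0..<6]"
  "list_all (\<lambda>i. list_all (\<lambda>j. i = j \<or> cartan_matrix E7 ! i ! j = - dA diagram_E8 i j) [0..<7]) [0..<7]"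
  "list_all (\<lambda>i. list_all (\<lambda>j. i = j \<or> cartan_matrix E8 ! i ! j = - dA diagram_E8 i j) [0..<8]) [0..<8]"
  "list_all (\<lambda>i. list_all (\<lambda>j. i = j \<or> cartan_matrix F4 ! i ! j = - dA diagram_F4 i j) [0..<4]) [0..<4]"
  "list_all (\<lambda>i. list_all (\<lambda>j. i = j \<or> cartan_matrix G2 ! i ! j = - dA diagram_G2 i j) [0..<2]) [0..<2]"
  by code_simp+

lemma nodes:
  "set [5, 4, 1, 3, 2, 0] = set [0..<6]"
  "set [6, 5, 4, 1, 3, 2, 0] = set [0..<7]"
  "set [7, 6, 5, 4, 1, 3, 2, 0] = set [0..<8]"
  "set [3, 2, 1, 0] = set [0..<4]"
  "set [1, 0] = set [0..<2]"
  by code_simp+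

lemma ranks:
  "length (cartan_matrix E6) = 6" "length (cartan_matrix E7) = 7" "length (cartan_matrix E8) = 8"
  "length (cartan_matrix F4) = 4" "length (cartan_matrix G2) = 2"
  by code_simp+

lemma entry_of_matrix:
  assumes "list_all (\<lambda>i. list_all (\<lambda>j. i = j \<or> M ! i ! j = - dA G i j) [0..<N]) [0..<N]" "i < N" "j < N" "i \<noteq> j"
  shows "M ! i ! j = - dA G i j"
  using bspec[OF bspec[OF assms(1)[unfolded list_all_iff], of i], of j] assms(2-4) by simp

theorem theorem1p6:
  fixes x :: "'a::field_char_0 ^ 'n::finite"
    and B :: "int ^ 'n ^ 'n"
    and X :: exceptional_type
  assumes "is_seed (x, B)"
    and "underlying_dynkin B X"
  shows "face_vector CARD('n) (positive_cluster_complex (x, B)) =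
    (case X of
       E6 \<Rightarrow> [1, 36, 300, 1035, 1720, 1368, 418]
     | E7 \<Rightarrow> [1, 63, 777, 3927, 9933, 13299, 9009, 2431]
     | E8 \<Rightarrow> [1, 120, 2135, 15120, 54327, 108360, 121555, 71760, 17342]
     | F4 \<Rightarrow> [1, 24, 101, 144, 66]
     | G2 \<Rightarrow> [1, 6, 5])"
proof -
  obtain \<pi> where bij: "bij_betw \<pi> (UNIV :: 'n set) {..<length (cartan_matrix X)}"
    and M: "\<And>i j. cartan_counterpart B $ i $ j = cartan_matrix X ! \<pi> i ! \<pi> j"
    using assms(2) unfolding underlying_dynkin_def by blast
  have rank: "rank diagram_E8 = 8" "rank diagram_F4 = 4" "rank diagram_G2 = 2"
    by (simp_all add: diagram_E8_def diagram_F4_def diagram_G2_def)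
  have faces: "list_all (check_faces diagram_E8 table_E8 faces_E8) (subseqs [0..<rank diagram_E8])"
    "list_all (check_faces diagram_F4 table_F4 faces_F4) (subseqs [0..<rank diagram_F4])"
    "list_all (check_faces diagram_G2 table_G2 faces_G2) (subseqs [0..<rank diagram_G2])"
    unfolding rank by (rule faces_E8 faces_F4 faces_G2)+
  show ?thesis
  proof (cases X)
    case E6
    \<comment> \<open>The Bourbaki labels of E6 are the first six labels of E8, so the table of E8
      is used with \<open>N = 6\<close>; type E7 is handled in the same way with
      \<open>N = 7\<close>.\<close>
    have b: "bij_betw \<pi> UNIV {..<6}" using bij unfolding E6 ranks .
    have "face_vector CARD('n) (positive_cluster_complex (x, B)) = [1, 36, 300, 1035, 1720, 1368, 418]"
    proof (rule face_vector_positive[OF assms(1) b M wf_E8 _ _ table_E8 faces(1) _ forests(1)])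
      show "6 \<le> rank diagram_E8" by (simp add: rank)
      show "cartan_matrix X ! i ! j = - dA diagram_E8 i j" if "i < 6" "j < 6" "i \<noteq> j" for i j
        unfolding E6 by (rule entry_of_matrix[OF matrices(1) that])
      show "set [5, 4, 1, 3, 2, 0] = {..<6 :: nat}" unfolding atLeast_upt by (rule nodes)
      show "avoid_list faces_E8 [5, 4, 1, 3, 2, 0] [0..<6] = map int [1, 36, 300, 1035, 1720, 1368, 418]"
        using avoid(1) by (simp only: list.map of_nat_numeral of_nat_1)
      show "length ([1, 36, 300, 1035, 1720, 1368, 418] :: nat list) = Suc 6" by code_simp
    qed
    then show ?thesis by (simp add: E6)
  next
    case E7
    have b: "bij_betw \<pi> UNIV {..<7}" using bij unfolding E7 ranks .
    have "face_vector CARD('n) (positive_cluster_complex (x, B)) = [1, 63, 777, 3927, 9933, 13299, 9009, 2431]"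
    proof (rule face_vector_positive[OF assms(1) b M wf_E8 _ _ table_E8 faces(1) _ forests(2)])
      show "7 \<le> rank diagram_E8" by (simp add: rank)
      show "cartan_matrix X ! i ! j = - dA diagram_E8 i j" if "i < 7" "j < 7" "i \<noteq> j" for i j
        unfolding E7 by (rule entry_of_matrix[OF matrices(2) that])
      show "set [6, 5, 4, 1, 3, 2, 0] = {..<7 :: nat}" unfolding atLeast_upt by (rule nodes)
      show "avoid_list faces_E8 [6, 5, 4, 1, 3, 2, 0] [0..<7] = map int [1, 63, 777, 3927, 9933, 13299, 9009, 2431]"
        using avoid(2) by (simp only: list.map of_nat_numeral of_nat_1)
      show "length ([1, 63, 777, 3927, 9933, 13299, 9009, 2431] :: nat list) = Suc 7" by code_simp
    qed
    then show ?thesis by (simp add: E7)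
  next
    case E8
    have b: "bij_betw \<pi> UNIV {..<8}" using bij unfolding E8 ranks .
    have "face_vector CARD('n) (positive_cluster_complex (x, B)) = [1, 120, 2135, 15120, 54327, 108360, 121555, 71760, 17342]"
    proof (rule face_vector_positive[OF assms(1) b M wf_E8 _ _ table_E8 faces(1) _ forests(3)])
      show "8 \<le> rank diagram_E8" by (simp add: rank)
      show "cartan_matrix X ! i ! j = - dA diagram_E8 i j" if "i < 8" "j < 8" "i \<noteq> j" for i j
        unfolding E8 by (rule entry_of_matrix[OF matrices(3) that])
      show "set [7, 6, 5, 4, 1, 3, 2, 0] = {..<8 :: nat}" unfolding atLeast_upt by (rule nodes)
      show "avoid_list faces_E8 [7, 6, 5, 4, 1, 3, 2, 0] [0..<8] = map int [1, 120, 2135, 15120, 54327, 108360, 121555, 71760, 17342]"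
        using avoid(3) by (simp only: list.map of_nat_numeral of_nat_1)
      show "length ([1, 120, 2135, 15120, 54327, 108360, 121555, 71760, 17342] :: nat list) = Suc 8" by code_simp
    qed
    then show ?thesis by (simp add: E8)
  next
    case F4
    have b: "bij_betw \<pi> UNIV {..<4}" using bij unfolding F4 ranks .
    have "face_vector CARD('n) (positive_cluster_complex (x, B)) = [1, 24, 101, 144, 66]"
    proof (rule face_vector_positive[OF assms(1) b M wf_F4 _ _ table_F4 faces(2) _ forests(4)])
      show "4 \<le> rank diagram_F4" by (simp add: rank)
      show "cartan_matrix X ! i ! j = - dA diagram_F4 i j" if "i < 4" "j < 4" "i \<noteq> j" for i j
        unfolding F4 by (rule entry_of_matrix[OF matrices(4) that])
      show "set [3, 2, 1, 0] = {..<4 :: nat}" unfolding atLeast_upt by (rule nodes)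
      show "avoid_list faces_F4 [3, 2, 1, 0] [0..<4] = map int [1, 24, 101, 144, 66]"
        using avoid(4) by (simp only: list.map of_nat_numeral of_nat_1)
      show "length ([1, 24, 101, 144, 66] :: nat list) = Suc 4" by code_simp
    qed
    then show ?thesis by (simp add: F4)
  next
    case G2
    have b: "bij_betw \<pi> UNIV {..<2}" using bij unfolding G2 ranks .
    have "face_vector CARD('n) (positive_cluster_complex (x, B)) = [1, 6, 5]"
    proof (rule face_vector_positive[OF assms(1) b M wf_G2 _ _ table_G2 faces(3) _ forests(5)])
      show "2 \<le> rank diagram_G2" by (simp add: rank)
      show "cartan_matrix X ! i ! j = - dA diagram_G2 i j" if "i < 2" "j < 2" "i \<noteq> j" for i j
        unfolding G2 by (rule entry_of_matrix[OF matrices(5) that])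
      show "set [1, 0] = {..<2 :: nat}" unfolding atLeast_upt by (rule nodes)
      show "avoid_list faces_G2 [1, 0] [0..<2] = map int [1, 6, 5]"
        using avoid(5) by (simp only: list.map of_nat_numeral of_nat_1)
      show "length ([1, 6, 5] :: nat list) = Suc 2" by code_simp
    qed
    then show ?thesis by (simp add: G2)
  qed
qed

end
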